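(* Let $\Sigma(A,B,C,\mathbf{G})$ be an $L^\infty$-BIBO stable system node on Banach spaces $(U,X,Y)$ such that $A^*$ generates a $C_0$-semigroup on $X^*$. Then the dual system node $\Sigma(A^*,C^*,B^*,\overline{\mathbf{G}}(\overline{\,\cdot\,}))$ is $L^1$-LILO stable.
   Context: All Banach spaces are over $\mathbb{C}$. For $\alpha\in\mathbb{R}$, $\mathbb{C}_\alpha:=\{z\in\mathbb{C}:\mathrm{Re}\,z>\alpha\}$. $\mathcal{L}(X,Y)$ denotes the bounded operators from $X$ to $Y$, $\mathrm{D}(A)$ the domain and $\rho(A)$ the resolvent set of $A$. System node: Let $U,X,Y$ be Banach spaces (input, state and output space). A system node on $(U,X,Y)$ is a collection $\Sigma(A,B,C,\mathbf{G})$ where $A:\mathrm{D}(A)\subset X\to X$ generates a strongly continuous semigroup $\mathbb{T}=(\mathbb{T}(t))_{t\ge0}$ on $X$ with growth bound $\omega(\mathbb{T})$, $B\in\mathcal{L}(U,X_{-1})$, $C\in\mathcal{L}(X_1,Y)$, and $\mathbf{G}:\mathbb{C}_{\omega(\mathbb{T})}\to\mathcal{L}(U,Y)$ is analytic with $\mathbf{G}(\alpha)-\mathbf{G}(\beta)=C[(\alpha\mathbb{I}-A)^{-1}-(\beta\mathbb{I}-A)^{-1}]B$ for all $\alpha,\beta\in\mathbb{C}_{\omega(\mathbb{T})}$. Here $X_1$ is $\mathrm{D}(A)$ with norm $\|x\|_{X_1}=\|(\beta\mathbb{I}-A)x\|_X$ and $X_{-1}$ is the completion of $X$ in the norm $\|x\|_{X_{-1}}=\|(\beta\mathbb{I}-A)^{-1}x\|_X$,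 for a fixed $\beta\in\rho(A)$; $A$, its resolvent and $\mathbb{T}$ are extended to $X_{-1}$ where needed (the extension of $\mathbb{T}$ is $\mathbb{T}_{-1}$). The combined observation/feedthrough operator $C\&D:\mathrm{D}(C\&D)\subset X\times U\to Y$ is $C\&D\begin{bmatrix}x\\ u\end{bmatrix}=C[x-(\beta\mathbb{I}-A)^{-1}Bu]+\mathbf{G}(\beta)u$ for some $\beta\in\mathbb{C}_{\omega(\mathbb{T})}$, with $\mathrm{D}(C\&D)=\{\begin{bmatrix}x\\ u\end{bmatrix}\in X\times U: Ax+Bu\in X\}$. Generalised (distributional) solution: a triple $(u,x,y)$ with $u\in L^1_{\mathrm{loc}}([0,\infty),U)$, $x\in C([0,\infty),X_{-1})$ given by $x(t)=\mathbb{T}(t)x_0+\int_0^t\mathbb{T}_{-1}(t-s)Bu(s)\,\mathrm{d}s$ for some $x_0\in X$, and $y$ the $Y$-valued distribution $y(t)=\frac{\mathrm{d}^2}{\mathrm{d}t^2}\left((C\&D)\int_0^t(t-s)\begin{bmatrix}x(s)\\ u(s)\end{bmatrix}\mathrm{d}s\right)$, $t\ge0$ (distributional derivative). $L^\infty$-BIBO stability: there exists $c>0$ such that for every generalised solution $(u,x,y)$ with $u\in L^\infty_{\mathrm{loc}}([0,\infty),U)$ and $x(0)=0$ one has $y\in L^\infty_{\mathrm{loc}}([0,\infty),Y)$ and $\|y\|_{L^\infty([0,t],Y)}\le c\|u\|_{L^\infty([0,t],U)}$ for all $t>0$. $L^1$-LILO stability: there exists $c>0$ such that for every generalised solution $(u,x,y)$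 with $u\in L^1_{\mathrm{loc}}([0,\infty),U)$ and $x(0)=0$ one has $y\in L^1_{\mathrm{loc}}([0,\infty),Y)$ and $\|y\|_{L^1([0,t],Y)}\le c\|u\|_{L^1([0,t],U)}$ for all $t>0$. Dual system node: $X^*$ denotes the dual space of bounded conjugate-linear functionals and $*$ the corresponding Banach space adjoint. If $A^*$ generates a strongly continuous semigroup $\mathbb{T}^*$ on $X^*$, the dual system node of $\Sigma(A,B,C,\mathbf{G})$ is the system node $\Sigma(A^*,C^*,B^*,\overline{\mathbf{G}}(\overline{\,\cdot\,}))$ on $(Y^*,X^*,U^* )$, where $\overline{\mathbf{G}}(\overline{\,\cdot\,})$ is the function $s\mapsto\mathbf{G}(\overline{s})^*\in\mathcal{L}(Y^*,U^* )$, and $(X_1)^*=(X^* )_{-1}$, $(X_{-1})^*=(X^* )_1$ (the spaces on the right being built from $A^*$), so that $C^*\in\mathcal{L}(Y^*,(X^* )_{-1})$ and $B^*\in\mathcal{L}((X^* )_1,U^* )$. *)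

theory Defs
  imports "HOL-Analysis.Analysis" "HOL-Probability.Essential_Supremum"
begin

section \<open>Complex Banach spaces, bounded operators, conjugate-linear duals\<close>

class cbanach = banach +
  fixes scaleC :: "complex \<Rightarrow> 'a \<Rightarrow> 'a"  (infixr "*\<^sub>C" 75)
  assumes scaleC_add_right: "c *\<^sub>C (x + y) = c *\<^sub>C x + c *\<^sub>C y"
    and scaleC_add_left: "(c + d) *\<^sub>C x = c *\<^sub>C x + d *\<^sub>C x"
    and scaleC_scaleC: "c *\<^sub>C d *\<^sub>C x = (c * d) *\<^sub>C x"
    and scaleR_scaleC: "r *\<^sub>R x = complex_of_real r *\<^sub>C x"
    and norm_scaleC: "norm (c *\<^sub>C x) = cmod c * norm x"

lemma scaleC_one: "1 *\<^sub>C (x::'a::cbanach) = x"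
  using scaleR_scaleC[of 1 x] by simp

lemma bounded_linear_scaleC: "bounded_linear (\<lambda>x::'a::cbanach. c *\<^sub>C x)"
proof (rule bounded_linear_intro[where K = "cmod c"])
  fix x y :: 'a and r :: real
  show "c *\<^sub>C (x + y) = c *\<^sub>C x + c *\<^sub>C y" by (rule scaleC_add_right)
  show "c *\<^sub>C r *\<^sub>R x = r *\<^sub>R c *\<^sub>C x"
    by (simp add: scaleR_scaleC scaleC_scaleC mult.commute)
  show "norm (c *\<^sub>C x) \<le> norm x * cmod c" by (simp add: norm_scaleC mult.commute)
qed

lemma onorm_scaleC:
  assumes "bounded_linear (f :: 'a::real_normed_vector \<Rightarrow> 'b::cbanach)"
  shows "onorm (\<lambda>x. c *\<^sub>C f x) = cmod c * onorm f"
proof (rule antisym)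
  have le: "onorm (\<lambda>x. d *\<^sub>C g x) \<le> cmod d * onorm g" if "bounded_linear g"
    for d and g :: "'a \<Rightarrow> 'b"
  proof (rule onorm_bound)
    show "0 \<le> cmod d * onorm g" by (simp add: onorm_pos_le[OF that])
    show "norm (d *\<^sub>C g x) \<le> cmod d * onorm g * norm x" for x
      using mult_left_mono[OF onorm[OF that, of x], of "cmod d"] by (simp add: norm_scaleC mult.assoc)
  qed
  show "onorm (\<lambda>x. c *\<^sub>C f x) \<le> cmod c * onorm f" by (rule le[OF assms])
  show "cmod c * onorm f \<le> onorm (\<lambda>x. c *\<^sub>C f x)"
  proof (cases "c = 0")
    case True
    then show ?thesis
      by (simp add: onorm_pos_le bounded_linear_compose[OF bounded_linear_scaleC assms])
  next
    case False
    have bl: "bounded_linear (\<lambda>x. c *\<^sub>C f x)"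
      by (rule bounded_linear_compose[OF bounded_linear_scaleC assms])
    have "onorm (\<lambda>x. inverse c *\<^sub>C c *\<^sub>C f x) \<le> cmod (inverse c) * onorm (\<lambda>x. c *\<^sub>C f x)"
      by (rule le[OF bl])
    then have "onorm f \<le> inverse (cmod c) * onorm (\<lambda>x. c *\<^sub>C f x)"
      using False by (simp add: scaleC_scaleC scaleC_one norm_inverse)
    then show ?thesis using False by (simp add: field_simps)
  qed
qed

instantiation complex :: cbanach
begin

definition scaleC_complex :: "complex \<Rightarrow> complex \<Rightarrow> complex" where "scaleC_complex c z = c * z"

instance
  by standard (simp_all add: scaleC_complex_def algebra_simps scaleR_conv_of_real norm_mult)

end

text \<open>\<open>('a, 'b) cblinfun\<close> is $\mathcal L(X,Y)$ with the operator norm.\<close>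

typedef (overloaded) ('a, 'b) cblinfun ("(_ \<Rightarrow>\<^sub>C\<^sub>L /_)" [22, 21] 21) =
  "{f :: 'a::cbanach \<Rightarrow>\<^sub>L 'b::cbanach. \<forall>c x. blinfun_apply f (c *\<^sub>C x) = c *\<^sub>C blinfun_apply f x}"
  morphisms blinfun_of_cblinfun Cblinfun
proof
  have "0 = c *\<^sub>C (0::'b)" for c using norm_scaleC[of c "0::'b"] by simp
  then show "0 \<in> {f :: 'a \<Rightarrow>\<^sub>L 'b. \<forall>c x. blinfun_apply f (c *\<^sub>C x) = c *\<^sub>C blinfun_apply f x}" by simp
qed

definition cblinfun_apply :: "('a::cbanach \<Rightarrow>\<^sub>C\<^sub>L 'b::cbanach) \<Rightarrow> 'a \<Rightarrow> 'b" where
  "cblinfun_apply f = blinfun_apply (blinfun_of_cblinfun f)"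

declare [[coercion "cblinfun_apply :: ('a::cbanach \<Rightarrow>\<^sub>C\<^sub>L 'b::cbanach) \<Rightarrow> 'a \<Rightarrow> 'b"]]

setup_lifting type_definition_cblinfun

instantiation cblinfun :: (cbanach, cbanach) real_normed_vector
begin

lift_definition norm_cblinfun :: "'a \<Rightarrow>\<^sub>C\<^sub>L 'b \<Rightarrow> real" is norm .
lift_definition zero_cblinfun :: "'a \<Rightarrow>\<^sub>C\<^sub>L 'b" is 0
  using norm_scaleC[of _ "0::'b"] by simp
lift_definition plus_cblinfun :: "'a \<Rightarrow>\<^sub>C\<^sub>L 'b \<Rightarrow> 'a \<Rightarrow>\<^sub>C\<^sub>L 'b \<Rightarrow> 'a \<Rightarrow>\<^sub>C\<^sub>L 'b" is "(+)"
  by (simp add: blinfun.add_left scaleC_add_right)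
lift_definition uminus_cblinfun :: "'a \<Rightarrow>\<^sub>C\<^sub>L 'b \<Rightarrow> 'a \<Rightarrow>\<^sub>C\<^sub>L 'b" is uminus
  by (simp add: blinfun.minus_left bounded_linear.linear[OF bounded_linear_scaleC] linear_neg)
lift_definition minus_cblinfun :: "'a \<Rightarrow>\<^sub>C\<^sub>L 'b \<Rightarrow> 'a \<Rightarrow>\<^sub>C\<^sub>L 'b \<Rightarrow> 'a \<Rightarrow>\<^sub>C\<^sub>L 'b" is "(-)"
  by (simp add: blinfun.diff_left bounded_linear.linear[OF bounded_linear_scaleC] linear_diff)
lift_definition scaleR_cblinfun :: "real \<Rightarrow> 'a \<Rightarrow>\<^sub>C\<^sub>L 'b \<Rightarrow> 'a \<Rightarrow>\<^sub>C\<^sub>L 'b" is "(*\<^sub>R)"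
  by (simp add: blinfun.scaleR_left scaleR_scaleC scaleC_scaleC mult.commute)
definition dist_cblinfun :: "'a \<Rightarrow>\<^sub>C\<^sub>L 'b \<Rightarrow> 'a \<Rightarrow>\<^sub>C\<^sub>L 'b \<Rightarrow> real"
  where "dist_cblinfun a b = norm (a - b)"
definition sgn_cblinfun :: "'a \<Rightarrow>\<^sub>C\<^sub>L 'b \<Rightarrow> 'a \<Rightarrow>\<^sub>C\<^sub>L 'b"
  where "sgn_cblinfun x = inverse (norm x) *\<^sub>R x"
definition [code del]:
  "(uniformity :: (('a \<Rightarrow>\<^sub>C\<^sub>L 'b) \<times> ('a \<Rightarrow>\<^sub>C\<^sub>L 'b)) filter) = (INF e\<in>{0 <..}. principal {(x, y). dist x y < e})"
definition open_cblinfun :: "('a \<Rightarrow>\<^sub>C\<^sub>L 'b) set \<Rightarrow> bool"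
  where [code del]: "open_cblinfun S = (\<forall>x\<in>S. \<forall>\<^sub>F (x', y) in uniformity. x' = x \<longrightarrow> y \<in> S)"

instance
proof
  fix f g h :: "'a \<Rightarrow>\<^sub>C\<^sub>L 'b" and r s :: real
  show "dist f g = norm (f - g)" by (rule dist_cblinfun_def)
  show "sgn f = inverse (norm f) *\<^sub>R f" by (rule sgn_cblinfun_def)
  show "(uniformity :: (('a \<Rightarrow>\<^sub>C\<^sub>L 'b) \<times> ('a \<Rightarrow>\<^sub>C\<^sub>L 'b)) filter) = (INF e\<in>{0 <..}. principal {(x, y). dist x y < e})"
    by (rule uniformity_cblinfun_def)
  show "open U = (\<forall>x\<in>U. \<forall>\<^sub>F (x', y) in uniformity. x' = x \<longrightarrow> y \<in> U)" for U :: "('a \<Rightarrow>\<^sub>C\<^sub>L 'b) set"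
    by (rule open_cblinfun_def)
  show "f + g + h = f + (g + h)" "f + g = g + f" "0 + f = f" "- f + f = 0" "f - g = f + - g"
    by (transfer, simp add: algebra_simps)+
  show "r *\<^sub>R (f + g) = r *\<^sub>R f + r *\<^sub>R g" "(r + s) *\<^sub>R f = r *\<^sub>R f + s *\<^sub>R f"
    "r *\<^sub>R s *\<^sub>R f = (r * s) *\<^sub>R f" "1 *\<^sub>R f = f"
    by (transfer, simp add: algebra_simps)+
  show "(norm f = 0) = (f = 0)" "norm (f + g) \<le> norm f + norm g" "norm (r *\<^sub>R f) = \<bar>r\<bar> * norm f"
    by (transfer, simp add: norm_triangle_ineq)+
qed

end

instantiation cblinfun :: (cbanach, cbanach) cbanach
begin

lift_definition scaleC_cblinfun :: "complex \<Rightarrow> 'a \<Rightarrow>\<^sub>C\<^sub>L 'b \<Rightarrow> 'a \<Rightarrow>\<^sub>C\<^sub>L 'b"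
  is "\<lambda>c f. Blinfun (\<lambda>x. c *\<^sub>C blinfun_apply f x)"
  by (simp add: bounded_linear_Blinfun_apply bounded_linear_compose[OF bounded_linear_scaleC]
      blinfun.bounded_linear_right scaleC_scaleC mult.commute)

instance
proof
  fix f g :: "'a \<Rightarrow>\<^sub>C\<^sub>L 'b" and r :: real and c d :: complex
  have bl: "bounded_linear (\<lambda>x. c *\<^sub>C blinfun_apply k x)" for c and k :: "'a \<Rightarrow>\<^sub>L 'b"
    by (intro bounded_linear_compose[OF bounded_linear_scaleC] blinfun.bounded_linear_right)
  have app: "blinfun_apply (blinfun_of_cblinfun (c *\<^sub>C k)) x = c *\<^sub>C blinfun_apply (blinfun_of_cblinfun k) x"
    for c and k :: "'a \<Rightarrow>\<^sub>C\<^sub>L 'b" and x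
    by (simp add: scaleC_cblinfun.rep_eq bounded_linear_Blinfun_apply bl)
  have eqI: "k = l" if "\<And>x. blinfun_apply (blinfun_of_cblinfun k) x = blinfun_apply (blinfun_of_cblinfun l) x"
    for k l :: "'a \<Rightarrow>\<^sub>C\<^sub>L 'b"
    using that by (metis blinfun_eqI blinfun_of_cblinfun_inject)
  show "c *\<^sub>C (f + g) = c *\<^sub>C f + c *\<^sub>C g"
    by (rule eqI) (simp add: app plus_cblinfun.rep_eq blinfun.add_left scaleC_add_right)
  show "(c + d) *\<^sub>C f = c *\<^sub>C f + d *\<^sub>C f"
    by (rule eqI) (simp add: app plus_cblinfun.rep_eq blinfun.add_left scaleC_add_left)
  show "c *\<^sub>C d *\<^sub>C f = (c * d) *\<^sub>C f"
    by (rule eqI) (simp add: app scaleC_scaleC)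
  show "r *\<^sub>R f = complex_of_real r *\<^sub>C f"
    by (rule eqI) (simp add: app scaleR_cblinfun.rep_eq blinfun.scaleR_left scaleR_scaleC)
  show "norm (c *\<^sub>C f) = cmod c * norm f"
    by (simp add: norm_cblinfun.rep_eq norm_blinfun.rep_eq ext[OF app] onorm_scaleC
        blinfun.bounded_linear_right)
next
  fix X :: "nat \<Rightarrow> 'a \<Rightarrow>\<^sub>C\<^sub>L 'b"
  assume "Cauchy X"
  let ?Y = "\<lambda>n. blinfun_of_cblinfun (X n)"
  have d: "dist (X m) k = dist (?Y m) (blinfun_of_cblinfun k)" for m k
    by (simp add: dist_cblinfun_def norm_cblinfun.rep_eq minus_cblinfun.rep_eq dist_norm)
  from \<open>Cauchy X\<close> have "Cauchy ?Y" by (simp add: Cauchy_def d)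
  then obtain L where L: "?Y \<longlonglongrightarrow> L" by (auto simp: Cauchy_convergent_iff convergent_def)
  have lim: "(\<lambda>n. blinfun_apply (?Y n) x) \<longlonglongrightarrow> blinfun_apply L x" for x
    by (intro tendsto_intros L)
  have "blinfun_apply L (c *\<^sub>C x) = c *\<^sub>C blinfun_apply L x" for c x
  proof (rule LIMSEQ_unique[OF lim])
    have "(\<lambda>n. c *\<^sub>C blinfun_apply (?Y n) x) \<longlonglongrightarrow> c *\<^sub>C blinfun_apply L x"
      by (rule bounded_linear.tendsto[OF bounded_linear_scaleC lim])
    then show "(\<lambda>n. blinfun_apply (?Y n) (c *\<^sub>C x)) \<longlonglongrightarrow> c *\<^sub>C blinfun_apply L x"
      using blinfun_of_cblinfun[where 'a='a and 'b='b] by auto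
  qed
  then have "blinfun_of_cblinfun (Cblinfun L) = L" by (simp add: Cblinfun_inverse)
  with L have "X \<longlonglongrightarrow> Cblinfun L" by (simp add: tendsto_iff d)
  then show "convergent X" by (auto simp: convergent_def)
qed

end

text \<open>\<open>'a cdual\<close> is the space $X^*$ of bounded conjugate-linear functionals; scalar
  multiplication is the pointwise one.\<close>

typedef (overloaded) 'a cdual =
  "{f :: 'a::cbanach \<Rightarrow>\<^sub>L complex. \<forall>c x. blinfun_apply f (c *\<^sub>C x) = cnj c * blinfun_apply f x}"
  morphisms blinfun_of_cdual Cdual
  by (rule exI[of _ 0]) simp

definition cdual_apply :: "'a::cbanach cdual \<Rightarrow> 'a \<Rightarrow> complex" where
  "cdual_apply f = blinfun_apply (blinfun_of_cdual f)"

declare [[coercion "cdual_apply :: 'a::cbanach cdual \<Rightarrow> 'a \<Rightarrow> complex"]]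

setup_lifting type_definition_cdual

instantiation cdual :: (cbanach) real_normed_vector
begin

lift_definition norm_cdual :: "'a cdual \<Rightarrow> real" is norm .
lift_definition zero_cdual :: "'a cdual" is 0 by simp
lift_definition plus_cdual :: "'a cdual \<Rightarrow> 'a cdual \<Rightarrow> 'a cdual" is "(+)"
  by (simp add: blinfun.add_left algebra_simps)
lift_definition uminus_cdual :: "'a cdual \<Rightarrow> 'a cdual" is uminus
  by (simp add: blinfun.minus_left)
lift_definition minus_cdual :: "'a cdual \<Rightarrow> 'a cdual \<Rightarrow> 'a cdual" is "(-)"
  by (simp add: blinfun.diff_left algebra_simps)
lift_definition scaleR_cdual :: "real \<Rightarrow> 'a cdual \<Rightarrow> 'a cdual" is "(*\<^sub>R)"
  by (simp add: blinfun.scaleR_left)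
definition dist_cdual :: "'a cdual \<Rightarrow> 'a cdual \<Rightarrow> real"
  where "dist_cdual a b = norm (a - b)"
definition sgn_cdual :: "'a cdual \<Rightarrow> 'a cdual"
  where "sgn_cdual x = inverse (norm x) *\<^sub>R x"
definition [code del]:
  "(uniformity :: ('a cdual \<times> 'a cdual) filter) = (INF e\<in>{0 <..}. principal {(x, y). dist x y < e})"
definition open_cdual :: "'a cdual set \<Rightarrow> bool"
  where [code del]: "open_cdual S = (\<forall>x\<in>S. \<forall>\<^sub>F (x', y) in uniformity. x' = x \<longrightarrow> y \<in> S)"

instance
proof
  fix f g h :: "'a cdual" and r s :: real
  show "dist f g = norm (f - g)" by (rule dist_cdual_def)
  show "sgn f = inverse (norm f) *\<^sub>R f" by (rule sgn_cdual_def)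
  show "(uniformity :: ('a cdual \<times> 'a cdual) filter) = (INF e\<in>{0 <..}. principal {(x, y). dist x y < e})"
    by (rule uniformity_cdual_def)
  show "open U = (\<forall>x\<in>U. \<forall>\<^sub>F (x', y) in uniformity. x' = x \<longrightarrow> y \<in> U)" for U :: "'a cdual set"
    by (rule open_cdual_def)
  show "f + g + h = f + (g + h)" "f + g = g + f" "0 + f = f" "- f + f = 0" "f - g = f + - g"
    by (transfer, simp add: algebra_simps)+
  show "r *\<^sub>R (f + g) = r *\<^sub>R f + r *\<^sub>R g" "(r + s) *\<^sub>R f = r *\<^sub>R f + s *\<^sub>R f"
    "r *\<^sub>R s *\<^sub>R f = (r * s) *\<^sub>R f" "1 *\<^sub>R f = f"
    by (transfer, simp add: algebra_simps)+
  show "(norm f = 0) = (f = 0)" "norm (f + g) \<le> norm f + norm g" "norm (r *\<^sub>R f) = \<bar>r\<bar> * norm f"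
    by (transfer, simp add: norm_triangle_ineq)+
qed

end

instantiation cdual :: (cbanach) cbanach
begin

lift_definition scaleC_cdual :: "complex \<Rightarrow> 'a cdual \<Rightarrow> 'a cdual"
  is "\<lambda>c f. Blinfun (\<lambda>x. c * blinfun_apply f x)"
  by (simp add: bounded_linear_Blinfun_apply bounded_linear_intros blinfun.bounded_linear_right)

instance
proof
  fix f g :: "'a cdual" and r :: real and c d :: complex
  have bl: "bounded_linear (\<lambda>x. c * blinfun_apply k x)" for c and k :: "'a \<Rightarrow>\<^sub>L complex"
    by (intro bounded_linear_intros blinfun.bounded_linear_right)
  have app: "blinfun_apply (blinfun_of_cdual (c *\<^sub>C k)) x = c * blinfun_apply (blinfun_of_cdual k) x"
    for c and k :: "'a cdual" and x
    by (simp add: scaleC_cdual.rep_eq bounded_linear_Blinfun_apply bl)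
  have eqI: "k = l" if "\<And>x. blinfun_apply (blinfun_of_cdual k) x = blinfun_apply (blinfun_of_cdual l) x"
    for k l :: "'a cdual"
    using that by (metis blinfun_eqI blinfun_of_cdual_inject)
  show "c *\<^sub>C (f + g) = c *\<^sub>C f + c *\<^sub>C g"
    by (rule eqI) (simp add: app plus_cdual.rep_eq blinfun.add_left distrib_left)
  show "(c + d) *\<^sub>C f = c *\<^sub>C f + d *\<^sub>C f"
    by (rule eqI) (simp add: app plus_cdual.rep_eq blinfun.add_left distrib_right)
  show "c *\<^sub>C d *\<^sub>C f = (c * d) *\<^sub>C f"
    by (rule eqI) (simp add: app mult.assoc)
  show "r *\<^sub>R f = complex_of_real r *\<^sub>C f"
    by (rule eqI) (simp add: app scaleR_cdual.rep_eq blinfun.scaleR_left scaleR_conv_of_real)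
  have "onorm (\<lambda>x. c * blinfun_apply k x) = cmod c * onorm (blinfun_apply k)" for k :: "'a \<Rightarrow>\<^sub>L complex"
    using onorm_scaleC[OF blinfun.bounded_linear_right, of c k] by (simp add: scaleC_complex_def)
  then show "norm (c *\<^sub>C f) = cmod c * norm f"
    by (simp add: norm_cdual.rep_eq norm_blinfun.rep_eq ext[OF app])
next
  fix X :: "nat \<Rightarrow> 'a cdual"
  assume "Cauchy X"
  let ?Y = "\<lambda>n. blinfun_of_cdual (X n)"
  have d: "dist (X m) k = dist (?Y m) (blinfun_of_cdual k)" for m k
    by (simp add: dist_cdual_def norm_cdual.rep_eq minus_cdual.rep_eq dist_norm)
  from \<open>Cauchy X\<close> have "Cauchy ?Y" by (simp add: Cauchy_def d)
  then obtain L where L: "?Y \<longlonglongrightarrow> L" by (auto simp: Cauchy_convergent_iff convergent_def)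
  have lim: "(\<lambda>n. blinfun_apply (?Y n) x) \<longlonglongrightarrow> blinfun_apply L x" for x
    by (intro tendsto_intros L)
  have "blinfun_apply L (c *\<^sub>C x) = cnj c * blinfun_apply L x" for c x
  proof (rule LIMSEQ_unique[OF lim])
    have "(\<lambda>n. cnj c * blinfun_apply (?Y n) x) \<longlonglongrightarrow> cnj c * blinfun_apply L x"
      by (intro tendsto_intros lim)
    then show "(\<lambda>n. blinfun_apply (?Y n) (c *\<^sub>C x)) \<longlonglongrightarrow> cnj c * blinfun_apply L x"
      using blinfun_of_cdual[where 'a='a] by auto
  qed
  then have "blinfun_of_cdual (Cdual L) = L" by (simp add: Cdual_inverse)
  with L have "X \<longlonglongrightarrow> Cdual L" by (simp add: tendsto_iff d)
  then show "convergent X" by (auto simp: convergent_def)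
qed

end

lemma cblinfun_apply_scaleC: "cblinfun_apply S (c *\<^sub>C x) = c *\<^sub>C cblinfun_apply S x"
  using blinfun_of_cblinfun[of S] by (simp add: cblinfun_apply_def)

lemma cdual_scaleC_apply: "cdual_apply (c *\<^sub>C f) x = c * cdual_apply f x"
  by (simp add: cdual_apply_def scaleC_cdual.rep_eq bounded_linear_Blinfun_apply
      bounded_linear_intros blinfun.bounded_linear_right)

lemma cdual_apply_scaleC: "cdual_apply f (c *\<^sub>C x) = cnj c * cdual_apply f x"
  using blinfun_of_cdual[of f] by (simp add: cdual_apply_def)

lift_definition cdual_comp :: "'b::cbanach cdual \<Rightarrow> ('a::cbanach \<Rightarrow>\<^sub>C\<^sub>L 'b) \<Rightarrow> 'a cdual"
  is "(o\<^sub>L)" by simp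

lemma cdual_comp_apply: "cdual_apply (cdual_comp f S) x = cdual_apply f (cblinfun_apply S x)"
  by (simp add: cdual_apply_def cblinfun_apply_def cdual_comp.rep_eq)

lemma cdual_eqI: "(\<And>x. cdual_apply f x = cdual_apply g x) \<Longrightarrow> f = g"
  unfolding cdual_apply_def by (metis blinfun_eqI blinfun_of_cdual_inject)

text \<open>The Banach space adjoint $S^*\in\mathcal L(Y^*,X^*)$ of $S\in\mathcal L(X,Y)$,
  $S^*f = f\circ S$.\<close>

definition cadjoint :: "('a::cbanach \<Rightarrow>\<^sub>C\<^sub>L 'b::cbanach) \<Rightarrow> ('b cdual \<Rightarrow>\<^sub>C\<^sub>L 'a cdual)" where
  "cadjoint S = Cblinfun (Blinfun (\<lambda>f. cdual_comp f S))"

lemma cadjoint_apply: "cblinfun_apply (cadjoint S) f = cdual_comp f S"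
proof -
  have bl: "bounded_linear (\<lambda>f. cdual_comp f S)"
  proof (rule bounded_linear_intro[where K = "norm S"])
    show "cdual_comp (f + g) S = cdual_comp f S + cdual_comp g S" for f g
      by (rule cdual_eqI)
        (simp add: cdual_comp_apply, simp add: cdual_apply_def plus_cdual.rep_eq blinfun.add_left
          cdual_comp.rep_eq cblinfun_apply_def)
    show "cdual_comp (r *\<^sub>R f) S = r *\<^sub>R cdual_comp f S" for r f
      by (rule cdual_eqI)
        (simp add: cdual_comp_apply, simp add: cdual_apply_def scaleR_cdual.rep_eq blinfun.scaleR_left
          cdual_comp.rep_eq cblinfun_apply_def)
    show "norm (cdual_comp f S) \<le> norm f * norm S" for f
      by (simp add: norm_cdual.rep_eq norm_cblinfun.rep_eq cdual_comp.rep_eq norm_blinfun_compose)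
  qed
  have "cdual_comp (c *\<^sub>C f) S = c *\<^sub>C cdual_comp f S" for c f
    by (rule cdual_eqI) (simp add: cdual_comp_apply cdual_scaleC_apply)
  then show ?thesis
    by (simp add: cadjoint_def cblinfun_apply_def Cblinfun_inverse bounded_linear_Blinfun_apply bl)
qed


section \<open>Bochner integration and Lebesgue spaces on half-lines\<close>

text \<open>The integral of \<^theory>\<open>HOL-Analysis.Bochner_Integration\<close> is restricted to second
  countable target spaces. The textbook notions for arbitrary Banach spaces are set up here on
  top of its integral of simple functions. They are used for the complete measure
  \<open>lebesgue\<close> only.\<close>

definition strongly_measurable :: "'a measure \<Rightarrow> ('a \<Rightarrow> 'b::cbanach) \<Rightarrow> bool" where
  "strongly_measurable M f \<longleftrightarrow>
    (\<exists>s. (\<forall>i. simple_function M (s i)) \<and> (AE x in M. (\<lambda>i. s i x) \<longlonglongrightarrow> f x))"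

definition has_Bochner_integral :: "'a measure \<Rightarrow> ('a \<Rightarrow> 'b::cbanach) \<Rightarrow> 'b \<Rightarrow> bool" where
  "has_Bochner_integral M f I \<longleftrightarrow> strongly_measurable M f \<and>
    (\<exists>s. (\<forall>i. Bochner_Integration.simple_bochner_integrable M (s i)) \<and>
         (\<lambda>i. \<integral>\<^sup>+x. ennreal (norm (f x - s i x)) \<partial>M) \<longlonglongrightarrow> 0 \<and>
         (\<lambda>i. Bochner_Integration.simple_bochner_integral M (s i)) \<longlonglongrightarrow> I)"

definition Bochner_integral :: "'a measure \<Rightarrow> ('a \<Rightarrow> 'b::cbanach) \<Rightarrow> 'b" where
  "Bochner_integral M f = (THE I. has_Bochner_integral M f I)"

definition L1_norm :: "real \<Rightarrow> (real \<Rightarrow> 'a::cbanach) \<Rightarrow> ennreal" where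
  "L1_norm t f = (\<integral>\<^sup>+s. ennreal (norm (f s)) \<partial>lebesgue_on {0..t})"

definition Linf_norm :: "real \<Rightarrow> (real \<Rightarrow> 'a::cbanach) \<Rightarrow> ennreal" where
  "Linf_norm t f = esssup (lebesgue_on {0..t}) (\<lambda>s. ennreal (norm (f s)))"

definition L1_loc :: "(real \<Rightarrow> 'a::cbanach) \<Rightarrow> bool" where
  "L1_loc f \<longleftrightarrow> (\<forall>t>0. strongly_measurable (lebesgue_on {0..t}) f \<and> L1_norm t f < \<infinity>)"

definition Linf_loc :: "(real \<Rightarrow> 'a::cbanach) \<Rightarrow> bool" where
  "Linf_loc f \<longleftrightarrow> (\<forall>t>0. strongly_measurable (lebesgue_on {0..t}) f \<and> Linf_norm t f < \<infinity>)"


section \<open>Vector-valued distributions\<close>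

definition test_functions :: "(real \<Rightarrow> real) set" where
  "test_functions = {\<phi>. (\<forall>n. (deriv ^^ n) \<phi> differentiable_on UNIV) \<and> compact (closure {t. \<phi> t \<noteq> 0})}"

text \<open>A distribution is given by its values on test functions. A function \<open>f\<close> on
  \<open>[0,\<infinity>)\<close> is identified with the distribution on the real line, supported in
  \<open>[0,\<infinity>)\<close>, of its extension by zero; thus the test functions need not vanish near
  \<open>0\<close>. Real-valued test functions suffice, by complex linearity.\<close>

type_synonym 'y distribution = "(real \<Rightarrow> real) \<Rightarrow> 'y"

definition is_regular_distribution :: "'y::cbanach distribution \<Rightarrow> (real \<Rightarrow> 'y) \<Rightarrow> bool" where
  "is_regular_distribution y f \<longleftrightarrow>
    (\<forall>\<phi>\<in>test_functions. y \<phi> = Bochner_integral (lebesgue_on {0..}) (\<lambda>t. \<phi> t *\<^sub>R f t))"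

text \<open>\<open>y\<close> is the second distributional derivative of \<open>F\<close>.\<close>

definition is_second_derivative :: "'y::cbanach distribution \<Rightarrow> (real \<Rightarrow> 'y) \<Rightarrow> bool" where
  "is_second_derivative y F \<longleftrightarrow>
    (\<forall>\<phi>\<in>test_functions. y \<phi> = Bochner_integral (lebesgue_on {0..}) (\<lambda>t. (deriv ^^ 2) \<phi> t *\<^sub>R F t))"


section \<open>Semigroups, generators, resolvents\<close>

text \<open>An unbounded operator on \<open>X\<close> is given by its graph.\<close>

type_synonym 'x operator_graph = "('x \<times> 'x) set"

definition C0_semigroup :: "(real \<Rightarrow> 'x::cbanach \<Rightarrow>\<^sub>C\<^sub>L 'x) \<Rightarrow> bool" where
  "C0_semigroup T \<longleftrightarrow> (\<forall>x. T 0 x = x) \<and>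
     (\<forall>s\<ge>0. \<forall>t\<ge>0. \<forall>x. T (s + t) x = T s (T t x)) \<and>
     (\<forall>x. continuous_on {0..} (\<lambda>t. T t x))"

definition generator :: "(real \<Rightarrow> 'x::cbanach \<Rightarrow>\<^sub>C\<^sub>L 'x) \<Rightarrow> 'x operator_graph" where
  "generator T = {(x, z). ((\<lambda>h. (1 / h) *\<^sub>R (T h x - x)) \<longlongrightarrow> z) (at_right 0)}"

definition generates_C0_semigroup :: "'x::cbanach operator_graph \<Rightarrow> bool" where
  "generates_C0_semigroup A \<longleftrightarrow> (\<exists>T. C0_semigroup T \<and> generator T = A)"

text \<open>The semigroup generated by \<open>A\<close>; its values at times \<open>t \<ge> 0\<close> are uniquely
  determined, and only these are ever used.\<close>

definition semigroup_of :: "'x::cbanach operator_graph \<Rightarrow> real \<Rightarrow> 'x \<Rightarrow>\<^sub>C\<^sub>L 'x" where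
  "semigroup_of A = (SOME T. C0_semigroup T \<and> generator T = A)"

definition growth_bound :: "(real \<Rightarrow> 'x::cbanach \<Rightarrow>\<^sub>C\<^sub>L 'x) \<Rightarrow> ereal" where
  "growth_bound T = Inf {ereal w |w. \<exists>M. \<forall>t\<ge>0. norm (T t) \<le> M * exp (w * t)}"

definition right_half_plane :: "ereal \<Rightarrow> complex set" where
  "right_half_plane a = {z. a < ereal (Re z)}"

text \<open>\<open>R = (\<mu> - A)\<^sup>-\<^sup>1\<close>: one has \<open>x \<in> D(A)\<close> and \<open>(\<mu> - A) x = z\<close> iff \<open>x = R z\<close>.\<close>

definition is_resolvent :: "'x::cbanach operator_graph \<Rightarrow> complex \<Rightarrow> ('x \<Rightarrow>\<^sub>C\<^sub>L 'x) \<Rightarrow> bool" where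
  "is_resolvent A \<mu> R \<longleftrightarrow> (\<forall>x z. (x, \<mu> *\<^sub>C x - z) \<in> A \<longleftrightarrow> x = R z)"

definition resolvent_set :: "'x::cbanach operator_graph \<Rightarrow> complex set" where
  "resolvent_set A = {\<mu>. \<exists>R. is_resolvent A \<mu> R}"

definition resolvent :: "'x::cbanach operator_graph \<Rightarrow> complex \<Rightarrow> 'x \<Rightarrow>\<^sub>C\<^sub>L 'x" where
  "resolvent A \<mu> = (THE R. is_resolvent A \<mu> R)"

text \<open>The graph of \<open>A\<^sup>*\<close>: \<open>f \<in> D(A\<^sup>*)\<close> and \<open>A\<^sup>* f = g\<close> iff \<open>f (A x) = g x\<close> for all \<open>x \<in> D(A)\<close>.\<close>

definition graph_adjoint :: "'x::cbanach operator_graph \<Rightarrow> 'x cdual operator_graph" where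
  "graph_adjoint A = {(f, g). \<forall>(x, z)\<in>A. cdual_apply f z = cdual_apply g x}"

definition analytic_on_set :: "(complex \<Rightarrow> 'a::cbanach) \<Rightarrow> complex set \<Rightarrow> bool" where
  "analytic_on_set g S \<longleftrightarrow>
    (\<forall>s\<in>S. \<exists>d. ((\<lambda>h. (1 / h) *\<^sub>C (g (s + h) - g s)) \<longlongrightarrow> d) (at 0))"


section \<open>System nodes\<close>

text \<open>The spaces \<open>X\<^sub>1\<close> and \<open>X\<^sub>-\<^sub>1\<close> depend on \<open>A\<close> and are therefore represented by
  Banach spaces \<open>'x1\<close>, \<open>'xm\<close> together with the embeddings \<open>i : X\<^sub>1 \<rightarrow> X\<close> and
  \<open>j : X \<rightarrow> X\<^sub>-\<^sub>1\<close>; the predicate \<open>system_node\<close> below requires that \<open>i\<close> identifies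
  \<open>'x1\<close> isometrically with \<open>D(A)\<close> under the \<open>X\<^sub>1\<close>-norm, and that \<open>'xm\<close> with \<open>j\<close> is a
  completion of \<open>X\<close> in the \<open>X\<^sub>-\<^sub>1\<close>-norm. This determines \<open>'x1\<close> and \<open>'xm\<close> up to isometric
  isomorphism. The field \<open>base\<close> is the point \<open>\<beta> \<in> \<rho>(A)\<close> in these norms.\<close>

record (overloaded) ('u::cbanach, 'x1::cbanach, 'x::cbanach, 'xm::cbanach, 'y::cbanach) node =
  A_op :: "'x operator_graph"
  base :: complex
  emb1 :: "'x1 \<Rightarrow>\<^sub>C\<^sub>L 'x"
  embm :: "'x \<Rightarrow>\<^sub>C\<^sub>L 'xm"
  B_op :: "'u \<Rightarrow>\<^sub>C\<^sub>L 'xm"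
  C_op :: "'x1 \<Rightarrow>\<^sub>C\<^sub>L 'y"
  G_tf :: "complex \<Rightarrow> 'u \<Rightarrow>\<^sub>C\<^sub>L 'y"

abbreviation node_semigroup :: "('u::cbanach, 'x1::cbanach, 'x::cbanach, 'xm::cbanach, 'y::cbanach) node
    \<Rightarrow> real \<Rightarrow> 'x \<Rightarrow>\<^sub>C\<^sub>L 'x" where
  "node_semigroup N \<equiv> semigroup_of (A_op N)"

definition node_half_plane :: "('u::cbanach, 'x1::cbanach, 'x::cbanach, 'xm::cbanach, 'y::cbanach) node
    \<Rightarrow> complex set" where
  "node_half_plane N = right_half_plane (growth_bound (node_semigroup N))"

text \<open>The extensions of the semigroup, of the resolvent (as an operator \<open>X\<^sub>-\<^sub>1 \<rightarrow> X\<close>) and of \<open>A\<close>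
  (as an operator \<open>X \<rightarrow> X\<^sub>-\<^sub>1\<close>).\<close>

definition semigroup_ext :: "('u::cbanach, 'x1::cbanach, 'x::cbanach, 'xm::cbanach, 'y::cbanach) node
    \<Rightarrow> real \<Rightarrow> 'xm \<Rightarrow>\<^sub>C\<^sub>L 'xm" where
  "semigroup_ext N t = (THE S. \<forall>x. cblinfun_apply S (embm N x) = embm N (node_semigroup N t x))"

definition resolvent_ext :: "('u::cbanach, 'x1::cbanach, 'x::cbanach, 'xm::cbanach, 'y::cbanach) node
    \<Rightarrow> complex \<Rightarrow> 'xm \<Rightarrow>\<^sub>C\<^sub>L 'x" where
  "resolvent_ext N \<mu> = (THE S. \<forall>x. cblinfun_apply S (embm N x) = resolvent (A_op N) \<mu> x)"

definition A_ext :: "('u::cbanach, 'x1::cbanach, 'x::cbanach, 'xm::cbanach, 'y::cbanach) node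
    \<Rightarrow> 'x \<Rightarrow>\<^sub>C\<^sub>L 'xm" where
  "A_ext N = (THE S. \<forall>(x, z)\<in>A_op N. cblinfun_apply S x = embm N z)"

definition system_node :: "('u::cbanach, 'x1::cbanach, 'x::cbanach, 'xm::cbanach, 'y::cbanach) node \<Rightarrow> bool" where
  "system_node N \<longleftrightarrow>
    generates_C0_semigroup (A_op N) \<and>
    base N \<in> resolvent_set (A_op N) \<and>
    range (emb1 N) = Domain (A_op N) \<and>
    (\<forall>\<xi> z. (emb1 N \<xi>, z) \<in> A_op N \<longrightarrow> norm \<xi> = norm (base N *\<^sub>C emb1 N \<xi> - z)) \<and>
    (\<forall>x. norm (embm N x) = norm (resolvent (A_op N) (base N) x)) \<and>
    closure (range (embm N)) = UNIV \<and>
    analytic_on_set (G_tf N) (node_half_plane N) \<and>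
    (\<forall>\<alpha>\<in>node_half_plane N. \<forall>\<beta>\<in>node_half_plane N. \<forall>u.
      G_tf N \<alpha> u - G_tf N \<beta> u =
        C_op N (inv (emb1 N) (resolvent_ext N \<alpha> (B_op N u) - resolvent_ext N \<beta> (B_op N u))))"

text \<open>\<open>D(C&D)\<close> and \<open>C&D\<close>; the value does not depend on the chosen \<open>\<beta>\<close>.\<close>

definition CD_dom :: "('u::cbanach, 'x1::cbanach, 'x::cbanach, 'xm::cbanach, 'y::cbanach) node \<Rightarrow> ('x \<times> 'u) set" where
  "CD_dom N = {(x, u). A_ext N x + B_op N u \<in> range (embm N)}"

definition CD :: "('u::cbanach, 'x1::cbanach, 'x::cbanach, 'xm::cbanach, 'y::cbanach) node \<Rightarrow> 'x \<times> 'u \<Rightarrow> 'y" where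
  "CD N = (\<lambda>(x, u). let \<beta> = (SOME \<beta>. \<beta> \<in> node_half_plane N) in
    C_op N (inv (emb1 N) (x - resolvent_ext N \<beta> (B_op N u))) + G_tf N \<beta> u)"

text \<open>In the definition of \<open>y\<close>, the integral of \<open>(t - s) x(s)\<close> is taken in \<open>X\<^sub>-\<^sub>1\<close>; its value
  lies in \<open>X\<close> and is denoted by \<open>z t\<close>.\<close>

definition generalised_solution :: "('u::cbanach, 'x1::cbanach, 'x::cbanach, 'xm::cbanach, 'y::cbanach) node
    \<Rightarrow> (real \<Rightarrow> 'u) \<Rightarrow> (real \<Rightarrow> 'xm) \<Rightarrow> 'y distribution \<Rightarrow> bool" where
  "generalised_solution N u x y \<longleftrightarrow>
    L1_loc u \<and> continuous_on {0..} x \<and>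
    (\<exists>x0. \<forall>t\<ge>0. x t = embm N (node_semigroup N t x0) +
       Bochner_integral (lebesgue_on {0..t}) (\<lambda>s. semigroup_ext N (t - s) (B_op N (u s)))) \<and>
    (\<exists>z F.
       (\<forall>t\<ge>0. embm N (z t) = Bochner_integral (lebesgue_on {0..t}) (\<lambda>s. (t - s) *\<^sub>R x s) \<and>
          (let w = Bochner_integral (lebesgue_on {0..t}) (\<lambda>s. (t - s) *\<^sub>R u s) in
            (z t, w) \<in> CD_dom N \<and> F t = CD N (z t, w))) \<and>
       is_second_derivative y F)"

definition Linf_BIBO_stable :: "('u::cbanach, 'x1::cbanach, 'x::cbanach, 'xm::cbanach, 'y::cbanach) node \<Rightarrow> bool" where
  "Linf_BIBO_stable N \<longleftrightarrow>
    (\<exists>c>0. \<forall>u x y. generalised_solution N u x y \<and> Linf_loc u \<and> x 0 = 0 \<longrightarrow>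
      (\<exists>f. is_regular_distribution y f \<and> Linf_loc f \<and>
        (\<forall>t>0. Linf_norm t f \<le> ennreal c * Linf_norm t u)))"

definition L1_LILO_stable :: "('u::cbanach, 'x1::cbanach, 'x::cbanach, 'xm::cbanach, 'y::cbanach) node \<Rightarrow> bool" where
  "L1_LILO_stable N \<longleftrightarrow>
    (\<exists>c>0. \<forall>u x y. generalised_solution N u x y \<and> L1_loc u \<and> x 0 = 0 \<longrightarrow>
      (\<exists>f. is_regular_distribution y f \<and> L1_loc f \<and>
        (\<forall>t>0. L1_norm t f \<le> ennreal c * L1_norm t u)))"

text \<open>The dual system node on \<open>(Y\<^sup>*, X\<^sup>*, U\<^sup>*)\<close>. The identifications \<open>(X\<^sub>-\<^sub>1)\<^sup>* = (X\<^sup>*)\<^sub>1\<close> and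
  \<open>(X\<^sub>1)\<^sup>* = (X\<^sup>*)\<^sub>-\<^sub>1\<close> are built in: the embeddings \<open>(X\<^sup>*)\<^sub>1 \<rightarrow> X\<^sup>* \<rightarrow> (X\<^sup>*)\<^sub>-\<^sub>1\<close> are the adjoints
  of \<open>X \<rightarrow> X\<^sub>-\<^sub>1\<close> and \<open>X\<^sub>1 \<rightarrow> X\<close>, that is, restriction of functionals.\<close>

definition dual_node :: "('u::cbanach, 'x1::cbanach, 'x::cbanach, 'xm::cbanach, 'y::cbanach) node
    \<Rightarrow> ('y cdual, 'xm cdual, 'x cdual, 'x1 cdual, 'u cdual) node" where
  "dual_node N = \<lparr>
     A_op = graph_adjoint (A_op N),
     base = cnj (base N),
     emb1 = cadjoint (embm N),
     embm = cadjoint (emb1 N),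
     B_op = cadjoint (C_op N),
     C_op = cadjoint (B_op N),
     G_tf = (\<lambda>s. cadjoint (G_tf N (cnj s)))\<rparr>"

end

theory Submission
  imports Defs
begin

text \<open>With zero initial state, the output of a system node is the second distributional derivative
  of a convolution \<open>K * u\<close>, where \<open>K\<close> is a strongly continuous kernel with \<open>K 0 = 0\<close>, and the kernel
  of the dual node is the pointwise adjoint \<open>K'\<close> of \<open>K\<close>. BIBO stability bounds the second difference
  quotients of \<open>K * u\<close> by \<open>c \<parallel>u\<parallel>\<^sub>\<infinity>\<close>. Since
  \<open>\<integral> \<langle>(K' * w)(s), u(T - s)\<rangle> ds = \<integral> \<langle>w(s), (K * u)(T - s)\<rangle> ds\<close>, testing with step functions \<open>u\<close> and
  moving second difference quotients from \<open>K * u\<close> to the second integral \<open>R w\<close> of \<open>w\<close> yields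
  \<open>\<parallel>K' * w\<parallel>\<^sub>1 \<le> c \<parallel>R w\<parallel>\<^sub>1\<close>. Let \<open>w\<close> run through the second difference quotients of an integrable
  input \<open>v\<close>: then \<open>R w \<rightarrow> v\<close> in \<open>L\<^sup>1\<close>, so the second difference quotients \<open>K' * w\<close> of \<open>K' * v\<close> are
  Cauchy in \<open>L\<^sup>1\<close>. Their limit is the output, and its norm is at most \<open>c \<parallel>v\<parallel>\<^sub>1\<close>.\<close>

section \<open>Bounded operators and functionals\<close>

text \<open>The output is only a distribution, because B maps into X_{-1} and C is defined on X_1:
  each is a bounded operator combined with one factor \<beta> - A. Integrating twice in time absorbs
  both factors, which is why the kernel is a genuine family of bounded operators. A bound on the
  dual output as a functional on bounded inputs would at best give a vector measure, and such a
  measure need not have a density. The estimate is therefore proved for the continuous functions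
  \<open>K' * w\<close>, where near-norming vectors can be chosen cell by cell of a partition, and
  the output is found by completeness of L1. Having the second integral of w, and not w, on the
  right of that estimate is what makes the difference quotients Cauchy. The hypothesis on the
  adjoint of A enters through strong continuity of the dual semigroup: the domain of its generator
  is dense, so the dual node is a system node and its semigroup consists of the adjoints. Vector
  integrals are reduced to Henstock--Kurzweil integrals, since the values lie in arbitrary, possibly
  nonseparable spaces.\<close>

lemma bounded_linear_cblinfun_apply: "bounded_linear (cblinfun_apply f)"
  by (simp add: cblinfun_apply_def[abs_def] blinfun.bounded_linear_right)

lemma cblinfun_add_right: "cblinfun_apply f (x + y) = cblinfun_apply f x + cblinfun_apply f y"
  and cblinfun_diff_right: "cblinfun_apply f (x - y) = cblinfun_apply f x - cblinfun_apply f y"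
  and cblinfun_minus_right: "cblinfun_apply f (- x) = - cblinfun_apply f x"
  and cblinfun_zero_right: "cblinfun_apply f 0 = 0"
  and cblinfun_scaleR_right: "cblinfun_apply f (r *\<^sub>R x) = r *\<^sub>R cblinfun_apply f x"
  by (simp_all add: cblinfun_apply_def blinfun.bilinear_simps)

lemma cblinfun_add_left: "cblinfun_apply (f + g) x = cblinfun_apply f x + cblinfun_apply g x"
  and cblinfun_diff_left: "cblinfun_apply (f - g) x = cblinfun_apply f x - cblinfun_apply g x"
  and cblinfun_zero_left: "cblinfun_apply 0 x = 0"
  and cblinfun_scaleR_left: "cblinfun_apply (r *\<^sub>R f) x = r *\<^sub>R cblinfun_apply f x"
  by (simp_all add: cblinfun_apply_def plus_cblinfun.rep_eq minus_cblinfun.rep_eq zero_cblinfun.rep_eq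
      scaleR_cblinfun.rep_eq blinfun.bilinear_simps)

lemma cblinfun_scaleC_left: "cblinfun_apply (c *\<^sub>C f) x = c *\<^sub>C cblinfun_apply f x"
  by (simp add: cblinfun_apply_def scaleC_cblinfun.rep_eq bounded_linear_Blinfun_apply
     bounded_linear_compose[OF bounded_linear_scaleC] blinfun.bounded_linear_right)

lemmas cblinfun_simps = cblinfun_add_right cblinfun_diff_right cblinfun_minus_right cblinfun_zero_right
  cblinfun_scaleR_right cblinfun_apply_scaleC cblinfun_add_left cblinfun_diff_left cblinfun_zero_left
  cblinfun_scaleR_left cblinfun_scaleC_left

lemma norm_cblinfun_apply: "norm (cblinfun_apply f x) \<le> norm f * norm x"
  by (simp add: cblinfun_apply_def norm_cblinfun.rep_eq norm_blinfun)

lemma norm_cblinfun_bound: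
  assumes "0 \<le> c" "\<And>x. norm (cblinfun_apply f x) \<le> c * norm x"
  shows "norm f \<le> c"
  using assms by (simp add: cblinfun_apply_def norm_cblinfun.rep_eq norm_blinfun_bound)

lemma cblinfun_eqI: "(\<And>x. cblinfun_apply f x = cblinfun_apply g x) \<Longrightarrow> f = g"
  unfolding cblinfun_apply_def by (metis blinfun_eqI blinfun_of_cblinfun_inject)

text \<open>A total constructor for operators given by a formula: the value is meaningful only when
  \<open>f\<close> is additive, complex homogeneous and bounded, which \<open>cblin_apply\<close>
  asks for.\<close>

definition cblin :: "('a::cbanach \<Rightarrow> 'b::cbanach) \<Rightarrow> 'a \<Rightarrow>\<^sub>C\<^sub>L 'b" where
  "cblin f = Cblinfun (Blinfun f)"

lemma cblin_apply:
  assumes add: "\<And>x y. f (x + y) = f x + f y" and hom: "\<And>c x. f (c *\<^sub>C x) = c *\<^sub>C f x"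
    and bd: "\<And>x. norm (f x) \<le> M * norm x"
  shows "cblinfun_apply (cblin f) x = f x"
proof -
  have bl: "bounded_linear f"
    by (rule bounded_linear_intro[where K=M]) (use assms in \<open>auto simp: scaleR_scaleC mult.commute\<close>)
  show ?thesis
    by (simp add: cblin_def cblinfun_apply_def Cblinfun_inverse bounded_linear_Blinfun_apply bl hom)
qed

definition ccomp :: "('b::cbanach \<Rightarrow>\<^sub>C\<^sub>L 'c::cbanach) \<Rightarrow> ('a::cbanach \<Rightarrow>\<^sub>C\<^sub>L 'b) \<Rightarrow> 'a \<Rightarrow>\<^sub>C\<^sub>L 'c" where
  "ccomp f g = cblin (\<lambda>x. f (g x))"

lemma ccomp_apply: "cblinfun_apply (ccomp f g) x = f (g x)"
  unfolding ccomp_def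
proof (rule cblin_apply[where M="norm f * norm g"])
  show "norm (cblinfun_apply f (cblinfun_apply g x)) \<le> norm f * norm g * norm x" for x
    using order_trans[OF norm_cblinfun_apply[of f "g x"] mult_left_mono[OF norm_cblinfun_apply[of g x]]]
    by (simp add: mult.assoc)
qed (simp_all add: cblinfun_simps)

definition cid :: "'a::cbanach \<Rightarrow>\<^sub>C\<^sub>L 'a" where "cid = cblin (\<lambda>x. x)"

lemma cid_apply [simp]: "cblinfun_apply cid x = x"
  unfolding cid_def by (rule cblin_apply[where M=1]) auto

section \<open>Conjugate-linear functionals and near-norming vectors\<close>

lemma cdual_add_left: "cdual_apply (f + g) x = cdual_apply f x + cdual_apply g x"
  and cdual_diff_left: "cdual_apply (f - g) x = cdual_apply f x - cdual_apply g x"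
  and cdual_zero_left: "cdual_apply 0 x = 0"
  and cdual_scaleR_left: "cdual_apply (r *\<^sub>R f) x = r *\<^sub>R cdual_apply f x"
  and cdual_add_right: "cdual_apply f (x + y) = cdual_apply f x + cdual_apply f y"
  and cdual_diff_right: "cdual_apply f (x - y) = cdual_apply f x - cdual_apply f y"
  and cdual_minus_right: "cdual_apply f (- x) = - cdual_apply f x"
  and cdual_zero_right: "cdual_apply f 0 = 0"
  and cdual_scaleR_right: "cdual_apply f (r *\<^sub>R x) = r *\<^sub>R cdual_apply f x"
  by (simp_all add: cdual_apply_def plus_cdual.rep_eq minus_cdual.rep_eq zero_cdual.rep_eq
      scaleR_cdual.rep_eq blinfun.bilinear_simps)

lemmas cdual_simps = cdual_add_left cdual_diff_left cdual_zero_left cdual_scaleR_left cdual_add_right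
  cdual_diff_right cdual_minus_right cdual_zero_right cdual_scaleR_right cdual_scaleC_apply cdual_apply_scaleC

lemma norm_cdual_apply: "norm (cdual_apply f x) \<le> norm f * norm x"
  by (simp add: cdual_apply_def norm_cdual.rep_eq norm_blinfun)

lemma norm_cdual_bound:
  assumes "0 \<le> c" "\<And>x. norm (cdual_apply f x) \<le> c * norm x"
  shows "norm f \<le> c"
  using assms by (simp add: cdual_apply_def norm_cdual.rep_eq norm_blinfun_bound)

lemma bounded_bilinear_cdual_apply: "bounded_bilinear cdual_apply"
  by (rule bounded_bilinear.intro)
    (auto simp: cdual_simps intro!: exI[of _ 1] norm_cdual_apply)

definition mk_cdual :: "('a::cbanach \<Rightarrow> complex) \<Rightarrow> 'a cdual" where
  "mk_cdual f = Cdual (Blinfun f)"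

lemma mk_cdual_apply:
  assumes add: "\<And>x y. f (x + y) = f x + f y" and hom: "\<And>c x. f (c *\<^sub>C x) = cnj c * f x"
    and bd: "\<And>x. norm (f x) \<le> M * norm x"
  shows "cdual_apply (mk_cdual f) x = f x"
proof -
  have "f (r *\<^sub>R x) = r *\<^sub>R f x" for r x
    by (simp add: scaleR_scaleC[of r x] hom scaleR_conv_of_real)
  then have bl: "bounded_linear f"
    by (intro bounded_linear_intro[where K=M]) (use add bd in \<open>auto simp: mult.commute\<close>)
  show ?thesis
    by (simp add: mk_cdual_def cdual_apply_def Cdual_inverse bounded_linear_Blinfun_apply bl hom)
qed

text \<open>A functional need not attain its norm, hence the loss \<open>e\<close>. Rotating
  \<open>x\<close> by a phase turns the modulus of the value into its real part; real parts are what
  add up over the cells in \<open>dual_conv_estimate\<close>.\<close>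

lemma cdual_nearly_norming:
  assumes "e > 0"
  shows "\<exists>x. norm x \<le> 1 \<and> norm f - e \<le> Re (cdual_apply f x)"
proof (rule ccontr)
  assume "\<not> ?thesis"
  then have less: "Re (cdual_apply f x) < norm f - e" if "norm x \<le> 1" for x
    using that by force
  have bd: "norm (cdual_apply f x) \<le> (norm f - e)" if "norm x \<le> 1" for x
  proof -
    \<comment> \<open>The functional is conjugate-linear, so the phase of the value itself, not its
      conjugate, cancels that phase.\<close>
    define \<theta> where "\<theta> = sgn (cdual_apply f x)"
    have "norm (\<theta> *\<^sub>C x) \<le> 1" using that
      by (auto simp: norm_scaleC \<theta>_def norm_sgn)
    moreover have "cdual_apply f (\<theta> *\<^sub>C x) = norm (cdual_apply f x)"
      unfolding cdual_apply_scaleC \<theta>_def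
      by (cases "cdual_apply f x = 0")
         (simp_all add: sgn_eq complex_norm_square[symmetric] power2_eq_square
            mult.commute[of "cnj _"])
    ultimately show ?thesis using less[of "\<theta> *\<^sub>C x"] by simp
  qed
  have ge: "0 \<le> norm f - e" using order_trans[OF norm_ge_zero bd[of 0]] by simp
  have "norm f \<le> norm f - e"
  proof (rule norm_cdual_bound[OF ge])
    fix x show "norm (cdual_apply f x) \<le> (norm f - e) * norm x"
    proof (cases "x = 0")
      case False
      have "norm (cdual_apply f (inverse (norm x) *\<^sub>R x)) \<le> norm f - e" using False by (intro bd) simp
      then show ?thesis using False by (simp add: cdual_simps field_simps)
    qed (simp add: cdual_simps)
  qed
  with assms show False by simp
qed

section \<open>The Hahn--Banach theorem\<close>

text \<open>Partial functionals dominated by the norm are represented by their graphs; a subspace of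
  \<open>X \<times> \<real>\<close> on which the second component is at most the norm of the first is automatically
  single-valued.\<close>

definition dominated_graph :: "('a::real_normed_vector \<times> real) set \<Rightarrow> bool" where
  "dominated_graph H \<longleftrightarrow> subspace H \<and> (\<forall>(x, a)\<in>H. a \<le> norm x)"

text \<open>The value \<open>\<xi>\<close> at \<open>x0\<close> is bounded from below by the case t
  = -1 and from above by the case t = 1; the triangle inequality puts every lower bound below every
  upper one, and homogeneity gives all other t. \<open>x0\<close> may lie in the domain already:
  domination then forces \<open>\<xi>\<close> to be its old value.\<close>

lemma dominated_graph_extend:
  assumes H: "dominated_graph H"
  shows "\<exists>\<xi>. dominated_graph {(y + t *\<^sub>R x0, a + t * \<xi>) |y a t. (y, a) \<in> H}"
proof -
  have sub: "subspace H" and dom: "\<And>x a. (x, a) \<in> H \<Longrightarrow> a \<le> norm x"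
    using H by (auto simp: dominated_graph_def)
  have H0: "(0, 0) \<in> H" using subspace_0[OF sub] by (simp add: zero_prod_def)
  have Hs: "(r *\<^sub>R x, r * a) \<in> H" if "(x, a) \<in> H" for r x a
    using subspace_scale[OF sub that, of r] by simp
  have Ha: "(x + y, a + b) \<in> H" if "(x, a) \<in> H" "(y, b) \<in> H" for x y a b
    using subspace_add[OF sub that] by simp
  define L where "L = {a - norm (y - x0) |y a. (y, a) \<in> H}"
  have cross: "l \<le> norm (y + x0) - a" if "l \<in> L" "(y, a) \<in> H" for l y a
  proof -
    obtain y' a' where l: "l = a' - norm (y' - x0)" "(y', a') \<in> H" using \<open>l \<in> L\<close> by (auto simp: L_def)
    have "a' + a \<le> norm (y' + y)" using dom[OF Ha[OF l(2) that(2)]] .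
    also have "\<dots> \<le> norm (y' - x0) + norm (y + x0)"
      using norm_triangle_ineq[of "y' - x0" "y + x0"] by simp
    finally show ?thesis using l by simp
  qed
  have ne: "L \<noteq> {}" using H0 by (auto simp: L_def)
  have bdd: "bdd_above L" using cross[OF _ H0] by (intro bdd_aboveI[of _ "norm x0"]) auto
  define \<xi> where "\<xi> = Sup L"
  have up: "\<xi> \<le> norm (y + x0) - a" if "(y, a) \<in> H" for y a
    unfolding \<xi>_def using ne cross that by (intro cSup_least) auto
  have lo: "a - norm (y - x0) \<le> \<xi>" if "(y, a) \<in> H" for y a
    unfolding \<xi>_def using that by (intro cSup_upper bdd) (auto simp: L_def)
  let ?G = "{(y + t *\<^sub>R x0, a + t * \<xi>) |y a t. (y, a) \<in> H}"
  have "a + t * \<xi> \<le> norm (y + t *\<^sub>R x0)" if "(y, a) \<in> H" for y a t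
  proof -
    consider "t = 0" | "t > 0" | "t < 0" by linarith
    then show ?thesis
    proof cases
      case 1 then show ?thesis using dom that by simp
    next
      case 2
      have "\<xi> \<le> norm (inverse t *\<^sub>R y + x0) - inverse t * a" by (rule up[OF Hs[OF that]])
      then have "t * \<xi> \<le> t * norm (inverse t *\<^sub>R y + x0) - a"
        using 2 by (simp add: field_simps)
      also have "t * norm (inverse t *\<^sub>R y + x0) = norm (t *\<^sub>R (inverse t *\<^sub>R y + x0))" using 2 by simp
      also have "t *\<^sub>R (inverse t *\<^sub>R y + x0) = y + t *\<^sub>R x0" using 2 by (simp add: scaleR_add_right)
      finally show ?thesis by simp
    next
      case 3
      define s where "s = - t"
      have s: "s > 0" "t = - s" using 3 by (auto simp: s_def)
      have "inverse s * a - norm (inverse s *\<^sub>R y - x0) \<le> \<xi>" by (rule lo[OF Hs[OF that]])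
      then have "a - s * norm (inverse s *\<^sub>R y - x0) \<le> s * \<xi>"
        using s by (simp add: field_simps)
      also have "s * norm (inverse s *\<^sub>R y - x0) = norm (s *\<^sub>R (inverse s *\<^sub>R y - x0))" using s by simp
      also have "s *\<^sub>R (inverse s *\<^sub>R y - x0) = y + t *\<^sub>R x0" using s by (simp add: scaleR_diff_right)
      finally show ?thesis using s by simp
    qed
  qed
  moreover have "subspace ?G"
  proof (rule subspaceI)
    show "0 \<in> ?G" using H0 by (auto simp: zero_prod_def intro!: exI[of _ 0])
    show "p + q \<in> ?G" if p: "p \<in> ?G" and q: "q \<in> ?G" for p q
    proof -
      obtain y a t where p: "p = (y + t *\<^sub>R x0, a + t * \<xi>)" "(y, a) \<in> H" using p by blast
      obtain y' a' t' where q: "q = (y' + t' *\<^sub>R x0, a' + t' * \<xi>)" "(y', a') \<in> H" using q by blast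
      have "p + q = ((y + y') + (t + t') *\<^sub>R x0, (a + a') + (t + t') * \<xi>)"
        by (simp add: p q algebra_simps)
      then show ?thesis using Ha[OF p(2) q(2)] by blast
    qed
    show "c *\<^sub>R p \<in> ?G" if p: "p \<in> ?G" for c p
    proof -
      obtain y a t where p: "p = (y + t *\<^sub>R x0, a + t * \<xi>)" "(y, a) \<in> H" using p by blast
      have "c *\<^sub>R p = (c *\<^sub>R y + (c * t) *\<^sub>R x0, c * a + (c * t) * \<xi>)"
        by (simp add: p algebra_simps)
      then show ?thesis using Hs[OF p(2)] by blast
    qed
  qed
  ultimately have "dominated_graph ?G" by (auto simp: dominated_graph_def)
  then show ?thesis by blast
qed

text \<open>Zorn's lemma for the dominated graphs that contain the line through (x, norm x). A
  maximal one has full domain, because otherwise the one-dimensional extension would enlarge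
  it.\<close>

lemma real_Hahn_Banach_norming:
  fixes x :: "'a::real_normed_vector"
  shows "\<exists>f. linear f \<and> (\<forall>y. f y \<le> norm y) \<and> f x = norm x"
proof -
  define H0 where "H0 = {(t *\<^sub>R x, t * norm x) |t. True}"
  define \<H> where "\<H> = {H. dominated_graph H \<and> H0 \<subseteq> H}"
  have H0: "H0 \<in> \<H>"
  proof -
    have "subspace H0"
    proof (rule subspaceI)
      show "0 \<in> H0" by (auto simp: H0_def zero_prod_def intro!: exI[of _ 0])
      show "p + q \<in> H0" if "p \<in> H0" "q \<in> H0" for p q
        using that by (auto simp: H0_def scaleR_add_left[symmetric] distrib_right[symmetric] simp del: scaleR_cancel_right)
      show "c *\<^sub>R p \<in> H0" if "p \<in> H0" for c p
        using that by (auto simp: H0_def mult.assoc[symmetric] simp del: scaleR_cancel_right mult_cancel_right)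
    qed
    moreover have "t * norm x \<le> \<bar>t\<bar> * norm x" for t by (simp add: mult_right_mono)
    ultimately show ?thesis by (auto simp: \<H>_def dominated_graph_def H0_def)
  qed
  have "\<exists>M\<in>\<H>. \<forall>H\<in>\<H>. M \<subseteq> H \<longrightarrow> H = M"
  proof (rule subset_Zorn_nonempty)
    show "\<H> \<noteq> {}" using H0 by blast
    fix \<C> assume ne: "\<C> \<noteq> {}" and ch: "subset.chain \<H> \<C>"
    have sub: "H \<in> \<C> \<Longrightarrow> dominated_graph H \<and> H0 \<subseteq> H" for H
      using ch by (auto simp: subset.chain_def \<H>_def)
    have tot: "H \<in> \<C> \<Longrightarrow> H' \<in> \<C> \<Longrightarrow> H \<subseteq> H' \<or> H' \<subseteq> H" for H H'
      using ch by (auto simp: subset.chain_def)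
    have "subspace (\<Union>\<C>)"
    proof (rule subspaceI)
      obtain H where "H \<in> \<C>" using ne by blast
      then show "0 \<in> \<Union>\<C>" using sub[of H] subspace_0[of H] by (auto simp: dominated_graph_def)
      show "p + q \<in> \<Union>\<C>" if pq: "p \<in> \<Union>\<C>" "q \<in> \<Union>\<C>" for p q
      proof -
        obtain H H' where "p \<in> H" "H \<in> \<C>" "q \<in> H'" "H' \<in> \<C>" using pq by blast
        then obtain K where "p \<in> K" "q \<in> K" "K \<in> \<C>" using tot by (metis subsetD)
        then show ?thesis using sub subspace_add by (metis UnionI dominated_graph_def)
      qed
      show "c *\<^sub>R p \<in> \<Union>\<C>" if "p \<in> \<Union>\<C>" for c p
        using that sub subspace_scale by (metis UnionE UnionI dominated_graph_def)
    qed
    moreover have "\<forall>(y, a)\<in>\<Union>\<C>. a \<le> norm y" using sub by (fastforce simp: dominated_graph_def)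
    moreover have "H0 \<subseteq> \<Union>\<C>" using ne sub by blast
    ultimately show "\<Union>\<C> \<in> \<H>" by (simp add: \<H>_def dominated_graph_def)
  qed
  then obtain M where M: "M \<in> \<H>" and max: "\<And>H. H \<in> \<H> \<Longrightarrow> M \<subseteq> H \<Longrightarrow> H = M" by blast
  have sub: "subspace M" and dom: "\<And>x a. (x, a) \<in> M \<Longrightarrow> a \<le> norm x"
    and x: "(x, norm x) \<in> M"
    using M by (auto simp: \<H>_def dominated_graph_def H0_def) (metis (mono_tags, lifting) scaleR_one mult_1 subsetD mem_Collect_eq)
  have ex: "\<exists>a. (y, a) \<in> M" for y
  proof -
    obtain \<xi> where \<xi>: "dominated_graph {(z + t *\<^sub>R y, a + t * \<xi>) |z a t. (z, a) \<in> M}"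
      (is "dominated_graph ?G")
      using dominated_graph_extend[of M y] M by (auto simp: \<H>_def)
    have "M \<subseteq> ?G"
    proof
      fix p assume "p \<in> M"
      then have "p = (fst p + 0 *\<^sub>R y, snd p + 0 * \<xi>)" "(fst p, snd p) \<in> M" by auto
      then show "p \<in> ?G" by blast
    qed
    then have "?G = M" using M \<xi> by (intro max) (auto simp: \<H>_def)
    moreover have "(0 + 1 *\<^sub>R y, 0 + 1 * \<xi>) \<in> ?G"
      using subspace_0[OF sub] unfolding zero_prod_def by blast
    ultimately show ?thesis by auto
  qed
  have uniq: "a = b" if "(y, a) \<in> M" "(y, b) \<in> M" for y a b
    using dom[of 0 "a - b"] dom[of 0 "b - a"] subspace_diff[OF sub that] subspace_diff[OF sub that(2,1)] by simp
  define f where "f = (\<lambda>y. THE a. (y, a) \<in> M)"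
  have f: "(y, f y) \<in> M" for y
  proof -
    have "\<exists>!a. (y, a) \<in> M" using ex[of y] uniq by blast
    from theI'[OF this] show ?thesis by (simp add: f_def)
  qed
  have "linear f"
  proof (rule linearI)
    show "f (y + z) = f y + f z" for y z using uniq[OF f] subspace_add[OF sub f f, of y z] by simp
    show "f (r *\<^sub>R y) = r *\<^sub>R f y" for r y using uniq[OF f] subspace_scale[OF sub f, of r y] by simp
  qed
  then show ?thesis using dom[OF f] uniq[OF f x] by blast
qed

text \<open>A conjugate-linear functional with real part \<open>\<phi>\<close> has
  \<open>\<phi> (\<i> *\<^sub>C y)\<close> as its imaginary part, since its value at i y is -i times
  its value at y. Rotation by a phase carries the bound from the real part over to the
  modulus.\<close>

lemma cdual_norming:
  fixes x :: "'a::cbanach"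
  shows "\<exists>f. norm f \<le> 1 \<and> cmod (cdual_apply f x) \<ge> norm x"
proof -
  obtain \<phi> :: "'a \<Rightarrow> real" where lin: "linear \<phi>" and le: "\<And>y. \<phi> y \<le> norm y" and x: "\<phi> x = norm x"
    using real_Hahn_Banach_norming[of x] by blast
  define g where "g y = Complex (\<phi> y) (\<phi> (\<i> *\<^sub>C y))" for y
  have add: "g (y + z) = g y + g z" for y z
    by (simp add: g_def complex_eq_iff linear_add[OF lin] scaleC_add_right)
  have hom: "g (c *\<^sub>C y) = cnj c * g y" for c y
  proof -
    have "c *\<^sub>C y = Re c *\<^sub>R y + Im c *\<^sub>R (\<i> *\<^sub>C y)"
    proof -
      have "c *\<^sub>C y = (complex_of_real (Re c) + complex_of_real (Im c) * \<i>) *\<^sub>C y"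
        by (rule arg_cong[where f="\<lambda>z. z *\<^sub>C y"]) (simp add: complex_eq_iff)
      then show ?thesis by (simp only: scaleC_add_left scaleR_scaleC scaleC_scaleC)
    qed
    moreover have "\<i> *\<^sub>C c *\<^sub>C y = - Im c *\<^sub>R y + Re c *\<^sub>R (\<i> *\<^sub>C y)"
    proof -
      have "\<i> *\<^sub>C c *\<^sub>C y = (complex_of_real (- Im c) + complex_of_real (Re c) * \<i>) *\<^sub>C y"
        unfolding scaleC_scaleC by (rule arg_cong[where f="\<lambda>z. z *\<^sub>C y"]) (simp add: complex_eq_iff)
      then show ?thesis by (simp only: scaleC_add_left scaleR_scaleC scaleC_scaleC)
    qed
    ultimately show ?thesis
      by (simp add: g_def complex_eq_iff linear_add[OF lin] linear_scale[OF lin] linear_neg[OF lin] linear_diff[OF lin])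
  qed
  have bd: "norm (g y) \<le> 1 * norm y" for y
  proof -
    define \<theta> where "\<theta> = sgn (g y)"
    have "g (\<theta> *\<^sub>C y) = norm (g y)"
      unfolding hom \<theta>_def
      by (cases "g y = 0")
        (simp_all add: sgn_eq complex_norm_square[symmetric] power2_eq_square mult.commute[of "cnj _"])
    then have "norm (g y) = Re (g (\<theta> *\<^sub>C y))" by simp
    also have "\<dots> \<le> norm (\<theta> *\<^sub>C y)" using le by (simp add: g_def)
    also have "\<dots> \<le> norm y" by (simp add: norm_scaleC \<theta>_def norm_sgn)
    finally show ?thesis by simp
  qed
  have ap: "cdual_apply (mk_cdual g) y = g y" for y by (rule mk_cdual_apply[OF add hom bd])
  have "norm (mk_cdual g) \<le> 1" by (rule norm_cdual_bound) (use bd ap in auto)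
  moreover have "cmod (g x) \<ge> norm x" using abs_Re_le_cmod[of "g x"] by (simp add: g_def x)
  ultimately show ?thesis using ap by (intro exI[of _ "mk_cdual g"]) simp
qed

text \<open>One of the two inequalities is Hahn--Banach. Equality gives a semigroup and its adjoint
  the same growth bound, and makes taking adjoints compatible with complex derivatives.\<close>

lemma norm_cadjoint: "norm (cadjoint S) = norm S"
proof (rule antisym)
  show "norm (cadjoint S) \<le> norm S"
  proof (rule norm_cblinfun_bound)
    fix f show "norm (cblinfun_apply (cadjoint S) f) \<le> norm S * norm f"
      unfolding cadjoint_apply
    proof (rule norm_cdual_bound)
      fix x
      have "norm (cdual_apply (cdual_comp f S) x) \<le> norm f * norm (cblinfun_apply S x)"
        by (simp add: cdual_comp_apply norm_cdual_apply)
      also have "\<dots> \<le> norm f * (norm S * norm x)" by (intro mult_left_mono norm_cblinfun_apply) simp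
      finally show "norm (cdual_apply (cdual_comp f S) x) \<le> norm S * norm f * norm x" by (simp add: mult_ac)
    qed simp
  qed simp
  show "norm S \<le> norm (cadjoint S)"
  proof (rule norm_cblinfun_bound)
    fix x
    obtain f where f: "norm f \<le> 1" "cmod (cdual_apply f (S x)) \<ge> norm (cblinfun_apply S x)"
      using cdual_norming by blast
    have "norm (cblinfun_apply S x) \<le> cmod (cdual_apply (cblinfun_apply (cadjoint S) f) x)"
      using f by (simp add: cadjoint_apply cdual_comp_apply)
    also have "\<dots> \<le> norm (cblinfun_apply (cadjoint S) f) * norm x" by (rule norm_cdual_apply)
    also have "\<dots> \<le> norm (cadjoint S) * norm x"
      using norm_cblinfun_apply[of "cadjoint S" f] mult_left_mono[OF f(1), of "norm (cadjoint S)"]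
      by (intro mult_right_mono) auto
    finally show "norm (cblinfun_apply S x) \<le> norm (cadjoint S) * norm x" .
  qed simp
qed

section \<open>Extension by density and uniform boundedness\<close>

lemma cblinfun_eq_on_dense:
  assumes dense: "closure (range (cblinfun_apply J)) = UNIV"
    and eq: "\<And>x. cblinfun_apply E (J x) = cblinfun_apply E' (J x)"
  shows "E = E'"
proof (rule cblinfun_eqI)
  fix y
  have "y \<in> closure (range (cblinfun_apply J))" using dense by simp
  moreover have "closed {y. cblinfun_apply E y = cblinfun_apply E' y}"
    by (intro closed_Collect_eq linear_continuous_on bounded_linear_cblinfun_apply)
  moreover have "range (cblinfun_apply J) \<subseteq> {y. cblinfun_apply E y = cblinfun_apply E' y}" using eq by auto
  ultimately have "y \<in> {y. cblinfun_apply E y = cblinfun_apply E' y}"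
    using closure_minimal by blast
  then show "cblinfun_apply E y = cblinfun_apply E' y" by simp
qed

lemma cblinfun_bound_on_dense:
  assumes dense: "closure (range (cblinfun_apply J)) = UNIV"
    and bd: "\<And>x. norm (cblinfun_apply E (J x)) \<le> c * norm (cblinfun_apply J x)"
  shows "norm (cblinfun_apply E y) \<le> c * norm y"
proof -
  have "closed {y. norm (cblinfun_apply E y) \<le> c * norm y}"
    by (intro closed_Collect_le continuous_intros linear_continuous_on bounded_linear_cblinfun_apply)
  then have "closure (range (cblinfun_apply J)) \<subseteq> {y. norm (cblinfun_apply E y) \<le> c * norm y}"
    by (intro closure_minimal) (use bd in auto)
  then show ?thesis using dense by auto
qed

text \<open>Domination by \<open>norm (J x)\<close>, and not merely by \<open>norm x\<close>, makes
  \<open>S\<close> uniformly continuous along the dense range of \<open>J\<close>. One approximating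
  sequence per point is fixed; \<open>char\<close> below shows that any other gives the same limit,
  and linearity follows from that.\<close>

lemma dense_extension:
  fixes J :: "'a::cbanach \<Rightarrow>\<^sub>C\<^sub>L 'b::cbanach" and S :: "'a \<Rightarrow> 'c::cbanach"
  assumes dense: "closure (range (cblinfun_apply J)) = UNIV"
    and add: "\<And>x y. S (x + y) = S x + S y" and hom: "\<And>c x. S (c *\<^sub>C x) = c *\<^sub>C S x"
    and bd: "\<And>x. norm (S x) \<le> M * norm (cblinfun_apply J x)"
  shows "\<exists>E. (\<forall>x. cblinfun_apply E (J x) = S x)"
proof -
  have diff: "S (x - y) = S x - S y" for x y using add[of "x - y" y] by (simp add: algebra_simps)
  have "\<exists>X. (\<lambda>n. cblinfun_apply J (X n)) \<longlonglongrightarrow> y" for y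
  proof -
    have "y \<in> closure (range (cblinfun_apply J))" using dense by simp
    then obtain f where f: "\<And>n. f n \<in> range (cblinfun_apply J)" "f \<longlonglongrightarrow> y"
      by (auto simp: closure_sequential)
    have "\<forall>n. \<exists>x. f n = cblinfun_apply J x" using f(1) by blast
    then obtain X where "\<And>n. f n = cblinfun_apply J (X n)" by (auto dest: choice)
    then have "f = (\<lambda>n. cblinfun_apply J (X n))" by auto
    with f show ?thesis by auto
  qed
  then obtain X where X: "\<And>y. (\<lambda>n. cblinfun_apply J (X y n)) \<longlonglongrightarrow> y" by metis
  have key: "(\<lambda>n. S (Z n)) \<longlonglongrightarrow> 0" if "(\<lambda>n. cblinfun_apply J (Z n)) \<longlonglongrightarrow> 0" for Z
  proof (rule Lim_null_comparison)
    show "(\<lambda>n. M * norm (cblinfun_apply J (Z n))) \<longlonglongrightarrow> 0"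
      using tendsto_mult_right_zero[OF tendsto_norm_zero[OF that], of M] by simp
  qed (use bd in auto)
  have cau: "Cauchy (\<lambda>n. S (X y n))" for y
  proof -
    have C: "Cauchy (\<lambda>n. cblinfun_apply J (X y n))" using X LIMSEQ_imp_Cauchy by blast
    show ?thesis
    proof (rule metric_CauchyI)
      fix e :: real assume e: "e > 0"
      define e' where "e' = e / (\<bar>M\<bar> + 1)"
      have "e' > 0" using e by (simp add: e'_def)
      then obtain N where N: "\<And>m n. m \<ge> N \<Longrightarrow> n \<ge> N \<Longrightarrow> dist (cblinfun_apply J (X y m)) (cblinfun_apply J (X y n)) < e'"
        using metric_CauchyD[OF C] by blast
      have "dist (S (X y m)) (S (X y n)) < e" if "m \<ge> N" "n \<ge> N" for m n
      proof -
        have "dist (S (X y m)) (S (X y n)) \<le> M * dist (cblinfun_apply J (X y m)) (cblinfun_apply J (X y n))"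
          using bd[of "X y m - X y n"] by (simp add: dist_norm diff cblinfun_simps)
        also have "\<dots> \<le> \<bar>M\<bar> * dist (cblinfun_apply J (X y m)) (cblinfun_apply J (X y n))"
          by (intro mult_right_mono) auto
        also have "\<dots> \<le> \<bar>M\<bar> * e'" using N[OF that] by (intro mult_left_mono) auto
        also have "\<dots> < e" using e by (simp add: e'_def field_simps)
        finally show ?thesis .
      qed
      then show "\<exists>N. \<forall>m\<ge>N. \<forall>n\<ge>N. dist (S (X y m)) (S (X y n)) < e" by blast
    qed
  qed
  define E where "E y = lim (\<lambda>n. S (X y n))" for y
  have lim: "(\<lambda>n. S (X y n)) \<longlonglongrightarrow> E y" for y
    unfolding E_def using cau convergent_LIMSEQ_iff Cauchy_convergent_iff by blast
  have char: "(\<lambda>n. S (Z n)) \<longlonglongrightarrow> E y" if "(\<lambda>n. cblinfun_apply J (Z n)) \<longlonglongrightarrow> y" for Z y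
  proof -
    have "(\<lambda>n. cblinfun_apply J (Z n - X y n)) \<longlonglongrightarrow> y - y"
      unfolding cblinfun_simps by (intro tendsto_intros that X)
    then have "(\<lambda>n. S (Z n - X y n)) \<longlonglongrightarrow> 0" using key[of "\<lambda>n. Z n - X y n"] by simp
    then have "(\<lambda>n. S (Z n - X y n) + S (X y n)) \<longlonglongrightarrow> 0 + E y" by (intro tendsto_intros lim)
    then show ?thesis by (simp add: diff)
  qed
  have EJ: "E (cblinfun_apply J x) = S x" for x
    using LIMSEQ_unique[OF char[of "\<lambda>n. x" "cblinfun_apply J x"], of "S x"] by simp
  have Eadd: "E (y + z) = E y + E z" for y z
  proof -
    have "(\<lambda>n. S (X y n + X z n)) \<longlonglongrightarrow> E (y + z)"
      by (rule char) (simp add: cblinfun_simps tendsto_add X)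
    moreover have "(\<lambda>n. S (X y n + X z n)) \<longlonglongrightarrow> E y + E z"
      unfolding add by (intro tendsto_intros lim)
    ultimately show ?thesis by (rule LIMSEQ_unique)
  qed
  have Ehom: "E (c *\<^sub>C y) = c *\<^sub>C E y" for c y
  proof -
    have "(\<lambda>n. S (c *\<^sub>C X y n)) \<longlonglongrightarrow> E (c *\<^sub>C y)"
      by (rule char) (simp add: cblinfun_simps bounded_linear.tendsto[OF bounded_linear_scaleC X])
    moreover have "(\<lambda>n. S (c *\<^sub>C X y n)) \<longlonglongrightarrow> c *\<^sub>C E y"
      unfolding hom by (intro bounded_linear.tendsto[OF bounded_linear_scaleC] lim)
    ultimately show ?thesis by (rule LIMSEQ_unique)
  qed
  have Ebd: "norm (E y) \<le> M * norm y" for y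
  proof (rule LIMSEQ_le)
    show "(\<lambda>n. norm (S (X y n))) \<longlonglongrightarrow> norm (E y)" by (intro tendsto_intros lim)
    show "(\<lambda>n. M * norm (cblinfun_apply J (X y n))) \<longlonglongrightarrow> M * norm y" by (intro tendsto_intros X)
  qed (use bd in auto)
  show ?thesis using cblin_apply[OF Eadd Ehom Ebd] EJ by (intro exI[of _ "cblin E"]) simp
qed

text \<open>Evaluates the definite descriptions behind \<open>semigroup_ext\<close> and
  \<open>resolvent_ext\<close>; density supplies uniqueness.\<close>

lemma dense_extension_the:
  assumes "closure (range (cblinfun_apply J)) = UNIV" "\<exists>E. \<forall>x. cblinfun_apply E (J x) = S x"
  shows "cblinfun_apply (THE E. \<forall>x. cblinfun_apply E (J x) = S x) (J x) = S x"
proof -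
  have "\<exists>!E. \<forall>x. cblinfun_apply E (J x) = S x"
  proof (rule ex_ex1I)
    show "E = E'" if "\<forall>x. cblinfun_apply E (J x) = S x" "\<forall>x. cblinfun_apply E' (J x) = S x" for E E'
      by (rule cblinfun_eq_on_dense[OF assms(1)]) (simp add: that)
  qed (rule assms(2))
  from theI'[OF this] show ?thesis by blast
qed

text \<open>Baire category: some \<open>F n\<close> contains a ball, and differences of its points
  control every \<open>T i\<close> on a small ball around 0.\<close>

lemma uniform_boundedness:
  fixes T :: "'i \<Rightarrow> 'a::cbanach \<Rightarrow>\<^sub>C\<^sub>L 'b::cbanach"
  assumes "\<And>x. \<exists>M. \<forall>i\<in>I. norm (cblinfun_apply (T i) x) \<le> M"
  shows "\<exists>M. \<forall>i\<in>I. norm (T i) \<le> M"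
proof -
  define F where "F n = {x. \<forall>i\<in>I. norm (cblinfun_apply (T i) x) \<le> real n}" for n :: nat
  have clF: "closed (F n)" for n
  proof -
    have "F n = (\<Inter>i\<in>I. {x. norm (cblinfun_apply (T i) x) \<le> real n})" by (auto simp: F_def)
    moreover have "closed {x. norm (cblinfun_apply (T i) x) \<le> real n}" for i
      by (intro closed_Collect_le continuous_intros linear_continuous_on bounded_linear_cblinfun_apply)
    ultimately show ?thesis by auto
  qed
  have un: "(\<Union>n. F n) = UNIV"
  proof -
    have "x \<in> (\<Union>n. F n)" for x
    proof -
      obtain M where M: "\<And>i. i \<in> I \<Longrightarrow> norm (cblinfun_apply (T i) x) \<le> M" using assms by blast
      obtain n where "M \<le> real n" using real_arch_simple by blast
      then have "x \<in> F n" using M by (auto simp: F_def intro: order_trans)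
      then show ?thesis by blast
    qed
    then show ?thesis by blast
  qed
  have "\<exists>n. interior (F n) \<noteq> {}"
  proof (rule ccontr)
    assume "\<not> ?thesis"
    then have int: "interior (F n) = {}" for n by auto
    have "euclidean closure_of \<Inter>(range (\<lambda>n. - F n)) = topspace (euclidean :: 'a topology)"
    proof (rule Baire_category)
      show "completely_metrizable_space (euclidean :: 'a topology) \<or> locally_compact_space (euclidean :: 'a topology) \<and> regular_space (euclidean :: 'a topology)"
        using completely_metrizable_space_euclidean by blast
      fix S assume "S \<in> range (\<lambda>n. - F n)"
      then obtain n where S: "S = - F n" by blast
      have "closure (- F n) = UNIV" using int[of n] by (simp add: closure_complement)
      then show "openin euclidean S \<and> euclidean closure_of S = topspace (euclidean :: 'a topology)"
        using clF S by (simp add: open_Compl)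
    qed simp
    moreover have "\<Inter>(range (\<lambda>n. - F n)) = {}" using un by auto
    ultimately show False by simp
  qed
  then obtain n a where "a \<in> interior (F n)" by blast
  then obtain e where e: "e > 0" "ball a e \<subseteq> F n"
    unfolding mem_interior by blast
  \<comment> \<open>The constant is 2 n divided by e / 2: \<open>y\<close> has length e / 2, and its
    image is a difference of two vectors of norm at most n.\<close>
  have bd: "norm (cblinfun_apply (T i) x) \<le> (4 * real n / e) * norm x" if i: "i \<in> I" for i x
  proof (cases "x = 0")
    case False
    define y where "y = (e / (2 * norm x)) *\<^sub>R x"
    have ny: "norm y = e / 2" using False e by (simp add: y_def)
    have "norm (cblinfun_apply (T i) (a + y)) \<le> real n" "norm (cblinfun_apply (T i) a) \<le> real n"
      using e ny i by (auto simp: F_def dist_norm subset_iff)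
    then have "norm (cblinfun_apply (T i) y) \<le> 2 * real n"
      using norm_triangle_ineq4[of "cblinfun_apply (T i) (a + y)" "cblinfun_apply (T i) a"] by (simp add: cblinfun_simps)
    then have "e / (2 * norm x) * norm (cblinfun_apply (T i) x) \<le> 2 * real n"
      using e by (simp add: y_def cblinfun_simps)
    then show ?thesis using False e by (simp add: field_simps)
  qed (simp add: cblinfun_simps)
  have "norm (T i) \<le> 4 * real n / e" if "i \<in> I" for i
    by (rule norm_cblinfun_bound) (use bd that e in auto)
  then show ?thesis by blast
qed

text \<open>The equation x = y + S x is solved by the Banach fixed point theorem; uniqueness of the
  fixed point makes the solution linear in y, so it defines the inverse \<open>Q\<close> of 1 -
  S.\<close>

lemma one_minus_contraction_inverse:
  fixes S :: "'a::cbanach \<Rightarrow>\<^sub>C\<^sub>L 'a"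
  assumes S: "norm S \<le> 1 / 2"
  shows "\<exists>Q. (\<forall>x. cblinfun_apply Q (x - S x) = x) \<and> (\<forall>x. Q x - cblinfun_apply S (Q x) = x)"
proof -
  have lip: "norm (cblinfun_apply S x) \<le> norm x / 2" for x
    using order_trans[OF norm_cblinfun_apply mult_right_mono[OF S]] by auto
  have ex: "\<exists>!x. y + cblinfun_apply S x = x" for y
  proof (rule banach_fix_type[where c="1/2"])
    show "\<forall>x z. dist (y + cblinfun_apply S x) (y + cblinfun_apply S z) \<le> 1 / 2 * dist x z"
      using lip by (auto simp: dist_norm cblinfun_diff_right[symmetric] algebra_simps)
  qed auto
  define q where "q y = (THE x. y + cblinfun_apply S x = x)" for y
  have q: "y + cblinfun_apply S (q y) = q y" for y unfolding q_def by (rule theI'[OF ex])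
  have uniq: "q y = x" if "y + cblinfun_apply S x = x" for x y
    using ex q that by blast
  have Q: "cblinfun_apply (cblin q) y = q y" for y
  proof (rule cblin_apply[where M=2])
    show "q (x + y) = q x + q y" for x y
    proof (rule uniq)
      have "x + y + cblinfun_apply S (q x + q y) = (x + cblinfun_apply S (q x)) + (y + cblinfun_apply S (q y))"
        by (simp add: cblinfun_simps)
      then show "x + y + cblinfun_apply S (q x + q y) = q x + q y" by (simp only: q)
    qed
    show "q (c *\<^sub>C x) = c *\<^sub>C q x" for c x
    proof (rule uniq)
      have "c *\<^sub>C x + cblinfun_apply S (c *\<^sub>C q x) = c *\<^sub>C (x + cblinfun_apply S (q x))"
        by (simp add: cblinfun_simps scaleC_add_right)
      then show "c *\<^sub>C x + cblinfun_apply S (c *\<^sub>C q x) = c *\<^sub>C q x" by (simp only: q)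
    qed
    show "norm (q x) \<le> 2 * norm x" for x
      using norm_triangle_ineq[of x "cblinfun_apply S (q x)"] lip[of "q x"] by (simp add: q)
  qed
  have "q (x - cblinfun_apply S x) = x" for x by (rule uniq) simp
  moreover have "q x - cblinfun_apply S (q x) = x" for x using q[of x] by (simp add: algebra_simps)
  ultimately show ?thesis using Q by (intro exI[of _ "cblin q"]) simp
qed

section \<open>Strongly continuous semigroups\<close>

lemma right_quotient_integral:
  fixes f :: "real \<Rightarrow> 'a::banach"
  assumes f: "continuous_on {a..} f" and t: "a \<le> t"
  shows "((\<lambda>h. (1 / h) *\<^sub>R (integral {a..t + h} f - integral {a..t} f)) \<longlongrightarrow> f t) (at_right 0)"
proof (rule tendstoI)
  fix e :: real assume e: "e > 0"
  have "continuous (at t within {a..}) f" using f t by (simp add: continuous_on_eq_continuous_within)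
  then obtain d where d: "d > 0" "\<And>s. s \<in> {a..} \<Longrightarrow> dist s t < d \<Longrightarrow> dist (f s) (f t) < e / 2"
    using e unfolding continuous_within_eps_delta by (metis half_gt_zero)
  have "dist ((1 / h) *\<^sub>R (integral {a..t + h} f - integral {a..t} f)) (f t) < e" if h: "0 < h" "h < d" for h
  proof -
    have int: "f integrable_on {a..t + h}" "f integrable_on {t..t + h}"
      using t by (auto intro!: integrable_continuous_real continuous_on_subset[OF f])
    have "integral {a..t + h} f - integral {a..t} f = integral {t..t + h} f"
      using Henstock_Kurzweil_Integration.integral_combine[of a t "t + h" f] int t h by (simp add: algebra_simps)
    moreover have "integral {t..t + h} f - h *\<^sub>R f t = integral {t..t + h} (\<lambda>s. f s - f t)"
      using int h by (subst Henstock_Kurzweil_Integration.integral_diff) auto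
    moreover have "norm (integral {t..t + h} (\<lambda>s. f s - f t)) \<le> (e / 2) * (t + h - t)"
    proof (rule integral_bound)
      show "continuous_on {t..t + h} (\<lambda>s. f s - f t)"
        using t by (intro continuous_intros continuous_on_subset[OF f]) auto
      show "norm (f s - f t) \<le> e / 2" if "s \<in> {t..t + h}" for s
        using d(2)[of s] that h t by (auto simp: dist_norm less_imp_le)
    qed (use h in auto)
    ultimately have "norm (integral {a..t + h} f - integral {a..t} f - h *\<^sub>R f t) \<le> (e / 2) * h" by simp
    moreover have "(1 / h) *\<^sub>R (integral {a..t + h} f - integral {a..t} f) - f t
      = (1 / h) *\<^sub>R (integral {a..t + h} f - integral {a..t} f - h *\<^sub>R f t)"
      using h by (simp add: scaleR_diff_right)
    ultimately have "norm ((1 / h) *\<^sub>R (integral {a..t + h} f - integral {a..t} f) - f t) \<le> (1 / h) * ((e / 2) * h)"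
      using h by (simp only: norm_scaleR) (intro mult_mono, auto)
    then show ?thesis using h e by (simp add: dist_norm)
  qed
  then show "\<forall>\<^sub>F h in at_right 0. dist ((1 / h) *\<^sub>R (integral {a..t + h} f - integral {a..t} f)) (f t) < e"
    unfolding eventually_at_right_field using d(1) by (intro exI[of _ d]) auto
qed

lemma cblinfun_integral:
  assumes "f integrable_on S"
  shows "cblinfun_apply E (integral S f) = integral S (\<lambda>s. cblinfun_apply E (f s))"
  using integral_linear[OF assms bounded_linear_cblinfun_apply[of E]] by (simp add: o_def)

lemma bounded_bilinear_scaleC: "bounded_bilinear (\<lambda>c (x::'z::cbanach). c *\<^sub>C x)"
proof (rule bounded_bilinear.intro)
  show "(r *\<^sub>R a) *\<^sub>C b = r *\<^sub>R a *\<^sub>C b" for r a and b :: 'z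
    by (simp add: scaleR_scaleC[of r "a *\<^sub>C b"] scaleC_scaleC scaleR_conv_of_real)
  show "a *\<^sub>C r *\<^sub>R b = r *\<^sub>R a *\<^sub>C b" for r a and b :: 'z
    by (simp add: scaleR_scaleC scaleC_scaleC mult.commute)
qed (auto simp: scaleC_add_left scaleC_add_right norm_scaleC intro!: exI[of _ 1])

locale c0_semigroup =
  fixes T :: "real \<Rightarrow> 'x::cbanach \<Rightarrow>\<^sub>C\<^sub>L 'x"
  assumes C0: "C0_semigroup T"
begin

lemma T_0 [simp]: "cblinfun_apply (T 0) x = x"
  and T_add: "0 \<le> s \<Longrightarrow> 0 \<le> t \<Longrightarrow> cblinfun_apply (T (s + t)) x = T s (cblinfun_apply (T t) x)"
  and T_continuous: "continuous_on {0..} (\<lambda>t. cblinfun_apply (T t) x)"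
  using C0 by (auto simp: C0_semigroup_def)

lemma T_commute: "0 \<le> s \<Longrightarrow> 0 \<le> t \<Longrightarrow> cblinfun_apply (T s) (T t x) = T t (cblinfun_apply (T s) x)"
  by (metis T_add add.commute)

lemma T_integrable: "0 \<le> a \<Longrightarrow> (\<lambda>s. cblinfun_apply (T s) x) integrable_on {a..b}"
  by (intro integrable_continuous_real continuous_on_subset[OF T_continuous]) auto

text \<open>Orbits over [0, 1] are compact, hence bounded for each x; the uniform boundedness
  principle removes the dependence on x.\<close>

lemma T_bounded_unit: "\<exists>M\<ge>1. \<forall>t\<in>{0..1}. norm (T t) \<le> M"
proof -
  have "\<exists>M. \<forall>t\<in>{0..1}. norm (cblinfun_apply (T t) x) \<le> M" for x
  proof -
    have "compact ((\<lambda>t. cblinfun_apply (T t) x) ` {0..1})"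
      by (intro compact_continuous_image continuous_on_subset[OF T_continuous]) auto
    then show ?thesis using compact_imp_bounded bounded_iff by (metis image_eqI)
  qed
  then obtain M where "\<forall>t\<in>{0..1}. norm (T t) \<le> M" using uniform_boundedness[of "{0..1}" T] by blast
  then show ?thesis by (intro exI[of _ "max M 1"]) auto
qed

text \<open>The semigroup law splits [0, t] into at most floor t + 1 steps of length at most 1, each
  of norm at most M; the rate is ln M.\<close>

lemma T_exp_bound: "\<exists>M w. \<forall>t\<ge>0. norm (T t) \<le> M * exp (w * t)"
proof -
  obtain M where M: "M \<ge> 1" "\<And>t. t \<in> {0..1} \<Longrightarrow> norm (T t) \<le> M" using T_bounded_unit by blast
  have pow: "norm (T t) \<le> M ^ Suc n" if "0 \<le> t" "t \<le> real (Suc n)" for n t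
    using that
  proof (induction n arbitrary: t)
    case 0
    then show ?case using M by simp
  next
    case (Suc n)
    show ?case
    proof (cases "t \<le> 1")
      case True
      then have "norm (T t) \<le> M" using Suc M by simp
      also have "\<dots> \<le> M ^ Suc (Suc n)" using M power_increasing[of 1 "Suc (Suc n)" M] by simp
      finally show ?thesis .
    next
      case False
      have IH: "norm (T (t - 1)) \<le> M ^ Suc n" by (rule Suc.IH) (use False Suc.prems in auto)
      show ?thesis
      proof (rule norm_cblinfun_bound)
        fix x
        have "cblinfun_apply (T t) x = T 1 (cblinfun_apply (T (t - 1)) x)"
          using T_add[of 1 "t - 1" x] False by simp
        then have "norm (cblinfun_apply (T t) x) \<le> norm (T 1) * (norm (T (t - 1)) * norm x)"
          using norm_cblinfun_apply[of "T 1" "T (t - 1) x"] mult_left_mono[OF norm_cblinfun_apply[of "T (t - 1)" x], of "norm (T 1)"]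
          by simp
        also have "\<dots> \<le> M * (M ^ Suc n * norm x)"
          by (intro mult_mono M IH) (use M in auto)
        finally show "norm (cblinfun_apply (T t) x) \<le> M ^ Suc (Suc n) * norm x" by (simp add: mult_ac)
      qed (use M in auto)
    qed
  qed
  have "norm (T t) \<le> M * exp (ln M * t)" if "t \<ge> 0" for t
  proof -
    define n where "n = nat \<lfloor>t\<rfloor>"
    have n: "real n \<le> t" "t \<le> real (Suc n)" using that by (auto simp: n_def) linarith
    have "norm (T t) \<le> M ^ Suc n" by (rule pow) (use n that in auto)
    also have "\<dots> = M * M powr real n" using M by (simp add: powr_realpow)
    also have "\<dots> \<le> M * M powr t" using M n by (intro mult_left_mono powr_mono) auto
    also have "\<dots> = M * exp (ln M * t)" using M by (simp add: powr_def mult.commute)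
    finally show ?thesis .
  qed
  then show ?thesis by blast
qed

lemma growth_bound_finite: "growth_bound T < \<infinity>"
proof -
  obtain M w where "\<forall>t\<ge>0. norm (T t) \<le> M * exp (w * t)" using T_exp_bound by blast
  then have "growth_bound T \<le> ereal w" unfolding growth_bound_def by (intro Inf_lower) auto
  then show ?thesis using ereal_infty_less_eq(1) less_ereal.simps(2) linorder_not_less by fastforce
qed

lemma T_locally_bounded: "\<exists>M\<ge>0. \<forall>t\<in>{0..\<tau>}. norm (T t) \<le> M"
proof -
  obtain M w where M: "\<forall>t\<ge>0. norm (T t) \<le> M * exp (w * t)" using T_exp_bound by blast
  have "norm (T t) \<le> \<bar>M\<bar> * exp (\<bar>w\<bar> * \<tau>)" if "t \<in> {0..\<tau>}" for t
  proof -
    have "norm (T t) \<le> M * exp (w * t)" using M that by simp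
    also have "\<dots> \<le> \<bar>M\<bar> * exp (\<bar>w\<bar> * \<tau>)"
      using that by (intro mult_mono) (auto intro!: mult_mono)
    finally show ?thesis .
  qed
  then show ?thesis by (intro exI[of _ "\<bar>M\<bar> * exp (\<bar>w\<bar> * \<tau>)"]) auto
qed

text \<open>The integrated semigroup. It maps X into the domain of the generator A, with A
  \<open>sg1 t\<close> = \<open>T t\<close> - 1 (see \<open>sg1_generator\<close>); resolvents and
  input-output kernels are built from it.\<close>

definition sg1 :: "real \<Rightarrow> 'x \<Rightarrow> 'x" where
  "sg1 t x = integral {0..t} (\<lambda>s. cblinfun_apply (T s) x)"

lemma sg1_add: "sg1 t (x + y) = sg1 t x + sg1 t y"
  and sg1_diff: "sg1 t (x - y) = sg1 t x - sg1 t y"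
  and sg1_scaleR: "sg1 t (r *\<^sub>R x) = r *\<^sub>R sg1 t x"
  and sg1_scaleC: "sg1 t (c *\<^sub>C x) = c *\<^sub>C sg1 t x"
  using integral_linear[OF T_integrable[of 0 x t] bounded_linear_scaleC[of c]]
  by (simp_all add: sg1_def cblinfun_simps integral_add integral_diff T_integrable o_def)

lemma sg1_bound: "\<exists>M\<ge>0. \<forall>t\<in>{0..\<tau>}. \<forall>x. norm (sg1 t x) \<le> M * norm x"
proof -
  obtain M where M: "M \<ge> 0" "\<And>t. t \<in> {0..\<tau>} \<Longrightarrow> norm (T t) \<le> M" using T_locally_bounded by blast
  have "norm (sg1 t x) \<le> M * \<bar>\<tau>\<bar> * norm x" if t: "t \<in> {0..\<tau>}" for t x
  proof -
    have "norm (sg1 t x) \<le> (M * norm x) * (t - 0)"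
      unfolding sg1_def
    proof (rule integral_bound)
      show "norm (cblinfun_apply (T s) x) \<le> M * norm x" if "s \<in> {0..t}" for s
        using order_trans[OF norm_cblinfun_apply mult_right_mono[OF M(2)]] that t by auto
    qed (use t in \<open>auto intro: continuous_on_subset[OF T_continuous]\<close>)
    also have "\<dots> \<le> (M * norm x) * \<bar>\<tau>\<bar>" using t M by (intro mult_left_mono) auto
    finally show ?thesis by (simp add: mult_ac)
  qed
  then show ?thesis using M(1) by (intro exI[of _ "M * \<bar>\<tau>\<bar>"]) auto
qed

lemma sg1_tendsto:
  assumes "(f \<longlongrightarrow> x) F" "0 \<le> t"
  shows "((\<lambda>h. sg1 t (f h)) \<longlongrightarrow> sg1 t x) F"
proof -
  obtain M where "\<forall>s\<in>{0..t}. \<forall>x. norm (sg1 s x) \<le> M * norm x" using sg1_bound[of t] by blast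
  then have M: "norm (sg1 t x) \<le> M * norm x" for x using assms(2) by simp
  have "bounded_linear (sg1 t)"
    by (rule bounded_linear_intro[where K=M]) (auto simp: sg1_add sg1_scaleR M mult.commute)
  then show ?thesis using assms(1) by (rule bounded_linear.tendsto)
qed

lemma sg1_T: "0 \<le> t \<Longrightarrow> 0 \<le> h \<Longrightarrow> sg1 t (cblinfun_apply (T h) x) = T h (sg1 t x)"
  unfolding sg1_def cblinfun_integral[OF T_integrable[OF order_refl]]
  by (rule integral_cong) (simp add: T_commute)

lemma sg1_shift:
  assumes "0 \<le> t" "0 \<le> h"
  shows "sg1 (t + h) x = sg1 h x + cblinfun_apply (T h) (sg1 t x)"
proof -
  have "cblinfun_apply (T h) (sg1 t x) = integral {0..t} (\<lambda>s. cblinfun_apply (T (s + h)) x)"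
    unfolding sg1_def cblinfun_integral[OF T_integrable[OF order_refl]]
    by (rule integral_cong) (use assms in \<open>simp add: T_add[of h, symmetric] add.commute\<close>)
  also have "\<dots> = integral {h..t + h} (\<lambda>s. cblinfun_apply (T s) x)"
    using integral_shift_real_ivl[of h h "t + h" "\<lambda>s. cblinfun_apply (T s) x"] by simp
  finally show ?thesis
    using Henstock_Kurzweil_Integration.integral_combine[of 0 h "t + h" "\<lambda>s. cblinfun_apply (T s) x"] assms
    by (simp add: sg1_def T_integrable)
qed

lemma sg1_quotient:
  assumes t: "0 \<le> t"
  shows "((\<lambda>h. (1 / h) *\<^sub>R (cblinfun_apply (T h) (sg1 t x) - sg1 t x)) \<longlongrightarrow> cblinfun_apply (T t) x - x) (at_right 0)"
proof -
  \<comment> \<open>By \<open>sg1_shift\<close>, the increment of the orbit of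
    \<open>sg1 t x\<close> is the increment of \<open>sg1\<close> at t minus that at 0, so its
    quotient is a difference of two right difference quotients of one primitive.\<close>
  have "((\<lambda>h. (1 / h) *\<^sub>R (sg1 (t + h) x - sg1 t x) - (1 / h) *\<^sub>R (sg1 (0 + h) x - sg1 0 x)) \<longlongrightarrow> cblinfun_apply (T t) x - T 0 x) (at_right 0)"
    unfolding sg1_def by (intro tendsto_diff right_quotient_integral T_continuous t) auto
  moreover have "\<forall>\<^sub>F h in at_right 0. (1 / h) *\<^sub>R (sg1 (t + h) x - sg1 t x) - (1 / h) *\<^sub>R (sg1 (0 + h) x - sg1 0 x)
    = (1 / h) *\<^sub>R (cblinfun_apply (T h) (sg1 t x) - sg1 t x)"
    unfolding eventually_at_right_field using t
    by (intro exI[of _ 1]) (auto simp: sg1_shift scaleR_diff_right[symmetric] sg1_def[of 0])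
  ultimately show ?thesis by (simp add: tendsto_cong)
qed

lemma sg1_generator: "0 \<le> t \<Longrightarrow> (sg1 t x, cblinfun_apply (T t) x - x) \<in> generator T"
  using sg1_quotient by (simp add: generator_def)

text \<open>\<open>sg1 t\<close> is bounded and commutes with the semigroup, so applying it to the
  difference quotients of x computes the same limit as \<open>sg1_quotient\<close>.\<close>

lemma generator_integral:
  assumes "(x, z) \<in> generator T" "0 \<le> t"
  shows "cblinfun_apply (T t) x - x = sg1 t z"
proof (rule tendsto_unique[OF _ sg1_quotient[OF assms(2)]])
  have "((\<lambda>h. sg1 t ((1 / h) *\<^sub>R (cblinfun_apply (T h) x - x))) \<longlongrightarrow> sg1 t z) (at_right 0)"
    using assms by (intro sg1_tendsto) (auto simp: generator_def)
  moreover have "\<forall>\<^sub>F h in at_right 0. sg1 t ((1 / h) *\<^sub>R (cblinfun_apply (T h) x - x)) = (1 / h) *\<^sub>R (cblinfun_apply (T h) (sg1 t x) - sg1 t x)"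
    unfolding eventually_at_right_field using assms(2)
    by (intro exI[of _ 1]) (auto simp: sg1_scaleR sg1_diff sg1_T)
  ultimately show "((\<lambda>h. (1 / h) *\<^sub>R (cblinfun_apply (T h) (sg1 t x) - sg1 t x)) \<longlongrightarrow> sg1 t z) (at_right 0)"
    by (simp add: tendsto_cong)
qed simp

lemma generator_unique: "(x, z) \<in> generator T \<Longrightarrow> (x, z') \<in> generator T \<Longrightarrow> z = z'"
  unfolding generator_def by (auto intro: tendsto_unique[rotated])

lemma generator_scaleC: "(x, z) \<in> generator T \<Longrightarrow> (c *\<^sub>C x, c *\<^sub>C z) \<in> generator T"
proof -
  assume "(x, z) \<in> generator T"
  then have "((\<lambda>h. c *\<^sub>C ((1 / h) *\<^sub>R (cblinfun_apply (T h) x - x))) \<longlongrightarrow> c *\<^sub>C z) (at_right 0)"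
    by (auto simp: generator_def intro: bounded_linear.tendsto[OF bounded_linear_scaleC])
  moreover have "c *\<^sub>C ((1 / h) *\<^sub>R (cblinfun_apply (T h) x - x)) = (1 / h) *\<^sub>R (cblinfun_apply (T h) (c *\<^sub>C x) - c *\<^sub>C x)" for h
    by (simp add: cblinfun_simps linear_scale[OF bounded_linear.linear[OF bounded_linear_scaleC]]
        linear_diff[OF bounded_linear.linear[OF bounded_linear_scaleC]])
  ultimately show ?thesis by (simp add: generator_def)
qed

lemma generator_zero: "(0, 0) \<in> generator T"
  by (simp add: generator_def cblinfun_simps)

lemma generator_T: "(x, z) \<in> generator T \<Longrightarrow> 0 \<le> t \<Longrightarrow> (cblinfun_apply (T t) x, cblinfun_apply (T t) z) \<in> generator T"
proof -
  assume "(x, z) \<in> generator T" and t: "0 \<le> t"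
  then have "((\<lambda>h. cblinfun_apply (T t) ((1 / h) *\<^sub>R (cblinfun_apply (T h) x - x))) \<longlongrightarrow> cblinfun_apply (T t) z) (at_right 0)"
    by (auto simp: generator_def intro: bounded_linear.tendsto[OF bounded_linear_cblinfun_apply])
  moreover have "\<forall>\<^sub>F h in at_right 0. cblinfun_apply (T t) ((1 / h) *\<^sub>R (cblinfun_apply (T h) x - x))
     = (1 / h) *\<^sub>R (cblinfun_apply (T h) (cblinfun_apply (T t) x) - cblinfun_apply (T t) x)"
    unfolding eventually_at_right_field using t
    by (intro exI[of _ 1]) (auto simp: cblinfun_simps T_commute[of _ t])
  ultimately show ?thesis by (simp add: generator_def tendsto_cong)
qed

text \<open>The averages of an orbit over short intervals [0, h] lie in the domain and tend to
  x.\<close>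

lemma generator_dense: "closure (Domain (generator T)) = UNIV"
proof -
  have "x \<in> closure (Domain (generator T))" for x
  proof (rule Lim_in_closed_set)
    show "((\<lambda>h. (1 / h) *\<^sub>R (sg1 (0 + h) x - sg1 0 x)) \<longlongrightarrow> x) (at_right 0)"
      using right_quotient_integral[OF T_continuous[of x], of 0] by (simp add: sg1_def)
    have "(1 / h) *\<^sub>R (sg1 (0 + h) x - sg1 0 x) \<in> Domain (generator T)" if "h > 0" for h
      using generator_scaleC[OF sg1_generator[of h x], of "complex_of_real (1 / h)"] that
      by (auto simp: sg1_def[of 0] scaleR_scaleC)
    then show "\<forall>\<^sub>F h in at_right 0. (1 / h) *\<^sub>R (sg1 (0 + h) x - sg1 0 x) \<in> closure (Domain (generator T))"
      unfolding eventually_at_right_field by (intro exI[of _ 1]) (auto intro: subsetD[OF closure_subset])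
  qed auto
  then show ?thesis by blast
qed

text \<open>The generator is defined by a right derivative at 0. Writing the orbit as x plus a
  primitive gives a derivative within the whole interval, as the product rule in
  \<open>adjoint_semigroup\<close> requires.\<close>

lemma T_derivative:
  assumes "(x, z) \<in> generator T" "s \<in> {0..t}"
  shows "((\<lambda>r. cblinfun_apply (T r) x) has_vector_derivative cblinfun_apply (T s) z) (at s within {0..t})"
proof -
  have "((\<lambda>r. x + sg1 r z) has_vector_derivative 0 + cblinfun_apply (T s) z) (at s within {0..t})"
    unfolding sg1_def
    by (intro has_vector_derivative_add has_vector_derivative_const integral_has_vector_derivative
      continuous_on_subset[OF T_continuous] assms) auto
  moreover have "x + sg1 r z = cblinfun_apply (T r) x" if "r \<in> {0..t}" for r
    using generator_integral[OF assms(1), of r] that by (simp add: algebra_simps)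
  ultimately show ?thesis
    using has_vector_derivative_transform[of s "{0..t}" "\<lambda>r. cblinfun_apply (T r) x" "\<lambda>r. x + sg1 r z"] assms(2) by auto
qed

end

section \<open>Rescaled semigroups and existence of the resolvent\<close>

context c0_semigroup begin

text \<open>Its generator is A - \<mu>, which moves the resolvent of A at \<mu> to the point
  0.\<close>

definition rescaled :: "complex \<Rightarrow> real \<Rightarrow> 'x \<Rightarrow>\<^sub>C\<^sub>L 'x" where
  "rescaled \<mu> t = exp (- \<mu> * complex_of_real t) *\<^sub>C T t"

lemma rescaled_apply: "cblinfun_apply (rescaled \<mu> t) x = exp (- \<mu> * complex_of_real t) *\<^sub>C cblinfun_apply (T t) x"
  by (simp add: rescaled_def cblinfun_simps)

lemma C0_rescaled: "C0_semigroup (rescaled \<mu>)"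
  unfolding C0_semigroup_def
proof (intro conjI allI impI)
  show "cblinfun_apply (rescaled \<mu> 0) x = x" for x by (simp add: rescaled_apply scaleC_one)
  show "cblinfun_apply (rescaled \<mu> (s + t)) x = rescaled \<mu> s (cblinfun_apply (rescaled \<mu> t) x)"
    if "0 \<le> s" "0 \<le> t" for s t x
    using that by (simp add: rescaled_apply T_add cblinfun_simps scaleC_scaleC exp_add[symmetric] algebra_simps)
  show "continuous_on {0..} (\<lambda>t. cblinfun_apply (rescaled \<mu> t) x)" for x
    unfolding rescaled_apply
    by (intro bounded_bilinear.continuous_on[OF bounded_bilinear_scaleC] T_continuous continuous_intros)
qed

text \<open>The difference quotient of the rescaled orbit splits as in the product rule. The
  exponential factor tends to 1, so it can be divided away again for the converse.\<close>

lemma generator_rescaled: "(x, z - \<mu> *\<^sub>C x) \<in> generator (rescaled \<mu>) \<longleftrightarrow> (x, z) \<in> generator T"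
proof -
  let ?e = "\<lambda>h::real. exp (- \<mu> * complex_of_real h)"
  have e1: "((\<lambda>h::real. (1 / h) *\<^sub>R (?e h - 1)) \<longlongrightarrow> - \<mu>) (at_right 0)"
  proof -
    have "((\<lambda>z. exp (- \<mu> * z)) has_field_derivative - \<mu>) (at 0)"
      by (auto intro!: derivative_eq_intros)
    then have "((\<lambda>z. (exp (- \<mu> * z) - 1) / z) \<longlongrightarrow> - \<mu>) (at 0)"
      by (simp add: DERIV_def)
    moreover have "filterlim complex_of_real (at 0) (at_right 0)"
      unfolding filterlim_at
      by (auto intro!: tendsto_eq_intros simp: eventually_at_filter)
    ultimately have "((\<lambda>h. (?e h - 1) / complex_of_real h) \<longlongrightarrow> - \<mu>) (at_right 0)"
      by (rule filterlim_compose)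
    then show ?thesis by (simp add: scaleR_conv_of_real divide_inverse mult.commute)
  qed
  have e0: "((\<lambda>h. ?e h) \<longlongrightarrow> 1) (at_right 0)"
  proof -
    have "((\<lambda>h. ?e h) \<longlongrightarrow> ?e 0) (at_right 0)" by (intro tendsto_intros)
    then show ?thesis by simp
  qed
  let ?q = "\<lambda>h. (1 / h) *\<^sub>R (cblinfun_apply (T h) x - x)"
  have split: "(1 / h) *\<^sub>R (cblinfun_apply (rescaled \<mu> h) x - x) = ?e h *\<^sub>C ?q h + ((1 / h) *\<^sub>R (?e h - 1)) *\<^sub>C x" for h
  proof -
    have "cblinfun_apply (rescaled \<mu> h) x - x = ?e h *\<^sub>C (cblinfun_apply (T h) x - x) + (?e h - 1) *\<^sub>C x"
      by (simp add: rescaled_apply bounded_bilinear.diff_right[OF bounded_bilinear_scaleC]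
        bounded_bilinear.diff_left[OF bounded_bilinear_scaleC] scaleC_one)
    then show ?thesis
      by (simp add: scaleR_add_right bounded_bilinear.scaleR_right[OF bounded_bilinear_scaleC]
        bounded_bilinear.scaleR_left[OF bounded_bilinear_scaleC])
  qed
  have ex: "((\<lambda>h. ((1 / h) *\<^sub>R (?e h - 1)) *\<^sub>C x) \<longlongrightarrow> (- \<mu>) *\<^sub>C x) (at_right 0)"
    by (intro bounded_bilinear.tendsto[OF bounded_bilinear_scaleC] e1 tendsto_const)
  show ?thesis
  proof
    assume "(x, z) \<in> generator T"
    then have "((\<lambda>h. ?e h *\<^sub>C ?q h + ((1 / h) *\<^sub>R (?e h - 1)) *\<^sub>C x) \<longlongrightarrow> 1 *\<^sub>C z + (- \<mu>) *\<^sub>C x) (at_right 0)"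
      by (intro tendsto_add bounded_bilinear.tendsto[OF bounded_bilinear_scaleC] e0 ex) (auto simp: generator_def)
    moreover have "1 *\<^sub>C z + (- \<mu>) *\<^sub>C x = z - \<mu> *\<^sub>C x"
      by (simp add: scaleC_one bounded_bilinear.minus_left[OF bounded_bilinear_scaleC])
    ultimately show "(x, z - \<mu> *\<^sub>C x) \<in> generator (rescaled \<mu>)"
      by (simp only: generator_def split mem_Collect_eq case_prod_conv)
  next
    assume "(x, z - \<mu> *\<^sub>C x) \<in> generator (rescaled \<mu>)"
    then have "((\<lambda>h. ?e h *\<^sub>C ?q h + ((1 / h) *\<^sub>R (?e h - 1)) *\<^sub>C x) \<longlongrightarrow> z - \<mu> *\<^sub>C x) (at_right 0)"
      by (simp only: generator_def split mem_Collect_eq case_prod_conv)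
    from tendsto_diff[OF this ex] have "((\<lambda>h. ?e h *\<^sub>C ?q h) \<longlongrightarrow> z) (at_right 0)"
      by (simp add: bounded_bilinear.minus_left[OF bounded_bilinear_scaleC])
    moreover have "((\<lambda>h. inverse (?e h)) \<longlongrightarrow> inverse 1) (at_right 0)" by (intro tendsto_inverse e0) simp
    ultimately have "((\<lambda>h. inverse (?e h) *\<^sub>C ?e h *\<^sub>C ?q h) \<longlongrightarrow> inverse 1 *\<^sub>C z) (at_right 0)"
      by (intro bounded_bilinear.tendsto[OF bounded_bilinear_scaleC])
    then show "(x, z) \<in> generator T" by (simp add: generator_def scaleC_scaleC scaleC_one)
  qed
qed

text \<open>In place of a Laplace integral over the half-line: at a time t with norm of
  \<open>S t\<close> at most 1/2 the operator 1 - \<open>S t\<close> is invertible, and (\<mu> - A)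
  \<open>S.sg1 t\<close> = 1 - \<open>S t\<close>. The resolvent is therefore \<open>S.sg1 t\<close>
  after the inverse of 1 - \<open>S t\<close>.\<close>

lemma resolvent_exists:
  assumes "growth_bound T < ereal (Re \<mu>)"
  shows "\<exists>R. is_resolvent (generator T) \<mu> R"
proof -
  obtain M w where w: "w < Re \<mu>" and M: "\<And>t. t \<ge> 0 \<Longrightarrow> norm (T t) \<le> M * exp (w * t)"
  proof -
    obtain a where a: "a \<in> {ereal w |w. \<exists>M. \<forall>t\<ge>0. norm (T t) \<le> M * exp (w * t)}" "a < ereal (Re \<mu>)"
      using assms unfolding growth_bound_def Inf_less_iff by blast
    then obtain w M where "a = ereal w" "\<forall>t\<ge>0. norm (T t) \<le> M * exp (w * t)" by blast
    with a(2) show ?thesis by (intro that[of w M]) auto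
  qed
  define S where "S = rescaled \<mu>"
  interpret S: c0_semigroup S by unfold_locales (simp add: S_def C0_rescaled)
  \<comment> \<open>Solves max M 1 exp (- (Re \<mu> - w) t) = 1/2; the maximum with 1 makes the
    logarithm, hence t, nonnegative.\<close>
  define t where "t = ln (2 * max M 1) / (Re \<mu> - w)"
  have t: "t \<ge> 0" using w by (simp add: t_def)
  have "norm (S t) \<le> 1 / 2"
  proof -
    have "norm (S t) = exp (- Re \<mu> * t) * norm (T t)" by (simp add: S_def rescaled_def norm_scaleC)
    also have "\<dots> \<le> exp (- Re \<mu> * t) * (max M 1 * exp (w * t))"
      by (intro mult_left_mono order_trans[OF M[OF t]] mult_right_mono) auto
    also have "\<dots> = max M 1 * exp (- ((Re \<mu> - w) * t))" by (simp add: algebra_simps exp_add[symmetric])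
    also have "(Re \<mu> - w) * t = ln (2 * max M 1)" using w by (simp add: t_def)
    also have "max M 1 * exp (- ln (2 * max M 1)) = 1 / 2" by (simp add: exp_minus)
    finally show ?thesis by simp
  qed
  then obtain Q where Q1: "\<And>x. cblinfun_apply Q (x - S t x) = x" and Q2: "\<And>x. cblinfun_apply Q x - cblinfun_apply (S t) (Q x) = x"
    using one_minus_contraction_inverse by blast
  obtain K where "\<forall>s\<in>{0..t}. \<forall>x. norm (S.sg1 s x) \<le> K * norm x" using S.sg1_bound[of t] by blast
  then have K: "norm (S.sg1 t x) \<le> K * norm x" for x using t by simp
  have R: "cblinfun_apply (cblin (\<lambda>x. S.sg1 t (Q x))) x = S.sg1 t (Q x)" for x
  proof (rule cblin_apply[where M="\<bar>K\<bar> * norm Q"])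
    show "norm (S.sg1 t (Q x)) \<le> \<bar>K\<bar> * norm Q * norm x" for x
    proof -
      have "norm (S.sg1 t (Q x)) \<le> \<bar>K\<bar> * norm (Q x)" 
        by (rule order_trans[OF K mult_right_mono]) auto
      also have "\<dots> \<le> \<bar>K\<bar> * (norm Q * norm x)" by (intro mult_left_mono norm_cblinfun_apply) simp
      finally show ?thesis by simp
    qed
  qed (simp_all add: cblinfun_simps S.sg1_add S.sg1_scaleC)
  have gen: "(x, \<mu> *\<^sub>C x - y) \<in> generator T \<longleftrightarrow> (x, - y) \<in> generator S" for x y
    using generator_rescaled[of x "\<mu> *\<^sub>C x - y" \<mu>] by (simp add: S_def)
  have "(x, - y) \<in> generator S \<longleftrightarrow> x = S.sg1 t (Q y)" for x y
  proof
    assume "(x, - y) \<in> generator S"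
    then have "x - S t x = S.sg1 t y"
      using S.generator_integral[of x "- y" t] t S.sg1_scaleR[of t "-1" y] by (simp add: algebra_simps)
    then have "x = Q (S.sg1 t y)" using Q1[of x] by simp
    also have "S.sg1 t y = S.sg1 t (Q y) - S t (S.sg1 t (Q y))"
      using t by (subst Q2[of y, symmetric]) (simp add: S.sg1_diff S.sg1_T)
    finally show "x = S.sg1 t (Q y)" using Q1 by simp
  next
    assume "x = S.sg1 t (Q y)"
    then show "(x, - y) \<in> generator S"
      using S.sg1_generator[OF t, of "Q y"] arg_cong[OF Q2[of y], of uminus] by simp
  qed
  then have "is_resolvent (generator T) \<mu> (cblin (\<lambda>x. S.sg1 t (Q x)))"
    by (simp only: is_resolvent_def gen R simp_thms)
  then show ?thesis by blast
qed

end

section \<open>The semigroup generated by the adjoint\<close>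

lemma semigroup_of:
  assumes "generates_C0_semigroup A"
  shows "C0_semigroup (semigroup_of A)" "generator (semigroup_of A) = A"
  using someI_ex[OF assms[unfolded generates_C0_semigroup_def]] by (auto simp: semigroup_of_def)

text \<open>For f and x in the domains of the two generators, the pairing of \<open>S s f\<close>
  with \<open>T (t - s) x\<close> has derivative 0 in s, and its values at s = t and s = 0 are the
  two sides. Density extends this first to all x, then to all f; the latter uses that
  \<open>S\<close> is itself strongly continuous.\<close>

lemma adjoint_semigroup:
  assumes T: "C0_semigroup T" and S: "C0_semigroup S" and gen: "generator S = graph_adjoint (generator T)"
    and t: "0 \<le> t"
  shows "S t = cadjoint (T t)"
proof -
  interpret T: c0_semigroup T by unfold_locales fact
  interpret S: c0_semigroup S by unfold_locales fact
  have 1: "cdual_apply (S t f) x = cdual_apply f (T t x)"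
    if f: "(f, g) \<in> generator S" and x: "(x, z) \<in> generator T" for f g x z
  proof -
    let ?\<phi> = "\<lambda>s. cdual_apply (S s f) (T (t - s) x)"
    have "(?\<phi> has_vector_derivative 0) (at s within {0..t})" if s: "s \<in> {0..t}" for s
    proof -
      have "((\<lambda>s. cblinfun_apply (T (t - s)) x) has_vector_derivative (-1) *\<^sub>R cblinfun_apply (T (t - s)) z) (at s within {0..t})"
      proof (rule vector_diff_chain_within[of "\<lambda>s. t - s" _ _ _ "\<lambda>r. cblinfun_apply (T r) x", unfolded o_def])
        show "((-) t has_vector_derivative - 1) (at s within {0..t})"
          by (auto intro!: derivative_eq_intros)
        show "((\<lambda>r. cblinfun_apply (T r) x) has_vector_derivative cblinfun_apply (T (t - s)) z) (at (t - s) within (-) t ` {0..t})"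
          by (rule has_vector_derivative_within_subset[OF T.T_derivative[OF x, where t=t]]) (use s in auto)
      qed
      from bounded_bilinear.has_vector_derivative[OF bounded_bilinear_cdual_apply S.T_derivative[OF f s] this]
      have "(?\<phi> has_vector_derivative (cdual_apply (S s f) ((-1) *\<^sub>R T (t - s) z) + cdual_apply (S s g) (T (t - s) x))) (at s within {0..t})" .
      moreover have "cdual_apply (S s f) (T (t - s) z) = cdual_apply (S s g) (T (t - s) x)"
        using S.generator_T[OF f, of s] T.generator_T[OF x, of "t - s"] s unfolding gen graph_adjoint_def by auto
      ultimately show ?thesis by (simp add: cdual_simps)
    qed
    then obtain c where "\<And>s. s \<in> {0..t} \<Longrightarrow> ?\<phi> s = c"
      using has_vector_derivative_zero_constant[of "{0..t}" ?\<phi>] by auto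
    then show ?thesis using t by (metis (no_types, lifting) S.T_0 T.T_0 atLeastAtMost_iff diff_self diff_zero order_refl)
  qed
  have 2: "cdual_apply (S t f) x = cdual_apply f (T t x)" if f: "(f, g) \<in> generator S" for f g x
  proof -
    have "closed {x. cdual_apply (S t f) x = cdual_apply f (T t x)}"
      by (intro closed_Collect_eq bounded_bilinear.continuous_on[OF bounded_bilinear_cdual_apply]
        continuous_intros linear_continuous_on bounded_linear_cblinfun_apply)
    then have "closure (Domain (generator T)) \<subseteq> {x. cdual_apply (S t f) x = cdual_apply f (T t x)}"
      by (rule closure_minimal[rotated]) (use 1[OF f] in auto)
    then show ?thesis using T.generator_dense by auto
  qed
  have 3: "S t f = cadjoint (T t) f" for f
  proof -
    have "closed {f. cblinfun_apply (S t) f = cblinfun_apply (cadjoint (T t)) f}"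
      by (intro closed_Collect_eq linear_continuous_on bounded_linear_cblinfun_apply)
    then have "closure (Domain (generator S)) \<subseteq> {f. cblinfun_apply (S t) f = cblinfun_apply (cadjoint (T t)) f}"
      by (rule closure_minimal[rotated]) (auto intro!: cdual_eqI simp: 2 cadjoint_apply cdual_comp_apply)
    then show ?thesis using S.generator_dense by auto
  qed
  then show ?thesis by (rule cblinfun_eqI)
qed

text \<open>Makes the half planes of a node and of its dual conjugate to each other.\<close>

lemma growth_bound_adjoint:
  assumes "\<And>t. 0 \<le> t \<Longrightarrow> S t = cadjoint (T t)"
  shows "growth_bound S = growth_bound T"
proof -
  have "norm (S t) = norm (T t)" if "t \<ge> 0" for t using assms[OF that] norm_cadjoint by metis
  then have "(\<forall>t\<ge>0. norm (S t) \<le> M * exp (w * t)) \<longleftrightarrow> (\<forall>t\<ge>0. norm (T t) \<le> M * exp (w * t))" for M w by auto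
  then show ?thesis by (simp add: growth_bound_def)
qed

section \<open>Resolvents and the spaces associated with a system node\<close>

lemma resolvent_eq:
  assumes "is_resolvent A \<mu> R"
  shows "resolvent A \<mu> = R"
  unfolding resolvent_def
proof (rule the_equality)
  show "is_resolvent A \<mu> R" by fact
  fix R' assume R': "is_resolvent A \<mu> R'"
  show "R' = R"
  proof (rule cblinfun_eqI)
    fix z
    have "(cblinfun_apply R' z, \<mu> *\<^sub>C cblinfun_apply R' z - z) \<in> A" using R' unfolding is_resolvent_def by blast
    then show "cblinfun_apply R' z = cblinfun_apply R z" using assms unfolding is_resolvent_def by blast
  qed
qed

lemma is_resolvent_resolvent: "\<mu> \<in> resolvent_set A \<Longrightarrow> is_resolvent A \<mu> (resolvent A \<mu>)"
  unfolding resolvent_set_def using resolvent_eq by blast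

lemma resolvent_mem: "\<mu> \<in> resolvent_set A \<Longrightarrow> (cblinfun_apply (resolvent A \<mu>) z, \<mu> *\<^sub>C cblinfun_apply (resolvent A \<mu>) z - z) \<in> A"
  and resolvent_cancel: "\<mu> \<in> resolvent_set A \<Longrightarrow> (x, z) \<in> A \<Longrightarrow> cblinfun_apply (resolvent A \<mu>) (\<mu> *\<^sub>C x - z) = x"
  using is_resolvent_resolvent[of \<mu> A] unfolding is_resolvent_def by (auto, metis diff_diff_eq2 diff_add_cancel add_diff_cancel_left')

text \<open>The point is conjugated because functionals are conjugate-linear: they turn a factor
  \<mu> of their argument into the factor cnj \<mu>.\<close>

lemma is_resolvent_adjoint:
  assumes R: "is_resolvent A \<mu> R"
  shows "is_resolvent (graph_adjoint A) (cnj \<mu>) (cadjoint R)"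
  unfolding is_resolvent_def
proof (intro allI iffI)
  have mem: "(cblinfun_apply R y, \<mu> *\<^sub>C cblinfun_apply R y - y) \<in> A" for y using R unfolding is_resolvent_def by blast
  have canc: "cblinfun_apply R (\<mu> *\<^sub>C x - z) = x" if "(x, z) \<in> A" for x z
  proof -
    have "(x, \<mu> *\<^sub>C x - (\<mu> *\<^sub>C x - z)) \<in> A" using that by simp
    then show ?thesis using R unfolding is_resolvent_def by metis
  qed
  fix f g
  show "f = cblinfun_apply (cadjoint R) g" if "(f, cnj \<mu> *\<^sub>C f - g) \<in> graph_adjoint A"
  proof (rule cdual_eqI)
    fix y
    have "cdual_apply f (\<mu> *\<^sub>C R y - y) = cdual_apply (cnj \<mu> *\<^sub>C f - g) (R y)"
      using that mem[of y] unfolding graph_adjoint_def by blast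
    then show "cdual_apply f y = cdual_apply (cblinfun_apply (cadjoint R) g) y"
      by (simp add: cdual_simps cadjoint_apply cdual_comp_apply)
  qed
  show "(f, cnj \<mu> *\<^sub>C f - g) \<in> graph_adjoint A" if f: "f = cblinfun_apply (cadjoint R) g"
  proof -
    have "cdual_apply f z = cdual_apply (cnj \<mu> *\<^sub>C f - g) x" if xz: "(x, z) \<in> A" for x z
    proof -
      have "cdual_apply g (R (\<mu> *\<^sub>C x - z)) = cdual_apply g x" by (simp add: canc[OF xz])
      then show ?thesis
        by (simp add: f cadjoint_apply cdual_comp_apply cdual_simps cblinfun_simps diff_eq_eq eq_diff_eq add.commute)
    qed
    then show ?thesis by (auto simp: graph_adjoint_def)
  qed
qed

locale node =
  fixes N :: "('u::cbanach, 'x1::cbanach, 'x::cbanach, 'xm::cbanach, 'y::cbanach) node"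
  assumes node: "system_node N"
begin

abbreviation "\<T> \<equiv> node_semigroup N"
abbreviation "\<A> \<equiv> A_op N"
abbreviation "\<H> \<equiv> node_half_plane N"
abbreviation "res \<equiv> resolvent \<A>"

lemma gen: "generator \<T> = \<A>" and C0_node: "C0_semigroup \<T>"
  using node semigroup_of by (auto simp: system_node_def)

end

sublocale node \<subseteq> c0: c0_semigroup "node_semigroup N"
  by unfold_locales (rule C0_node)

context node begin

lemmas A_unique = c0.generator_unique[unfolded gen]
  and A_zero = c0.generator_zero[unfolded gen]
  and A_T = c0.generator_T[unfolded gen]
  and A_dense = c0.generator_dense[unfolded gen]

lemma base: "base N \<in> resolvent_set \<A>"
  and emb1_range: "range (cblinfun_apply (emb1 N)) = Domain \<A>"
  and emb1_norm: "(cblinfun_apply (emb1 N) \<xi>, z) \<in> \<A> \<Longrightarrow> norm \<xi> = norm (base N *\<^sub>C cblinfun_apply (emb1 N) \<xi> - z)"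
  and embm_norm: "norm (cblinfun_apply (embm N) x) = norm (cblinfun_apply (res (base N)) x)"
  and embm_dense: "closure (range (cblinfun_apply (embm N))) = UNIV"
  and G_analytic: "analytic_on_set (G_tf N) \<H>"
  and G_eq: "\<alpha> \<in> \<H> \<Longrightarrow> \<beta> \<in> \<H> \<Longrightarrow> cblinfun_apply (G_tf N \<alpha>) u - cblinfun_apply (G_tf N \<beta>) u =
        C_op N (inv (emb1 N) (resolvent_ext N \<alpha> (B_op N u) - resolvent_ext N \<beta> (B_op N u)))"
  using node unfolding system_node_def by auto

lemma half_plane_resolvent: "\<mu> \<in> \<H> \<Longrightarrow> \<mu> \<in> resolvent_set \<A>"
  using c0.resolvent_exists[of \<mu>] by (auto simp: node_half_plane_def right_half_plane_def gen resolvent_set_def)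

lemma half_plane_nonempty: "\<H> \<noteq> {}"
proof -
  obtain r where "growth_bound \<T> < ereal r" using c0.growth_bound_finite less_PInf_Ex_of_nat by (metis ereal_dense2)
  then have "complex_of_real r \<in> \<H>" by (simp add: node_half_plane_def right_half_plane_def)
  then show ?thesis by blast
qed

lemma res_range: "\<mu> \<in> resolvent_set \<A> \<Longrightarrow> range (cblinfun_apply (res \<mu>)) = Domain \<A>"
  using resolvent_mem[of \<mu> \<A>] resolvent_cancel[of \<mu> \<A>] by (auto simp: image_iff) metis

lemma res_dense: "\<mu> \<in> resolvent_set \<A> \<Longrightarrow> closure (range (cblinfun_apply (res \<mu>))) = UNIV"
  by (simp add: res_range A_dense)

lemma res_inj:
  assumes "\<mu> \<in> resolvent_set \<A>" "cblinfun_apply (res \<mu>) z = 0"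
  shows "z = 0"
proof -
  have "\<mu> *\<^sub>C (0::'x) = 0" using norm_scaleC[of \<mu> "0::'x"] by simp
  then have "(0, - z) \<in> \<A>" using resolvent_mem[OF assms(1), of z] assms(2) by simp
  then show ?thesis using A_unique[OF _ A_zero] by fastforce
qed

lemma res_identity:
  assumes "\<mu> \<in> resolvent_set \<A>" "\<nu> \<in> resolvent_set \<A>"
  shows "cblinfun_apply (res \<mu>) x - res \<nu> x = (\<nu> - \<mu>) *\<^sub>C res \<mu> (cblinfun_apply (res \<nu>) x)"
proof -
  have "cblinfun_apply (res \<mu>) (\<mu> *\<^sub>C res \<nu> x - (\<nu> *\<^sub>C res \<nu> x - x)) = res \<nu> x"
    by (rule resolvent_cancel[OF assms(1) resolvent_mem[OF assms(2)]])
  then have "res \<nu> x = \<mu> *\<^sub>C res \<mu> (cblinfun_apply (res \<nu>) x) - \<nu> *\<^sub>C res \<mu> (cblinfun_apply (res \<nu>) x) + cblinfun_apply (res \<mu>) x"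
    by (simp add: cblinfun_simps algebra_simps)
  then have "cblinfun_apply (res \<mu>) x - res \<nu> x = cblinfun_apply (res \<mu>) x
     - (\<mu> *\<^sub>C res \<mu> (cblinfun_apply (res \<nu>) x) - \<nu> *\<^sub>C res \<mu> (cblinfun_apply (res \<nu>) x) + cblinfun_apply (res \<mu>) x)"
    by (rule arg_cong)
  then show ?thesis by (simp add: bounded_bilinear.diff_left[OF bounded_bilinear_scaleC])
qed

lemma res_T: "\<mu> \<in> resolvent_set \<A> \<Longrightarrow> 0 \<le> t \<Longrightarrow> cblinfun_apply (res \<mu>) (\<T> t x) = \<T> t (cblinfun_apply (res \<mu>) x)"
  using resolvent_cancel[OF _ A_T[OF resolvent_mem], of \<mu> \<mu> t x] by (simp add: cblinfun_simps)

text \<open>The norm of X_{-1} is attached to \<open>base N\<close>, which need not lie in the half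
  plane. Comparability lets the resolvent at any point of the resolvent set extend to X_{-1} and be
  bounded below there.\<close>

lemma res_comparable:
  assumes "\<mu> \<in> resolvent_set \<A>" "\<nu> \<in> resolvent_set \<A>"
  shows "\<exists>M>0. \<forall>x. norm (cblinfun_apply (res \<mu>) x) \<le> M * norm (cblinfun_apply (res \<nu>) x)"
proof -
  let ?M = "1 + cmod (\<nu> - \<mu>) * norm (res \<mu>)"
  have "norm (cblinfun_apply (res \<mu>) x) \<le> ?M * norm (cblinfun_apply (res \<nu>) x)" for x
  proof -
    have "cblinfun_apply (res \<mu>) x = res \<nu> x + (\<nu> - \<mu>) *\<^sub>C res \<mu> (cblinfun_apply (res \<nu>) x)"
      using res_identity[OF assms, of x] by (simp add: algebra_simps)
    then have "norm (cblinfun_apply (res \<mu>) x) \<le> norm (cblinfun_apply (res \<nu>) x)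
       + cmod (\<nu> - \<mu>) * norm (cblinfun_apply (res \<mu>) (cblinfun_apply (res \<nu>) x))"
      using norm_triangle_ineq[of "cblinfun_apply (res \<nu>) x" "(\<nu> - \<mu>) *\<^sub>C res \<mu> (cblinfun_apply (res \<nu>) x)"]
      by (simp add: norm_scaleC)
    also have "\<dots> \<le> norm (cblinfun_apply (res \<nu>) x)
       + cmod (\<nu> - \<mu>) * (norm (res \<mu>) * norm (cblinfun_apply (res \<nu>) x))"
      by (intro add_left_mono mult_left_mono norm_cblinfun_apply) auto
    finally show ?thesis by (simp add: algebra_simps)
  qed
  moreover have "?M > 0" by (simp add: add_pos_nonneg)
  ultimately show ?thesis by blast
qed

section \<open>Resolvents with values in X_1 and extensions to X_{-1}\<close>

lemma emb1_inj: "inj (cblinfun_apply (emb1 N))"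
proof (rule injI)
  fix \<xi> \<eta> assume "cblinfun_apply (emb1 N) \<xi> = cblinfun_apply (emb1 N) \<eta>"
  then have 0: "cblinfun_apply (emb1 N) (\<xi> - \<eta>) = 0" by (simp add: cblinfun_simps)
  have "base N *\<^sub>C (0::'x) = 0" using norm_scaleC[of "base N" "0::'x"] by simp
  then have "norm (\<xi> - \<eta>) = 0" using emb1_norm[of "\<xi> - \<eta>" 0] A_zero 0 by simp
  then show "\<xi> = \<eta>" by simp
qed

lemma emb1_inv: "(x, z) \<in> \<A> \<Longrightarrow> cblinfun_apply (emb1 N) (inv (emb1 N) x) = x"
  using emb1_range f_inv_into_f[of x "cblinfun_apply (emb1 N)" UNIV] by auto

text \<open>The resolvent as an operator into X_1, where C acts. Its adjoint will be the extended
  resolvent of the dual node, see \<open>dual_resolvent_ext\<close>.\<close>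

definition res1 :: "complex \<Rightarrow> 'x \<Rightarrow>\<^sub>C\<^sub>L 'x1" where
  "res1 \<mu> = cblin (\<lambda>y. inv (emb1 N) (res \<mu> y))"

lemma res1_apply:
  assumes \<mu>: "\<mu> \<in> resolvent_set \<A>"
  shows "cblinfun_apply (res1 \<mu>) y = inv (emb1 N) (res \<mu> y)"
  unfolding res1_def
proof (rule cblin_apply[where M="cmod (base N - \<mu>) * norm (res \<mu>) + 1"])
  note e = emb1_inv[OF resolvent_mem[OF \<mu>]]
  note i = injD[OF emb1_inj]
  show "inv (emb1 N) (res \<mu> (x + y)) = inv (emb1 N) (res \<mu> x) + inv (emb1 N) (res \<mu> y)" for x y
    by (rule i) (simp only: e cblinfun_add_right[of "emb1 N"], simp only: cblinfun_add_right)
  show "inv (emb1 N) (res \<mu> (c *\<^sub>C x)) = c *\<^sub>C inv (emb1 N) (res \<mu> x)" for c x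
    by (rule i) (simp only: e cblinfun_apply_scaleC[of "emb1 N"], simp only: cblinfun_apply_scaleC)
  show "norm (inv (emb1 N) (res \<mu> y)) \<le> (cmod (base N - \<mu>) * norm (res \<mu>) + 1) * norm y" for y
  proof -
    have "norm (inv (emb1 N) (res \<mu> y)) = norm (base N *\<^sub>C res \<mu> y - (\<mu> *\<^sub>C cblinfun_apply (res \<mu>) y - y))"
      by (rule emb1_norm[of "inv (emb1 N) (res \<mu> y)", unfolded e, OF resolvent_mem[OF \<mu>]])
    also have "base N *\<^sub>C res \<mu> y - (\<mu> *\<^sub>C cblinfun_apply (res \<mu>) y - y) = (base N - \<mu>) *\<^sub>C res \<mu> y + y"
      by (simp add: bounded_bilinear.diff_left[OF bounded_bilinear_scaleC])
    also have "norm \<dots> \<le> cmod (base N - \<mu>) * norm (cblinfun_apply (res \<mu>) y) + norm y"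
      using norm_triangle_ineq[of "(base N - \<mu>) *\<^sub>C res \<mu> y" y] by (simp add: norm_scaleC)
    also have "\<dots> \<le> cmod (base N - \<mu>) * (norm (res \<mu>) * norm y) + norm y"
      by (intro add_right_mono mult_left_mono norm_cblinfun_apply) auto
    finally show ?thesis by (simp add: algebra_simps)
  qed
qed

lemma emb1_res1: "\<mu> \<in> resolvent_set \<A> \<Longrightarrow> cblinfun_apply (emb1 N) (cblinfun_apply (res1 \<mu>) y) = res \<mu> y"
  by (simp add: res1_apply emb1_inv[OF resolvent_mem])

text \<open>Together with \<open>res1_base_surj\<close> this gives an isometry of X onto X_1, so
  that dual norms on X_1 can be computed as suprema over X.\<close>

lemma norm_res1_base: "norm (cblinfun_apply (res1 (base N)) y) = norm y"
  using emb1_norm[of "res1 (base N) y", unfolded emb1_res1[OF base], OF resolvent_mem[OF base]] by simp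

lemma res1_base_surj: "\<exists>y. \<xi> = cblinfun_apply (res1 (base N)) y"
proof -
  obtain z where "(cblinfun_apply (emb1 N) \<xi>, z) \<in> \<A>" using emb1_range by blast
  then have "cblinfun_apply (emb1 N) (res1 (base N) (base N *\<^sub>C emb1 N \<xi> - z)) = emb1 N \<xi>"
    using emb1_res1[OF base] resolvent_cancel[OF base] by simp
  then show ?thesis using injD[OF emb1_inj] by metis
qed

lemma resolvent_ext:
  assumes \<mu>: "\<mu> \<in> resolvent_set \<A>"
  shows "cblinfun_apply (resolvent_ext N \<mu>) (embm N x) = res \<mu> x"
  unfolding resolvent_ext_def
proof (rule dense_extension_the[OF embm_dense])
  obtain M where M: "\<And>x. norm (cblinfun_apply (res \<mu>) x) \<le> M * norm (cblinfun_apply (res (base N)) x)"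
    using res_comparable[OF \<mu> base] by blast
  show "\<exists>E. \<forall>x. cblinfun_apply E (embm N x) = res \<mu> x"
    by (rule dense_extension[OF embm_dense, where M=M]) (auto simp: cblinfun_simps embm_norm M)
qed

text \<open>On the dense image of X this is \<open>res_comparable\<close> read in the other
  direction; both sides are continuous.\<close>

lemma resolvent_ext_below:
  assumes \<mu>: "\<mu> \<in> resolvent_set \<A>"
  shows "\<exists>M. \<forall>y. norm y \<le> M * norm (cblinfun_apply (resolvent_ext N \<mu>) y)"
proof -
  obtain M where M: "\<And>x. norm (cblinfun_apply (res (base N)) x) \<le> M * norm (cblinfun_apply (res \<mu>) x)"
    using res_comparable[OF base \<mu>] by blast
  have "norm y \<le> M * norm (cblinfun_apply (resolvent_ext N \<mu>) y)" for y
  proof -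
    have "closed {y. norm y \<le> M * norm (cblinfun_apply (resolvent_ext N \<mu>) y)}"
      by (intro closed_Collect_le continuous_intros linear_continuous_on bounded_linear_cblinfun_apply)
    then have "closure (range (cblinfun_apply (embm N))) \<subseteq> {y. norm y \<le> M * norm (cblinfun_apply (resolvent_ext N \<mu>) y)}"
      by (intro closure_minimal) (auto simp: embm_norm resolvent_ext[OF \<mu>] M)
    then show ?thesis using embm_dense by auto
  qed
  then show ?thesis by blast
qed

text \<open>The means of proving identities in X_{-1}: apply the resolvent and compare in X.\<close>

lemma resolvent_ext_inj:
  assumes "\<mu> \<in> resolvent_set \<A>" "cblinfun_apply (resolvent_ext N \<mu>) y = cblinfun_apply (resolvent_ext N \<mu>) y'"
  shows "y = y'"
proof -
  obtain M where "norm (y - y') \<le> M * norm (cblinfun_apply (resolvent_ext N \<mu>) (y - y'))"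
    using resolvent_ext_below[OF assms(1)] by blast
  then show ?thesis using assms(2) by (simp add: cblinfun_simps)
qed

lemma embm_inj: "cblinfun_apply (embm N) x = cblinfun_apply (embm N) x' \<Longrightarrow> x = x'"
  using res_inj[OF base, of "x - x'"] resolvent_ext[OF base, of x] resolvent_ext[OF base, of x']
  by (simp add: cblinfun_simps)

text \<open>In the norm of X_{-1} the semigroup is no larger than on X, because it commutes with the
  resolvent that defines this norm.\<close>

lemma semigroup_ext:
  assumes t: "0 \<le> t"
  shows "cblinfun_apply (semigroup_ext N t) (embm N x) = embm N (\<T> t x)"
  unfolding semigroup_ext_def
proof (rule dense_extension_the[OF embm_dense])
  show "\<exists>E. \<forall>x. cblinfun_apply E (embm N x) = embm N (\<T> t x)"
    by (rule dense_extension[OF embm_dense, where M="norm (\<T> t)"])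
      (auto simp: cblinfun_simps embm_norm res_T[OF base t] norm_cblinfun_apply)
qed

lemma resolvent_semigroup_ext:
  assumes "\<mu> \<in> resolvent_set \<A>" "0 \<le> t"
  shows "cblinfun_apply (resolvent_ext N \<mu>) (semigroup_ext N t y) = \<T> t (cblinfun_apply (resolvent_ext N \<mu>) y)"
proof -
  have "ccomp (resolvent_ext N \<mu>) (semigroup_ext N t) = ccomp (\<T> t) (resolvent_ext N \<mu>)"
    by (rule cblinfun_eq_on_dense[OF embm_dense])
      (simp add: ccomp_apply semigroup_ext resolvent_ext res_T assms)
  then show ?thesis by (metis ccomp_apply)
qed

text \<open>Each x in the domain is the resolvent at \<open>base N\<close> of some y, and then A x
  is \<open>base N\<close> times x minus y. In the norm of X_{-1} this vector is controlled by the
  norm of x alone, so A extends by density.\<close>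

lemma A_ext:
  assumes "(x, z) \<in> \<A>"
  shows "cblinfun_apply (A_ext N) x = embm N z"
proof -
  let ?P = "\<lambda>S. \<forall>(x, z)\<in>\<A>. cblinfun_apply S x = embm N z"
  have bd: "norm (cblinfun_apply (embm N) (base N *\<^sub>C res (base N) x - x)) \<le> (cmod (base N) * norm (res (base N)) + 1) * norm (cblinfun_apply (res (base N)) x)" for x
  proof -
    let ?R = "cblinfun_apply (res (base N))"
    have "norm (cblinfun_apply (embm N) (base N *\<^sub>C ?R x - x)) = norm (base N *\<^sub>C ?R (?R x) - ?R x)"
      unfolding embm_norm by (simp add: cblinfun_simps)
    also have "\<dots> \<le> cmod (base N) * norm (?R (?R x)) + norm (?R x)"
      using norm_triangle_ineq4[of "base N *\<^sub>C ?R (?R x)" "?R x"] by (simp add: norm_scaleC)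
    also have "\<dots> \<le> cmod (base N) * (norm (res (base N)) * norm (?R x)) + norm (?R x)"
      by (intro add_right_mono mult_left_mono norm_cblinfun_apply) auto
    finally show ?thesis by (simp add: algebra_simps)
  qed
  have "\<exists>E. \<forall>x. cblinfun_apply E (res (base N) x) = embm N (base N *\<^sub>C res (base N) x - x)"
    by (rule dense_extension[OF res_dense[OF base] _ _ bd])
      (simp_all add: cblinfun_simps scaleC_add_right scaleC_scaleC mult.commute
       bounded_bilinear.diff_right[OF bounded_bilinear_scaleC])
  then obtain E where E: "\<And>x. cblinfun_apply E (res (base N) x) = embm N (base N *\<^sub>C res (base N) x - x)" by blast
  have "cblinfun_apply E x = embm N z" if "(x, z) \<in> \<A>" for x z
    using E[of "base N *\<^sub>C x - z"] resolvent_cancel[OF base that] by simp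
  then have P: "?P E" by auto
  have "?P (A_ext N)"
    unfolding A_ext_def
  proof (rule theI[where P="?P"])
    show "?P E" by (rule P)
    fix E' assume P': "?P E'"
    show "E' = E"
    proof (rule cblinfun_eq_on_dense[OF res_dense[OF base]])
      show "cblinfun_apply E' (res (base N) x) = cblinfun_apply E (res (base N) x)" for x
        using bspec[OF P' resolvent_mem[OF base, of x]] bspec[OF P resolvent_mem[OF base, of x]] by simp
    qed
  qed
  then show ?thesis using assms by auto
qed

lemma resolvent_A_ext:
  assumes \<mu>: "\<mu> \<in> resolvent_set \<A>"
  shows "cblinfun_apply (resolvent_ext N \<mu>) (A_ext N x) = \<mu> *\<^sub>C res \<mu> x - x"
proof -
  have "ccomp (resolvent_ext N \<mu>) (A_ext N) = \<mu> *\<^sub>C res \<mu> - cid"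
  proof (rule cblinfun_eq_on_dense[OF res_dense[OF \<mu>]])
    show "cblinfun_apply (ccomp (resolvent_ext N \<mu>) (A_ext N)) (res \<mu> y) = cblinfun_apply (\<mu> *\<^sub>C res \<mu> - cid) (res \<mu> y)" for y
      using A_ext[OF resolvent_mem[OF \<mu>, of y]]
      by (simp add: ccomp_apply resolvent_ext[OF \<mu>] cblinfun_simps)
  qed
  then show ?thesis by (metis ccomp_apply cblinfun_diff_left cblinfun_scaleC_left cid_apply)
qed

text \<open>A difference of resolvents is a multiple of their product, so it gains two steps of
  regularity, from X_{-1} to X_1. \<open>E\<close> is the operator that stands between B and C in
  the identity for \<open>G_tf\<close>.\<close>

lemma res1_diff_ext:
  assumes \<mu>: "\<mu> \<in> resolvent_set \<A>" and \<nu>: "\<nu> \<in> resolvent_set \<A>"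
  shows "\<exists>E. (\<forall>x. cblinfun_apply E (embm N x) = cblinfun_apply (res1 \<mu>) x - res1 \<nu> x) \<and>
    (\<forall>y. cblinfun_apply (emb1 N) (cblinfun_apply E y) = cblinfun_apply (resolvent_ext N \<mu>) y - resolvent_ext N \<nu> y)"
proof -
  obtain M where M: "M > 0" "\<And>x. norm (cblinfun_apply (res \<nu>) x) \<le> M * norm (cblinfun_apply (res (base N)) x)"
    using res_comparable[OF \<nu> base] by blast
  have id: "cblinfun_apply (res1 \<mu>) x - res1 \<nu> x = (\<nu> - \<mu>) *\<^sub>C res1 \<mu> (cblinfun_apply (res \<nu>) x)" for x
    by (rule injD[OF emb1_inj]) (simp add: cblinfun_simps emb1_res1 \<mu> \<nu> res_identity[OF \<mu> \<nu>, symmetric])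
  have bd: "norm (cblinfun_apply (res1 \<mu>) x - res1 \<nu> x) \<le> (cmod (\<nu> - \<mu>) * (norm (res1 \<mu>) * M)) * norm (cblinfun_apply (embm N) x)" for x
  proof -
    have "norm (cblinfun_apply (res1 \<mu>) x - res1 \<nu> x) \<le> cmod (\<nu> - \<mu>) * (norm (res1 \<mu>) * norm (cblinfun_apply (res \<nu>) x))"
      unfolding id norm_scaleC by (intro mult_left_mono norm_cblinfun_apply) auto
    also have "\<dots> \<le> cmod (\<nu> - \<mu>) * (norm (res1 \<mu>) * (M * norm (cblinfun_apply (res (base N)) x)))"
      by (intro mult_left_mono M) auto
    finally show ?thesis by (simp add: embm_norm mult_ac)
  qed
  obtain E where E: "\<And>x. cblinfun_apply E (embm N x) = cblinfun_apply (res1 \<mu>) x - res1 \<nu> x"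
    using dense_extension[OF embm_dense _ _ bd]
    by (auto simp: cblinfun_simps bounded_bilinear.diff_right[OF bounded_bilinear_scaleC])
  have "ccomp (emb1 N) E = resolvent_ext N \<mu> - resolvent_ext N \<nu>"
    by (rule cblinfun_eq_on_dense[OF embm_dense])
      (simp add: ccomp_apply E cblinfun_simps emb1_res1 resolvent_ext \<mu> \<nu>)
  then have "cblinfun_apply (emb1 N) (cblinfun_apply E y) = cblinfun_apply (resolvent_ext N \<mu>) y - resolvent_ext N \<nu> y" for y
    by (metis ccomp_apply cblinfun_diff_left)
  then show ?thesis using E by blast
qed

end

section \<open>The dual system node\<close>

locale dual_pair = node N for N :: "('u::cbanach, 'x1::cbanach, 'x::cbanach, 'xm::cbanach, 'y::cbanach) node" +
  assumes gen_adjoint: "generates_C0_semigroup (graph_adjoint (A_op N))"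
begin

abbreviation "N' \<equiv> dual_node N"

lemma dual_fields [simp]:
  "A_op N' = graph_adjoint \<A>" "base N' = cnj (base N)" "emb1 N' = cadjoint (embm N)" "embm N' = cadjoint (emb1 N)"
  "B_op N' = cadjoint (C_op N)" "C_op N' = cadjoint (B_op N)" "G_tf N' s = cadjoint (G_tf N (cnj s))"
  by (simp_all add: dual_node_def)

lemma dual_semigroup: "0 \<le> t \<Longrightarrow> node_semigroup N' t = cadjoint (\<T> t)"
  using adjoint_semigroup[OF C0_node semigroup_of(1)[OF gen_adjoint]] semigroup_of(2)[OF gen_adjoint] by (simp add: gen)

lemma dual_half_plane: "s \<in> node_half_plane N' \<longleftrightarrow> cnj s \<in> \<H>"
  using growth_bound_adjoint[of "node_semigroup N'" \<T>, OF dual_semigroup]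
  by (simp add: node_half_plane_def right_half_plane_def)

lemma dual_resolvent:
  assumes "\<mu> \<in> resolvent_set \<A>"
  shows "cnj \<mu> \<in> resolvent_set (graph_adjoint \<A>)" "resolvent (graph_adjoint \<A>) (cnj \<mu>) = cadjoint (res \<mu>)"
  using is_resolvent_adjoint[OF is_resolvent_resolvent[OF assms]] resolvent_eq
  by (auto simp: resolvent_set_def)

lemma dual_domain: "f \<in> Domain (graph_adjoint \<A>) \<longleftrightarrow> (\<exists>k. f = cadjoint (res (base N)) k)"
proof -
  have "is_resolvent (graph_adjoint \<A>) (cnj (base N)) (cadjoint (res (base N)))"
    by (rule is_resolvent_adjoint[OF is_resolvent_resolvent[OF base]])
  note r = this[unfolded is_resolvent_def, rule_format]
  show ?thesis
  proof
    assume "f \<in> Domain (graph_adjoint \<A>)"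
    then obtain g where "(f, g) \<in> graph_adjoint \<A>" by blast
    then have "(f, cnj (base N) *\<^sub>C f - (cnj (base N) *\<^sub>C f - g)) \<in> graph_adjoint \<A>" by simp
    then show "\<exists>k. f = cadjoint (res (base N)) k" unfolding r by blast
  next
    assume "\<exists>k. f = cadjoint (res (base N)) k"
    then show "f \<in> Domain (graph_adjoint \<A>)" unfolding r[symmetric] by blast
  qed
qed

text \<open>Two functionals on X_{-1} that agree on the dense image of X are equal.\<close>

lemma dual_emb1_inj: "inj (cblinfun_apply (cadjoint (embm N)))"
proof (rule injI)
  fix \<xi> \<eta> assume eq: "cblinfun_apply (cadjoint (embm N)) \<xi> = cblinfun_apply (cadjoint (embm N)) \<eta>"
  show "\<xi> = \<eta>"
  proof (rule cdual_eqI)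
    fix y
    have "closed {y. cdual_apply \<xi> y = cdual_apply \<eta> y}"
      by (intro closed_Collect_eq bounded_bilinear.continuous_on[OF bounded_bilinear_cdual_apply] continuous_intros)
    then have "closure (range (cblinfun_apply (embm N))) \<subseteq> {y. cdual_apply \<xi> y = cdual_apply \<eta> y}"
      by (intro closure_minimal) (auto simp: cdual_comp_apply[symmetric] eq[unfolded cadjoint_apply])
    then show "cdual_apply \<xi> y = cdual_apply \<eta> y" using embm_dense by auto
  qed
qed

text \<open>Both sides say that a functional factors through the resolvent R at
  \<open>base N\<close>: R is a bounded operator after \<open>embm N\<close>, and
  \<open>embm N\<close> is a bounded operator after R.\<close>

lemma dual_emb1_range: "range (cblinfun_apply (cadjoint (embm N))) = Domain (graph_adjoint \<A>)"
proof (intro equalityI subsetI)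
  fix f assume "f \<in> range (cblinfun_apply (cadjoint (embm N)))"
  then obtain \<xi> where f: "f = cadjoint (embm N) \<xi>" by blast
  \<comment> \<open>\<open>E\<close> extends \<open>embm N \<circ> (base N - A)\<close> from the dense domain of \<open>A\<close> to \<open>X\<close>\<close>
  have "\<exists>E. \<forall>x. cblinfun_apply E (res (base N) x) = embm N x"
    by (rule dense_extension[OF res_dense[OF base], where M=1]) (auto simp: cblinfun_simps embm_norm)
  then obtain E where E: "\<And>x. cblinfun_apply E (res (base N) x) = embm N x" by blast
  have "f = cadjoint (res (base N)) (cadjoint E \<xi>)"
    by (rule cdual_eqI) (simp add: f cadjoint_apply cdual_comp_apply E)
  then show "f \<in> Domain (graph_adjoint \<A>)" using dual_domain by blast
next
  fix f assume "f \<in> Domain (graph_adjoint \<A>)"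
  then obtain k where f: "f = cadjoint (res (base N)) k" using dual_domain by blast
  have "f = cadjoint (embm N) (cadjoint (resolvent_ext N (base N)) k)"
    by (rule cdual_eqI) (simp add: f cadjoint_apply cdual_comp_apply resolvent_ext[OF base])
  then show "f \<in> range (cblinfun_apply (cadjoint (embm N)))" by blast
qed

text \<open>With R the resolvent at \<open>base N\<close>, the value of \<xi> at
  \<open>embm N x\<close> is that of \<open>g\<close> at R x, and these two vectors have equal norms
  by the choice of the norm of X_{-1}. Both families of vectors are dense, so the two functionals
  have equal norms.\<close>

lemma dual_emb1_norm:
  assumes "(cblinfun_apply (cadjoint (embm N)) \<xi>, h) \<in> graph_adjoint \<A>"
  shows "norm \<xi> = norm (cnj (base N) *\<^sub>C cblinfun_apply (cadjoint (embm N)) \<xi> - h)"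
proof -
  define g where "g = cnj (base N) *\<^sub>C cblinfun_apply (cadjoint (embm N)) \<xi> - h"
  have "cadjoint (res (base N)) g = cadjoint (embm N) \<xi>"
    using resolvent_cancel[OF dual_resolvent(1)[OF base] assms] by (simp add: g_def dual_resolvent(2)[OF base])
  then have eq: "cdual_apply \<xi> (embm N x) = cdual_apply g (res (base N) x)" for x
    by (metis cadjoint_apply cdual_comp_apply)
  have "norm \<xi> \<le> norm g"
  proof (rule norm_cdual_bound)
    fix y
    have "closed {y. norm (cdual_apply \<xi> y) \<le> norm g * norm y}"
      by (intro closed_Collect_le bounded_bilinear.continuous_on[OF bounded_bilinear_cdual_apply] continuous_intros)
    then have "closure (range (cblinfun_apply (embm N))) \<subseteq> {y. norm (cdual_apply \<xi> y) \<le> norm g * norm y}"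
      by (intro closure_minimal) (auto simp: eq embm_norm norm_cdual_apply)
    then show "norm (cdual_apply \<xi> y) \<le> norm g * norm y" using embm_dense by auto
  qed simp
  moreover have "norm g \<le> norm \<xi>"
  proof (rule norm_cdual_bound)
    fix y
    have "closed {y. norm (cdual_apply g y) \<le> norm \<xi> * norm y}"
      by (intro closed_Collect_le bounded_bilinear.continuous_on[OF bounded_bilinear_cdual_apply] continuous_intros)
    then have "closure (range (cblinfun_apply (res (base N)))) \<subseteq> {y. norm (cdual_apply g y) \<le> norm \<xi> * norm y}"
      by (intro closure_minimal) (auto simp: eq[symmetric] embm_norm[symmetric] norm_cdual_apply)
    then show "norm (cdual_apply g y) \<le> norm \<xi> * norm y" using res_dense[OF base] by auto
  qed simp
  ultimately show ?thesis by (simp add: g_def)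
qed

text \<open>With R the resolvent at \<open>base N\<close>, both norms are suprema of the modulus of
  f (R y) over the unit ball of X, the first after the isometric substitution of
  \<open>res1 (base N) y\<close> for \<xi>.\<close>

lemma dual_embm_norm: "norm (cblinfun_apply (cadjoint (emb1 N)) f) = norm (cblinfun_apply (cadjoint (res (base N))) f)"
proof (rule antisym)
  show "norm (cblinfun_apply (cadjoint (emb1 N)) f) \<le> norm (cblinfun_apply (cadjoint (res (base N))) f)"
  proof (rule norm_cdual_bound)
    fix \<xi> :: 'x1
    obtain y where \<xi>: "\<xi> = cblinfun_apply (res1 (base N)) y" using res1_base_surj by blast
    show "norm (cdual_apply (cblinfun_apply (cadjoint (emb1 N)) f) \<xi>) \<le> norm (cblinfun_apply (cadjoint (res (base N))) f) * norm \<xi>"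
      using norm_cdual_apply[of "cadjoint (res (base N)) f" y]
      by (simp add: \<xi> cadjoint_apply cdual_comp_apply emb1_res1[OF base] norm_res1_base)
  qed simp
  show "norm (cblinfun_apply (cadjoint (res (base N))) f) \<le> norm (cblinfun_apply (cadjoint (emb1 N)) f)"
  proof (rule norm_cdual_bound)
    show "norm (cdual_apply (cblinfun_apply (cadjoint (res (base N))) f) y) \<le> norm (cblinfun_apply (cadjoint (emb1 N)) f) * norm y" for y
      using norm_cdual_apply[of "cadjoint (emb1 N) f" "res1 (base N) y"]
      by (simp add: cadjoint_apply cdual_comp_apply emb1_res1[OF base] norm_res1_base)
  qed simp
qed

text \<open>Pulling functionals back along the isometry \<open>res1 (base N)\<close> turns the
  restrictions to X_1 of functionals on X into the domain of the adjoint generator. The density of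
  that domain comes from strong continuity of the dual semigroup.\<close>

lemma dual_embm_dense: "closure (range (cblinfun_apply (cadjoint (emb1 N)))) = UNIV"
proof -
  have "\<psi> \<in> closure (range (cblinfun_apply (cadjoint (emb1 N))))" for \<psi>
  proof (unfold closure_approachable, intro allI impI)
    fix e :: real assume e: "e > 0"
    define g where "g = cadjoint (res1 (base N)) \<psi>"
    interpret S: c0_semigroup "node_semigroup N'"
      by unfold_locales (simp add: semigroup_of(1)[OF gen_adjoint])
    have "g \<in> closure (Domain (graph_adjoint \<A>))"
      using S.generator_dense semigroup_of(2)[OF gen_adjoint] by simp
    then obtain h k where h: "dist h g < e" "(h, k) \<in> graph_adjoint \<A>"
      unfolding closure_approachable using e by blast
    define f where "f = cnj (base N) *\<^sub>C h - k"
    have hf: "h = cadjoint (res (base N)) f"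
      using resolvent_cancel[OF dual_resolvent(1)[OF base] h(2)] by (simp add: f_def dual_resolvent(2)[OF base])
    have "norm (cblinfun_apply (cadjoint (emb1 N)) f - \<psi>) \<le> norm (h - g)"
    proof (rule norm_cdual_bound)
      fix \<xi> :: 'x1
      obtain y where \<xi>: "\<xi> = cblinfun_apply (res1 (base N)) y" using res1_base_surj by blast
      show "norm (cdual_apply (cblinfun_apply (cadjoint (emb1 N)) f - \<psi>) \<xi>) \<le> norm (h - g) * norm \<xi>"
        using norm_cdual_apply[of "h - g" y]
        by (simp add: \<xi> hf g_def cdual_simps cadjoint_apply cdual_comp_apply emb1_res1[OF base] norm_res1_base)
    qed simp
    then show "\<exists>y\<in>range (cblinfun_apply (cadjoint (emb1 N))). dist y \<psi> < e"
      using h(1) by (intro bexI[of _ "cadjoint (emb1 N) f"]) (auto simp: dist_norm)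
  qed
  then show ?thesis by blast
qed

text \<open>Duality exchanges X_1 and X_{-1}: extending the dual resolvent to a larger space
  corresponds to letting the original one take its values in the smaller space X_1.\<close>

lemma dual_resolvent_ext:
  assumes \<mu>: "\<mu> \<in> resolvent_set \<A>"
  shows "resolvent_ext N' (cnj \<mu>) = cadjoint (res1 \<mu>)"
  unfolding resolvent_ext_def
proof (rule the_equality)
  show "\<forall>f. cblinfun_apply (cadjoint (res1 \<mu>)) (embm N' f) = resolvent (A_op N') (cnj \<mu>) f"
    by (auto intro!: cdual_eqI simp: dual_resolvent[OF \<mu>] cadjoint_apply cdual_comp_apply emb1_res1[OF \<mu>])
  fix E assume E: "\<forall>f. cblinfun_apply E (embm N' f) = resolvent (A_op N') (cnj \<mu>) f"
  show "E = cadjoint (res1 \<mu>)"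
    by (rule cblinfun_eq_on_dense[OF dual_embm_dense])
      (use E in \<open>auto intro!: cdual_eqI simp: dual_resolvent[OF \<mu>] cadjoint_apply cdual_comp_apply emb1_res1[OF \<mu>]\<close>)
qed

lemma dual_emb1_inv: "inv (cblinfun_apply (cadjoint (embm N))) (cadjoint (embm N) \<eta>) = \<eta>"
  by (rule inv_f_f[OF dual_emb1_inj])

lemma cadjoint_diff: "cadjoint (S - S') = cadjoint S - cadjoint S'"
  and cadjoint_scaleC: "cadjoint (c *\<^sub>C S) = cnj c *\<^sub>C cadjoint S"
  by (auto intro!: cblinfun_eqI cdual_eqI simp: cblinfun_simps cdual_simps cadjoint_apply cdual_comp_apply)

text \<open>The derivative at s is the adjoint of the derivative of \<open>G_tf N\<close> at cnj s.
  The conjugation of the increment and the one caused by taking adjoints cancel in the difference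
  quotient, so complex differentiability survives.\<close>

lemma dual_G_analytic: "analytic_on_set (G_tf N') (node_half_plane N')"
  unfolding analytic_on_set_def
proof
  fix s assume "s \<in> node_half_plane N'"
  then obtain d where d: "((\<lambda>h. (1 / h) *\<^sub>C (G_tf N (cnj s + h) - G_tf N (cnj s))) \<longlongrightarrow> d) (at 0)"
    using G_analytic unfolding analytic_on_set_def dual_half_plane by blast
  have fl: "filterlim cnj (at 0) (at 0)"
    unfolding filterlim_at by (auto intro!: tendsto_eq_intros simp: eventually_at_filter)
  have "((\<lambda>h. cadjoint ((1 / cnj h) *\<^sub>C (G_tf N (cnj s + cnj h) - G_tf N (cnj s)))) \<longlongrightarrow> cadjoint d) (at 0)"
  proof (rule LIM_zero_cancel, rule Lim_null_comparison)
    show "((\<lambda>h::complex. norm ((1 / cnj h) *\<^sub>C (G_tf N (cnj s + cnj h) - G_tf N (cnj s)) - d)) \<longlongrightarrow> 0) (at 0)"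
      using filterlim_compose[OF d fl] by (simp add: Lim_null[of _ d] tendsto_norm_zero)
  qed (simp add: cadjoint_diff[symmetric] norm_cadjoint)
  then have "((\<lambda>h. (1 / h) *\<^sub>C (G_tf N' (s + h) - G_tf N' s)) \<longlongrightarrow> cadjoint d) (at 0)"
    by (simp add: cadjoint_scaleC cadjoint_diff)
  then show "\<exists>d. ((\<lambda>h. (1 / h) *\<^sub>C (G_tf N' (s + h) - G_tf N' s)) \<longlongrightarrow> d) (at 0)" by blast
qed

text \<open>With \<open>E\<close> from \<open>res1_diff_ext\<close>, both sides evaluate at u to g
  (C (E (B u))): the adjoint of \<open>E\<close> is the corresponding operator of the dual
  node.\<close>

lemma dual_G_eq:
  assumes "\<alpha> \<in> node_half_plane N'" "\<beta> \<in> node_half_plane N'"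
  shows "cblinfun_apply (G_tf N' \<alpha>) g - cblinfun_apply (G_tf N' \<beta>) g =
        C_op N' (inv (emb1 N') (resolvent_ext N' \<alpha> (B_op N' g) - resolvent_ext N' \<beta> (B_op N' g)))"
proof -
  define \<mu> \<nu> where "\<mu> = cnj \<alpha>" and "\<nu> = cnj \<beta>"
  have \<mu>: "\<mu> \<in> \<H>" "\<alpha> = cnj \<mu>" and \<nu>: "\<nu> \<in> \<H>" "\<beta> = cnj \<nu>"
    using assms by (simp_all add: \<mu>_def \<nu>_def dual_half_plane)
  note \<mu>r = half_plane_resolvent[OF \<mu>(1)] and \<nu>r = half_plane_resolvent[OF \<nu>(1)]
  obtain E where E: "\<And>x. cblinfun_apply E (embm N x) = cblinfun_apply (res1 \<mu>) x - res1 \<nu> x"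
    "\<And>y. cblinfun_apply (emb1 N) (cblinfun_apply E y) = cblinfun_apply (resolvent_ext N \<mu>) y - resolvent_ext N \<nu> y"
    using res1_diff_ext[OF \<mu>r \<nu>r] by blast
  have "cblinfun_apply (cadjoint (res1 \<mu>)) (cadjoint (C_op N) g) - cadjoint (res1 \<nu>) (cadjoint (C_op N) g)
     = cadjoint (embm N) (cadjoint E (cblinfun_apply (cadjoint (C_op N)) g))"
    by (rule cdual_eqI) (simp add: cdual_simps cadjoint_apply cdual_comp_apply E(1) cblinfun_simps)
  then have R: "inv (emb1 N') (resolvent_ext N' \<alpha> (B_op N' g) - resolvent_ext N' \<beta> (B_op N' g))
    = cadjoint E (cblinfun_apply (cadjoint (C_op N)) g)"
    by (simp add: \<mu>(2) \<nu>(2) dual_resolvent_ext \<mu>r \<nu>r dual_emb1_inv)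
  have "inv (cblinfun_apply (emb1 N)) (resolvent_ext N \<mu> (B_op N u) - resolvent_ext N \<nu> (B_op N u)) = E (B_op N u)" for u
    unfolding E(2)[symmetric] by (rule inv_f_f[OF emb1_inj])
  then have L: "cblinfun_apply (G_tf N \<mu>) u - cblinfun_apply (G_tf N \<nu>) u = C_op N (E (B_op N u))" for u
    using G_eq[OF \<mu>(1) \<nu>(1)] by simp
  show ?thesis
    unfolding R by (rule cdual_eqI)
      (simp add: cdual_simps cadjoint_apply cdual_comp_apply \<mu>(2) \<nu>(2) L[symmetric])
qed

lemma system_node_dual: "system_node N'"
  unfolding system_node_def
proof (intro conjI)
  show "generates_C0_semigroup (A_op N')" by (simp add: gen_adjoint)
  show "base N' \<in> resolvent_set (A_op N')" by (simp add: dual_resolvent[OF base])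
  show "range (emb1 N') = Domain (A_op N')" by (simp add: dual_emb1_range)
  show "\<forall>\<xi> z. (emb1 N' \<xi>, z) \<in> A_op N' \<longrightarrow> norm \<xi> = norm (base N' *\<^sub>C emb1 N' \<xi> - z)"
    by (simp add: dual_emb1_norm)
  show "\<forall>x. norm (embm N' x) = norm (resolvent (A_op N') (base N') x)"
    by (simp add: dual_embm_norm dual_resolvent[OF base])
  show "closure (range (embm N')) = UNIV" by (simp add: dual_embm_dense)
  show "analytic_on_set (G_tf N') (node_half_plane N')" by (rule dual_G_analytic)
  show "\<forall>\<alpha>\<in>node_half_plane N'. \<forall>\<beta>\<in>node_half_plane N'. \<forall>g.
      G_tf N' \<alpha> g - G_tf N' \<beta> g =
        C_op N' (inv (emb1 N') (resolvent_ext N' \<alpha> (B_op N' g) - resolvent_ext N' \<beta> (B_op N' g)))"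
    using dual_G_eq by blast
qed

end

section \<open>Bochner integrable functions and the Henstock--Kurzweil integral\<close>

text \<open>Bochner integrability on an interval is equivalent to approximability by continuous functions,
  with an integrable majorant of the error whose integral is small. This form avoids measurability
  and immediately implies Henstock--Kurzweil integrability.\<close>

definition L1_on :: "real \<Rightarrow> (real \<Rightarrow> 'a::banach) \<Rightarrow> bool" where
  "L1_on T v \<longleftrightarrow> (\<forall>e>0. \<exists>q r. continuous_on {0..T} q \<and> r integrable_on {0..T} \<and>
     (\<forall>s\<in>{0..T}. norm (v s - q s) \<le> r s) \<and> integral {0..T} r \<le> e)"

lemma L1_onI:
  assumes "\<And>e. e > 0 \<Longrightarrow> \<exists>q r. continuous_on {0..T} q \<and> r integrable_on {0..T} \<and>
     (\<forall>s\<in>{0..T}. norm (v s - q s) \<le> r s) \<and> integral {0..T} r \<le> e"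
  shows "L1_on T v"
  using assms by (simp add: L1_on_def)

lemma L1_onE:
  assumes "L1_on T v" "e > 0"
  obtains q r where "continuous_on {0..T} q" "r integrable_on {0..T}"
     "\<And>s. s \<in> {0..T} \<Longrightarrow> norm (v s - q s) \<le> r s" "integral {0..T} r \<le> e"
  using assms unfolding L1_on_def by metis

lemma L1_on_continuous: "continuous_on {0..T} q \<Longrightarrow> L1_on T q"
  by (rule L1_onI, rule exI[of _ q], rule exI[of _ "\<lambda>_. 0"]) auto

text \<open>Lets approximants be merely in L1. Delays are reached in this way through delayed
  continuous functions, and measurable functions through simple ones.\<close>

lemma L1_on_approx:
  assumes "\<And>e. e > 0 \<Longrightarrow> \<exists>w r. L1_on T w \<and> r integrable_on {0..T} \<and>
     (\<forall>s\<in>{0..T}. norm (v s - w s) \<le> r s) \<and> integral {0..T} r \<le> e"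
  shows "L1_on T v"
proof (rule L1_onI)
  fix e :: real assume e: "e > 0"
  obtain w r where w: "L1_on T w" "r integrable_on {0..T}" "\<And>s. s\<in>{0..T} \<Longrightarrow> norm (v s - w s) \<le> r s"
    "integral {0..T} r \<le> e / 2"
    using assms[of "e / 2"] e by auto
  obtain q r' where q: "continuous_on {0..T} q" "r' integrable_on {0..T}"
     "\<And>s. s \<in> {0..T} \<Longrightarrow> norm (w s - q s) \<le> r' s" "integral {0..T} r' \<le> e / 2"
    using L1_onE[OF w(1), of "e / 2"] e by auto
  have "norm (v s - q s) \<le> r s + r' s" if "s \<in> {0..T}" for s
    using norm_triangle_ineq[of "v s - w s" "w s - q s"] w(3)[OF that] q(3)[OF that] by simp
  then show "\<exists>q r. continuous_on {0..T} q \<and> r integrable_on {0..T} \<and>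
     (\<forall>s\<in>{0..T}. norm (v s - q s) \<le> r s) \<and> integral {0..T} r \<le> e"
    using q w by (intro exI[of _ q] exI[of _ "\<lambda>s. r s + r' s"])
      (auto intro: Henstock_Kurzweil_Integration.integrable_add simp: Henstock_Kurzweil_Integration.integral_add)
qed

text \<open>Cauchy criterion for Riemann sums: over a fine division the sums of \<open>v\<close> and
  \<open>q\<close> differ by at most the sum of the majorant \<open>r\<close>, which is close to its
  small integral.\<close>

lemma L1_on_integrable:
  fixes v :: "real \<Rightarrow> 'a::banach"
  assumes v: "L1_on T v"
  shows "v integrable_on {0..T}"
proof -
  have "v integrable_on cbox 0 T"
    unfolding integrable_Cauchy
  proof (intro allI impI)
    fix e :: real assume e: "e > 0"
    obtain q r where q: "continuous_on {0..T} q" and r: "r integrable_on {0..T}"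
      and le: "\<And>s. s \<in> {0..T} \<Longrightarrow> norm (v s - q s) \<le> r s" and small: "integral {0..T} r \<le> e / 8"
      using L1_onE[OF v, of "e / 8"] e by auto
    have "(q has_integral integral {0..T} q) (cbox 0 T)" "(r has_integral integral {0..T} r) (cbox 0 T)"
      using r by (auto intro!: integrable_integral integrable_continuous_real q)
    then obtain \<gamma>1 \<gamma>2 where g: "gauge \<gamma>1" "gauge \<gamma>2"
      and g1: "\<And>\<D>. \<D> tagged_division_of (cbox 0 T) \<Longrightarrow> \<gamma>1 fine \<D> \<Longrightarrow> norm ((\<Sum>(x,K)\<in>\<D>. measure lborel K *\<^sub>R q x) - integral {0..T} q) < e / 8"
      and g2: "\<And>\<D>. \<D> tagged_division_of (cbox 0 T) \<Longrightarrow> \<gamma>2 fine \<D> \<Longrightarrow> norm ((\<Sum>(x,K)\<in>\<D>. measure lborel K *\<^sub>R r x) - integral {0..T} r) < e / 8"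
    proof -
      assume q: "(q has_integral integral {0..T} q) (cbox 0 T)" and r: "(r has_integral integral {0..T} r) (cbox 0 T)"
      have e8: "e / 8 > 0" using e by simp
      show ?thesis
        by (rule has_integralD[OF q e8], rule has_integralD[OF r e8]) (rule that)
    qed
    \<comment> \<open>At most e/8 from the sum of \<open>q\<close>, e/8 from the integral of
      \<open>r\<close> and e/8 from the sum of \<open>r\<close>; two such bounds stay below
      e.\<close>
    have est: "norm ((\<Sum>(x,K)\<in>\<D>. measure lborel K *\<^sub>R v x) - integral {0..T} q) < 3 * e / 8"
      if D: "\<D> tagged_division_of (cbox 0 T)" "\<gamma>1 fine \<D>" "\<gamma>2 fine \<D>" for \<D>
    proof -
      have "norm ((\<Sum>(x,K)\<in>\<D>. measure lborel K *\<^sub>R v x) - (\<Sum>(x,K)\<in>\<D>. measure lborel K *\<^sub>R q x))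
         = norm (\<Sum>(x,K)\<in>\<D>. measure lborel K *\<^sub>R (v x - q x))"
        by (simp add: sum_subtractf[symmetric] scaleR_diff_right case_prod_unfold)
      also have "\<dots> \<le> (\<Sum>(x,K)\<in>\<D>. measure lborel K *\<^sub>R r x)"
      proof (rule sum_norm_le, clarify)
        fix x K assume "(x, K) \<in> \<D>"
        then have "x \<in> {0..T}" using tag_in_interval[OF D(1)] by simp
        then show "norm (measure lborel K *\<^sub>R (v x - q x)) \<le> measure lborel K *\<^sub>R r x"
          by (simp add: le mult_left_mono)
      qed
      finally show ?thesis using g1[OF D(1,2)] g2[OF D(1,3)] small
        norm_triangle_ineq[of "(\<Sum>(x,K)\<in>\<D>. measure lborel K *\<^sub>R v x) - (\<Sum>(x,K)\<in>\<D>. measure lborel K *\<^sub>R q x)" "(\<Sum>(x,K)\<in>\<D>. measure lborel K *\<^sub>R q x) - integral {0..T} q"]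
        by (simp add: abs_if split: if_splits)
    qed
    show "\<exists>\<gamma>. gauge \<gamma> \<and>
          (\<forall>\<D>1 \<D>2. \<D>1 tagged_division_of (cbox 0 T) \<and> \<gamma> fine \<D>1 \<and>
            \<D>2 tagged_division_of (cbox 0 T) \<and> \<gamma> fine \<D>2 \<longrightarrow>
            norm ((\<Sum>(x,K)\<in>\<D>1. measure lborel K *\<^sub>R v x) - (\<Sum>(x,K)\<in>\<D>2. measure lborel K *\<^sub>R v x)) < e)"
    proof (intro exI[of _ "\<lambda>x. \<gamma>1 x \<inter> \<gamma>2 x"] conjI allI impI)
      show "gauge (\<lambda>x. \<gamma>1 x \<inter> \<gamma>2 x)" using g by (rule gauge_Int)
      fix \<D>1 \<D>2
      assume "\<D>1 tagged_division_of (cbox 0 T) \<and> (\<lambda>x. \<gamma>1 x \<inter> \<gamma>2 x) fine \<D>1 \<and>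
            \<D>2 tagged_division_of (cbox 0 T) \<and> (\<lambda>x. \<gamma>1 x \<inter> \<gamma>2 x) fine \<D>2"
      then have "norm ((\<Sum>(x,K)\<in>\<D>1. measure lborel K *\<^sub>R v x) - integral {0..T} q) < 3 * e / 8"
        "norm ((\<Sum>(x,K)\<in>\<D>2. measure lborel K *\<^sub>R v x) - integral {0..T} q) < 3 * e / 8"
        unfolding fine_Int by (intro est; blast)+
      then show "norm ((\<Sum>(x,K)\<in>\<D>1. measure lborel K *\<^sub>R v x) - (\<Sum>(x,K)\<in>\<D>2. measure lborel K *\<^sub>R v x)) < e"
        using norm_triangle_ineq4[of "(\<Sum>(x,K)\<in>\<D>1. measure lborel K *\<^sub>R v x) - integral {0..T} q" "(\<Sum>(x,K)\<in>\<D>2. measure lborel K *\<^sub>R v x) - integral {0..T} q"] e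
        by simp
    qed
  qed
  then show ?thesis by simp
qed

text \<open>\<open>h\<close> is a uniformly Lipschitz family, not necessarily linear, that preserves
  continuity of paths. This covers norms, continuous weights, pairings with a continuous function,
  and kernels that depend on time only strongly continuously.\<close>

lemma L1_on_operator:
  fixes h :: "real \<Rightarrow> 'a::banach \<Rightarrow> 'b::banach"
  assumes v: "L1_on T v" and bd: "\<And>s x y. s \<in> {0..T} \<Longrightarrow> norm (h s x - h s y) \<le> M * norm (x - y)"
    and cont: "\<And>q. continuous_on {0..T} q \<Longrightarrow> continuous_on {0..T} (\<lambda>s. h s (q s))"
  shows "L1_on T (\<lambda>s. h s (v s))"
proof (rule L1_onI)
  fix e :: real assume e: "e > 0"
  obtain q r where q: "continuous_on {0..T} q" and r: "r integrable_on {0..T}"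
    and le: "\<And>s. s \<in> {0..T} \<Longrightarrow> norm (v s - q s) \<le> r s" and small: "integral {0..T} r \<le> e / (\<bar>M\<bar> + 1)"
    
  proof -
    have "e / (\<bar>M\<bar> + 1) > 0" using e by simp
    from L1_onE[OF v this] show ?thesis using that by blast
  qed
  have "norm (h s (v s) - h s (q s)) \<le> (\<bar>M\<bar> + 1) * r s" if s: "s \<in> {0..T}" for s
  proof -
    have "norm (h s (v s) - h s (q s)) \<le> M * norm (v s - q s)" by (rule bd[OF s])
    also have "\<dots> \<le> (\<bar>M\<bar> + 1) * norm (v s - q s)" by (intro mult_right_mono) auto
    also have "\<dots> \<le> (\<bar>M\<bar> + 1) * r s" by (intro mult_left_mono le[OF s]) auto
    finally show ?thesis .
  qed
  moreover have "integral {0..T} (\<lambda>s. (\<bar>M\<bar> + 1) * r s) \<le> e"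
    unfolding Henstock_Kurzweil_Integration.integral_mult_right using small by (simp add: field_simps)
  ultimately show "\<exists>q r. continuous_on {0..T} q \<and> r integrable_on {0..T} \<and>
     (\<forall>s\<in>{0..T}. norm (h s (v s) - q s) \<le> r s) \<and> integral {0..T} r \<le> e"
    using q r by (intro exI[of _ "\<lambda>s. h s (q s)"] exI[of _ "\<lambda>s. (\<bar>M\<bar> + 1) * r s"])
      (auto intro!: cont integrable_on_mult_right)
qed

lemma L1_on_bounded_linear: "bounded_linear f \<Longrightarrow> L1_on T v \<Longrightarrow> L1_on T (\<lambda>s. f (v s))"
proof -
  assume f: "bounded_linear f" and v: "L1_on T v"
  obtain K where "\<And>x. norm (f x) \<le> norm x * K" using bounded_linear.bounded[OF f] by blast
  then show ?thesis
    by (intro L1_on_operator[OF v, of "\<lambda>s. f" K])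
      (auto simp: linear_diff[OF bounded_linear.linear[OF f], symmetric] mult.commute intro: bounded_linear.continuous_on[OF f])
qed

lemma L1_on_norm: "L1_on T v \<Longrightarrow> L1_on T (\<lambda>s. norm (v s))"
  by (rule L1_on_operator[where M=1 and h="\<lambda>s x. norm x"]) (auto simp: norm_triangle_ineq3 intro: continuous_intros)

lemma L1_on_norm_integrable: "L1_on T v \<Longrightarrow> (\<lambda>s. norm (v s)) integrable_on {0..T}"
  by (intro L1_on_integrable L1_on_norm)

lemma L1_on_add: "L1_on T v \<Longrightarrow> L1_on T w \<Longrightarrow> L1_on T (\<lambda>s. v s + w s)"
proof (rule L1_onI)
  fix e :: real assume e: "e > 0" and v: "L1_on T v" and w: "L1_on T w"
  have e2: "e / 2 > 0" using e by simp
  obtain q r where q: "continuous_on {0..T} q" "r integrable_on {0..T}"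
     "\<And>s. s \<in> {0..T} \<Longrightarrow> norm (v s - q s) \<le> r s" "integral {0..T} r \<le> e / 2"
    using L1_onE[OF v e2] by blast
  obtain q' r' where q': "continuous_on {0..T} q'" "r' integrable_on {0..T}"
     "\<And>s. s \<in> {0..T} \<Longrightarrow> norm (w s - q' s) \<le> r' s" "integral {0..T} r' \<le> e / 2"
    using L1_onE[OF w e2] by blast
  have "norm (v s + w s - (q s + q' s)) \<le> r s + r' s" if "s \<in> {0..T}" for s
    using norm_triangle_ineq[of "v s - q s" "w s - q' s"] q(3)[OF that] q'(3)[OF that] by (simp add: algebra_simps)
  then show "\<exists>q r. continuous_on {0..T} q \<and> r integrable_on {0..T} \<and>
     (\<forall>s\<in>{0..T}. norm (v s + w s - q s) \<le> r s) \<and> integral {0..T} r \<le> e"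
    using q q' by (intro exI[of _ "\<lambda>s. q s + q' s"] exI[of _ "\<lambda>s. r s + r' s"])
      (auto intro!: continuous_intros Henstock_Kurzweil_Integration.integrable_add simp: Henstock_Kurzweil_Integration.integral_add)
qed

lemma L1_on_scaleR: "L1_on T v \<Longrightarrow> L1_on T (\<lambda>s. c *\<^sub>R v s)"
  by (rule L1_on_bounded_linear[OF bounded_linear_scaleR_right])

lemma L1_on_diff: "L1_on T v \<Longrightarrow> L1_on T w \<Longrightarrow> L1_on T (\<lambda>s. v s - w s)"
  using L1_on_add[of T v "\<lambda>s. (-1) *\<^sub>R w s"] L1_on_scaleR[of T w "-1"] by simp

lemma L1_on_zero: "L1_on T (\<lambda>s. 0)"
  by (rule L1_on_continuous) auto

lemma L1_on_sum: "finite I \<Longrightarrow> (\<And>i. i \<in> I \<Longrightarrow> L1_on T (v i)) \<Longrightarrow> L1_on T (\<lambda>s. \<Sum>i\<in>I. v i s)"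
  by (induction I rule: finite_induct) (auto intro: L1_on_add L1_on_zero)

lemma L1_on_subset:
  assumes v: "L1_on T v" and t: "t \<le> T"
  shows "L1_on t v"
proof (rule L1_onI)
  fix e :: real assume e: "e > 0"
  obtain q r where q: "continuous_on {0..T} q" and r: "r integrable_on {0..T}"
    and le: "\<And>s. s \<in> {0..T} \<Longrightarrow> norm (v s - q s) \<le> r s" and small: "integral {0..T} r \<le> e"
    using L1_onE[OF v e] by blast
  have r': "r integrable_on {0..t}" using t by (auto intro: integrable_on_subinterval[OF r])
  have "integral {0..t} r \<le> integral {0..T} r"
    by (rule integral_subset_le) (use t r r' order_trans[OF norm_ge_zero le] in auto)
  then show "\<exists>q r. continuous_on {0..t} q \<and> r integrable_on {0..t} \<and>
     (\<forall>s\<in>{0..t}. norm (v s - q s) \<le> r s) \<and> integral {0..t} r \<le> e"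
    using small t r' le by (intro exI[of _ q] exI[of _ r]) (auto intro: continuous_on_subset[OF q])
qed

lemma L1_on_cong: "L1_on T v \<Longrightarrow> (\<And>s. s \<in> {0..T} \<Longrightarrow> v s = w s) \<Longrightarrow> L1_on T w"
  unfolding L1_on_def by metis

lemma L1_on_norm_mono: "L1_on T v \<Longrightarrow> t \<le> T \<Longrightarrow> integral {0..t} (\<lambda>s. norm (v s)) \<le> integral {0..T} (\<lambda>s. norm (v s))"
  by (rule integral_subset_le) (auto intro: L1_on_norm_integrable L1_on_subset)

text \<open>The case h > T is included: then {0..T - h} is empty, \<open>I\<close> is 0, and the
  delayed function vanishes on {0..T}. Convolutions can thus be delayed by any amount.\<close>

lemma has_integral_delay:
  fixes f :: "real \<Rightarrow> 'a::banach"
  assumes f: "(f has_integral I) {0..T - h}" and h: "0 \<le> h"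
  shows "((\<lambda>s. if s < h then 0 else f (s - h)) has_integral I) {0..T}"
proof (cases "h \<le> T")
  case True
  have "((\<lambda>s. f (s - h)) has_integral I) {h..T}"
    using has_integral_shift_real_ivl_iff[of f I 0 "T - h" "- h"] f by simp
  then have 2: "((\<lambda>s. if s < h then 0 else f (s - h)) has_integral I) {h..T}"
    by (rule has_integral_eq[rotated]) auto
  have "((\<lambda>s. 0) has_integral (0::'a)) {0..h}" by simp
  then have 1: "((\<lambda>s. if s < h then 0 else f (s - h)) has_integral 0) {0..h}"
    by (rule has_integral_spike[of "{h}", rotated 2]) auto
  show ?thesis using has_integral_combine[OF h True 1 2] by simp
next
  case False
  then have "I = 0" using f h by (intro has_integral_unique[OF f]) auto
  moreover have "((\<lambda>s. if s < h then 0 else f (s - h)) has_integral 0) {0..T}"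
    using False by (intro has_integral_is_0) auto
  ultimately show ?thesis by simp
qed

text \<open>The delayed function may jump at h even if \<open>v\<close> is continuous. A cutoff
  \<open>c\<close> that climbs linearly from 0 to 1 on [h, h + d] restores continuity, at an L1 cost
  of at most d B = e.\<close>

lemma L1_on_delay:
  fixes v :: "real \<Rightarrow> 'a::banach"
  assumes v: "L1_on T v" and h: "0 \<le> h"
  shows "L1_on T (\<lambda>s. if s < h then 0 else v (s - h))"
proof (cases "h \<le> T")
  case False
  then show ?thesis by (intro L1_on_cong[OF L1_on_zero]) auto
next
  case True
  have cont: "L1_on T (\<lambda>s. if s < h then 0 else q (s - h))" if q: "continuous_on {0..T} q" for q :: "real \<Rightarrow> 'a"
  proof (rule L1_onI)
    fix e :: real assume e: "e > 0"
    have "compact (q ` {0..T})" by (intro compact_continuous_image q) auto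
    then obtain B where B: "B > 0" "\<And>s. s \<in> {0..T} \<Longrightarrow> norm (q s) \<le> B"
      using compact_imp_bounded bounded_pos by (metis imageI)
    define d where "d = e / B"
    have d: "d > 0" using e B by (simp add: d_def)
    define c where "c s = min 1 (max 0 ((s - h) / d))" for s
    define p where "p s = c s *\<^sub>R q (max 0 (s - h))" for s
    define r where "r s = (if s \<in> {h..min T (h + d)} then B else 0)" for s
    have contp: "continuous_on {0..T} p"
      unfolding p_def c_def
      by (intro continuous_intros continuous_on_compose2[OF q]) (use d h in auto)
    have "((\<lambda>s. B) has_integral (min T (h + d) - h) * B) {h..min T (h + d)}"
      using has_integral_const_real[of B h "min T (h + d)"] True d by simp
    then have r: "(r has_integral (min T (h + d) - h) * B) {0..T}"
      unfolding r_def by (subst has_integral_restrict) (use h in auto)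
    have "(min T (h + d) - h) * B \<le> d * B" using B by (intro mult_right_mono) auto
    also have "\<dots> = e" using B by (simp add: d_def)
    finally have small: "integral {0..T} r \<le> e" using integral_unique[OF r] by simp
    have "norm ((if s < h then 0 else q (s - h)) - p s) \<le> r s" if s: "s \<in> {0..T}" for s
    proof -
      consider "s < h" | "h \<le> s" "s \<le> h + d" | "s > h + d" by linarith
      then show ?thesis
      proof cases
        case 1
        then have "(s - h) / d < 0" using d by (simp add: divide_neg_pos)
        then have "c s = 0" by (simp add: c_def)
        then show ?thesis using 1 B by (simp add: p_def r_def)
      next
        case 2
        then have m: "max 0 (s - h) = s - h" by simp
        have "(if s < h then 0 else q (s - h)) - p s = (1 - c s) *\<^sub>R q (s - h)"
          using 2 by (simp only: p_def m) (simp add: scaleR_diff_left)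
        moreover have "\<bar>1 - c s\<bar> * norm (q (s - h)) \<le> 1 * B"
          by (intro mult_mono B(2)) (use 2 s h d in \<open>auto simp: c_def\<close>)
        ultimately show ?thesis using 2 s by (simp add: r_def)
      next
        case 3
        then have "c s = 1" using d by (simp add: c_def max_def min_def field_simps)
        then show ?thesis using 3 d B by (simp add: p_def r_def)
      qed
    qed
    then show "\<exists>q' r. continuous_on {0..T} q' \<and> r integrable_on {0..T} \<and>
       (\<forall>s\<in>{0..T}. norm ((if s < h then 0 else q (s - h)) - q' s) \<le> r s) \<and> integral {0..T} r \<le> e"
      using contp r small by blast
  qed
  show ?thesis
  proof (rule L1_on_approx)
    fix e :: real assume "e > 0"
    then obtain q r where q: "continuous_on {0..T} q" and r: "r integrable_on {0..T}"
      and le: "\<And>s. s \<in> {0..T} \<Longrightarrow> norm (v s - q s) \<le> r s" and small: "integral {0..T} r \<le> e"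
      using L1_onE[OF v] by blast
    have r': "r integrable_on {0..T - h}" using h by (auto intro: integrable_on_subinterval[OF r])
    have "integral {0..T - h} r \<le> integral {0..T} r"
      by (rule integral_subset_le) (use h r r' order_trans[OF norm_ge_zero le] in auto)
    moreover note has_integral_delay[OF integrable_integral[OF r'] h]
    ultimately show "\<exists>w r. L1_on T w \<and> r integrable_on {0..T} \<and>
     (\<forall>s\<in>{0..T}. norm ((if s < h then 0 else v (s - h)) - w s) \<le> r s) \<and> integral {0..T} r \<le> e"
      using small le h
      by (intro exI[of _ "\<lambda>s. if s < h then 0 else q (s - h)"] exI[of _ "\<lambda>s. if s < h then 0 else r (s - h)"] conjI cont[OF q])
        (auto simp: integral_unique has_integral_integrable)
  qed
qed

section \<open>Comparison with the measure-theoretic notions\<close>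

lemma nn_integral_lebesgue_on_integral:
  fixes r :: "real \<Rightarrow> real"
  assumes S: "S \<in> sets lebesgue" and r: "r integrable_on S" "\<And>s. s \<in> S \<Longrightarrow> 0 \<le> r s"
  shows "r \<in> borel_measurable (lebesgue_on S)" "(\<integral>\<^sup>+s. ennreal (r s) \<partial>lebesgue_on S) = ennreal (integral S r)"
proof -
  have i: "integrable (lebesgue_on S) r"
    using absolutely_integrable_imp_integrable[OF nonnegative_absolutely_integrable_1[OF r] S] .
  then show "r \<in> borel_measurable (lebesgue_on S)" by auto
  have "integral\<^sup>L (lebesgue_on S) r = integral S r"
    using has_integral_integral_lebesgue_on[OF i S] by (simp add: integral_unique)
  then show "(\<integral>\<^sup>+s. ennreal (r s) \<partial>lebesgue_on S) = ennreal (integral S r)"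
    using nn_integral_eq_integral[OF i AE_I2] r(2) by (simp add: S)
qed

lemma integrable_on_if_nn_integral_finite:
  fixes r :: "real \<Rightarrow> real"
  assumes S: "S \<in> sets lebesgue" and r: "r \<in> borel_measurable (lebesgue_on S)" "\<And>s. s \<in> S \<Longrightarrow> 0 \<le> r s"
    and fin: "(\<integral>\<^sup>+s. ennreal (r s) \<partial>lebesgue_on S) < \<infinity>"
  shows "r integrable_on S" "(\<integral>\<^sup>+s. ennreal (r s) \<partial>lebesgue_on S) = ennreal (integral S r)"
proof -
  have "integrable (lebesgue_on S) r"
    by (rule integrableI_nonneg[OF r(1) _ fin]) (use r(2) S in \<open>auto\<close>)
  then show 1: "r integrable_on S" by (rule integrable_on_lebesgue_on[OF _ S])
  show "(\<integral>\<^sup>+s. ennreal (r s) \<partial>lebesgue_on S) = ennreal (integral S r)"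
    using nn_integral_lebesgue_on_integral[OF S 1] r(2) by simp
qed

text \<open>\<open>h\<close> is defined everywhere by limits and hence measurable; it agrees with
  \<open>g\<close> almost everywhere, and Lebesgue measure is complete.\<close>

lemma AE_limit_measurable:
  fixes g :: "real \<Rightarrow> real"
  assumes S: "S \<in> sets lebesgue" and m: "\<And>i. f i \<in> borel_measurable (lebesgue_on S)"
    and lim: "AE x in lebesgue_on S. (\<lambda>i. f i x) \<longlonglongrightarrow> g x"
  shows "g \<in> borel_measurable (lebesgue_on S)"
proof -
  define h where "h x = (if Cauchy (\<lambda>i. f i x) then lim (\<lambda>i. f i x) else 0)" for x
  have "h \<in> borel_measurable (lebesgue_on S)"
    unfolding h_def using borel_measurable_lim_metric[of f "lebesgue_on S"] m by measurable
  then have 1: "(\<lambda>x. if x \<in> S then h x else 0) \<in> borel_measurable lebesgue"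
    using borel_measurable_if[OF S] by blast
  have "AE x in lebesgue_on S. h x = g x"
    using lim by eventually_elim (auto simp: h_def limI LIMSEQ_imp_Cauchy)
  then have "AE x in lebesgue. x \<in> S \<longrightarrow> h x = g x"
    using AE_restrict_space_iff[of S lebesgue] S by simp
  then have "AE x in lebesgue. (if x \<in> S then h x else 0) = (if x \<in> S then g x else 0)"
    by eventually_elim auto
  then have "(\<lambda>x. if x \<in> S then g x else 0) \<in> borel_measurable lebesgue"
    by (rule borel_measurable_AE[OF 1])
  then show ?thesis using borel_measurable_if[OF S] by blast
qed

lemma strongly_measurable_norm_diff:
  fixes f :: "real \<Rightarrow> 'a::cbanach"
  assumes S: "S \<in> sets lebesgue" and f: "strongly_measurable (lebesgue_on S) f" and c: "simple_function (lebesgue_on S) c"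
  shows "(\<lambda>x. norm (f x - c x)) \<in> borel_measurable (lebesgue_on S)"
proof -
  obtain s where s: "\<And>i. simple_function (lebesgue_on S) (s i)" "AE x in lebesgue_on S. (\<lambda>i. s i x) \<longlonglongrightarrow> f x"
    using f unfolding strongly_measurable_def by blast
  show ?thesis
  proof (rule AE_limit_measurable[OF S])
    show "(\<lambda>x. norm (s i x - c x)) \<in> borel_measurable (lebesgue_on S)" for i
      by (rule borel_measurable_simple_function) (rule simple_function_compose2[OF s(1) c])
    show "AE x in lebesgue_on S. (\<lambda>i. norm (s i x - c x)) \<longlonglongrightarrow> norm (f x - c x)"
      using s(2) by eventually_elim (intro tendsto_intros)
  qed
qed

lemma strongly_measurable_norm:
  fixes f :: "real \<Rightarrow> 'a::cbanach"
  assumes "S \<in> sets lebesgue" "strongly_measurable (lebesgue_on S) f"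
  shows "(\<lambda>x. norm (f x)) \<in> borel_measurable (lebesgue_on S)"
  using strongly_measurable_norm_diff[OF assms, of "\<lambda>x. 0"] by simp

lemma simple_function_lebesgue_on_sets:
  assumes "simple_function (lebesgue_on S) c" "S \<in> sets lebesgue"
  shows "{x \<in> S. c x = y} \<in> sets lebesgue"
proof -
  have "c -` {y} \<inter> space (lebesgue_on S) \<in> sets (lebesgue_on S)"
    by (rule simple_functionD(2)[OF assms(1)])
  moreover have "c -` {y} \<inter> space (lebesgue_on S) = {x \<in> S. c x = y}" by auto
  ultimately show ?thesis using assms(2) by (metis sets_restrict_space_iff space_lebesgue_on sets.Int_space_eq2 UNIV_I inf_top.right_neutral space_completion space_lborel)
qed

lemma L1_on_indicator:
  assumes E: "E \<in> sets lebesgue"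
  shows "L1_on T (indicat_real E)"
proof (rule L1_onI)
  fix e :: real assume e: "e > 0"
  obtain N g where N: "negligible N" and g: "\<And>n. continuous_on UNIV (g n)"
    and lim: "\<And>x. x \<notin> N \<Longrightarrow> (\<lambda>n. g n x) \<longlonglongrightarrow> indicat_real E x"
    using indicator_measurable_on[OF E] unfolding measurable_on_def by auto
  \<comment> \<open>Clamping to [0, 1] keeps the limit and supplies the dominating function
    1.\<close>
  define p where "p n x = max 0 (min 1 (g n x))" for n :: nat and x
  have p: "continuous_on A (p n)" for n A
    unfolding p_def by (intro continuous_intros continuous_on_subset[OF g]) auto
  have limp: "(\<lambda>n. p n x) \<longlonglongrightarrow> indicat_real E x" if "x \<notin> N" for x
  proof -
    have "(\<lambda>n. p n x) \<longlonglongrightarrow> max 0 (min 1 (indicat_real E x))"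
      unfolding p_def by (intro tendsto_intros lim that)
    then show ?thesis by (simp add: indicator_def)
  qed
  let ?M = "lebesgue_on {0..T}"
  let ?d = "\<lambda>n x. \<bar>indicat_real E x - p n x\<bar>"
  have [measurable]: "indicat_real E \<in> borel_measurable ?M"
    by (intro measurable_restrict_space1 borel_measurable_indicator E)
  have [measurable]: "p n \<in> borel_measurable ?M" for n
    by (intro continuous_imp_measurable_on_sets_lebesgue p) auto
  have "(\<lambda>n. \<integral>\<^sup>+x. ennreal (?d n x) \<partial>?M) \<longlonglongrightarrow> (\<integral>\<^sup>+x. 0 \<partial>?M)"
  proof (rule nn_integral_dominated_convergence[where w="\<lambda>_. 1"])
    have "AE x in lebesgue. x \<notin> N" using N by (simp add: negligible_iff_null_sets AE_not_in)
    then have "AE x in ?M. x \<notin> N" by (subst AE_restrict_space_iff) (auto elim: eventually_mono)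
    then show "AE x in ?M. (\<lambda>n. ennreal (?d n x)) \<longlonglongrightarrow> 0"
    proof eventually_elim
      case (elim x)
      have "(\<lambda>n. ?d n x) \<longlonglongrightarrow> \<bar>indicat_real E x - indicat_real E x\<bar>"
        by (intro tendsto_intros limp elim)
      then have "(\<lambda>n. ennreal (?d n x)) \<longlonglongrightarrow> ennreal 0" by (intro tendsto_ennrealI) simp
      then show ?case by simp
    qed
    show "AE x in ?M. ennreal (?d n x) \<le> 1" for n
      by (rule AE_I2) (auto simp: p_def indicator_def)
    show "(\<integral>\<^sup>+x. 1 \<partial>?M) < \<infinity>"
      by (simp add: emeasure_restrict_space emeasure_lborel_Icc_eq)
  qed auto
  then have "\<forall>\<^sub>F n in sequentially. (\<integral>\<^sup>+x. ennreal (?d n x) \<partial>?M) < ennreal e"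
    using e by (intro order_tendstoD(2)) auto
  then obtain n where n: "(\<integral>\<^sup>+x. ennreal (?d n x) \<partial>?M) < ennreal e"
    using eventually_happens'[OF sequentially_bot] by blast
  have "?d n integrable_on {0..T}" "(\<integral>\<^sup>+x. ennreal (?d n x) \<partial>?M) = ennreal (integral {0..T} (?d n))"
    by (rule integrable_on_if_nn_integral_finite; use n less_trans in \<open>auto simp: less_top[symmetric]\<close>)+
  then show "\<exists>q r. continuous_on {0..T} q \<and> r integrable_on {0..T} \<and>
     (\<forall>s\<in>{0..T}. norm (indicat_real E s - q s) \<le> r s) \<and> integral {0..T} r \<le> e"
    using n e by (intro exI[of _ "p n"] exI[of _ "?d n"]) (auto simp: p ennreal_less_iff integral_nonneg)
qed

section \<open>Simple functions and Bochner integrals\<close>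

lemma simple_function_sum_representation:
  fixes c :: "real \<Rightarrow> 'a::real_vector"
  assumes "finite (c ` S)" "x \<in> S"
  shows "c x = (\<Sum>y\<in>c ` S. indicat_real {x \<in> S. c x = y} x *\<^sub>R y)"
proof -
  have "(\<Sum>y\<in>c ` S. indicat_real {x \<in> S. c x = y} x *\<^sub>R y) = (\<Sum>y\<in>c ` S. if c x = y then y else 0)"
    by (rule sum.cong) (use assms in \<open>auto simp: indicator_def\<close>)
  then show ?thesis using assms by (simp add: sum.delta)
qed

lemma L1_on_simple_function:
  assumes "simple_function (lebesgue_on {0..T}) c"
  shows "L1_on T (c :: real \<Rightarrow> 'a::cbanach)"
proof -
  have fin: "finite (c ` {0..T})" using simple_functionD(1)[OF assms] by simp
  have "L1_on T (\<lambda>x. \<Sum>y\<in>c ` {0..T}. indicat_real {x \<in> {0..T}. c x = y} x *\<^sub>R y)"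
    by (intro L1_on_sum fin L1_on_bounded_linear[OF bounded_linear_scaleR_left] L1_on_indicator
      simple_function_lebesgue_on_sets[OF assms]) auto
  then show ?thesis by (rule L1_on_cong) (rule simple_function_sum_representation[OF fin, symmetric])
qed

lemma L1_on_strongly_measurable:
  fixes v :: "real \<Rightarrow> 'a::cbanach"
  assumes v: "strongly_measurable (lebesgue_on {0..T}) v" and fin: "L1_norm T v < \<infinity>"
  shows "L1_on T v"
proof (rule L1_on_approx)
  fix e :: real assume e: "e > 0"
  let ?M = "lebesgue_on {0..T}"
  obtain s where s: "\<And>i. simple_function ?M (s i)" "AE x in ?M. (\<lambda>i. s i x) \<longlonglongrightarrow> v x"
    using v unfolding strongly_measurable_def by blast
  have nv[measurable]: "(\<lambda>x. norm (v x)) \<in> borel_measurable ?M" by (rule strongly_measurable_norm[OF _ v]) auto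
  have ns[measurable]: "(\<lambda>x. norm (s i x)) \<in> borel_measurable ?M" for i
    by (rule borel_measurable_simple_function) (rule simple_function_compose1[OF s(1)])
  \<comment> \<open>Values larger than twice the norm of \<open>v x\<close> are discarded. This
    dominates the error by three times that norm, and where \<open>v x\<close> is nonzero it
    eventually changes nothing.\<close>
  define c where "c i x = (if norm (s i x) \<le> 2 * norm (v x) then s i x else 0)" for i x
  have c: "simple_function ?M (c i)" for i
    unfolding c_def by (intro simple_function_If s(1)) measurable
  have "(\<lambda>i. \<integral>\<^sup>+x. ennreal (norm (v x - c i x)) \<partial>?M) \<longlonglongrightarrow> (\<integral>\<^sup>+x. 0 \<partial>?M)"
  proof (rule nn_integral_dominated_convergence[where w="\<lambda>x. 3 * ennreal (norm (v x))"])
    show "(\<lambda>x. ennreal (norm (v x - c i x))) \<in> borel_measurable ?M" for i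
      by (intro measurable_compose[OF strongly_measurable_norm_diff[OF _ v c] measurable_ennreal]) auto
    have "norm (v x - c i x) \<le> 3 * norm (v x)" for x i
      using norm_triangle_ineq4[of "v x" "s i x"] by (auto simp: c_def)
    then show "AE x in ?M. ennreal (norm (v x - c i x)) \<le> 3 * ennreal (norm (v x))" for i
      by (intro AE_I2) (metis ennreal_leI ennreal_mult ennreal_numeral norm_ge_zero zero_le_numeral)
    show "(\<integral>\<^sup>+ x. 3 * ennreal (norm (v x)) \<partial>?M) < \<infinity>"
      using fin by (simp add: nn_integral_cmult L1_norm_def ennreal_mult_less_top)
    show "AE x in ?M. (\<lambda>i. ennreal (norm (v x - c i x))) \<longlonglongrightarrow> 0"
      using s(2)
    proof eventually_elim
      case (elim x)
      have "(\<lambda>i. c i x) \<longlonglongrightarrow> v x"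
      proof (cases "v x = 0")
        case True
        have "(\<lambda>i. c i x) = (\<lambda>i. 0)" by (auto simp: c_def True)
        then show ?thesis by (simp add: True)
      next
        case False
        have "(\<lambda>i. norm (s i x)) \<longlonglongrightarrow> norm (v x)" by (intro tendsto_intros elim)
        then have "\<forall>\<^sub>F i in sequentially. norm (s i x) < 2 * norm (v x)"
          by (rule order_tendstoD) (use False in simp)
        then have ev: "\<forall>\<^sub>F i in sequentially. c i x = s i x" by eventually_elim (simp add: c_def)
        show ?thesis using elim by (simp only: tendsto_cong[OF ev])
      qed
      then have "(\<lambda>i. norm (v x - c i x)) \<longlonglongrightarrow> norm (v x - v x)" by (intro tendsto_intros)
      then have "(\<lambda>i. ennreal (norm (v x - c i x))) \<longlonglongrightarrow> ennreal 0" by (intro tendsto_ennrealI) simp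
      then show ?case by simp
    qed
  qed auto
  then have "\<forall>\<^sub>F i in sequentially. (\<integral>\<^sup>+x. ennreal (norm (v x - c i x)) \<partial>?M) < ennreal e"
    using e by (intro order_tendstoD(2)) auto
  then obtain i where i: "(\<integral>\<^sup>+x. ennreal (norm (v x - c i x)) \<partial>?M) < ennreal e"
    using eventually_happens'[OF sequentially_bot] by blast
  have "(\<lambda>x. norm (v x - c i x)) integrable_on {0..T}"
    "(\<integral>\<^sup>+x. ennreal (norm (v x - c i x)) \<partial>?M) = ennreal (integral {0..T} (\<lambda>x. norm (v x - c i x)))"
    by (rule integrable_on_if_nn_integral_finite; use i less_trans strongly_measurable_norm_diff[OF _ v c] in \<open>auto simp: less_top[symmetric]\<close>)+
  then show "\<exists>w r. L1_on T w \<and> r integrable_on {0..T} \<and>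
     (\<forall>s\<in>{0..T}. norm (v s - w s) \<le> r s) \<and> integral {0..T} r \<le> e"
    using i e by (intro exI[of _ "c i"] exI[of _ "\<lambda>x. norm (v x - c i x)"])
      (auto simp: L1_on_simple_function[OF c] ennreal_less_iff integral_nonneg)
qed

lemma simple_bochner_integrable_simple: "Bochner_Integration.simple_bochner_integrable M f \<Longrightarrow> simple_function M f"
  by (auto elim: Bochner_Integration.simple_bochner_integrable.cases)

text \<open>Justifies the definite description in \<open>Bochner_integral\<close>: two approximating
  sequences are close to each other in L1, and the integral of a simple function is bounded by its
  L1 norm.\<close>

lemma has_Bochner_integral_unique:
  fixes f :: "real \<Rightarrow> 'a::cbanach"
  assumes S: "S \<in> sets lebesgue"
    and I: "has_Bochner_integral (lebesgue_on S) f I" and J: "has_Bochner_integral (lebesgue_on S) f J"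
  shows "I = J"
proof -
  let ?M = "lebesgue_on S"
  let ?int = "Bochner_Integration.simple_bochner_integral ?M"
  have f: "strongly_measurable ?M f" using I by (simp add: has_Bochner_integral_def)
  obtain s where s: "\<And>i. Bochner_Integration.simple_bochner_integrable ?M (s i)"
    "(\<lambda>i. \<integral>\<^sup>+x. ennreal (norm (f x - s i x)) \<partial>?M) \<longlonglongrightarrow> 0" "(\<lambda>i. ?int (s i)) \<longlonglongrightarrow> I"
    using I unfolding has_Bochner_integral_def by blast
  obtain t where t: "\<And>i. Bochner_Integration.simple_bochner_integrable ?M (t i)"
    "(\<lambda>i. \<integral>\<^sup>+x. ennreal (norm (f x - t i x)) \<partial>?M) \<longlonglongrightarrow> 0" "(\<lambda>i. ?int (t i)) \<longlonglongrightarrow> J"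
    using J unfolding has_Bochner_integral_def by blast
  have le: "ennreal (norm (?int (s i) - ?int (t i))) \<le>
     (\<integral>\<^sup>+x. ennreal (norm (f x - s i x)) \<partial>?M) + (\<integral>\<^sup>+x. ennreal (norm (f x - t i x)) \<partial>?M)" for i
  proof -
    have st: "Bochner_Integration.simple_bochner_integrable ?M (\<lambda>x. s i x - t i x)"
      by (rule simple_bochner_integrable_compose2[OF _ s(1) t(1)]) simp
    have nst: "Bochner_Integration.simple_bochner_integrable ?M (\<lambda>x. norm (s i x - t i x))"
      by (rule simple_bochner_integrable_compose2[OF _ s(1) t(1)]) simp
    have "norm (?int (s i) - ?int (t i)) = norm (?int (\<lambda>x. s i x - t i x))"
      by (simp add: simple_bochner_integral_diff[OF s(1) t(1)])
    also have "\<dots> \<le> ?int (\<lambda>x. norm (s i x - t i x))" by (rule simple_bochner_integral_norm_bound[OF st])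
    finally have "ennreal (norm (?int (s i) - ?int (t i))) \<le> ennreal (?int (\<lambda>x. norm (s i x - t i x)))"
      by (rule ennreal_leI)
    also have "\<dots> = (\<integral>\<^sup>+x. ennreal (norm (s i x - t i x)) \<partial>?M)"
      by (rule simple_bochner_integral_eq_nn_integral[OF nst]) simp
    also have "\<dots> \<le> (\<integral>\<^sup>+x. ennreal (norm (f x - s i x)) + ennreal (norm (f x - t i x)) \<partial>?M)"
    proof (rule nn_integral_mono)
      fix x
      have "norm (s i x - t i x) \<le> norm (f x - s i x) + norm (f x - t i x)"
        using norm_triangle_ineq4[of "f x - t i x" "f x - s i x"] by simp
      then show "ennreal (norm (s i x - t i x)) \<le> ennreal (norm (f x - s i x)) + ennreal (norm (f x - t i x))"
        by (simp add: ennreal_plus[symmetric] del: ennreal_plus)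
    qed
    also have "\<dots> = (\<integral>\<^sup>+x. ennreal (norm (f x - s i x)) \<partial>?M) + (\<integral>\<^sup>+x. ennreal (norm (f x - t i x)) \<partial>?M)"
      using strongly_measurable_norm_diff[OF S f simple_bochner_integrable_simple[OF s(1)]]
        strongly_measurable_norm_diff[OF S f simple_bochner_integrable_simple[OF t(1)]]
      by (intro nn_integral_add) auto
    finally show ?thesis .
  qed
  have "ennreal (norm (I - J)) \<le> 0 + 0"
  proof (rule LIMSEQ_le)
    show "(\<lambda>i. ennreal (norm (?int (s i) - ?int (t i)))) \<longlonglongrightarrow> ennreal (norm (I - J))"
      by (intro tendsto_ennrealI tendsto_intros s t)
    show "(\<lambda>i. (\<integral>\<^sup>+x. ennreal (norm (f x - s i x)) \<partial>?M) + (\<integral>\<^sup>+x. ennreal (norm (f x - t i x)) \<partial>?M)) \<longlonglongrightarrow> 0 + 0"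
      by (intro tendsto_add s t)
  qed (use le in auto)
  then show ?thesis by simp
qed

lemma simple_bochner_integral_has_integral:
  fixes c :: "real \<Rightarrow> 'a::cbanach"
  assumes S: "S \<in> sets lebesgue" and c: "Bochner_Integration.simple_bochner_integrable (lebesgue_on S) c"
  shows "(c has_integral Bochner_Integration.simple_bochner_integral (lebesgue_on S) c) S"
proof -
  let ?M = "lebesgue_on S"
  let ?E = "\<lambda>y. {x \<in> S. c x = y}"
  have sf: "simple_function ?M c" by (rule simple_bochner_integrable_simple[OF c])
  have fin: "finite (c ` S)" using simple_functionD(1)[OF sf] by simp
  have E: "?E y \<in> sets lebesgue" for y by (rule simple_function_lebesgue_on_sets[OF sf S])
  have "((\<lambda>x. indicat_real (?E y) x *\<^sub>R y) has_integral measure lebesgue (?E y) *\<^sub>R y) S" for y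
  \<comment> \<open>The level set of 0 may have infinite measure; its term is 0 all the
    same.\<close>
  proof (cases "y = 0")
    case False
    have "emeasure ?M {x \<in> space ?M. c x \<noteq> 0} < \<infinity>"
      using c by (auto simp: Bochner_Integration.simple_bochner_integrable.simps less_top)
    moreover have "emeasure ?M (?E y) \<le> emeasure ?M {x \<in> space ?M. c x \<noteq> 0}"
    proof (rule emeasure_mono)
      have "{x \<in> S. c x \<noteq> 0} = S - ?E 0" by auto
      then show "{x \<in> space ?M. c x \<noteq> 0} \<in> sets ?M" using E[of 0] S by (simp add: sets_restrict_space_iff sets.Diff)
    qed (use False in auto)
    ultimately have "emeasure lebesgue (?E y) < \<infinity>"
      using S E[of y] by (simp add: emeasure_restrict_space)
    then have "?E y \<in> lmeasurable" using E[of y] by (simp add: fmeasurable_def)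
    then have "(indicat_real (?E y) has_integral measure lebesgue (?E y)) UNIV"
      by (simp add: lmeasurable_iff_has_integral)
    moreover have "(\<lambda>x. if x \<in> S then indicat_real (?E y) x else 0) = indicat_real (?E y)" by (auto simp: indicator_def)
    ultimately have "(indicat_real (?E y) has_integral measure lebesgue (?E y)) S"
      by (subst has_integral_restrict_UNIV[symmetric]) simp
    then show ?thesis by (rule has_integral_scaleR_left)
  qed simp
  then have "((\<lambda>x. \<Sum>y\<in>c ` S. indicat_real (?E y) x *\<^sub>R y) has_integral (\<Sum>y\<in>c ` S. measure lebesgue (?E y) *\<^sub>R y)) S"
    by (intro has_integral_sum fin)
  then have "(c has_integral (\<Sum>y\<in>c ` S. measure lebesgue (?E y) *\<^sub>R y)) S"
    by (rule has_integral_eq[rotated]) (rule simple_function_sum_representation[OF fin, symmetric])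
  moreover have "measure ?M (?E y) = measure lebesgue (?E y)" for y
    using S E[of y] by (intro measure_restrict_space) auto
  ultimately show ?thesis by (simp add: Bochner_Integration.simple_bochner_integral_def)
qed

text \<open>The step function is \<open>G\<close> composed with the integer-valued \<open>k\<close>,
  so it is simple as soon as \<open>k\<close> is, and that reduces to measurability of the level
  sets of a floor function.\<close>

lemma continuous_step_approx:
  fixes q :: "real \<Rightarrow> 'a::cbanach"
  assumes q: "continuous_on {0..T} q" and T: "0 \<le> T" and e: "e > 0"
    and S: "S \<in> sets lebesgue" "{0..T} \<subseteq> S"
  shows "\<exists>c. Bochner_Integration.simple_bochner_integrable (lebesgue_on S) c \<and>
    (\<forall>x\<in>{0..T}. norm (q x - c x) \<le> e) \<and> (\<forall>x. x \<notin> {0..T} \<longrightarrow> c x = 0)"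
proof -
  have "uniformly_continuous_on {0..T} q" by (intro compact_uniformly_continuous q) auto
  then obtain d where d: "d > 0" "\<And>x y. x \<in> {0..T} \<Longrightarrow> y \<in> {0..T} \<Longrightarrow> dist y x < d \<Longrightarrow> dist (q y) (q x) < e"
    unfolding uniformly_continuous_on_def using e by metis
  obtain n :: nat where n: "n > 0" "1 / real n < d"
    using d(1) by (metis ex_inverse_of_nat_less inverse_eq_divide)
  obtain fl where fl_def: "fl = (\<lambda>x. \<lfloor>x * real n\<rfloor>)" by blast
  have fl: "0 \<le> fl x" "fl x \<le> fl T" if "x \<in> {0..T}" for x
    unfolding fl_def using that by (auto intro!: floor_mono mult_right_mono)
  have fl_vimage: "{x. fl x = j} \<in> sets lebesgue" for j
  proof -
    have "{x. fl x = j} = {of_int j / real n..<(of_int j + 1) / real n}"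
      using n by (auto simp: fl_def floor_eq_iff field_simps)
    then show ?thesis by simp
  qed
  \<comment> \<open>The value -1 marks the points outside {0..T}, where \<open>G\<close> returns
    0.\<close>
  define k where "k x = (if x \<in> {0..T} then fl x else -1)" for x
  define G where "G j = (if j \<ge> 0 then q (of_int j / real n) else 0)" for j :: int
  let ?M = "lebesgue_on S"
  have k: "simple_function ?M k"
    unfolding simple_function_def
  proof (intro conjI ballI)
    have "k ` space ?M \<subseteq> insert (-1) {0..fl T}" using fl by (auto simp: k_def)
    then show "finite (k ` space ?M)" by (rule finite_subset) simp
    fix j
    have "k -` {j} \<inter> space ?M = (if j = -1 then S - {0..T} else {}) \<union> ({0..T} \<inter> {x. fl x = j})"
      unfolding k_def using S(2) by (auto split: if_splits)
    moreover have "\<dots> \<in> sets lebesgue"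
      by (intro sets.Un sets.Int fl_vimage) (use S(1) in auto)
    ultimately have "k -` {j} \<inter> space ?M \<in> sets lebesgue" by (simp only:)
    then show "k -` {j} \<inter> space ?M \<in> sets ?M" using S(1) by (subst sets_restrict_space_iff) auto
  qed
  have Gk: "G (k x) = (if x \<in> {0..T} then q (of_int (fl x) / real n) else 0)" for x
    using fl(1)[of x] by (simp add: G_def k_def)
  have "Bochner_Integration.simple_bochner_integrable ?M (\<lambda>x. G (k x))"
  proof
    show "simple_function ?M (\<lambda>x. G (k x))" by (rule simple_function_compose1[OF k])
    have "emeasure ?M {y \<in> space ?M. G (k y) \<noteq> 0} \<le> emeasure ?M {0..T}"
      using S by (intro emeasure_mono) (auto simp: Gk sets_restrict_space_iff split: if_splits)
    also have "\<dots> < \<infinity>" using S T by (simp add: emeasure_restrict_space)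
    finally show "emeasure ?M {y \<in> space ?M. G (k y) \<noteq> 0} \<noteq> \<infinity>" by simp
  qed
  moreover have "norm (q x - G (k x)) \<le> e" if x: "x \<in> {0..T}" for x
  proof -
    have "of_int (fl x) / real n \<le> x" "x < of_int (fl x) / real n + 1 / real n"
      using n floor_correct[of "x * real n"] unfolding fl_def by (auto simp: field_simps)
    moreover have "0 \<le> of_int (fl x) / real n" using fl(1)[OF x] by simp
    ultimately have "dist (q x) (q (of_int (fl x) / real n)) < e"
      using x n(2) by (intro d(2)) (auto simp: dist_real_def)
    then show ?thesis using x by (simp add: Gk dist_norm)
  qed
  ultimately show ?thesis by (intro exI[of _ "\<lambda>x. G (k x)"]) (auto simp: Gk)
qed

lemma L1_on_step_approx:
  fixes v :: "real \<Rightarrow> 'a::cbanach"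
  assumes v: "L1_on T v" and T: "0 \<le> T" and e: "e > 0"
    and S: "S \<in> sets lebesgue" "{0..T} \<subseteq> S" and zero: "\<And>x. x \<in> S - {0..T} \<Longrightarrow> v x = 0"
  shows "\<exists>c r. Bochner_Integration.simple_bochner_integrable (lebesgue_on S) c \<and> r integrable_on S \<and>
    (\<forall>x\<in>S. norm (v x - c x) \<le> r x) \<and> integral S r \<le> e"
proof -
  have "e / 2 > 0" using e by simp
  then obtain q r where q: "continuous_on {0..T} q" and r: "r integrable_on {0..T}"
    and le: "\<And>s. s \<in> {0..T} \<Longrightarrow> norm (v s - q s) \<le> r s" and small: "integral {0..T} r \<le> e / 2"
    using L1_onE[OF v] by blast
  \<comment> \<open>The halves of e pay for \<open>r\<close> and for the step approximation; T + 1
    in the denominator also serves T = 0.\<close>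
  define \<delta> where "\<delta> = e / (2 * (T + 1))"
  have \<delta>: "\<delta> > 0" "T * \<delta> \<le> e / 2" using T e by (auto simp: \<delta>_def field_simps)
  obtain c where c: "Bochner_Integration.simple_bochner_integrable (lebesgue_on S) c"
    "\<And>x. x \<in> {0..T} \<Longrightarrow> norm (q x - c x) \<le> \<delta>" "\<And>x. x \<notin> {0..T} \<Longrightarrow> c x = 0"
    using continuous_step_approx[OF q T \<delta>(1) S] by blast
  define r' where "r' x = (if x \<in> {0..T} then r x + \<delta> else 0)" for x
  have "((\<lambda>x. r x + \<delta>) has_integral integral {0..T} r + T * \<delta>) {0..T}"
    using has_integral_add[OF integrable_integral[OF r] has_integral_const_real[of \<delta> 0 T]] T by simp
  then have r': "(r' has_integral integral {0..T} r + T * \<delta>) S"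
    unfolding r'_def by (subst has_integral_restrict[OF S(2)])
  have "norm (v x - c x) \<le> r' x" if "x \<in> S" for x
  proof (cases "x \<in> {0..T}")
    case True
    then show ?thesis using le[OF True] c(2)[OF True] norm_triangle_ineq[of "v x - q x" "q x - c x"]
      by (simp add: r'_def)
  next
    case False
    then have "v x = 0" using that by (intro zero) auto
    then show ?thesis using c(3)[OF False] False by (auto simp: r'_def)
  qed
  moreover have "integral S r' \<le> e" using integral_unique[OF r'] small \<delta>(2) by simp
  ultimately show ?thesis using c(1) r' by blast
qed

text \<open>Errors of size (1/2)^n make the majorants \<open>r n\<close> summable in L1, hence
  convergent to 0 almost everywhere, which yields strong measurability. In the applications
  \<open>S\<close> is the interval itself or the half-line.\<close>

lemma L1_on_has_Bochner_integral:
  fixes v :: "real \<Rightarrow> 'a::cbanach"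
  assumes v: "L1_on T v" and T: "0 \<le> T"
    and S: "S \<in> sets lebesgue" "{0..T} \<subseteq> S" and zero: "\<And>x. x \<in> S - {0..T} \<Longrightarrow> v x = 0"
  shows "has_Bochner_integral (lebesgue_on S) v (integral {0..T} v)"
proof -
  let ?M = "lebesgue_on S"
  have "\<exists>c r. Bochner_Integration.simple_bochner_integrable (lebesgue_on S) c \<and> r integrable_on S \<and>
    (\<forall>x\<in>S. norm (v x - c x) \<le> r x) \<and> integral S r \<le> (1/2) ^ n" for n :: nat
    by (rule L1_on_step_approx[OF v T _ S zero]) auto
  then obtain c r where c: "\<And>n. Bochner_Integration.simple_bochner_integrable (lebesgue_on S) (c n)"
    and r: "\<And>n. r n integrable_on S" and le: "\<And>n x. x \<in> S \<Longrightarrow> norm (v x - c n x) \<le> r n x"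
    and small: "\<And>n. integral S (r n) \<le> (1/2) ^ n" by metis
  have r0: "0 \<le> r n x" if "x \<in> S" for n x using order_trans[OF norm_ge_zero le[OF that]] .
  note R = nn_integral_lebesgue_on_integral[OF S(1) r r0]
  have nnr: "(\<integral>\<^sup>+x. ennreal (r n x) \<partial>?M) \<le> ennreal ((1/2) ^ n)" for n
    using R(2) small by (simp add: ennreal_leI)
  have nnv: "(\<integral>\<^sup>+x. ennreal (norm (v x - c n x)) \<partial>?M) \<le> ennreal ((1/2) ^ n)" for n
    by (rule order_trans[OF nn_integral_mono nnr]) (auto intro!: ennreal_leI le)
  have lim: "(\<lambda>n. ennreal ((1/2) ^ n)) \<longlonglongrightarrow> 0"
    using tendsto_ennrealI[OF LIMSEQ_realpow_zero[of "1/2::real"]] by simp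
  have "(\<integral>\<^sup>+x. (\<Sum>n. ennreal (r n x)) \<partial>?M) = (\<Sum>n. \<integral>\<^sup>+x. ennreal (r n x) \<partial>?M)"
    by (rule nn_integral_suminf) (use R(1) in auto)
  also have "\<dots> \<le> (\<Sum>n. ennreal ((1/2) ^ n))" by (intro suminf_le nnr) auto
  also have "\<dots> = ennreal (\<Sum>n. (1/2) ^ n)" by (rule suminf_ennreal2) (auto intro: summable_geometric)
  finally have "(\<integral>\<^sup>+x. (\<Sum>n. ennreal (r n x)) \<partial>?M) \<noteq> \<infinity>"
    by (metis ennreal_neq_top infinity_ennreal_def neq_top_trans)
  then have "AE x in ?M. (\<Sum>n. ennreal (r n x)) \<noteq> \<infinity>"
    by (intro nn_integral_noteq_infinite borel_measurable_suminf_order) (use R(1) in auto)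
  then have "AE x in ?M. (\<lambda>n. c n x) \<longlonglongrightarrow> v x"
    using AE_space
  proof eventually_elim
    case (elim x)
    have x: "x \<in> S" using elim(2) by simp
    have "summable (\<lambda>n. r n x)" using elim(1) r0[OF x] by (intro summable_suminf_not_top) auto
    then have "(\<lambda>n. r n x) \<longlonglongrightarrow> 0" by (rule summable_LIMSEQ_zero)
    then have "(\<lambda>n. v x - c n x) \<longlonglongrightarrow> 0" by (rule Lim_null_comparison[rotated]) (use le[OF x] in auto)
    then have "(\<lambda>n. v x - (v x - c n x)) \<longlonglongrightarrow> v x - 0" by (intro tendsto_intros)
    then show ?case by simp
  qed
  then have sm: "strongly_measurable ?M v"
    unfolding strongly_measurable_def using simple_bochner_integrable_simple[OF c] by blast
  have "(v has_integral integral {0..T} v) S"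
    using has_integral_restrict[OF S(2), of v "integral {0..T} v"] integrable_integral[OF L1_on_integrable[OF v]]
    by (auto intro: has_integral_eq[rotated] simp: zero)
  then have vint: "v integrable_on S" "integral S v = integral {0..T} v" by auto
  have "norm (Bochner_Integration.simple_bochner_integral ?M (c n) - integral {0..T} v) \<le> (1/2) ^ n" for n
  proof -
    have ci: "(c n has_integral Bochner_Integration.simple_bochner_integral ?M (c n)) S"
      by (rule simple_bochner_integral_has_integral[OF S(1) c])
    have "((\<lambda>x. c n x - v x) has_integral Bochner_Integration.simple_bochner_integral ?M (c n) - integral {0..T} v) S"
      using has_integral_diff[OF ci integrable_integral[OF vint(1)]] vint(2) by simp
    moreover from this have "norm (integral S (\<lambda>x. c n x - v x)) \<le> integral S (r n)"
      using le by (intro integral_norm_bound_integral r has_integral_integrable) (auto simp: norm_minus_commute)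
    ultimately have "norm (Bochner_Integration.simple_bochner_integral ?M (c n) - integral {0..T} v) \<le> integral S (r n)"
      by (simp only: integral_unique)
    then show ?thesis using small[of n] by simp
  qed
  then have "(\<lambda>n. Bochner_Integration.simple_bochner_integral ?M (c n) - integral {0..T} v) \<longlonglongrightarrow> 0"
    by (intro Lim_null_comparison[OF _ LIMSEQ_realpow_zero[of "1/2::real"]]) auto
  then have "(\<lambda>n. Bochner_Integration.simple_bochner_integral ?M (c n)) \<longlonglongrightarrow> integral {0..T} v"
    by (rule LIM_zero_cancel)
  moreover have "(\<lambda>n. \<integral>\<^sup>+x. ennreal (norm (v x - c n x)) \<partial>?M) \<longlonglongrightarrow> 0"
    by (rule tendsto_sandwich[OF _ _ tendsto_const lim]) (auto intro!: always_eventually nnv)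
  ultimately show ?thesis unfolding has_Bochner_integral_def using sm c by blast
qed

lemma Bochner_integral_eq:
  fixes f :: "real \<Rightarrow> 'a::cbanach"
  assumes "S \<in> sets lebesgue" "has_Bochner_integral (lebesgue_on S) f I"
  shows "Bochner_integral (lebesgue_on S) f = I"
  unfolding Bochner_integral_def
  by (rule the_equality[where P="has_Bochner_integral (lebesgue_on S) f"])
    (use assms has_Bochner_integral_unique in blast)+

lemma Bochner_integral_interval:
  fixes f :: "real \<Rightarrow> 'a::cbanach"
  assumes "L1_on T f" "0 \<le> T"
  shows "Bochner_integral (lebesgue_on {0..T}) f = integral {0..T} f"
  by (rule Bochner_integral_eq, simp, rule L1_on_has_Bochner_integral) (use assms in auto)

lemma Bochner_integral_halfline:
  fixes f :: "real \<Rightarrow> 'a::cbanach"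
  assumes "L1_on T f" "0 \<le> T" "\<And>s. s > T \<Longrightarrow> f s = 0"
  shows "Bochner_integral (lebesgue_on {0..}) f = integral {0..T} f"
  by (rule Bochner_integral_eq, simp, rule L1_on_has_Bochner_integral) (use assms in auto)

lemma L1_on_L1_norm:
  fixes v :: "real \<Rightarrow> 'a::cbanach"
  assumes "L1_on T v"
  shows "L1_norm T v = ennreal (integral {0..T} (\<lambda>s. norm (v s)))"
  unfolding L1_norm_def
  by (rule nn_integral_lebesgue_on_integral) (auto intro: L1_on_norm_integrable assms)

lemma L1_loc_iff_L1_on: "L1_loc v \<longleftrightarrow> (\<forall>T. L1_on T v)"
proof
  assume v: "L1_loc v"
  have pos: "L1_on T v" if "T > 0" for T
    using v that unfolding L1_loc_def by (intro L1_on_strongly_measurable) auto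
  show "\<forall>T. L1_on T v"
  proof
    fix T show "L1_on T v" by (rule L1_on_subset[OF pos[of "max 1 T"]]) auto
  qed
next
  assume v: "\<forall>T. L1_on T v"
  have "strongly_measurable (lebesgue_on {0..T}) v" if "T > 0" for T
    using L1_on_has_Bochner_integral[of T v "{0..T}"] v that by (auto simp: has_Bochner_integral_def)
  then show "L1_loc v" using v by (auto simp: L1_loc_def L1_on_L1_norm)
qed

lemma Linf_norm_AE: "Linf_norm T f \<le> ennreal c \<Longrightarrow> 0 \<le> c \<Longrightarrow> AE s in lebesgue_on {0..T}. norm (f s) \<le> c"
  using esssup_AE[of "\<lambda>s. ennreal (norm (f s))" "lebesgue_on {0..T}"]
  unfolding Linf_norm_def by (auto elim!: eventually_mono dest: order_trans)

lemma Linf_loc_L1_on: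
  assumes f: "Linf_loc f"
  shows "L1_on T f"
proof -
  have "L1_loc f"
    unfolding L1_loc_def
  proof (intro allI impI conjI)
    fix t :: real assume t: "t > 0"
    show "strongly_measurable (lebesgue_on {0..t}) f" using f t by (simp add: Linf_loc_def)
    have fin: "Linf_norm t f < \<infinity>" using f t by (simp add: Linf_loc_def)
    have "L1_norm t f \<le> (\<integral>\<^sup>+s. Linf_norm t f \<partial>lebesgue_on {0..t})"
      unfolding L1_norm_def Linf_norm_def by (intro nn_integral_mono_AE esssup_AE)
    also have "\<dots> = Linf_norm t f * ennreal t"
      using t by (simp add: emeasure_restrict_space)
    also have "\<dots> < \<infinity>" using fin by (simp add: ennreal_mult_less_top)
    finally show "L1_norm t f < \<infinity>" .
  qed
  then show ?thesis by (simp add: L1_loc_iff_L1_on)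
qed

section \<open>Weights, essential bounds and completeness of L1\<close>

lemma continuous_on_interval_bounded:
  fixes f :: "real \<Rightarrow> 'a::real_normed_vector"
  assumes "continuous_on {a..b} f"
  obtains B where "0 \<le> B" "\<And>s. s \<in> {a..b} \<Longrightarrow> norm (f s) \<le> B"
proof -
  have "compact (f ` {a..b})" using assms by (intro compact_continuous_image) auto
  then have "bounded (f ` {a..b})" by (rule compact_imp_bounded)
  then obtain B where B: "\<forall>y\<in>f ` {a..b}. norm y \<le> B" unfolding bounded_iff by blast
  show ?thesis by (rule that[of "max 0 B"]) (use B in \<open>auto intro: max.coboundedI2\<close>)
qed

lemma L1_on_weight:
  fixes f :: "real \<Rightarrow> 'a::banach" and \<phi> :: "real \<Rightarrow> real"
  assumes f: "L1_on T f" and \<phi>: "continuous_on {0..T} \<phi>"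
  shows "L1_on T (\<lambda>s. \<phi> s *\<^sub>R f s)"
proof -
  obtain B where B: "\<And>s. s \<in> {0..T} \<Longrightarrow> norm (\<phi> s) \<le> B"
    using continuous_on_interval_bounded[OF \<phi>] by blast
  show ?thesis
  proof (rule L1_on_operator[OF f, where M=B])
    show "norm (\<phi> s *\<^sub>R x - \<phi> s *\<^sub>R y) \<le> B * norm (x - y)" if "s \<in> {0..T}" for s and x y :: 'a
      unfolding scaleR_diff_right[symmetric] norm_scaleR using B[OF that] by (intro mult_right_mono) auto
  qed (intro continuous_intros \<phi>)
qed

text \<open>The bound on \<open>f\<close> holds off a null set only; setting integrand and majorant
  to 0 there changes neither integral.\<close>

lemma norm_integral_weight_le:
  fixes f :: "real \<Rightarrow> 'a::cbanach"
  assumes f: "L1_on T f" and bd: "AE s in lebesgue_on {0..T}. norm (f s) \<le> c"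
    and \<phi>: "continuous_on {0..T} \<phi>" "\<And>s. 0 \<le> \<phi> s"
  shows "norm (integral {0..T} (\<lambda>s. \<phi> s *\<^sub>R f s)) \<le> c * integral {0..T} \<phi>"
proof -
  have "AE s in lebesgue. s \<in> {0..T} \<longrightarrow> norm (f s) \<le> c" using bd by (subst (asm) AE_restrict_space_iff) auto
  then obtain N where N: "negligible N" "\<And>s. s \<notin> N \<Longrightarrow> s \<in> {0..T} \<Longrightarrow> norm (f s) \<le> c"
    unfolding completion.AE_iff_null_sets negligible_iff_null_sets by auto
  define g where "g s = (if s \<in> N then 0 else \<phi> s *\<^sub>R f s)" for s
  have L: "L1_on T (\<lambda>s. \<phi> s *\<^sub>R f s)" by (rule L1_on_weight[OF f \<phi>(1)])
  have eq: "integral {0..T} (\<lambda>s. \<phi> s *\<^sub>R f s) = integral {0..T} g"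
    by (rule integral_spike[OF N(1)]) (simp add: g_def)
  have "g integrable_on {0..T}"
    by (rule integrable_spike[OF L1_on_integrable[OF L] N(1)]) (simp add: g_def)
  then have "norm (integral {0..T} g) \<le> integral {0..T} (\<lambda>s. (if s \<in> N then 0 else c) * \<phi> s)"
  proof (rule integral_norm_bound_integral)
    have "(\<lambda>s. c * \<phi> s) integrable_on {0..T}" by (intro integrable_continuous_real continuous_intros \<phi>)
    then show "(\<lambda>s. (if s \<in> N then 0 else c) * \<phi> s) integrable_on {0..T}"
      by (rule integrable_spike[OF _ N(1)]) simp
    show "norm (g s) \<le> (if s \<in> N then 0 else c) * \<phi> s" if "s \<in> {0..T}" for s
    proof (cases "s \<in> N")
      case False
      have "\<phi> s * norm (f s) \<le> \<phi> s * c" by (intro mult_left_mono N(2)[OF False that] \<phi>(2))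
      then show ?thesis using False \<phi>(2)[of s] by (simp add: g_def mult.commute)
    qed (simp add: g_def)
  qed
  also have "\<dots> = integral {0..T} (\<lambda>s. c * \<phi> s)" by (rule integral_spike[OF N(1)]) simp
  also have "\<dots> = c * integral {0..T} \<phi>" by simp
  finally show ?thesis by (simp add: eq)
qed

text \<open>Riesz--Fischer with a geometric rate. Increments are controlled on {0..T} only once n
  \<ge> T, which suits difference quotients that are good approximations on growing
  intervals.\<close>

lemma L1_on_complete:
  fixes y :: "nat \<Rightarrow> real \<Rightarrow> 'a::cbanach"
  assumes y: "\<And>n T. L1_on T (y n)"
    and cau: "\<And>n T. T \<le> real n \<Longrightarrow> integral {0..T} (\<lambda>s. norm (y (Suc n) s - y n s)) \<le> C * (1/2) ^ n"
  shows "\<exists>f. \<forall>T. L1_on T f \<and> (\<lambda>n. integral {0..T} (\<lambda>s. norm (f s - y n s))) \<longlonglongrightarrow> 0"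
proof -
  define f where "f s = (if convergent (\<lambda>n. y n s) then lim (\<lambda>n. y n s) else 0)" for s
  have key: "\<exists>r. r integrable_on {0..T} \<and> (\<forall>s\<in>{0..T}. norm (f s - y n s) \<le> r s) \<and> integral {0..T} r \<le> 2 * C * (1/2) ^ n"
    if n: "T \<le> real n" for n T
  proof -
    let ?M = "lebesgue_on {0..T}"
    let ?d = "\<lambda>k s. norm (y (Suc (k + n)) s - y (k + n) s)"
    have di: "?d k integrable_on {0..T}" for k by (intro L1_on_norm_integrable L1_on_diff y)
    note D = nn_integral_lebesgue_on_integral[of "{0..T}", OF _ di]
    have dm[measurable]: "?d k \<in> borel_measurable ?M" for k by (rule D(1)) auto
    have dle: "(\<integral>\<^sup>+s. ennreal (?d k s) \<partial>?M) \<le> ennreal (C * (1/2) ^ n * (1/2) ^ k)" for k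
    proof -
      have "integral {0..T} (?d k) \<le> C * (1/2) ^ (k + n)" using n by (intro cau) auto
      then show ?thesis by (subst D(2)) (auto simp: power_add mult_ac intro!: ennreal_leI)
    qed
    have C0: "0 \<le> C * (1/2) ^ n"
    proof -
      have "0 \<le> integral {0..T} (\<lambda>s. norm (y (Suc n) s - y n s))" by (rule integral_nonneg) (use di[of 0] in auto)
      then show ?thesis using cau[OF n] by simp
    qed
    define S where "S s = (\<Sum>k. ennreal (?d k s))" for s
    have Sm[measurable]: "S \<in> borel_measurable ?M" unfolding S_def by measurable
    have "(\<integral>\<^sup>+s. S s \<partial>?M) = (\<Sum>k. \<integral>\<^sup>+s. ennreal (?d k s) \<partial>?M)"
      unfolding S_def by (rule nn_integral_suminf) auto
    also have "\<dots> \<le> (\<Sum>k. ennreal (C * (1/2) ^ n * (1/2) ^ k))" by (intro suminf_le dle) auto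
    also have "\<dots> = ennreal (\<Sum>k. C * (1/2) ^ n * (1/2) ^ k)"
      by (rule suminf_ennreal2) (use C0 in \<open>auto intro!: summable_mult summable_geometric mult_nonneg_nonneg\<close>)
    also have "(\<Sum>k. C * (1/2) ^ n * (1/2) ^ k) = 2 * C * (1/2) ^ n"
      using suminf_geometric[of "1/2::real"] by (subst suminf_mult) (auto intro: summable_geometric)
    finally have Sint: "(\<integral>\<^sup>+s. S s \<partial>?M) \<le> ennreal (2 * C * (1/2) ^ n)" .
    then have Sfin: "AE s in ?M. S s \<noteq> \<infinity>"
      by (intro nn_integral_noteq_infinite) (auto simp: top_unique)
    then have "AE s in lebesgue. s \<in> {0..T} \<longrightarrow> S s \<noteq> \<infinity>" by (subst (asm) AE_restrict_space_iff) auto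
    then obtain N where N: "negligible N" "\<And>s. s \<notin> N \<Longrightarrow> s \<in> {0..T} \<Longrightarrow> S s \<noteq> \<infinity>"
      unfolding completion.AE_iff_null_sets negligible_iff_null_sets by auto
    have Seq: "AE s in ?M. ennreal (enn2real (S s)) = S s"
      using Sfin by eventually_elim (simp add: less_top)
    have nnS: "(\<integral>\<^sup>+s. ennreal (enn2real (S s)) \<partial>?M) = (\<integral>\<^sup>+s. S s \<partial>?M)"
      by (rule nn_integral_cong_AE[OF Seq])
    have Snt: "(\<integral>\<^sup>+s. S s \<partial>?M) \<noteq> top"
      using Sint by (metis ennreal_neq_top neq_top_trans)
    have Sreal: "(\<lambda>s. enn2real (S s)) integrable_on {0..T}"
      "ennreal (integral {0..T} (\<lambda>s. enn2real (S s))) = (\<integral>\<^sup>+s. ennreal (enn2real (S s)) \<partial>?M)"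
      using integrable_on_if_nn_integral_finite[of "{0..T}" "\<lambda>s. enn2real (S s)"] Snt
      by (auto simp: nnS top_unique less_top[symmetric])
    have Sle: "integral {0..T} (\<lambda>s. enn2real (S s)) \<le> 2 * C * (1/2) ^ n"
      using Sint C0 unfolding nnS[symmetric] Sreal(2)[symmetric] by (simp add: ennreal_le_iff)
    \<comment> \<open>\<open>L1_on\<close> asks for a majorant at every point; on the null set
      \<open>N\<close>, where the series may diverge, the error itself is taken.\<close>
    define r where "r s = (if s \<in> N then norm (f s - y n s) else enn2real (S s))" for s
    have r: "r integrable_on {0..T}" by (rule integrable_spike[OF Sreal(1) N(1)]) (simp add: r_def)
    have "integral {0..T} r = integral {0..T} (\<lambda>s. enn2real (S s))"
      by (rule integral_spike[OF N(1)]) (simp add: r_def)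
    moreover have "norm (f s - y n s) \<le> r s" if s: "s \<in> {0..T}" for s
    proof (cases "s \<in> N")
      case False
      have "S s \<noteq> \<infinity>" by (rule N(2)[OF False s])
      then have sum: "summable (\<lambda>k. ?d k s)" unfolding S_def by (intro summable_suminf_not_top) auto
      have Ssum: "enn2real (S s) = (\<Sum>k. ?d k s)"
        unfolding S_def by (subst suminf_ennreal2[OF _ sum]) (auto intro!: enn2real_ennreal suminf_nonneg sum)
      have sumv: "summable (\<lambda>k. y (Suc (k + n)) s - y (k + n) s)" by (rule summable_norm_cancel[OF sum])
      have tel: "(\<Sum>k<m. y (Suc (k + n)) s - y (k + n) s) = y (m + n) s - y n s" for m
        using sum_lessThan_telescope[of "\<lambda>k. y (k + n) s" m] by simp
      have "(\<lambda>m. y (m + n) s - y n s) \<longlonglongrightarrow> (\<Sum>k. y (Suc (k + n)) s - y (k + n) s)"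
        using summable_LIMSEQ[OF sumv] by (simp add: tel)
      then have "(\<lambda>m. y (m + n) s - y n s + y n s) \<longlonglongrightarrow> (\<Sum>k. y (Suc (k + n)) s - y (k + n) s) + y n s"
        by (intro tendsto_intros)
      then have lim: "(\<lambda>m. y m s) \<longlonglongrightarrow> (\<Sum>k. y (Suc (k + n)) s - y (k + n) s) + y n s"
        by (simp add: LIMSEQ_offset)
      then have "f s - y n s = (\<Sum>k. y (Suc (k + n)) s - y (k + n) s)"
        by (auto simp: f_def convergent_def limI)
      then show ?thesis using summable_norm[OF sum] False by (simp add: r_def Ssum)
    qed (simp add: r_def)
    ultimately show ?thesis using r Sle by auto
  qed
  have L: "L1_on T f" for T
  proof (rule L1_on_approx)
    fix e :: real assume e: "e > 0"
    have "(\<lambda>n. 2 * C * (1/2) ^ n) \<longlonglongrightarrow> 2 * C * 0" by (intro tendsto_intros LIMSEQ_realpow_zero) auto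
    then have "\<forall>\<^sub>F n in sequentially. 2 * C * (1/2) ^ n < e" by (rule order_tendstoD) (use e in simp)
    moreover have "\<forall>\<^sub>F n in sequentially. T \<le> real n"
      using eventually_ge_at_top[of "nat \<lceil>T\<rceil>"] by eventually_elim linarith
    ultimately have "\<forall>\<^sub>F n in sequentially. 2 * C * (1/2) ^ n < e \<and> T \<le> real n" by (rule eventually_conj)
    then obtain n where n: "2 * C * (1/2) ^ n < e" "T \<le> real n"
      using eventually_happens'[OF sequentially_bot] by blast
    from key[OF n(2)] obtain r where "r integrable_on {0..T}" "\<forall>s\<in>{0..T}. norm (f s - y n s) \<le> r s" "integral {0..T} r \<le> 2 * C * (1/2) ^ n"
      by blast
    then show "\<exists>w r. L1_on T w \<and> r integrable_on {0..T} \<and>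
     (\<forall>s\<in>{0..T}. norm (f s - w s) \<le> r s) \<and> integral {0..T} r \<le> e"
      using y n(1) by (intro exI[of _ "y n"] exI[of _ r]) auto
  qed
  have "(\<lambda>n. integral {0..T} (\<lambda>s. norm (f s - y n s))) \<longlonglongrightarrow> 0" for T
  proof (rule Lim_null_comparison)
    have "(\<lambda>n. 2 * C * (1/2) ^ n) \<longlonglongrightarrow> 2 * C * 0" by (intro tendsto_intros LIMSEQ_realpow_zero) auto
    then show "(\<lambda>n. 2 * C * (1/2) ^ n) \<longlonglongrightarrow> 0" by simp
    have "norm (integral {0..T} (\<lambda>s. norm (f s - y n s))) \<le> 2 * C * (1/2) ^ n" if n: "T \<le> real n" for n
    proof -
      obtain r where r: "r integrable_on {0..T}" "\<And>s. s \<in> {0..T} \<Longrightarrow> norm (f s - y n s) \<le> r s" "integral {0..T} r \<le> 2 * C * (1/2) ^ n"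
        using key[OF n] by blast
      have "(\<lambda>s. norm (f s - y n s)) integrable_on {0..T}" by (intro L1_on_norm_integrable L1_on_diff L y)
      then have "norm (integral {0..T} (\<lambda>s. norm (f s - y n s))) \<le> integral {0..T} r"
        by (rule integral_norm_bound_integral) (use r in auto)
      then show ?thesis using r(3) by simp
    qed
    then show "\<forall>\<^sub>F n in sequentially. norm (integral {0..T} (\<lambda>s. norm (f s - y n s))) \<le> 2 * C * (1/2) ^ n"
      using eventually_ge_at_top[of "nat \<lceil>T\<rceil>"] by (auto elim!: eventually_mono)
  qed
  then show ?thesis using L by blast
qed

section \<open>Convolution with a strongly continuous kernel\<close>

text \<open>Continuity is strong, since semigroups are rarely continuous in operator norm. Kernels
  are plain families of real-linear maps, so that scalar kernels acting on real functions, such as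
  \<open>hat\<close>, are included.\<close>

definition kern :: "(real \<Rightarrow> 'a::banach \<Rightarrow> 'b::banach) \<Rightarrow> bool" where
  "kern \<kappa> \<longleftrightarrow> (\<forall>t. linear (\<kappa> t)) \<and> (\<forall>x. continuous_on {0..} (\<lambda>t. \<kappa> t x)) \<and>
     (\<forall>T. \<exists>M\<ge>0. \<forall>t\<in>{0..T}. \<forall>x. norm (\<kappa> t x) \<le> M * norm x)"

definition conv :: "(real \<Rightarrow> 'a::banach \<Rightarrow> 'b::banach) \<Rightarrow> (real \<Rightarrow> 'a) \<Rightarrow> real \<Rightarrow> 'b" where
  "conv \<kappa> p t = integral {0..t} (\<lambda>s. \<kappa> (t - s) (p s))"

lemma
  assumes "kern \<kappa>"
  shows kern_linear: "linear (\<kappa> t)" and kern_continuous: "continuous_on {0..} (\<lambda>t. \<kappa> t x)"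
    and kern_bound: "\<exists>M\<ge>0. \<forall>t\<in>{0..T}. \<forall>x. norm (\<kappa> t x) \<le> M * norm x"
  using assms by (auto simp: kern_def)

lemma kern_diff: "kern \<kappa> \<Longrightarrow> \<kappa> t (x - y) = \<kappa> t x - \<kappa> t y"
  by (rule linear_diff[OF kern_linear])

text \<open>Strong continuity and a local bound give joint continuity: split
  \<open>\<kappa> (g b) (q b)\<close> into \<open>\<kappa> (g b) (q b - q a)\<close> and
  \<open>\<kappa> (g b) (q a)\<close>.\<close>

lemma kern_continuous_on_compose:
  fixes g :: "'c::metric_space \<Rightarrow> real"
  assumes \<kappa>: "kern \<kappa>" and g: "continuous_on A g" "g ` A \<subseteq> {0..T}" and q: "continuous_on A q"
  shows "continuous_on A (\<lambda>a. \<kappa> (g a) (q a))"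
  unfolding continuous_on_def
proof
  fix a assume a: "a \<in> A"
  obtain M where M: "M \<ge> 0" "\<And>t x. t \<in> {0..T} \<Longrightarrow> norm (\<kappa> t x) \<le> M * norm x" using kern_bound[OF \<kappa>, of T] by blast
  have "continuous_on A (\<lambda>b. \<kappa> (g b) (q a))"
    by (rule continuous_on_compose2[OF kern_continuous[OF \<kappa>] g(1)]) (use g(2) in auto)
  then have 1: "((\<lambda>b. \<kappa> (g b) (q a)) \<longlongrightarrow> \<kappa> (g a) (q a)) (at a within A)"
    using a by (simp add: continuous_on_def)
  have "((\<lambda>b. \<kappa> (g b) (q b - q a)) \<longlongrightarrow> 0) (at a within A)"
  proof (rule Lim_null_comparison)
    have "(q \<longlongrightarrow> q a) (at a within A)" using q a by (simp add: continuous_on_def)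
    then have "((\<lambda>b. M * norm (q b - q a)) \<longlongrightarrow> M * norm (q a - q a)) (at a within A)" by (intro tendsto_intros)
    then show "((\<lambda>b. M * norm (q b - q a)) \<longlongrightarrow> 0) (at a within A)" by simp
    show "\<forall>\<^sub>F b in at a within A. norm (\<kappa> (g b) (q b - q a)) \<le> M * norm (q b - q a)"
      unfolding eventually_at by (intro exI[of _ 1]) (use M(2) g(2) in auto)
  qed
  from tendsto_add[OF this 1] show "((\<lambda>a. \<kappa> (g a) (q a)) \<longlongrightarrow> \<kappa> (g a) (q a)) (at a within A)"
    by (simp add: kern_diff[OF \<kappa>])
qed

lemma kern_primitive:
  assumes \<kappa>: "kern \<kappa>"
  shows "kern (\<lambda>t x. integral {0..t} (\<lambda>r. \<kappa> r x))"
proof -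
  have int: "(\<lambda>r. \<kappa> r x) integrable_on {0..t}" for x t
    by (intro integrable_continuous_real continuous_on_subset[OF kern_continuous[OF \<kappa>]]) auto
  have "linear (\<lambda>x. integral {0..t} (\<lambda>r. \<kappa> r x))" for t
    by (rule linearI)
      (simp_all add: linear_add[OF kern_linear[OF \<kappa>]] linear_scale[OF kern_linear[OF \<kappa>]]
        Henstock_Kurzweil_Integration.integral_add int)
  moreover have "continuous_on {0..} (\<lambda>t. integral {0..t} (\<lambda>r. \<kappa> r x))" for x
    unfolding continuous_on_eq_continuous_within
  proof
    fix t :: real assume t: "t \<in> {0..}"
    have "continuous_on {0..t + 1} (\<lambda>t. integral {0..t} (\<lambda>r. \<kappa> r x))"
      by (rule indefinite_integral_continuous_1[OF int])
    then have "continuous (at t within {0..t + 1}) (\<lambda>t. integral {0..t} (\<lambda>r. \<kappa> r x))"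
      using t by (simp add: continuous_on_eq_continuous_within)
    moreover have "at t within {0..t + 1} = at t within {0..}"
      by (rule at_within_nhd[of t "{..<t + 1}"]) auto
    ultimately show "continuous (at t within {0..}) (\<lambda>t. integral {0..t} (\<lambda>r. \<kappa> r x))"
      by (simp add: continuous_within)
  qed
  moreover have "\<exists>M\<ge>0. \<forall>t\<in>{0..T}. \<forall>x. norm (integral {0..t} (\<lambda>r. \<kappa> r x)) \<le> M * norm x" for T
  proof -
    obtain M where M: "M \<ge> 0" "\<And>t x. t \<in> {0..T} \<Longrightarrow> norm (\<kappa> t x) \<le> M * norm x" using kern_bound[OF \<kappa>, of T] by blast
    have "norm (integral {0..t} (\<lambda>r. \<kappa> r x)) \<le> (M * \<bar>T\<bar>) * norm x" if t: "t \<in> {0..T}" for t x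
    proof -
      have "norm (integral {0..t} (\<lambda>r. \<kappa> r x)) \<le> (M * norm x) * (t - 0)"
        using t M by (intro integral_bound continuous_on_subset[OF kern_continuous[OF \<kappa>]]) auto
      also have "\<dots> \<le> (M * norm x) * \<bar>T\<bar>" using t M by (intro mult_left_mono) auto
      finally show ?thesis by (simp add: mult_ac)
    qed
    then show ?thesis using M(1) by (intro exI[of _ "M * \<bar>T\<bar>"]) auto
  qed
  ultimately show ?thesis by (simp add: kern_def)
qed

lemma kern_add:
  assumes "kern \<kappa>" "kern \<mu>"
  shows "kern (\<lambda>t x. \<kappa> t x + \<mu> t x)"
  unfolding kern_def
proof (intro conjI allI)
  show "linear (\<lambda>x. \<kappa> t x + \<mu> t x)" for t by (intro linear_compose_add kern_linear assms)
  show "continuous_on {0..} (\<lambda>t. \<kappa> t x + \<mu> t x)" for x by (intro continuous_intros kern_continuous assms)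
  fix T
  obtain M M' where M: "M \<ge> 0" "\<forall>t\<in>{0..T}. \<forall>x. norm (\<kappa> t x) \<le> M * norm x" "M' \<ge> 0" "\<forall>t\<in>{0..T}. \<forall>x. norm (\<mu> t x) \<le> M' * norm x"
    using kern_bound[OF assms(1), of T] kern_bound[OF assms(2), of T] by blast
  have "norm (\<kappa> t x + \<mu> t x) \<le> (M + M') * norm x" if "t \<in> {0..T}" for t x
  proof -
    have "norm (\<kappa> t x) \<le> M * norm x" "norm (\<mu> t x) \<le> M' * norm x" using M that by blast+
    then show ?thesis using norm_triangle_ineq[of "\<kappa> t x" "\<mu> t x"] by (simp add: distrib_right)
  qed
  then show "\<exists>M\<ge>0. \<forall>t\<in>{0..T}. \<forall>x. norm (\<kappa> t x + \<mu> t x) \<le> M * norm x"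
    using M(1,3) by (intro exI[of _ "M + M'"]) auto
qed

lemma kern_compose:
  assumes f: "bounded_linear f" and \<kappa>: "kern \<kappa>" and g: "bounded_linear g"
  shows "kern (\<lambda>t x. f (\<kappa> t (g x)))"
  unfolding kern_def
proof (intro conjI allI)
  show "linear (\<lambda>x. f (\<kappa> t (g x)))" for t
    using linear_compose[OF linear_compose[OF bounded_linear.linear[OF g] kern_linear[OF \<kappa>]] bounded_linear.linear[OF f]] by (simp add: o_def)
  show "continuous_on {0..} (\<lambda>t. f (\<kappa> t (g x)))" for x by (intro bounded_linear.continuous_on[OF f] kern_continuous \<kappa>)
  fix T
  obtain M where M: "M \<ge> 0" "\<And>t x. t \<in> {0..T} \<Longrightarrow> norm (\<kappa> t x) \<le> M * norm x" using kern_bound[OF \<kappa>, of T] by blast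
  obtain F where F: "F \<ge> 0" "\<And>x. norm (f x) \<le> F * norm x" using bounded_linear.nonneg_bounded[OF f] by (auto simp: mult.commute)
  obtain G where G: "G \<ge> 0" "\<And>x. norm (g x) \<le> G * norm x" using bounded_linear.nonneg_bounded[OF g] by (auto simp: mult.commute)
  have "norm (f (\<kappa> t (g x))) \<le> (F * (M * G)) * norm x" if "t \<in> {0..T}" for t x
  proof -
    have "norm (f (\<kappa> t (g x))) \<le> F * norm (\<kappa> t (g x))" by (rule F(2))
    also have "\<dots> \<le> F * (M * norm (g x))" by (intro mult_left_mono M that F)
    also have "\<dots> \<le> F * (M * (G * norm x))" by (intro mult_left_mono G M F)
    finally show ?thesis by (simp add: mult_ac)
  qed
  then show "\<exists>M\<ge>0. \<forall>t\<in>{0..T}. \<forall>x. norm (f (\<kappa> t (g x))) \<le> M * norm x"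
    using M(1) F(1) G(1) by (intro exI[of _ "F * (M * G)"]) auto
qed

lemma kern_const: "bounded_linear f \<Longrightarrow> kern (\<lambda>t. f)"
  unfolding kern_def using bounded_linear.nonneg_bounded[of f]
  by (auto simp: bounded_linear.linear mult.commute)

lemma kern_time: "bounded_linear f \<Longrightarrow> kern (\<lambda>t x. t *\<^sub>R f x)"
  unfolding kern_def
proof (intro conjI allI)
  assume f: "bounded_linear f"
  show "linear (\<lambda>x. t *\<^sub>R f x)" for t by (intro linear_compose_scale_right bounded_linear.linear f)
  show "continuous_on {0..} (\<lambda>t. t *\<^sub>R f x)" for x by (intro continuous_intros)
  fix T :: real
  obtain F where F: "F \<ge> 0" "\<And>x. norm (f x) \<le> F * norm x" using bounded_linear.nonneg_bounded[OF f] by (auto simp: mult.commute)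
  have "norm (t *\<^sub>R f x) \<le> (\<bar>T\<bar> * F) * norm x" if "t \<in> {0..T}" for t x
    using mult_mono[of "\<bar>t\<bar>" "\<bar>T\<bar>" "norm (f x)" "F * norm x"] that F by (auto simp: mult_ac)
  then show "\<exists>M\<ge>0. \<forall>t\<in>{0..T}. \<forall>x. norm (t *\<^sub>R f x) \<le> M * norm x"
    using F(1) by (intro exI[of _ "\<bar>T\<bar> * F"]) auto
qed

lemma L1_on_kern:
  assumes \<kappa>: "kern \<kappa>" and p: "L1_on t p"
  shows "L1_on t (\<lambda>s. \<kappa> (t - s) (p s))"
proof -
  obtain M where M: "M \<ge> 0" "\<And>r x. r \<in> {0..t} \<Longrightarrow> norm (\<kappa> r x) \<le> M * norm x" using kern_bound[OF \<kappa>, of t] by blast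
  show ?thesis
  proof (rule L1_on_operator[OF p, where M=M])
    show "norm (\<kappa> (t - s) x - \<kappa> (t - s) y) \<le> M * norm (x - y)" if "s \<in> {0..t}" for s x y
      using M(2)[of "t - s" "x - y"] that by (simp add: kern_diff[OF \<kappa>])
    show "continuous_on {0..t} (\<lambda>s. \<kappa> (t - s) (q s))" if "continuous_on {0..t} q" for q
      by (rule kern_continuous_on_compose[OF \<kappa> _ _ that, of _ t]) (auto intro!: continuous_intros)
  qed
qed

lemma conv_diff:
  assumes "kern \<kappa>" "L1_on t p" "L1_on t q"
  shows "conv \<kappa> (\<lambda>s. p s - q s) t = conv \<kappa> p t - conv \<kappa> q t"
  unfolding conv_def kern_diff[OF assms(1)]
  by (rule Henstock_Kurzweil_Integration.integral_diff)
    (rule L1_on_integrable[OF L1_on_kern[OF assms(1)]], fact)+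

lemma conv_add:
  assumes "kern \<kappa>" "L1_on t p" "L1_on t q"
  shows "conv \<kappa> (\<lambda>s. p s + q s) t = conv \<kappa> p t + conv \<kappa> q t"
  unfolding conv_def linear_add[OF kern_linear[OF assms(1)]]
  by (rule Henstock_Kurzweil_Integration.integral_add)
    (rule L1_on_integrable[OF L1_on_kern[OF assms(1)]], fact)+

lemma conv_scaleR: "kern \<kappa> \<Longrightarrow> conv \<kappa> (\<lambda>s. c *\<^sub>R p s) t = c *\<^sub>R conv \<kappa> p t"
  by (simp add: conv_def linear_scale[OF kern_linear])

lemma conv_kern_add:
  assumes "kern \<kappa>" "kern \<mu>" "L1_on t p"
  shows "conv (\<lambda>t x. \<kappa> t x + \<mu> t x) p t = conv \<kappa> p t + conv \<mu> p t"
  unfolding conv_def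
  by (rule Henstock_Kurzweil_Integration.integral_add)
    (rule L1_on_integrable[OF L1_on_kern[OF _ assms(3)]], fact)+

lemma conv_bounded_linear:
  assumes "bounded_linear f" "kern \<kappa>" "L1_on t p"
  shows "f (conv \<kappa> p t) = conv (\<lambda>t x. f (\<kappa> t x)) p t"
  unfolding conv_def
  using integral_linear[OF L1_on_integrable[OF L1_on_kern[OF assms(2,3)]] assms(1)] by (simp add: o_def)

lemma conv_cong: "(\<And>s. 0 \<le> s \<Longrightarrow> s \<le> t \<Longrightarrow> \<kappa> (t - s) (p s) = \<mu> (t - s) (q s)) \<Longrightarrow> conv \<kappa> p t = conv \<mu> q t"
  unfolding conv_def by (rule integral_cong) auto

lemma norm_conv_le:
  assumes \<kappa>: "kern \<kappa>" and p: "L1_on T p" and t: "t \<in> {0..T}"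
    and M: "\<And>r x. r \<in> {0..T} \<Longrightarrow> norm (\<kappa> r x) \<le> M * norm x" "0 \<le> M"
    and r: "r integrable_on {0..T}" "\<And>s. s \<in> {0..T} \<Longrightarrow> norm (p s) \<le> r s"
  shows "norm (conv \<kappa> p t) \<le> M * integral {0..T} r"
proof -
  have pt: "L1_on t p" by (rule L1_on_subset[OF p]) (use t in simp)
  have rt: "r integrable_on {0..t}" by (rule integrable_on_subinterval[OF r(1)]) (use t in auto)
  have "norm (conv \<kappa> p t) \<le> integral {0..t} (\<lambda>s. M * r s)"
    unfolding conv_def
  proof (rule integral_norm_bound_integral)
    show "norm (\<kappa> (t - s) (p s)) \<le> M * r s" if "s \<in> {0..t}" for s
      using order_trans[OF M(1) mult_left_mono[OF r(2) M(2)], of "t - s" s] that t by auto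
  qed (rule L1_on_integrable[OF L1_on_kern[OF \<kappa> pt]] integrable_on_mult_right[OF rt])+
  also have "\<dots> = M * integral {0..t} r" by simp
  also have "integral {0..t} r \<le> integral {0..T} r"
    by (rule integral_subset_le) (use t rt r order_trans[OF norm_ge_zero r(2)] in auto)
  finally show ?thesis using M(2) by (simp add: mult_left_mono)
qed

lemma conv_approx:
  assumes \<kappa>: "kern \<kappa>" and p: "L1_on T p" and q: "continuous_on {0..T} q" and r: "r integrable_on {0..T}"
    and le: "\<And>s. s \<in> {0..T} \<Longrightarrow> norm (p s - q s) \<le> r s" and t: "t \<in> {0..T}"
    and M: "\<And>r x. r \<in> {0..T} \<Longrightarrow> norm (\<kappa> r x) \<le> M * norm x" "0 \<le> M"
  shows "norm (conv \<kappa> p t - conv \<kappa> q t) \<le> M * integral {0..T} r"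
proof -
  have q': "L1_on T q" using q by (rule L1_on_continuous)
  have "conv \<kappa> p t - conv \<kappa> q t = conv \<kappa> (\<lambda>s. p s - q s) t"
    using t by (subst conv_diff[OF \<kappa>]) (auto intro: L1_on_subset[OF p] L1_on_subset[OF q'])
  then show ?thesis
    using norm_conv_le[OF \<kappa> L1_on_diff[OF p q'] t M r le] by simp
qed

lemma continuous_on_uniform_approx:
  fixes f :: "'a::topological_space \<Rightarrow> 'b::real_normed_vector"
  assumes "\<And>e. e > 0 \<Longrightarrow> \<exists>g. continuous_on S g \<and> (\<forall>t\<in>S. norm (f t - g t) \<le> e)"
  shows "continuous_on S f"
proof -
  have "\<exists>g. continuous_on S g \<and> (\<forall>t\<in>S. norm (f t - g t) \<le> 1 / real (Suc n))" for n by (rule assms) simp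
  then obtain g where g: "\<And>n. continuous_on S (g n)" "\<And>n t. t \<in> S \<Longrightarrow> norm (f t - g n t) \<le> 1 / real (Suc n)" by metis
  have "uniform_limit S g f sequentially"
  proof (rule uniform_limitI)
    fix e :: real assume e: "e > 0"
    have "\<forall>\<^sub>F n in sequentially. 1 / real (Suc n) < e"
      using LIMSEQ_inverse_real_of_nat e unfolding inverse_eq_divide by (rule order_tendstoD(2))
    then show "\<forall>\<^sub>F n in sequentially. \<forall>x\<in>S. dist (g n x) (f x) < e"
      by eventually_elim (auto simp: dist_norm norm_minus_commute intro: le_less_trans[OF g(2)])
  qed
  then show ?thesis by (rule uniform_limit_theorem[rotated]) (use g(1) in auto)
qed

text \<open>The kernel may jump at \<open>0\<close>. Subtracting its initial value gives an integrand that is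
  continuous on the whole square when extended by \<open>0\<close> above the diagonal.\<close>

lemma conv_continuous_integrand:
  assumes \<kappa>: "kern \<kappa>" and q: "continuous_on {0..T} q" and T: "0 \<le> T"
  shows "continuous_on {0..T} (conv \<kappa> q)" (is ?cont)
    and "integral {0..T} (conv \<kappa> q) = conv (\<lambda>t x. integral {0..t} (\<lambda>r. \<kappa> r x)) q T" (is ?fubini)
proof -
  define f where "f t s = \<kappa> (max 0 (t - s)) (q s) - \<kappa> 0 (q s)" for t s
  have k0: "continuous_on A (\<lambda>a. \<kappa> 0 (q (g a)))" if "continuous_on A g" "g ` A \<subseteq> {0..T}" for A :: "'c::metric_space set" and g
    by (rule kern_continuous_on_compose[OF \<kappa>, where T=0]) (auto intro!: continuous_on_compose2[OF q] that)
  have fc: "continuous_on (cbox (0, 0) (T, T)) (\<lambda>(t, s). f t s)"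
  proof -
    have "continuous_on (cbox (0, 0) (T, T)) (\<lambda>z. \<kappa> (max 0 (fst z - snd z)) (q (snd z)))"
      by (rule kern_continuous_on_compose[OF \<kappa>, where T=T])
        (auto intro!: continuous_intros continuous_on_compose2[OF q] simp: cbox_Pair_eq)
    moreover have "continuous_on (cbox (0, 0) (T, T)) (\<lambda>z. \<kappa> 0 (q (snd z)))"
      by (rule k0) (auto intro!: continuous_intros simp: cbox_Pair_eq)
    ultimately show ?thesis unfolding f_def case_prod_unfold by (rule continuous_on_diff)
  qed
  have k0q: "continuous_on {0..T} (\<lambda>s. \<kappa> 0 (q s))" by (rule k0) auto
  have k0i: "(\<lambda>s. \<kappa> 0 (q s)) integrable_on {0..t}" if "t \<le> T" for t
    using that by (intro integrable_continuous_real continuous_on_subset[OF k0q]) auto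
  have fi: "(\<lambda>s. f t s) integrable_on {0..T}" if "t \<in> {0..T}" for t
  proof (rule integrable_continuous_real)
    have "continuous_on {0..T} (\<lambda>s. case (t, s) of (t, s) \<Rightarrow> f t s)"
      by (rule continuous_on_compose2[OF fc]) (use that in \<open>auto intro!: continuous_intros simp: cbox_Pair_eq\<close>)
    then show "continuous_on {0..T} (\<lambda>s. f t s)" by simp
  qed
  have split: "conv \<kappa> q t = integral {0..T} (f t) + integral {0..t} (\<lambda>s. \<kappa> 0 (q s))" if t: "t \<in> {0..T}" for t
  proof -
    have ft: "f t integrable_on {0..t}" using t by (auto intro: integrable_on_subinterval[OF fi[OF t]])
    have "integral {0..T} (f t) = integral {0..t} (f t) + integral {t..T} (f t)"
      using t by (intro Henstock_Kurzweil_Integration.integral_combine[symmetric] fi) auto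
    moreover have "integral {t..T} (f t) = integral {t..T} (\<lambda>s. 0)"
      by (rule integral_cong) (auto simp: f_def)
    moreover have "conv \<kappa> q t = integral {0..t} (\<lambda>s. f t s + \<kappa> 0 (q s))"
      unfolding conv_def by (rule integral_cong) (auto simp: f_def)
    moreover have "\<dots> = integral {0..t} (f t) + integral {0..t} (\<lambda>s. \<kappa> 0 (q s))"
      by (intro Henstock_Kurzweil_Integration.integral_add ft k0i) (use t in auto)
    ultimately show ?thesis by simp
  qed
  have c1: "continuous_on {0..T} (\<lambda>t. integral {0..T} (f t))"
  proof -
    have "continuous_on ({0..T} \<times> cbox 0 T) (\<lambda>(t, s). f t s)" using fc by (simp add: cbox_Pair_eq)
    from integral_continuous_on_param[OF this] show ?thesis by simp
  qed
  have c2: "continuous_on {0..T} (\<lambda>t. integral {0..t} (\<lambda>s. \<kappa> 0 (q s)))"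
    by (rule indefinite_integral_continuous_1) (rule k0i, simp)
  show ?cont
    by (rule continuous_on_eq[OF continuous_on_add[OF c1 c2]]) (simp add: split)
  have "integral {0..T} (conv \<kappa> q) = integral {0..T} (\<lambda>t. integral {0..T} (f t) + integral {0..t} (\<lambda>s. \<kappa> 0 (q s)))"
    by (rule integral_cong) (simp add: split)
  also have "\<dots> = integral {0..T} (\<lambda>t. integral {0..T} (f t)) + integral {0..T} (\<lambda>t. integral {0..t} (\<lambda>s. \<kappa> 0 (q s)))"
    by (intro Henstock_Kurzweil_Integration.integral_add integrable_continuous_real c1 c2)
  also have "integral {0..T} (\<lambda>t. integral {0..T} (f t)) = integral {0..T} (\<lambda>s. integral {0..T} (\<lambda>t. f t s))"
    using integral_swap_continuous[OF fc] by simp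
  also have "integral {0..T} (\<lambda>t. integral {0..t} (\<lambda>s. \<kappa> 0 (q s))) = integral {0..T} (\<lambda>s. (T - s) *\<^sub>R \<kappa> 0 (q s))"
  proof -
    let ?P = "\<lambda>t. integral {0..t} (\<lambda>s. \<kappa> 0 (q s))"
    \<comment> \<open>Integration by parts: the factor t - T vanishes at T and the primitive
      \<open>?P\<close> at 0, so no boundary terms remain.\<close>
    have "((\<lambda>t. (t - T) *\<^sub>R ?P t) has_vector_derivative ((t - T) *\<^sub>R \<kappa> 0 (q t) + 1 *\<^sub>R ?P t)) (at t within {0..T})"
      if "t \<in> {0..T}" for t
      by (rule bounded_bilinear.has_vector_derivative[OF bounded_bilinear_scaleR])
        (auto intro!: derivative_eq_intros integral_has_vector_derivative k0q that)
    then have "((\<lambda>t. (t - T) *\<^sub>R \<kappa> 0 (q t) + 1 *\<^sub>R ?P t) has_integral (T - T) *\<^sub>R ?P T - (0 - T) *\<^sub>R ?P 0) {0..T}"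
      by (rule fundamental_theorem_of_calculus[OF T])
    then have "((\<lambda>t. (t - T) *\<^sub>R \<kappa> 0 (q t) + ?P t) has_integral 0) {0..T}" by simp
    moreover have "((\<lambda>s. (T - s) *\<^sub>R \<kappa> 0 (q s)) has_integral integral {0..T} (\<lambda>s. (T - s) *\<^sub>R \<kappa> 0 (q s))) {0..T}"
      by (intro integrable_integral integrable_continuous_real continuous_intros k0q)
    ultimately have "((\<lambda>t. ((t - T) *\<^sub>R \<kappa> 0 (q t) + ?P t) + (T - t) *\<^sub>R \<kappa> 0 (q t)) has_integral 0 + integral {0..T} (\<lambda>s. (T - s) *\<^sub>R \<kappa> 0 (q s))) {0..T}"
      by (rule has_integral_add)
    moreover have "((t - T) *\<^sub>R \<kappa> 0 (q t) + ?P t) + (T - t) *\<^sub>R \<kappa> 0 (q t) = ?P t" for t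
      by (simp add: scaleR_diff_left)
    ultimately show ?thesis by (simp add: integral_unique)
  qed
  also have "integral {0..T} (\<lambda>s. integral {0..T} (\<lambda>t. f t s)) + integral {0..T} (\<lambda>s. (T - s) *\<^sub>R \<kappa> 0 (q s))
     = integral {0..T} (\<lambda>s. integral {0..T} (\<lambda>t. f t s) + (T - s) *\<^sub>R \<kappa> 0 (q s))"
  proof (rule Henstock_Kurzweil_Integration.integral_add[symmetric])
    have "continuous_on ({0..T} \<times> cbox 0 T) (\<lambda>z. case (snd z, fst z) of (t, s) \<Rightarrow> f t s)"
      by (rule continuous_on_compose2[OF fc]) (auto intro!: continuous_intros simp: cbox_Pair_eq)
    then have "continuous_on ({0..T} \<times> cbox 0 T) (\<lambda>(s, t). f t s)" by (simp add: case_prod_unfold)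
    from integral_continuous_on_param[OF this]
    show "(\<lambda>s. integral {0..T} (\<lambda>t. f t s)) integrable_on {0..T}" by (intro integrable_continuous_real) simp
    show "(\<lambda>s. (T - s) *\<^sub>R \<kappa> 0 (q s)) integrable_on {0..T}"
      by (intro integrable_continuous_real continuous_intros k0q)
  qed
  also have "\<dots> = conv (\<lambda>t x. integral {0..t} (\<lambda>r. \<kappa> r x)) q T"
    unfolding conv_def
  proof (rule integral_cong)
    fix s assume s: "s \<in> {0..T}"
    have ki: "(\<lambda>r. \<kappa> r (q s)) integrable_on {0..T - s}"
      by (intro integrable_continuous_real continuous_on_subset[OF kern_continuous[OF \<kappa>]]) auto
    \<comment> \<open>As a function of t, \<open>f t s\<close> is this integrand delayed by
      s.\<close>
    have "((\<lambda>r. \<kappa> r (q s) - \<kappa> 0 (q s)) has_integral integral {0..T - s} (\<lambda>r. \<kappa> r (q s)) - (T - s) *\<^sub>R \<kappa> 0 (q s)) {0..T - s}"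
      using has_integral_diff[OF integrable_integral[OF ki] has_integral_const_real[of "\<kappa> 0 (q s)" 0 "T - s"]] s by simp
    from has_integral_delay[OF this, of ] s
    have "((\<lambda>t. if t < s then 0 else \<kappa> (t - s) (q s) - \<kappa> 0 (q s)) has_integral integral {0..T - s} (\<lambda>r. \<kappa> r (q s)) - (T - s) *\<^sub>R \<kappa> 0 (q s)) {0..T}"
      by auto
    moreover have "(if t < s then 0 else \<kappa> (t - s) (q s) - \<kappa> 0 (q s)) = f t s" for t by (auto simp: f_def)
    ultimately have "integral {0..T} (\<lambda>t. f t s) = integral {0..T - s} (\<lambda>r. \<kappa> r (q s)) - (T - s) *\<^sub>R \<kappa> 0 (q s)"
      by (simp add: integral_unique)
    then show "integral {0..T} (\<lambda>t. f t s) + (T - s) *\<^sub>R \<kappa> 0 (q s) = integral {0..T - s} (\<lambda>r. \<kappa> r (q s))" by simp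
  qed
  finally show ?fubini .
qed

text \<open>A uniform limit of convolutions with continuous inputs: local boundedness of the kernel
  turns closeness of the inputs in L1 into uniform closeness.\<close>

lemma conv_continuous:
  assumes \<kappa>: "kern \<kappa>" and p: "L1_on T p"
  shows "continuous_on {0..T} (conv \<kappa> p)"
proof (cases "0 \<le> T")
  case True
  obtain M where M: "M \<ge> 0" "\<And>t x. t \<in> {0..T} \<Longrightarrow> norm (\<kappa> t x) \<le> M * norm x" using kern_bound[OF \<kappa>, of T] by blast
  show ?thesis
  proof (rule continuous_on_uniform_approx)
    fix e :: real assume e: "e > 0"
    have "e / (M + 1) > 0" using e M by simp
    then obtain q r where q: "continuous_on {0..T} q" and r: "r integrable_on {0..T}"
      and le: "\<And>s. s \<in> {0..T} \<Longrightarrow> norm (p s - q s) \<le> r s" and small: "integral {0..T} r \<le> e / (M + 1)"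
      using L1_onE[OF p] by blast
    have "M * integral {0..T} r \<le> M * (e / (M + 1))" using M small by (intro mult_left_mono) auto
    also have "\<dots> \<le> e" using M e by (simp add: field_simps)
    finally have "norm (conv \<kappa> p t - conv \<kappa> q t) \<le> e" if "t \<in> {0..T}" for t
      using conv_approx[OF \<kappa> p q r le that M(2,1)] by simp
    then show "\<exists>g. continuous_on {0..T} g \<and> (\<forall>t\<in>{0..T}. norm (conv \<kappa> p t - g t) \<le> e)"
      using conv_continuous_integrand(1)[OF \<kappa> q True] by blast
  qed
qed auto

text \<open>Fubini on the triangle. Continuous inputs are \<open>conv_continuous_integrand\<close>;
  both sides depend continuously on the input in L1, which covers the rest.\<close>

lemma integral_conv:
  assumes \<kappa>: "kern \<kappa>" and p: "L1_on T p" and T: "0 \<le> T"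
  shows "integral {0..T} (conv \<kappa> p) = conv (\<lambda>t x. integral {0..t} (\<lambda>r. \<kappa> r x)) p T"
proof -
  let ?\<mu> = "\<lambda>t x. integral {0..t} (\<lambda>r. \<kappa> r x)"
  have \<mu>: "kern ?\<mu>" by (rule kern_primitive[OF \<kappa>])
  obtain M where M: "M \<ge> 0" "\<And>t x. t \<in> {0..T} \<Longrightarrow> norm (\<kappa> t x) \<le> M * norm x" using kern_bound[OF \<kappa>, of T] by blast
  obtain L where L: "L \<ge> 0" "\<And>t x. t \<in> {0..T} \<Longrightarrow> norm (?\<mu> t x) \<le> L * norm x" using kern_bound[OF \<mu>, of T] by blast
  have "norm (integral {0..T} (conv \<kappa> p) - conv ?\<mu> p T) \<le> (M * T + L) * e" if e: "e > 0" for e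
  proof -
    obtain q r where q: "continuous_on {0..T} q" and r: "r integrable_on {0..T}"
      and le: "\<And>s. s \<in> {0..T} \<Longrightarrow> norm (p s - q s) \<le> r s" and small: "integral {0..T} r \<le> e"
      using L1_onE[OF p e] by blast
    have "norm (integral {0..T} (conv \<kappa> p) - integral {0..T} (conv \<kappa> q)) = norm (integral {0..T} (\<lambda>t. conv \<kappa> p t - conv \<kappa> q t))"
      by (subst Henstock_Kurzweil_Integration.integral_diff)
        (auto intro: integrable_continuous_real conv_continuous \<kappa> p L1_on_continuous q)
    also have "\<dots> \<le> (M * e) * (T - 0)"
    proof (rule integral_bound[OF T])
      show "continuous_on {0..T} (\<lambda>t. conv \<kappa> p t - conv \<kappa> q t)"
        by (intro continuous_intros conv_continuous \<kappa> p L1_on_continuous q)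
      show "norm (conv \<kappa> p t - conv \<kappa> q t) \<le> M * e" if "t \<in> {0..T}" for t
        using conv_approx[OF \<kappa> p q r le that M(2,1)] mult_left_mono[OF small M(1)] by simp
    qed
    finally have 1: "norm (integral {0..T} (conv \<kappa> p) - integral {0..T} (conv \<kappa> q)) \<le> M * T * e" by (simp add: mult_ac)
    have 2: "norm (conv ?\<mu> p T - conv ?\<mu> q T) \<le> L * e"
      using conv_approx[OF \<mu> p q r le _ L(2,1), of T] mult_left_mono[OF small L(1)] T by simp
    have "integral {0..T} (conv \<kappa> p) - conv ?\<mu> p T = (integral {0..T} (conv \<kappa> p) - integral {0..T} (conv \<kappa> q)) - (conv ?\<mu> p T - conv ?\<mu> q T)"
      using conv_continuous_integrand(2)[OF \<kappa> q T] by simp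
    then have "norm (integral {0..T} (conv \<kappa> p) - conv ?\<mu> p T) \<le> norm (integral {0..T} (conv \<kappa> p) - integral {0..T} (conv \<kappa> q)) + norm (conv ?\<mu> p T - conv ?\<mu> q T)"
      using norm_triangle_ineq4 by metis
    then show ?thesis using 1 2 by (simp add: distrib_right)
  qed
  then have bd: "norm (integral {0..T} (conv \<kappa> p) - conv ?\<mu> p T) \<le> (M * T + L) * e" if "e > 0" for e using that .
  have "norm (integral {0..T} (conv \<kappa> p) - conv ?\<mu> p T) \<le> 0"
  proof (rule field_le_epsilon)
    fix e :: real assume e: "e > 0"
    have "M * T + L + 1 > 0" using M L T by (simp add: add_nonneg_pos)
    then have "(M * T + L) * (e / (M * T + L + 1)) \<le> e" using e by (simp add: field_simps)
    then show "norm (integral {0..T} (conv \<kappa> p) - conv ?\<mu> p T) \<le> 0 + e"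
      using bd[of "e / (M * T + L + 1)"] e \<open>M * T + L + 1 > 0\<close> by simp
  qed
  then show ?thesis by simp
qed

text \<open>The operator \<open>R\<close> of the overview, by Cauchy's formula for iterated
  integrals. Written as a convolution, it inherits the rules for linearity, delays and
  continuity.\<close>

definition ramp :: "(real \<Rightarrow> 'a::banach) \<Rightarrow> real \<Rightarrow> 'a" where
  "ramp p = conv (\<lambda>t x. t *\<^sub>R x) p"

lemma ramp_eq: "ramp p t = integral {0..t} (\<lambda>s. (t - s) *\<^sub>R p s)"
  by (simp add: ramp_def conv_def)

lemma kern_id: "kern (\<lambda>t x. x)" and kern_ramp: "kern (\<lambda>t x. t *\<^sub>R x)"
  using kern_const[OF bounded_linear_ident] kern_time[OF bounded_linear_ident] by simp_all

text \<open>The kernel t is the primitive of the constant kernel 1, so this is an instance of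
  \<open>integral_conv\<close>.\<close>

lemma ramp_double_integral:
  assumes p: "L1_on t p" and t: "0 \<le> t"
  shows "ramp p t = integral {0..t} (\<lambda>s. integral {0..s} p)"
proof -
  have "integral {0..t} (conv (\<lambda>t x. x) p) = conv (\<lambda>t x. integral {0..t} (\<lambda>r. x)) p t"
    by (rule integral_conv[OF kern_id p t])
  also have "\<dots> = ramp p t" unfolding ramp_def by (rule conv_cong) simp
  finally show ?thesis by (simp add: conv_def[of "\<lambda>t x. x", abs_def])
qed

text \<open>Two applications of \<open>integral_conv\<close> move both integrations from the
  convolution onto the kernel.\<close>

lemma ramp_conv:
  assumes \<kappa>: "kern \<kappa>" and p: "L1_on t p" and t: "0 \<le> t"
  shows "ramp (conv \<kappa> p) t = conv (\<lambda>t x. integral {0..t} (\<lambda>s. integral {0..s} (\<lambda>r. \<kappa> r x))) p t"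
proof -
  have "ramp (conv \<kappa> p) t = integral {0..t} (\<lambda>s. integral {0..s} (conv \<kappa> p))"
    by (rule ramp_double_integral[OF L1_on_continuous[OF conv_continuous[OF \<kappa> p]] t])
  also have "\<dots> = integral {0..t} (conv (\<lambda>t x. integral {0..t} (\<lambda>r. \<kappa> r x)) p)"
    by (rule integral_cong) (auto intro!: integral_conv[OF \<kappa>] L1_on_subset[OF p])
  also have "\<dots> = conv (\<lambda>t x. integral {0..t} (\<lambda>s. integral {0..s} (\<lambda>r. \<kappa> r x))) p t"
    by (rule integral_conv[OF kern_primitive[OF \<kappa>] p t])
  finally show ?thesis .
qed

section \<open>The input-output kernel of a system node\<close>

text \<open>The witness functions in \<open>generalised_solution\<close> are specified on the
  half-line only, so outputs have to be compared there.\<close>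

lemma Bochner_integral_cong:
  fixes f g :: "'s \<Rightarrow> 'a::cbanach"
  assumes eq: "\<And>x. x \<in> space M \<Longrightarrow> f x = g x"
  shows "Bochner_integral M f = Bochner_integral M g"
proof -
  have sm: "strongly_measurable M f = strongly_measurable M g"
    unfolding strongly_measurable_def
    by (intro ex_cong1 conj_cong refl AE_cong) (simp add: eq)
  have "(\<integral>\<^sup>+x. ennreal (norm (f x - s i x)) \<partial>M) = (\<integral>\<^sup>+x. ennreal (norm (g x - s i x)) \<partial>M)" for s :: "nat \<Rightarrow> 's \<Rightarrow> 'a" and i
    by (rule nn_integral_cong) (simp add: eq)
  then have "has_Bochner_integral M f = has_Bochner_integral M g"
    unfolding has_Bochner_integral_def fun_eq_iff sm by simp
  then show ?thesis by (simp add: Bochner_integral_def)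
qed

lemma Bochner_integral_eq_conv:
  fixes p :: "real \<Rightarrow> 'a::cbanach" and \<kappa> :: "real \<Rightarrow> 'a \<Rightarrow> 'b::cbanach"
  assumes "kern \<kappa>" "L1_on t p" "0 \<le> t"
  shows "Bochner_integral (lebesgue_on {0..t}) (\<lambda>s. \<kappa> (t - s) (p s)) = conv \<kappa> p t"
  unfolding conv_def by (rule Bochner_integral_interval[OF L1_on_kern[OF assms(1,2)] assms(3)])

lemma L1_on_cblinfun: "L1_on T v \<Longrightarrow> L1_on T (\<lambda>s. cblinfun_apply E (v s))"
  by (rule L1_on_bounded_linear[OF bounded_linear_cblinfun_apply])

lemma scaleC_minus_one: "(-1) *\<^sub>C (x::'a::cbanach) = - x"
  using scaleR_scaleC[of "-1" x] by simp

lemmas scaleC_diff_right = bounded_bilinear.diff_right[OF bounded_bilinear_scaleC]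
  and scaleC_diff_left = bounded_bilinear.diff_left[OF bounded_bilinear_scaleC]
  and scaleC_minus_right = bounded_bilinear.minus_right[OF bounded_bilinear_scaleC]
  and scaleC_minus_left = bounded_bilinear.minus_left[OF bounded_bilinear_scaleC]
  and scaleC_scaleR_right = bounded_bilinear.scaleR_right[OF bounded_bilinear_scaleC]

lemmas scaleC_simps = scaleC_add_right scaleC_add_left scaleC_diff_right scaleC_diff_left scaleC_minus_right
  scaleC_minus_left scaleC_scaleR_right scaleC_scaleC scaleC_one

lemma (in c0_semigroup) kern_T: "kern (\<lambda>t x. cblinfun_apply (T t) x)"
  unfolding kern_def
proof (intro conjI allI)
  show "linear (\<lambda>x. cblinfun_apply (T t) x)" for t by (rule bounded_linear.linear[OF bounded_linear_cblinfun_apply])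
  show "continuous_on {0..} (\<lambda>t. cblinfun_apply (T t) x)" for x by (rule T_continuous)
  fix \<tau>
  obtain M where M: "M \<ge> 0" "\<And>t. t \<in> {0..\<tau>} \<Longrightarrow> norm (T t) \<le> M" using T_locally_bounded by blast
  then have "norm (cblinfun_apply (T t) x) \<le> M * norm x" if "t \<in> {0..\<tau>}" for t x
    using order_trans[OF norm_cblinfun_apply mult_right_mono[OF M(2)[OF that]]] by simp
  then show "\<exists>M\<ge>0. \<forall>t\<in>{0..\<tau>}. \<forall>x. norm (cblinfun_apply (T t) x) \<le> M * norm x" using M(1) by blast
qed

context c0_semigroup begin

definition sg2 :: "real \<Rightarrow> 'x \<Rightarrow> 'x" where
  "sg2 t x = integral {0..t} (\<lambda>s. sg1 s x)"

lemma kern_sg1: "kern sg1" and kern_sg2: "kern sg2"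
proof -
  show 1: "kern sg1" using kern_primitive[OF kern_T] by (simp add: sg1_def[abs_def])
  show "kern sg2" using kern_primitive[OF 1] by (simp add: sg2_def[abs_def])
qed

lemma ramp_conv_T: "L1_on t p \<Longrightarrow> 0 \<le> t \<Longrightarrow> ramp (conv (\<lambda>t. cblinfun_apply (T t)) p) t = conv sg2 p t"
  using ramp_conv[OF kern_T, of t p] by (simp add: sg2_def[abs_def] sg1_def[abs_def])

text \<open>Formally \<open>kz \<beta> t = (\<beta> - A) sg2 t\<close> and \<open>kq \<beta> t = (\<beta> - A) (kz \<beta> t - t)\<close>, expanded by
  \<open>A sg1 t = T t - 1\<close> and \<open>A sg2 t = sg1 t - t\<close>.\<close>

definition kz :: "complex \<Rightarrow> real \<Rightarrow> 'x \<Rightarrow> 'x" where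
  "kz \<beta> t y = \<beta> *\<^sub>C sg2 t y + (-1) *\<^sub>C sg1 t y + t *\<^sub>R y"

definition kq :: "complex \<Rightarrow> real \<Rightarrow> 'x \<Rightarrow> 'x" where
  "kq \<beta> t y = cblinfun_apply (T t) y + (-1) *\<^sub>C y + (-2 * \<beta>) *\<^sub>C sg1 t y + t *\<^sub>R (\<beta> *\<^sub>C y) + (\<beta> * \<beta>) *\<^sub>C sg2 t y"

lemma kern_scaleC: "kern \<kappa> \<Longrightarrow> kern (\<lambda>t x. c *\<^sub>C \<kappa> t x)"
  using kern_compose[OF bounded_linear_scaleC _ bounded_linear_ident] by blast

lemma kern_kz: "kern (kz \<beta>)" and kern_kq: "kern (kq \<beta>)"
  unfolding kz_def[abs_def] kq_def[abs_def]
  by (intro kern_add kern_scaleC kern_sg1 kern_sg2 kern_ramp kern_T kern_const kern_time bounded_linear_scaleC)+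

end

context node begin

lemma res_sg1:
  assumes \<beta>: "\<beta> \<in> resolvent_set \<A>" and t: "0 \<le> t"
  shows "cblinfun_apply (res \<beta>) (\<beta> *\<^sub>C c0.sg1 t y + (-1) *\<^sub>C \<T> t y + y) = c0.sg1 t y"
  using resolvent_cancel[OF \<beta> c0.sg1_generator[OF t, of y, unfolded gen]]
  by (simp add: scaleC_minus_one algebra_simps)

text \<open>Obtained by integrating \<open>res_sg1\<close> in time. This and \<open>res_kq\<close>
  make the formal formulas for the kernels rigorous: resolvents are injective, so \<open>kz\<close>
  and \<open>kq\<close> are identified without applying A.\<close>

lemma res_kz:
  assumes \<beta>: "\<beta> \<in> resolvent_set \<A>" and t: "0 \<le> t"
  shows "cblinfun_apply (res \<beta>) (c0.kz \<beta> t y) = c0.sg2 t y"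
proof -
  have i: "(\<lambda>s. c0.sg1 s y) integrable_on {0..t}" "(\<lambda>s. cblinfun_apply (\<T> s) y) integrable_on {0..t}"
    by (intro integrable_continuous_real continuous_on_subset[OF kern_continuous[OF c0.kern_sg1]]
        continuous_on_subset[OF kern_continuous[OF c0.kern_T]]; auto)+
  have "((\<lambda>s. \<beta> *\<^sub>C c0.sg1 s y) has_integral \<beta> *\<^sub>C c0.sg2 t y) {0..t}"
    unfolding c0.sg2_def using has_integral_linear[OF integrable_integral[OF i(1)] bounded_linear_scaleC[of \<beta>]] by (simp add: o_def)
  moreover have "((\<lambda>s. (-1) *\<^sub>C cblinfun_apply (\<T> s) y) has_integral (-1) *\<^sub>C c0.sg1 t y) {0..t}"
    unfolding c0.sg1_def using has_integral_linear[OF integrable_integral[OF i(2)] bounded_linear_scaleC[of "-1"]] by (simp add: o_def)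
  moreover have "((\<lambda>s. y) has_integral t *\<^sub>R y) {0..t}" using has_integral_const_real[of y 0 t] t by simp
  ultimately have "((\<lambda>s. \<beta> *\<^sub>C c0.sg1 s y + (-1) *\<^sub>C cblinfun_apply (\<T> s) y + y) has_integral c0.kz \<beta> t y) {0..t}"
    unfolding c0.kz_def by (intro has_integral_add)
  from has_integral_linear[OF this bounded_linear_cblinfun_apply[of "res \<beta>"]]
  have "integral {0..t} (\<lambda>s. cblinfun_apply (res \<beta>) (\<beta> *\<^sub>C c0.sg1 s y + (-1) *\<^sub>C cblinfun_apply (\<T> s) y + y)) = cblinfun_apply (res \<beta>) (c0.kz \<beta> t y)"
    by (simp add: o_def integral_unique)
  moreover have "integral {0..t} (\<lambda>s. cblinfun_apply (res \<beta>) (\<beta> *\<^sub>C c0.sg1 s y + (-1) *\<^sub>C cblinfun_apply (\<T> s) y + y)) = c0.sg2 t y"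
    unfolding c0.sg2_def by (rule integral_cong) (simp add: res_sg1[OF \<beta>])
  ultimately show ?thesis by simp
qed

lemma res_kq:
  assumes \<beta>: "\<beta> \<in> resolvent_set \<A>" and t: "0 \<le> t"
  shows "cblinfun_apply (res \<beta>) (c0.kq \<beta> t y) = c0.kz \<beta> t y - t *\<^sub>R y"
proof -
  have "c0.kq \<beta> t y = \<beta> *\<^sub>C c0.kz \<beta> t y - (\<beta> *\<^sub>C c0.sg1 t y + (-1) *\<^sub>C \<T> t y + y)"
  proof -
    have "(2 * \<beta>) *\<^sub>C v = \<beta> *\<^sub>C v + \<beta> *\<^sub>C v" for v :: 'x by (simp only: mult_2 scaleC_add_left)
    then show ?thesis by (simp add: c0.kq_def c0.kz_def scaleC_simps)
  qed
  then have "cblinfun_apply (res \<beta>) (c0.kq \<beta> t y) = \<beta> *\<^sub>C c0.sg2 t y - c0.sg1 t y"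
    by (simp only: cblinfun_diff_right cblinfun_apply_scaleC res_kz[OF \<beta> t] res_sg1[OF \<beta> t])
  then show ?thesis by (simp add: c0.kz_def scaleC_minus_one)
qed

lemma semigroup_ext_bound: "0 \<le> t \<Longrightarrow> norm (cblinfun_apply (semigroup_ext N t) y) \<le> norm (\<T> t) * norm y"
  by (rule cblinfun_bound_on_dense[OF embm_dense])
    (simp add: semigroup_ext embm_norm res_T[OF base] norm_cblinfun_apply)

text \<open>On the dense image of X, continuity is inherited from the semigroup on X; the local
  bound makes the approximation uniform on compact time intervals.\<close>

lemma kern_semigroup_ext: "kern (\<lambda>t y. cblinfun_apply (semigroup_ext N t) y)"
  unfolding kern_def
proof (intro conjI allI)
  show "linear (\<lambda>x. cblinfun_apply (semigroup_ext N t) x)" for t by (rule bounded_linear.linear[OF bounded_linear_cblinfun_apply])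
  have bd: "\<exists>M\<ge>0. \<forall>t\<in>{0..\<tau>}. \<forall>x. norm (cblinfun_apply (semigroup_ext N t) x) \<le> M * norm x" for \<tau>
  proof -
    obtain M where M: "M \<ge> 0" "\<And>t. t \<in> {0..\<tau>} \<Longrightarrow> norm (\<T> t) \<le> M" using c0.T_locally_bounded by blast
    then have "norm (cblinfun_apply (semigroup_ext N t) x) \<le> M * norm x" if "t \<in> {0..\<tau>}" for t x
      using order_trans[OF semigroup_ext_bound mult_right_mono[OF M(2)[OF that]]] that by simp
    then show ?thesis using M(1) by blast
  qed
  then show "\<exists>M\<ge>0. \<forall>t\<in>{0..\<tau>}. \<forall>x. norm (cblinfun_apply (semigroup_ext N t) x) \<le> M * norm x" for \<tau> .
  show "continuous_on {0..} (\<lambda>t. cblinfun_apply (semigroup_ext N t) y)" for y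
  proof -
    have "continuous_on {0..\<tau>} (\<lambda>t. cblinfun_apply (semigroup_ext N t) y)" for \<tau>
    proof (rule continuous_on_uniform_approx)
      fix e :: real assume e: "e > 0"
      obtain M where M: "M \<ge> 0" "\<And>t x. t \<in> {0..\<tau>} \<Longrightarrow> norm (cblinfun_apply (semigroup_ext N t) x) \<le> M * norm x"
        using bd[of \<tau>] by blast
      have "y \<in> closure (range (cblinfun_apply (embm N)))" using embm_dense by simp
      moreover have e': "e / (M + 1) > 0" using e M by simp
      ultimately obtain x where x: "dist (cblinfun_apply (embm N) x) y < e / (M + 1)"
        unfolding closure_approachable by blast
      have "continuous_on {0..\<tau>} (\<lambda>t. cblinfun_apply (embm N) (\<T> t x))"
        by (intro bounded_linear.continuous_on[OF bounded_linear_cblinfun_apply] continuous_on_subset[OF c0.T_continuous]) auto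
      moreover have "norm (cblinfun_apply (semigroup_ext N t) y - embm N (\<T> t x)) \<le> e" if t: "t \<in> {0..\<tau>}" for t
      proof -
        have "cblinfun_apply (semigroup_ext N t) y - embm N (\<T> t x) = semigroup_ext N t (y - embm N x)"
          using t by (simp add: cblinfun_simps semigroup_ext)
        then have "norm (cblinfun_apply (semigroup_ext N t) y - embm N (\<T> t x)) \<le> M * norm (y - embm N x)"
          using M(2)[OF t] by simp
        also have "\<dots> \<le> M * (e / (M + 1))" using x M by (intro mult_left_mono) (auto simp: dist_norm norm_minus_commute)
        also have "\<dots> \<le> e" using M e by (simp add: field_simps)
        finally show ?thesis .
      qed
      ultimately show "\<exists>g. continuous_on {0..\<tau>} g \<and> (\<forall>t\<in>{0..\<tau>}. norm (cblinfun_apply (semigroup_ext N t) y - g t) \<le> e)"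
        by blast
    qed
    note c = this
    show ?thesis
      unfolding continuous_on_eq_continuous_within
    proof
      fix t :: real assume t: "t \<in> {0..}"
      have "continuous (at t within {0..t + 1}) (\<lambda>t. cblinfun_apply (semigroup_ext N t) y)"
        using c[of "t + 1"] t by (simp add: continuous_on_eq_continuous_within)
      moreover have "at t within {0..t + 1} = at t within {0..}"
        by (rule at_within_nhd[of t "{..<t + 1}"]) auto
      ultimately show "continuous (at t within {0..}) (\<lambda>t. cblinfun_apply (semigroup_ext N t) y)"
        by (simp add: continuous_within)
    qed
  qed
qed

text \<open>B followed by a resolvent, and C preceded by one, are bounded operators from U to X and
  from X to Y. The two resolvents inserted here are compensated by the two factors \<beta> - A in
  \<open>kq\<close>.\<close>

definition Bres :: "complex \<Rightarrow> 'u \<Rightarrow>\<^sub>C\<^sub>L 'x" where "Bres \<beta> = ccomp (resolvent_ext N \<beta>) (B_op N)"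
definition Cres :: "complex \<Rightarrow> 'x \<Rightarrow>\<^sub>C\<^sub>L 'y" where "Cres \<beta> = ccomp (C_op N) (res1 \<beta>)"

text \<open>\<open>io_kernel \<beta> t u\<close> is the value at time \<open>t\<close> of \<open>C&D\<close> applied to the second integral of the
  state--input pair produced by the impulse \<open>\<delta>\<^sub>0 u\<close>; it does not depend on \<open>\<beta>\<close>.\<close>

definition io_kernel :: "complex \<Rightarrow> real \<Rightarrow> 'u \<Rightarrow> 'y" where
  "io_kernel \<beta> t u = cblinfun_apply (Cres \<beta>) (c0.kq \<beta> t (Bres \<beta> u)) + t *\<^sub>R cblinfun_apply (G_tf N \<beta>) u"

lemma kern_io_kernel: "kern (io_kernel \<beta>)"
  unfolding io_kernel_def[abs_def]
  by (intro kern_add kern_compose[OF _ c0.kern_kq] kern_time bounded_linear_cblinfun_apply)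

lemma io_kernel_0: "io_kernel \<beta> 0 u = 0"
  by (simp add: io_kernel_def c0.kq_def c0.sg1_def c0.sg2_def scaleC_minus_one scaleC_diff_right[of _ 0 0, simplified] cblinfun_simps)

text \<open>\<open>CD\<close> fixes some point of the half plane by choice. Passing to another one
  changes the argument of C by \<open>E\<close> applied to B u and the feedthrough term by C of the
  same vector, and these changes cancel.\<close>

lemma CD_eq:
  assumes \<beta>: "\<beta> \<in> \<H>" and q: "x - resolvent_ext N \<beta> (B_op N u) = res \<beta> q"
  shows "CD N (x, u) = cblinfun_apply (Cres \<beta>) q + cblinfun_apply (G_tf N \<beta>) u"
proof -
  define \<alpha> where "\<alpha> = (SOME \<beta>. \<beta> \<in> \<H>)"
  have \<alpha>: "\<alpha> \<in> \<H>" using half_plane_nonempty unfolding \<alpha>_def by (simp add: some_in_eq)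
  note r = half_plane_resolvent[OF \<beta>] half_plane_resolvent[OF \<alpha>]
  obtain E where E: "\<And>y. cblinfun_apply (emb1 N) (cblinfun_apply E y) = cblinfun_apply (resolvent_ext N \<beta>) y - resolvent_ext N \<alpha> y"
    using res1_diff_ext[OF r] by blast
  have G: "cblinfun_apply (G_tf N \<beta>) u - cblinfun_apply (G_tf N \<alpha>) u = C_op N (E (B_op N u))"
    using G_eq[OF \<beta> \<alpha>, of u] by (simp add: E[symmetric] inv_f_f[OF emb1_inj])
  have "x - resolvent_ext N \<alpha> (B_op N u) = emb1 N (cblinfun_apply (res1 \<beta>) q + E (B_op N u))"
    using q by (simp add: cblinfun_simps E emb1_res1[OF r(1)] diff_eq_eq)
  then have "inv (cblinfun_apply (emb1 N)) (x - resolvent_ext N \<alpha> (B_op N u)) = cblinfun_apply (res1 \<beta>) q + E (B_op N u)"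
    by (simp add: inv_f_f[OF emb1_inj])
  then show ?thesis using G unfolding CD_def \<alpha>_def[symmetric]
    by (simp add: Let_def cblinfun_simps Cres_def ccomp_apply algebra_simps)
qed

text \<open>A priori the integrated state lies in X_{-1} only. A vector \<open>z\<close> of X is
  given explicitly by the kernel \<open>kz\<close>, and the equation is checked after applying the
  extended resolvent, which is injective. The vector \<open>q\<close> then gives both membership in
  \<open>CD_dom\<close> and the value of \<open>CD\<close>.\<close>

lemma solution_state:
  assumes \<beta>: "\<beta> \<in> \<H>" and u: "\<And>T. L1_on T u" and t: "0 \<le> t"
  defines "x \<equiv> conv (\<lambda>t. cblinfun_apply (semigroup_ext N t)) (\<lambda>s. cblinfun_apply (B_op N) (u s))"
    and "z \<equiv> conv (c0.kz \<beta>) (\<lambda>s. cblinfun_apply (Bres \<beta>) (u s)) t"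
  shows "cblinfun_apply (embm N) z = ramp x t" "(z, ramp u t) \<in> CD_dom N" "CD N (z, ramp u t) = conv (io_kernel \<beta>) u t"
proof -
  note \<beta>r = half_plane_resolvent[OF \<beta>]
  let ?\<rho> = "cblinfun_apply (resolvent_ext N \<beta>)"
  define p where "p s = cblinfun_apply (Bres \<beta>) (u s)" for s
  have p: "L1_on T p" for T unfolding p_def[abs_def] by (rule L1_on_cblinfun[OF u])
  have Bu: "L1_on T (\<lambda>s. cblinfun_apply (B_op N) (u s))" for T by (rule L1_on_cblinfun[OF u])
  have xc: "L1_on T x" for T
    unfolding x_def by (rule L1_on_continuous[OF conv_continuous[OF kern_semigroup_ext Bu]])
  have \<rho>x: "?\<rho> (x s) = conv (\<lambda>t. cblinfun_apply (\<T> t)) p s" for s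
    unfolding x_def conv_bounded_linear[OF bounded_linear_cblinfun_apply kern_semigroup_ext Bu]
    by (rule conv_cong) (simp add: resolvent_semigroup_ext[OF \<beta>r] p_def Bres_def ccomp_apply)
  have \<rho>ramp: "?\<rho> (ramp x t) = conv c0.sg2 p t"
  proof -
    have "?\<rho> (ramp x t) = ramp (\<lambda>s. ?\<rho> (x s)) t"
      unfolding ramp_def conv_bounded_linear[OF bounded_linear_cblinfun_apply kern_ramp xc]
      by (rule conv_cong) (simp add: cblinfun_simps)
    then show ?thesis using c0.ramp_conv_T[OF p t] by (simp add: \<rho>x)
  qed
  have z: "z = conv (c0.kz \<beta>) p t" by (simp add: z_def p_def[abs_def])
  have Rz: "cblinfun_apply (res \<beta>) z = conv c0.sg2 p t"
    unfolding z conv_bounded_linear[OF bounded_linear_cblinfun_apply c0.kern_kz p]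
    by (rule conv_cong) (simp add: res_kz[OF \<beta>r])
  show "cblinfun_apply (embm N) z = ramp x t"
    by (rule resolvent_ext_inj[OF \<beta>r]) (simp add: resolvent_ext[OF \<beta>r] Rz \<rho>ramp)
  have \<rho>Bw: "?\<rho> (cblinfun_apply (B_op N) (ramp u t)) = ramp p t"
    unfolding ramp_def conv_bounded_linear[OF bounded_linear_cblinfun_apply kern_ramp u]
      conv_bounded_linear[OF bounded_linear_cblinfun_apply kern_compose[OF bounded_linear_cblinfun_apply kern_ramp bounded_linear_ident] u]
    by (rule conv_cong) (simp add: cblinfun_simps p_def Bres_def ccomp_apply)
  define q where "q = conv (c0.kq \<beta>) p t"
  have Rq: "cblinfun_apply (res \<beta>) q = z - ramp p t"
  proof -
    have "cblinfun_apply (res \<beta>) q = conv (\<lambda>t y. cblinfun_apply (res \<beta>) (c0.kq \<beta> t y)) p t"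
      unfolding q_def by (rule conv_bounded_linear[OF bounded_linear_cblinfun_apply c0.kern_kq p])
    then have "cblinfun_apply (res \<beta>) q + ramp p t = conv (\<lambda>t y. cblinfun_apply (res \<beta>) (c0.kq \<beta> t y) + t *\<^sub>R y) p t"
      unfolding ramp_def
      by (simp add: conv_kern_add[OF kern_compose[OF bounded_linear_cblinfun_apply c0.kern_kq bounded_linear_ident] kern_ramp p])
    also have "\<dots> = z" unfolding z by (rule conv_cong) (simp add: res_kq[OF \<beta>r])
    finally show ?thesis by (simp add: algebra_simps)
  qed
  \<comment> \<open>By \<open>Rq\<close>, formally (\<beta> - A) z = q + B w with w =
    \<open>ramp u t\<close>, so that A z + B w is the vector \<beta> z - q of X.\<close>
  have "?\<rho> (A_ext N z + B_op N (ramp u t)) = ?\<rho> (embm N (\<beta> *\<^sub>C z - q))"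
    by (simp add: cblinfun_add_right resolvent_A_ext[OF \<beta>r] \<rho>Bw resolvent_ext[OF \<beta>r] cblinfun_diff_right cblinfun_apply_scaleC Rq)
  then have "A_ext N z + B_op N (ramp u t) = embm N (\<beta> *\<^sub>C z - q)"
    by (rule resolvent_ext_inj[OF \<beta>r])
  then show "(z, ramp u t) \<in> CD_dom N" by (simp add: CD_dom_def)
  have "CD N (z, ramp u t) = cblinfun_apply (Cres \<beta>) q + cblinfun_apply (G_tf N \<beta>) (ramp u t)"
    by (rule CD_eq[OF \<beta>]) (simp add: \<rho>Bw Rq)
  also have "cblinfun_apply (Cres \<beta>) q = conv (\<lambda>t u. cblinfun_apply (Cres \<beta>) (c0.kq \<beta> t (Bres \<beta> u))) u t"
    unfolding q_def conv_bounded_linear[OF bounded_linear_cblinfun_apply c0.kern_kq p]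
    by (rule conv_cong) (simp add: p_def)
  also have "cblinfun_apply (G_tf N \<beta>) (ramp u t) = conv (\<lambda>t u. t *\<^sub>R cblinfun_apply (G_tf N \<beta>) u) u t"
    unfolding ramp_def conv_bounded_linear[OF bounded_linear_cblinfun_apply kern_ramp u]
    by (rule conv_cong) (simp add: cblinfun_simps)
  also have "conv (\<lambda>t u. cblinfun_apply (Cres \<beta>) (c0.kq \<beta> t (Bres \<beta> u))) u t + conv (\<lambda>t u. t *\<^sub>R cblinfun_apply (G_tf N \<beta>) u) u t = conv (io_kernel \<beta>) u t"
    unfolding io_kernel_def[abs_def]
    by (rule conv_kern_add[symmetric]) (intro kern_compose[OF _ c0.kern_kq] kern_time bounded_linear_cblinfun_apply u)+
  finally show "CD N (z, ramp u t) = conv (io_kernel \<beta>) u t" .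
qed

lemma Bochner_ramp:
  fixes f :: "real \<Rightarrow> 'a::cbanach"
  shows "L1_on t f \<Longrightarrow> 0 \<le> t \<Longrightarrow> Bochner_integral (lebesgue_on {0..t}) (\<lambda>s. (t - s) *\<^sub>R f s) = ramp f t"
  unfolding ramp_def by (rule Bochner_integral_eq_conv[OF kern_ramp])

lemma Bochner_state:
  assumes u: "\<And>T. L1_on T u" and t: "0 \<le> t"
  shows "Bochner_integral (lebesgue_on {0..t}) (\<lambda>s. cblinfun_apply (semigroup_ext N (t - s)) (B_op N (u s)))
    = conv (\<lambda>t. cblinfun_apply (semigroup_ext N t)) (\<lambda>s. cblinfun_apply (B_op N) (u s)) t"
  by (rule Bochner_integral_eq_conv[OF kern_semigroup_ext _ t]) (rule L1_on_cblinfun[OF u])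

text \<open>Injectivity of \<open>embm N\<close> forces the initial vector to be 0 and determines
  the witness \<open>z t\<close>, so every solution has the output that
  \<open>solution_state\<close> computes.\<close>

lemma generalised_solution_output:
  assumes \<beta>: "\<beta> \<in> \<H>" and sol: "generalised_solution N u x y" and x0: "x 0 = 0"
  shows "is_second_derivative y (conv (io_kernel \<beta>) u)"
proof -
  have u: "L1_on T u" for T using sol by (auto simp: generalised_solution_def L1_loc_iff_L1_on)
  obtain xi where xi: "\<And>t. 0 \<le> t \<Longrightarrow> x t = embm N (node_semigroup N t xi) +
       Bochner_integral (lebesgue_on {0..t}) (\<lambda>s. semigroup_ext N (t - s) (B_op N (u s)))"
    using sol unfolding generalised_solution_def by blast
  obtain z F where zF: "\<And>t. 0 \<le> t \<Longrightarrow> embm N (z t) = Bochner_integral (lebesgue_on {0..t}) (\<lambda>s. (t - s) *\<^sub>R x s)"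
    "\<And>t. 0 \<le> t \<Longrightarrow> F t = CD N (z t, Bochner_integral (lebesgue_on {0..t}) (\<lambda>s. (t - s) *\<^sub>R u s))"
    and y: "is_second_derivative y F"
    using sol unfolding generalised_solution_def Let_def by blast
  let ?X = "conv (\<lambda>t. cblinfun_apply (semigroup_ext N t)) (\<lambda>s. cblinfun_apply (B_op N) (u s))"
  have "embm N xi = 0" using xi[of 0] x0 Bochner_state[OF u, of 0] by (simp add: conv_def)
  then have "xi = 0" using embm_inj[of xi 0] by (simp add: cblinfun_simps)
  then have x: "x t = ?X t" if "0 \<le> t" for t using xi[OF that] Bochner_state[OF u that] by (simp add: cblinfun_simps)
  have X: "L1_on T ?X" for T
    by (rule L1_on_continuous[OF conv_continuous[OF kern_semigroup_ext L1_on_cblinfun[OF u]]])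
  have xL: "L1_on T x" for T by (rule L1_on_cong[OF X]) (simp add: x)
  have ramp_x: "ramp x t = ramp ?X t" for t unfolding ramp_def by (rule conv_cong) (simp add: x)
  have F: "F t = conv (io_kernel \<beta>) u t" if t: "0 \<le> t" for t
  proof -
    have "embm N (z t) = ramp ?X t" using zF(1)[OF t] Bochner_ramp[OF xL t] ramp_x by simp
    then have "z t = conv (c0.kz \<beta>) (\<lambda>s. cblinfun_apply (Bres \<beta>) (u s)) t"
      using solution_state(1)[where u=u, OF \<beta> u t] by (intro embm_inj) simp
    then show ?thesis using zF(2)[OF t] Bochner_ramp[OF u t] solution_state(3)[where u=u, OF \<beta> u t] by simp
  qed
  have "Bochner_integral (lebesgue_on {0..}) (\<lambda>t. (deriv ^^ 2) \<phi> t *\<^sub>R F t) = Bochner_integral (lebesgue_on {0..}) (\<lambda>t. (deriv ^^ 2) \<phi> t *\<^sub>R conv (io_kernel \<beta>) u t)" for \<phi>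
    by (rule Bochner_integral_cong) (simp add: F)
  then show ?thesis using y by (simp add: is_second_derivative_def)
qed

text \<open>\<open>Linf_BIBO_stable\<close> speaks about given solutions; this produces one for each
  input.\<close>

lemma generalised_solution_exists:
  assumes \<beta>: "\<beta> \<in> \<H>" and u: "\<And>T. L1_on T u" and y: "is_second_derivative y (conv (io_kernel \<beta>) u)"
  shows "\<exists>x. generalised_solution N u x y \<and> x 0 = 0"
proof -
  let ?X = "conv (\<lambda>t. cblinfun_apply (semigroup_ext N t)) (\<lambda>s. cblinfun_apply (B_op N) (u s))"
  let ?z = "\<lambda>t. conv (c0.kz \<beta>) (\<lambda>s. cblinfun_apply (Bres \<beta>) (u s)) t"
  have Bu: "L1_on T (\<lambda>s. cblinfun_apply (B_op N) (u s))" for T by (rule L1_on_cblinfun[OF u])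
  have Xc: "continuous_on {0..T} ?X" for T by (rule conv_continuous[OF kern_semigroup_ext Bu])
  have X: "L1_on T ?X" for T by (rule L1_on_continuous[OF Xc])
  have "generalised_solution N u ?X y"
    unfolding generalised_solution_def
  proof (intro conjI)
    show "L1_loc u" using u by (simp add: L1_loc_iff_L1_on)
    show "continuous_on {0..} ?X"
      unfolding continuous_on_eq_continuous_within
    proof
      fix t :: real assume t: "t \<in> {0..}"
      have "continuous (at t within {0..t + 1}) ?X"
        using Xc[of "t + 1"] t by (simp add: continuous_on_eq_continuous_within)
      moreover have "at t within {0..t + 1} = at t within {0..}"
        by (rule at_within_nhd[of t "{..<t + 1}"]) auto
      ultimately show "continuous (at t within {0..}) ?X" by (simp add: continuous_within)
    qed
    show "\<exists>x0. \<forall>t\<ge>0. ?X t = embm N (node_semigroup N t x0) +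
       Bochner_integral (lebesgue_on {0..t}) (\<lambda>s. semigroup_ext N (t - s) (B_op N (u s)))"
      by (rule exI[of _ 0]) (simp add: cblinfun_simps Bochner_state[where u=u, OF u])
    show "\<exists>z F. (\<forall>t\<ge>0. embm N (z t) = Bochner_integral (lebesgue_on {0..t}) (\<lambda>s. (t - s) *\<^sub>R ?X s) \<and>
          (let w = Bochner_integral (lebesgue_on {0..t}) (\<lambda>s. (t - s) *\<^sub>R u s) in
            (z t, w) \<in> CD_dom N \<and> F t = CD N (z t, w))) \<and>
       is_second_derivative y F"
      using y by (intro exI[of _ ?z] exI[of _ "conv (io_kernel \<beta>) u"])
        (simp add: Let_def Bochner_ramp X u solution_state[where u=u, OF \<beta> u])
  qed
  then show ?thesis by (intro exI[of _ ?X]) (simp add: conv_def)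
qed

end

section \<open>Smooth bump functions and second differences\<close>

definition smooth_fun :: "(real \<Rightarrow> real) \<Rightarrow> bool" where
  "smooth_fun f \<longleftrightarrow> (\<forall>n. (deriv ^^ n) f differentiable_on UNIV)"

text \<open>Coinduction: iterated derivatives never leave \<open>F\<close>. Smoothness below is
  proved by naming a suitable \<open>F\<close> instead of computing higher derivatives.\<close>

lemma smooth_funI:
  assumes closed: "\<And>f. f \<in> F \<Longrightarrow> \<exists>g\<in>F. \<forall>x. (f has_real_derivative g x) (at x)" and f: "f \<in> F"
  shows "smooth_fun f"
proof -
  have mem: "(deriv ^^ n) f \<in> F" for n
  proof (induction n)
    case (Suc n)
    then obtain g where g: "g \<in> F" "\<And>x. ((deriv ^^ n) f has_real_derivative g x) (at x)" using closed by blast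
    then have "deriv ((deriv ^^ n) f) = g" by (auto intro!: DERIV_imp_deriv)
    then show ?case using g by simp
  qed (simp add: f)
  have "h differentiable_on UNIV" if "h \<in> F" for h
    using closed[OF that] by (auto simp: differentiable_on_def real_differentiable_def intro: has_field_derivative_at_within)
  then show ?thesis using mem by (simp add: smooth_fun_def)
qed

lemma smooth_fun_deriv:
  assumes "smooth_fun f"
  shows "smooth_fun (deriv f)" "(f has_real_derivative deriv f x) (at x)"
proof -
  have "(deriv ^^ n) (deriv f) = (deriv ^^ Suc n) f" for n by (simp add: funpow_swap1)
  then show "smooth_fun (deriv f)" using assms unfolding smooth_fun_def by metis
  have "(deriv ^^ 0) f differentiable_on UNIV" using assms unfolding smooth_fun_def by blast
  then have "f differentiable (at x)" by (simp add: differentiable_on_def)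
  then show "(f has_real_derivative deriv f x) (at x)"
    using DERIV_deriv_iff_real_differentiable by blast
qed

lemma smooth_fun_antideriv:
  assumes f: "smooth_fun f" and F: "\<And>x. (F has_real_derivative f x) (at x)"
  shows "smooth_fun F"
  by (rule smooth_funI[of "insert F {f. smooth_fun f}"]) (use f F smooth_fun_deriv in blast)+

lemma smooth_fun_affine:
  assumes f: "smooth_fun f"
  shows "smooth_fun (\<lambda>t. c * f (a * t + b))"
proof (rule smooth_funI)
  show "(\<lambda>t. c * f (a * t + b)) \<in> {\<lambda>t. c * f (a * t + b) |c f. smooth_fun f}" using f by blast
  fix g assume "g \<in> {\<lambda>t. c * f (a * t + b) |c f. smooth_fun f}"
  then obtain c f where g: "g = (\<lambda>t. c * f (a * t + b))" "smooth_fun f" by blast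
  have "(g has_real_derivative (c * a) * deriv f (a * x + b)) (at x)" for x
  proof -
    have "((\<lambda>x. f (a * x + b)) has_real_derivative deriv f (a * x + b) * a) (at x)"
      by (rule DERIV_chain2[OF smooth_fun_deriv(2)[OF g(2)]]) (auto intro!: derivative_eq_intros)
    from DERIV_cmult[OF this, of c] show ?thesis by (simp add: g(1) mult_ac)
  qed
  then show "\<exists>h\<in>{\<lambda>t. c * f (a * t + b) |c f. smooth_fun f}. \<forall>x. (g has_real_derivative h x) (at x)"
    using smooth_fun_deriv(1)[OF g(2)] by (intro bexI[of _ "\<lambda>x. (c * a) * deriv f (a * x + b)"]) auto
qed

lemma smooth_fun_add:
  assumes "smooth_fun f" "smooth_fun g"
  shows "smooth_fun (\<lambda>t. f t + g t)"
proof (rule smooth_funI)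
  show "(\<lambda>t. f t + g t) \<in> {\<lambda>t. f t + g t |f g. smooth_fun f \<and> smooth_fun g}" using assms by blast
  fix h assume "h \<in> {\<lambda>t. f t + g t |f g. smooth_fun f \<and> smooth_fun g}"
  then obtain f g where h: "h = (\<lambda>t. f t + g t)" "smooth_fun f" "smooth_fun g" by blast
  have "(h has_real_derivative deriv f x + deriv g x) (at x)" for x
    unfolding h(1) by (intro DERIV_add smooth_fun_deriv h)
  then show "\<exists>k\<in>{\<lambda>t. f t + g t |f g. smooth_fun f \<and> smooth_fun g}. \<forall>x. (h has_real_derivative k x) (at x)"
    using smooth_fun_deriv(1) h by (intro bexI[of _ "\<lambda>x. deriv f x + deriv g x"]) auto
qed

text \<open>The standard bump exp (-1 / (t (1 - t))) times a polynomial over a power of t (1 - t): a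
  family that is closed under differentiation.\<close>

definition bump_fun :: "real poly \<Rightarrow> nat \<Rightarrow> real \<Rightarrow> real" where
  "bump_fun q m t = (if 0 < t \<and> t < 1 then poly q t * (exp (- (1 / (t * (1 - t)))) / (t * (1 - t)) ^ m) else 0)"

text \<open>The term of order m + 2 of the exponential series beats the denominator of order m and
  leaves the square of t (1 - t). A quadratic bound at an endpoint is what makes the derivative
  vanish there (\<open>DERIV_zero_quadratic\<close>).\<close>

lemma bump_fun_bound: "\<exists>K\<ge>0. \<forall>t. \<bar>bump_fun q m t\<bar> \<le> K * t\<^sup>2 \<and> \<bar>bump_fun q m t\<bar> \<le> K * (1 - t)\<^sup>2"
proof -
  obtain B where B: "0 \<le> B" "\<And>s. s \<in> {0..1} \<Longrightarrow> norm (poly q s) \<le> B"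
    by (rule continuous_on_interval_bounded[of 0 1 "poly q"]) (auto intro: continuous_intros)
  have main: "\<bar>bump_fun q m t\<bar> \<le> B * (fact (m + 2) * (t * (1 - t))\<^sup>2)" if t: "0 < t" "t < 1" for t
  proof -
    define w where "w = t * (1 - t)"
    have w: "w > 0" using t by (simp add: w_def)
    have "(1 / w) ^ (m + 2) / fact (m + 2) \<le> exp (1 / w)"
    proof -
      have "(1 / w) ^ (m + 2) /\<^sub>R fact (m + 2) \<le> (\<Sum>n<m + 3. (1 / w) ^ n /\<^sub>R fact n)"
        using w by (intro member_le_sum) auto
      also have "\<dots> \<le> exp (1 / w)" unfolding exp_def
        using w summable_exp_generic[of "1 / w"] by (intro sum_le_suminf) auto
      finally show ?thesis by (simp add: divide_inverse mult.commute)
    qed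
    moreover define F where "F = (fact (m + 2) :: real)"
    moreover have "F > 0" by (simp add: F_def)
    ultimately have "exp (- (1 / w)) \<le> F * w ^ (m + 2)"
      using w by (simp add: exp_minus power_divide field_simps del: fact_Suc power_Suc power_add power_add_numeral)
    also have "w ^ (m + 2) = w\<^sup>2 * w ^ m" by (simp only: power_add mult.commute)
    finally have "exp (- (1 / w)) / w ^ m \<le> fact (m + 2) * w\<^sup>2"
      using w unfolding F_def by (simp add: pos_divide_le_eq mult.assoc del: fact_Suc)
    then have "\<bar>poly q t\<bar> * (exp (- (1 / w)) / w ^ m) \<le> B * (fact (m + 2) * w\<^sup>2)"
      using B(2)[of t] t w by (intro mult_mono) auto
    then show ?thesis using t w by (simp add: bump_fun_def w_def[symmetric] abs_mult)
  qed
  have t1: "(t * (1 - t))\<^sup>2 \<le> t\<^sup>2" "(t * (1 - t))\<^sup>2 \<le> (1 - t)\<^sup>2" if t: "0 < t" "t < 1" for t :: real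
    using t by (auto intro!: power_mono mult_left_le mult_right_le_one_le mult_left_le_one_le)
  have "\<bar>bump_fun q m t\<bar> \<le> (B * fact (m + 2)) * t\<^sup>2 \<and> \<bar>bump_fun q m t\<bar> \<le> (B * fact (m + 2)) * (1 - t)\<^sup>2" for t
  proof (cases "0 < t \<and> t < 1")
    case True
    have "B * (fact (m + 2) * (t * (1 - t))\<^sup>2) \<le> B * (fact (m + 2) * t\<^sup>2)"
      "B * (fact (m + 2) * (t * (1 - t))\<^sup>2) \<le> B * (fact (m + 2) * (1 - t)\<^sup>2)"
      using t1 True B(1) by (auto intro!: mult_left_mono simp del: power_mult_distrib)
    then show ?thesis using main[of t] True by (simp add: mult.assoc)
  qed (use B in \<open>auto simp: bump_fun_def\<close>)
  then show ?thesis using B(1) by (intro exI[of _ "B * fact (m + 2)"]) auto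
qed

lemma DERIV_zero_quadratic:
  fixes f :: "real \<Rightarrow> real"
  assumes "\<And>t. \<bar>f t\<bar> \<le> K * (t - a)\<^sup>2"
  shows "(f has_real_derivative 0) (at a)"
proof -
  have fa: "f a = 0" using assms[of a] by simp
  have "((\<lambda>h. (f (a + h) - f a) / h) \<longlongrightarrow> 0) (at 0)"
  proof (rule Lim_null_comparison)
    show "\<forall>\<^sub>F h in at 0. norm ((f (a + h) - f a) / h) \<le> K * \<bar>h\<bar>"
      unfolding eventually_at_filter
    proof (rule always_eventually, intro allI impI)
      fix h :: real assume "h \<noteq> 0"
      then show "norm ((f (a + h) - f a) / h) \<le> K * \<bar>h\<bar>"
        using assms[of "a + h"] by (simp add: fa divide_le_eq power2_eq_square mult.assoc abs_mult_self_eq)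
    qed
    have "((\<lambda>h. K * \<bar>h\<bar>) \<longlongrightarrow> K * \<bar>0\<bar>) (at (0::real))" by (intro tendsto_intros)
    then show "((\<lambda>h. K * \<bar>h\<bar>) \<longlongrightarrow> 0) (at (0::real))" by simp
  qed
  then show ?thesis by (simp add: DERIV_def)
qed

lemma bump_fun_deriv: "\<exists>q'. \<forall>t. (bump_fun q m has_real_derivative bump_fun q' (m + 2) t) (at t)"
proof -
  define W W' :: "real poly" where "W = [:0, 1, -1:]" and "W' = [:1, -2:]"
  \<comment> \<open>The numerator of the derivative over the common denominator W^(m + 2), where W
    is t (1 - t): the three terms come from \<open>q\<close>, from the exponential and from
    W^m.\<close>
  define q' where "q' = pderiv q * W ^ 2 + q * W' - of_nat m * q * W' * W"
  have "(bump_fun q m has_real_derivative bump_fun q' (m + 2) t) (at t)" for t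
  proof -
    obtain K where K: "\<And>t. \<bar>bump_fun q m t\<bar> \<le> K * t\<^sup>2" "\<And>t. \<bar>bump_fun q m t\<bar> \<le> K * (1 - t)\<^sup>2"
      using bump_fun_bound[of q m] by blast
    consider "t = 0" | "t = 1" | "t < 0 \<or> t > 1" | "0 < t" "t < 1" by linarith
    then show ?thesis
    proof cases
      case 1
      have "(bump_fun q m has_real_derivative 0) (at 0)" by (rule DERIV_zero_quadratic[of _ K]) (use K(1) in auto)
      then show ?thesis by (simp add: 1 bump_fun_def[of _ _ 0])
    next
      case 2
      have "(bump_fun q m has_real_derivative 0) (at 1)"
        by (rule DERIV_zero_quadratic[of _ K]) (use K(2) in \<open>auto simp: power2_commute\<close>)
      then show ?thesis by (simp add: 2 bump_fun_def[of _ _ 1])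
    next
      case 3
      have "((\<lambda>t. 0) has_real_derivative 0) (at t)" by simp
      moreover have "\<forall>\<^sub>F s in nhds t. bump_fun q m s = 0"
        using 3
      proof
        assume "t < 0"
        then have "\<forall>\<^sub>F s in nhds t. s < 0" by (intro eventually_nhds_in_open[of "{..<0}" t, simplified]) auto
        then show ?thesis by eventually_elim (simp add: bump_fun_def)
      next
        assume "t > 1"
        then have "\<forall>\<^sub>F s in nhds t. s > 1" by (intro eventually_nhds_in_open[of "{1<..}" t, simplified]) auto
        then show ?thesis by eventually_elim (simp add: bump_fun_def)
      qed
      ultimately have "(bump_fun q m has_real_derivative 0) (at t)" by (subst DERIV_cong_ev[OF refl _ refl])
      then show ?thesis using 3 by (auto simp: bump_fun_def)
    next
      case 4
      define w where "w = t * (1 - t)"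
      have w: "w > 0" using 4 by (simp add: w_def)
      have pW: "poly W t = w" "poly W' t = 1 - 2 * t" by (simp_all add: W_def W'_def w_def algebra_simps)
      have dw: "((\<lambda>t. t * (1 - t)) has_real_derivative (1 - 2 * t)) (at t)"
        by (auto intro!: derivative_eq_intros)
      have "((\<lambda>t. poly q t * (exp (- (1 / (t * (1 - t)))) / (t * (1 - t)) ^ m)) has_real_derivative
         poly (pderiv q) t * (exp (- (1 / w)) / w ^ m) +
         (exp (- (1 / w)) * ((1 - 2 * t) / (w * w)) * w ^ m - exp (- (1 / w)) * (real m * (w ^ (m - Suc 0) * (1 - 2 * t)))) / (w ^ m * w ^ m) * poly q t) (at t)"
      proof -
        have exp_d: "((\<lambda>s. exp (- (1 / g s))) has_real_derivative exp (- (1 / g t)) * (g' / (g t * g t))) (at t)"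
          and pow_d: "((\<lambda>s. g s ^ m) has_real_derivative real m * (g t ^ (m - Suc 0) * g')) (at t)"
          if "(g has_real_derivative g') (at t)" "g t \<noteq> 0" for g g'
          using that by (auto intro!: derivative_eq_intros simp: power2_eq_square)
        have w0: "t * (1 - t) \<noteq> 0" using w unfolding w_def by linarith
        then have "(t * (1 - t)) ^ m \<noteq> 0" by simp
        from DERIV_mult[OF poly_DERIV[of q t] DERIV_divide[OF exp_d[OF dw w0] pow_d[OF dw w0] this]]
        show ?thesis unfolding w_def .
      qed
      also have "poly (pderiv q) t * (exp (- (1 / w)) / w ^ m) +
         (exp (- (1 / w)) * ((1 - 2 * t) / (w * w)) * w ^ m - exp (- (1 / w)) * (real m * (w ^ (m - Suc 0) * (1 - 2 * t)))) / (w ^ m * w ^ m) * poly q t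
         = bump_fun q' (m + 2) t"
      proof -
        have mm: "real m * w ^ (m - Suc 0) = real m * w ^ m / w" using w by (cases m) auto
        have "bump_fun q' (m + 2) t = poly q' t * (exp (- (1 / w)) / w ^ (m + 2))" using 4 by (simp add: bump_fun_def w_def)
        also have "poly q' t = poly (pderiv q) t * w\<^sup>2 + poly q t * (1 - 2 * t) - real m * poly q t * (1 - 2 * t) * w"
          by (simp add: q'_def pW of_nat_poly)
        also have "\<dots> * (exp (- (1 / w)) / w ^ (m + 2)) = poly (pderiv q) t * (exp (- (1 / w)) / w ^ m) +
         (exp (- (1 / w)) * ((1 - 2 * t) / (w * w)) * w ^ m - exp (- (1 / w)) * ((real m * w ^ m / w) * (1 - 2 * t))) / (w ^ m * w ^ m) * poly q t"
          using w by (simp add: field_simps power2_eq_square power_add)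
        finally show ?thesis by (simp only: mm[symmetric] mult.assoc)
      qed
      finally have "((\<lambda>t. poly q t * (exp (- (1 / (t * (1 - t)))) / (t * (1 - t)) ^ m)) has_real_derivative bump_fun q' (m + 2) t) (at t)" .
      moreover have "\<forall>\<^sub>F s in nhds t. s \<in> {0<..<1}" using 4 by (intro eventually_nhds_in_open) auto
      then have "\<forall>\<^sub>F s in nhds t. bump_fun q m s = poly q s * (exp (- (1 / (s * (1 - s)))) / (s * (1 - s)) ^ m)"
        by eventually_elim (simp add: bump_fun_def)
      ultimately show ?thesis by (subst DERIV_cong_ev[OF refl _ refl])
    qed
  qed
  then show ?thesis by blast
qed

lemma smooth_bump_fun: "smooth_fun (bump_fun q m)"
proof (rule smooth_funI[of "{bump_fun q m |q m. True}"])
  fix f assume "f \<in> {bump_fun q m |q m. True}"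
  then obtain q m where f: "f = bump_fun q m" by blast
  show "\<exists>g\<in>{bump_fun q m |q m. True}. \<forall>x. (f has_real_derivative g x) (at x)"
    using bump_fun_deriv[of q m] unfolding f by blast
qed blast

lemma continuous_antiderivative:
  fixes f :: "real \<Rightarrow> real"
  assumes "\<And>x. isCont f x"
  shows "\<exists>F. (\<forall>x. (F has_real_derivative f x) (at x)) \<and> F 0 = 0"
proof -
  obtain F where F: "\<And>x. (F has_vector_derivative f x) (at x)"
    using einterval_antiderivative[of "-\<infinity>" "\<infinity>" f] assms by auto
  have "((\<lambda>x. F x - F 0) has_real_derivative f x) (at x)" for x
    using F[of x] by (auto intro!: derivative_eq_intros simp: has_real_derivative_iff_has_vector_derivative)
  then show ?thesis by (intro exI[of _ "\<lambda>x. F x - F 0"]) auto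
qed

lemma smooth_fun_isCont: "smooth_fun f \<Longrightarrow> isCont f x"
  using smooth_fun_deriv(2) DERIV_isCont by blast

lemma DERIV_zero_left:
  fixes F :: "real \<Rightarrow> real"
  assumes F: "\<And>x. (F has_real_derivative f x) (at x)" and F0: "F a = b" and f0: "\<And>x. x \<le> a \<Longrightarrow> f x = 0" and x: "x \<le> a"
  shows "F x = b"
proof (cases "x = a")
  case False
  then have "x < a" using x by simp
  then obtain z where "z < a" "F a - F x = (a - x) * f z" using MVT2[of x a F f] F by blast
  then show ?thesis using f0[of z] F0 by simp
qed (simp add: F0)

text \<open>\<open>\<rho>\<close> is a mollifier supported in [0, e], and \<open>N1\<close>,
  \<open>N\<close>, \<open>N2\<close> are its successive antiderivatives from the left: smooth
  versions of the unit step, of max 0 t and of half the square of max 0 t.\<close>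

lemma approximate_unit:
  assumes e: "e > 0"
  obtains \<rho> N1 N N2 :: "real \<Rightarrow> real" where "smooth_fun \<rho>" "\<And>t. 0 \<le> \<rho> t" "\<And>t. t \<le> 0 \<or> t \<ge> e \<Longrightarrow> \<rho> t = 0"
    "\<And>t. (N1 has_real_derivative \<rho> t) (at t)" "\<And>t. t \<le> 0 \<Longrightarrow> N1 t = 0" "\<And>t. t \<ge> e \<Longrightarrow> N1 t = 1" "\<And>t. 0 \<le> N1 t" "\<And>t. N1 t \<le> 1"
    "\<And>t. (N has_real_derivative N1 t) (at t)" "\<And>t. t \<le> 0 \<Longrightarrow> N t = 0"
    "\<And>t. (N2 has_real_derivative N t) (at t)" "\<And>t. t \<le> 0 \<Longrightarrow> N2 t = 0"
proof -
  define b where "b = bump_fun 1 0"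
  have b: "smooth_fun b" "\<And>t. 0 \<le> b t" "\<And>t. t \<le> 0 \<or> t \<ge> 1 \<Longrightarrow> b t = 0" "\<And>t. 0 < t \<Longrightarrow> t < 1 \<Longrightarrow> 0 < b t"
    by (auto simp: b_def smooth_bump_fun bump_fun_def)
  obtain F where F: "\<And>x. (F has_real_derivative b x) (at x)" "F 0 = 0"
    using continuous_antiderivative[OF smooth_fun_isCont[OF b(1)]] by blast
  have Fl: "F t = 0" if "t \<le> 0" for t by (rule DERIV_zero_left[OF F _ that]) (use b in auto)
  have F1: "F 1 > 0"
  proof -
    obtain z where "0 < z" "z < 1" "F 1 - F 0 = (1 - 0) * b z" using MVT2[of 0 1 F b] F by auto
    then show ?thesis using b(4)[of z] F(2) by simp
  qed
  define Z where "Z = F 1"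
  have Z: "Z > 0" using F1 by (simp add: Z_def)
  have mono: "F s \<le> F t" if "s \<le> t" for s t
    by (rule DERIV_nonneg_imp_nondecreasing[OF that]) (use F b(2) in blast)
  have Fr: "F t = F 1" if "t \<ge> 1" for t
  proof (cases "t = 1")
    case False
    then have "1 < t" using that by simp
    then obtain z where "1 < z" "F t - F 1 = (t - 1) * b z" using MVT2[of 1 t F b] F by auto
    then show ?thesis using b(3)[of z] by simp
  qed simp
  define \<rho> where "\<rho> t = 1 / (e * Z) * b ((1 / e) * t + 0)" for t
  define N1 where "N1 t = F (t / e) / Z" for t
  have \<rho>s: "smooth_fun \<rho>" unfolding \<rho>_def[abs_def] by (rule smooth_fun_affine[OF b(1)])
  have N1d: "(N1 has_real_derivative \<rho> t) (at t)" for t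
    unfolding N1_def[abs_def] \<rho>_def using e Z
    by (auto intro!: derivative_eq_intros DERIV_chain2[of F, OF F(1)])
  obtain N where N: "\<And>x. (N has_real_derivative N1 x) (at x)" "N 0 = 0"
    using continuous_antiderivative[of N1] DERIV_isCont[OF N1d] by blast
  obtain N2 where N2: "\<And>x. (N2 has_real_derivative N x) (at x)" "N2 0 = 0"
    using continuous_antiderivative[of N] DERIV_isCont[OF N(1)] by blast
  have N1l: "N1 t = 0" if "t \<le> 0" for t using that e by (simp add: N1_def Fl divide_nonpos_pos)
  have Nl: "N t = 0" if "t \<le> 0" for t by (rule DERIV_zero_left[OF N _ that]) (use N1l in auto)
  show ?thesis
  proof (rule that[of \<rho> N1 N N2])
    show "0 \<le> \<rho> t" for t using e Z b(2) by (simp add: \<rho>_def)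
    show "\<rho> t = 0" if "t \<le> 0 \<or> t \<ge> e" for t using that e b(3)[of "t / e"] by (auto simp: \<rho>_def field_simps)
    show "N1 t = 1" if "t \<ge> e" for t using that e Fr[of "t / e"] Z by (simp add: N1_def Z_def)
    show "0 \<le> N1 t" for t using mono[of "min 0 (t / e)" "t / e"] Fl[of "min 0 (t / e)"] Z by (simp add: N1_def)
    show "N1 t \<le> 1" for t using mono[of "t / e" "max 1 (t / e)"] Fr[of "max 1 (t / e)"] Z by (simp add: N1_def Z_def)
    show "N2 t = 0" if "t \<le> 0" for t by (rule DERIV_zero_left[OF N2 _ that]) (use Nl in auto)
  qed (use \<rho>s N1d N N2 N1l Nl in auto)
qed

text \<open>The mean value theorem twice: for the difference f x - f (x - h), then for
  \<open>f'\<close>.\<close>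

lemma second_difference_MVT:
  fixes f :: "real \<Rightarrow> real"
  assumes f: "\<And>x. (f has_real_derivative f' x) (at x)" and f': "\<And>x. (f' has_real_derivative f'' x) (at x)" and h: "h > 0"
  shows "\<exists>\<theta>. s - 2 * h < \<theta> \<and> \<theta> < s \<and> f s - 2 * f (s - h) + f (s - 2 * h) = h\<^sup>2 * f'' \<theta>"
proof -
  have "((\<lambda>x. f x - f (x - h)) has_real_derivative f' x - f' (x - h)) (at x)" for x
    by (auto intro!: derivative_eq_intros DERIV_chain2[of f, OF f] f)
  then obtain \<xi> where \<xi>: "s - h < \<xi>" "\<xi> < s" "(f s - f (s - h)) - (f (s - h) - f (s - h - h)) = h * (f' \<xi> - f' (\<xi> - h))"
    using MVT2[of "s - h" s "\<lambda>x. f x - f (x - h)" "\<lambda>x. f' x - f' (x - h)"] h by auto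
  obtain \<theta> where \<theta>: "\<xi> - h < \<theta>" "\<theta> < \<xi>" "f' \<xi> - f' (\<xi> - h) = h * f'' \<theta>"
    using MVT2[of "\<xi> - h" \<xi> f' f''] f' h by auto
  have "f s - 2 * f (s - h) + f (s - 2 * h) = h\<^sup>2 * f'' \<theta>"
    using \<xi>(3) \<theta>(3) by (simp add: power2_eq_square algebra_simps)
  then show ?thesis using \<xi> \<theta> by (intro exI[of _ \<theta>]) auto
qed

text \<open>Backward differences: the value at t depends only on the past, so functions that vanish
  on the negative axis keep this property, and convolution with a causal kernel commutes with the
  operation.\<close>

definition diff2 :: "real \<Rightarrow> (real \<Rightarrow> 'a::real_vector) \<Rightarrow> real \<Rightarrow> 'a" where
  "diff2 h f t = (1 / h\<^sup>2) *\<^sub>R (f t - 2 *\<^sub>R f (t - h) + f (t - 2 * h))"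

text \<open>The reflected mollifier has mass 1 inside the interval, so the difference is an average
  of \<open>\<Phi> t - \<Phi> a\<close> over points t within distance e of a.\<close>

lemma approximate_unit_integral:
  fixes \<Phi> :: "real \<Rightarrow> 'a::banach"
  assumes \<Phi>: "continuous_on UNIV \<Phi>" and \<rho>: "continuous_on UNIV \<rho>" "\<And>t. 0 \<le> \<rho> t" "\<And>t. t \<le> 0 \<or> t \<ge> e \<Longrightarrow> \<rho> t = 0"
    and N1: "\<And>t. (N1 has_real_derivative \<rho> t) (at t)" "\<And>t. t \<le> 0 \<Longrightarrow> N1 t = 0" "\<And>t. t \<ge> e \<Longrightarrow> N1 t = 1"
    and a: "a \<le> r" "e \<le> a + L" "- L \<le> r"
    and osc: "\<And>t. \<bar>t - a\<bar> \<le> e \<Longrightarrow> norm (\<Phi> t - \<Phi> a) \<le> d"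
  shows "norm (integral {- L..r} (\<lambda>t. \<rho> (a - t) *\<^sub>R \<Phi> t) - \<Phi> a) \<le> d"
proof -
  have c: "continuous_on S (\<lambda>t. \<rho> (a - t))" for S
    by (rule continuous_on_compose2[OF \<rho>(1)]) (auto intro!: continuous_intros)
  have c\<Phi>: "continuous_on S \<Phi>" for S by (rule continuous_on_subset[OF \<Phi>]) auto
  have "((\<lambda>t. \<rho> (a - t)) has_integral (- N1 (a - r)) - (- N1 (a - (- L)))) {- L..r}"
  proof (rule fundamental_theorem_of_calculus[OF a(3)])
    fix x
    have "((\<lambda>t. - N1 (a - t)) has_real_derivative \<rho> (a - x)) (at x)"
      by (auto intro!: derivative_eq_intros DERIV_chain2[of N1, OF N1(1)])
    then show "((\<lambda>t. - N1 (a - t)) has_vector_derivative \<rho> (a - x)) (at x within {- L..r})"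
      by (simp add: has_real_derivative_iff_has_vector_derivative has_vector_derivative_at_within)
  qed
  then have one: "((\<lambda>t. \<rho> (a - t)) has_integral 1) {- L..r}" using N1(2)[of "a - r"] N1(3)[of "a + L"] a by simp
  have i: "(\<lambda>t. \<rho> (a - t) *\<^sub>R \<Phi> t) integrable_on {- L..r}"
    by (intro integrable_continuous_real continuous_intros c c\<Phi>)
  have "((\<lambda>t. \<rho> (a - t) *\<^sub>R \<Phi> t - \<rho> (a - t) *\<^sub>R \<Phi> a) has_integral integral {- L..r} (\<lambda>t. \<rho> (a - t) *\<^sub>R \<Phi> t) - 1 *\<^sub>R \<Phi> a) {- L..r}"
    by (intro has_integral_diff integrable_integral i has_integral_scaleR_left one)
  then have "integral {- L..r} (\<lambda>t. \<rho> (a - t) *\<^sub>R \<Phi> t) - \<Phi> a = integral {- L..r} (\<lambda>t. \<rho> (a - t) *\<^sub>R (\<Phi> t - \<Phi> a))"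
    by (simp add: scaleR_diff_right integral_unique)
  also have "norm \<dots> \<le> integral {- L..r} (\<lambda>t. d * \<rho> (a - t))"
  proof (rule integral_norm_bound_integral)
    show "(\<lambda>t. \<rho> (a - t) *\<^sub>R (\<Phi> t - \<Phi> a)) integrable_on {- L..r}"
      by (intro integrable_continuous_real continuous_intros c c\<Phi>)
    show "(\<lambda>t. d * \<rho> (a - t)) integrable_on {- L..r}" by (intro integrable_continuous_real continuous_intros c)
    fix t
    show "norm (\<rho> (a - t) *\<^sub>R (\<Phi> t - \<Phi> a)) \<le> d * \<rho> (a - t)"
    proof (cases "a - t \<le> 0 \<or> a - t \<ge> e")
      case False
      then have "norm (\<Phi> t - \<Phi> a) \<le> d" by (intro osc) auto
      then show ?thesis using \<rho>(2)[of "a - t"] by (simp add: mult.commute[of d] mult_left_mono)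
    qed (simp add: \<rho>(3))
  qed
  also have "\<dots> = d" using integral_unique[OF one] by simp
  finally show ?thesis .
qed

text \<open>If the second distributional derivative of \<open>\<Phi>\<close> is bounded by \<open>c\<close>, so are its second
  difference quotients: test with the second differences of an approximation of \<open>max 0\<close>.\<close>

lemma second_difference_bound:
  fixes \<Phi> f :: "real \<Rightarrow> 'a::cbanach"
  assumes \<Phi>: "continuous_on UNIV \<Phi>" and \<Phi>0: "\<And>t. t \<le> 0 \<Longrightarrow> \<Phi> t = 0"
    and y\<Phi>: "is_second_derivative y \<Phi>" and yf: "is_regular_distribution y f"
    and f: "\<And>T. L1_on T f" and c: "0 \<le> c" "\<And>T. 0 < T \<Longrightarrow> AE s in lebesgue_on {0..T}. norm (f s) \<le> c"
    and h: "h > 0"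
  shows "norm (diff2 h \<Phi> r) \<le> c"
proof (cases "r \<le> 0")
  case True
  then show ?thesis using h c by (simp add: diff2_def \<Phi>0)
next
  case False
  then have r: "r > 0" by simp
  \<comment> \<open>The slack 4 d is d times 1 + 2 + 1, the weights of the three values that get
    replaced by averages.\<close>
  have approx: "norm (\<Phi> r - 2 *\<^sub>R \<Phi> (r - h) + \<Phi> (r - 2 * h)) \<le> c * h\<^sup>2 + 4 * d" if d: "d > 0" for d
  proof -
    have "\<exists>e>0. e \<le> 1 \<and> (\<forall>t. \<bar>t - a\<bar> \<le> e \<longrightarrow> norm (\<Phi> t - \<Phi> a) \<le> d)" for a
    proof -
      have "isCont \<Phi> a" using \<Phi> by (simp add: continuous_on_eq_continuous_at)
      then obtain s where s: "s > 0" "\<And>t. dist t a < s \<Longrightarrow> dist (\<Phi> t) (\<Phi> a) < d"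
        using d unfolding continuous_at_eps_delta by metis
      show ?thesis using s by (intro exI[of _ "min 1 (s / 2)"]) (auto simp: dist_norm less_imp_le)
    qed
    then obtain \<epsilon> where \<epsilon>: "\<And>a. \<epsilon> a > 0" "\<And>a. \<epsilon> a \<le> 1" "\<And>a t. \<bar>t - a\<bar> \<le> \<epsilon> a \<Longrightarrow> norm (\<Phi> t - \<Phi> a) \<le> d" by metis
    define e where "e = min (\<epsilon> r) (min (\<epsilon> (r - h)) (\<epsilon> (r - 2 * h)))"
    have e: "e > 0" "e \<le> 1" using \<epsilon> by (auto simp: e_def min_le_iff_disj)
    obtain \<rho> N1 N N2 where \<rho>: "smooth_fun \<rho>" "\<And>t. 0 \<le> \<rho> t" "\<And>t. t \<le> 0 \<or> t \<ge> e \<Longrightarrow> \<rho> t = 0"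
      and N1: "\<And>t. (N1 has_real_derivative \<rho> t) (at t)" "\<And>t. t \<le> 0 \<Longrightarrow> N1 t = 0" "\<And>t. t \<ge> e \<Longrightarrow> N1 t = 1" "\<And>t. 0 \<le> N1 t" "\<And>t. N1 t \<le> 1"
      and N: "\<And>t. (N has_real_derivative N1 t) (at t)" "\<And>t. t \<le> 0 \<Longrightarrow> N t = 0"
      and N2: "\<And>t. (N2 has_real_derivative N t) (at t)" "\<And>t. t \<le> 0 \<Longrightarrow> N2 t = 0"
      using approximate_unit[OF e(1)] by blast
    have \<rho>c: "continuous_on UNIV \<rho>" using smooth_fun_isCont[OF \<rho>(1)] by (simp add: continuous_at_imp_continuous_on)
    \<comment> \<open>Second differences in the reflected variable. \<open>D N\<close> is a smoothed
      triangle over [r - 2 h, r], a test function whose second derivative \<open>D \<rho>\<close>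
      evaluates \<Phi> near r, r - h and r - 2 h.\<close>
    define D where "D F t = F (r - t) - 2 * F (r - h - t) + F (r - 2 * h - t)" for F :: "real \<Rightarrow> real" and t
    have Dd: "((\<lambda>t. D F t) has_real_derivative - D G x) (at x)" if "\<And>x. (F has_real_derivative G x) (at x)" for F G x
      unfolding D_def by (auto intro!: derivative_eq_intros DERIV_chain2[of F, OF that])
    define \<phi> where "\<phi> = D N"
    have \<phi>s: "smooth_fun \<phi>"
    proof -
      have Ns: "smooth_fun N" by (rule smooth_fun_antideriv[OF smooth_fun_antideriv[OF \<rho>(1) N1(1)] N(1)])
      have "smooth_fun (\<lambda>t. (1 * N ((-1) * t + r) + (-2) * N ((-1) * t + (r - h))) + 1 * N ((-1) * t + (r - 2 * h)))"
        by (intro smooth_fun_add smooth_fun_affine Ns)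
      moreover have "(\<lambda>t. (1 * N ((-1) * t + r) + (-2) * N ((-1) * t + (r - h))) + 1 * N ((-1) * t + (r - 2 * h))) = \<phi>"
        by (auto simp: \<phi>_def D_def fun_eq_iff algebra_simps)
      ultimately show ?thesis by simp
    qed
    have "deriv \<phi> = (\<lambda>x. - D N1 x)" unfolding \<phi>_def using Dd[OF N(1)] by (auto intro!: DERIV_imp_deriv)
    moreover have "deriv (\<lambda>x. - D N1 x) = D \<rho>"
    proof
      fix x
      have "((\<lambda>x. - D N1 x) has_real_derivative - (- D \<rho> x)) (at x)" by (intro DERIV_minus Dd N1)
      then show "deriv (\<lambda>x. - D N1 x) x = D \<rho> x" by (simp add: DERIV_imp_deriv)
    qed
    ultimately have \<phi>'': "(deriv ^^ 2) \<phi> = D \<rho>" by (simp add: numeral_2_eq_2)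
    have Nr: "N t = N e + (t - e)" if "t \<ge> e" for t
    proof (cases "t = e")
      case False
      then have "e < t" using that by simp
      then obtain z where "e < z" "N t - N e = (t - e) * N1 z" using MVT2[of e t N N1] N by auto
      then show ?thesis using N1(3)[of z] by simp
    qed simp
    \<comment> \<open>Left of r - 2 h - e all three arguments exceed e, where \<open>N\<close> is
      affine; second differences annihilate affine functions.\<close>
    have \<phi>sup: "\<phi> t = 0" if "t \<ge> r \<or> t \<le> r - 2 * h - e" for t
      using that
    proof
      assume "t \<ge> r"
      then show ?thesis using h by (simp add: \<phi>_def D_def N(2))
    next
      assume "t \<le> r - 2 * h - e"
      then have "r - t \<ge> e" "r - h - t \<ge> e" "r - 2 * h - t \<ge> e" using h by auto
      then have "N (r - t) = N e + (r - t - e)" "N (r - h - t) = N e + (r - h - t - e)" "N (r - 2 * h - t) = N e + (r - 2 * h - t - e)"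
        by (intro Nr; simp)+
      then show ?thesis by (simp add: \<phi>_def D_def)
    qed
    have "bounded {t. \<phi> t \<noteq> 0}"
    proof (rule bounded_subset[of "{r - 2 * h - e..r}"])
      show "{t. \<phi> t \<noteq> 0} \<subseteq> {r - 2 * h - e..r}"
      proof
        fix t assume "t \<in> {t. \<phi> t \<noteq> 0}"
        then have "\<not> (t \<ge> r \<or> t \<le> r - 2 * h - e)" using \<phi>sup[of t] by blast
        then show "t \<in> {r - 2 * h - e..r}" by auto
      qed
    qed simp
    then have \<phi>T: "\<phi> \<in> test_functions"
      using \<phi>s by (simp add: test_functions_def smooth_fun_def compact_closure)
    have \<phi>pos: "0 \<le> \<phi> t" for t
      using second_difference_MVT[OF N(1) N1(1) h, of "r - t"] \<rho>(2) h by (auto simp: \<phi>_def D_def algebra_simps zero_le_mult_iff)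
    have \<phi>c: "continuous_on S \<phi>" for S
      using smooth_fun_isCont[OF \<phi>s] by (simp add: continuous_at_imp_continuous_on)
    \<comment> \<open>\<Phi> vanishes on the negative axis, so integration may start at -L. This
      leaves room for all three mollifiers, which reach back to r - 2 h - 1 at most.\<close>
    define L where "L = 2 * h + 1"
    \<comment> \<open>The area of \<open>\<phi>\<close> over {0..r} is a second difference of
      \<open>N2\<close>, that is h^2 times a value of \<open>N1\<close>, which is at most 1.\<close>
    have \<phi>int: "integral {0..r} \<phi> \<le> h\<^sup>2"
    proof -
      have "((\<lambda>t. D N t) has_integral (- D N2 r) - (- D N2 0)) {0..r}"
      proof (rule fundamental_theorem_of_calculus)
        fix x
        have "((\<lambda>x. - D N2 x) has_real_derivative - (- D N x)) (at x)" by (intro DERIV_minus Dd N2)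
        then show "((\<lambda>x. - D N2 x) has_vector_derivative D N x) (at x within {0..r})"
          by (simp add: has_real_derivative_iff_has_vector_derivative has_vector_derivative_at_within)
      qed (use r in simp)
      moreover have "D N2 r = 0" using h by (simp add: D_def N2(2))
      moreover have "D N2 0 \<le> h\<^sup>2"
        using second_difference_MVT[OF N2(1) N(1) h, of r] N1(5) by (auto simp: D_def mult_left_le)
      ultimately show ?thesis unfolding \<phi>_def by (simp add: integral_unique)
    qed
    have \<phi>f: "L1_on r (\<lambda>t. \<phi> t *\<^sub>R f t)" by (rule L1_on_weight[OF f \<phi>c])
    have D\<rho>c: "continuous_on S (D \<rho>)" for S
      unfolding D_def[abs_def] by (intro continuous_intros continuous_on_compose2[OF \<rho>c]) auto
    have "y \<phi> = integral {0..r} (\<lambda>t. \<phi> t *\<^sub>R f t)"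
      using yf \<phi>T Bochner_integral_halfline[OF \<phi>f] r \<phi>sup by (simp add: is_regular_distribution_def)
    then have "norm (y \<phi>) \<le> c * integral {0..r} \<phi>"
      using norm_integral_weight_le[OF f c(2)[OF r] \<phi>c \<phi>pos] by simp
    also have "\<dots> \<le> c * h\<^sup>2" using \<phi>int c by (intro mult_left_mono) auto
    finally have 1: "norm (y \<phi>) \<le> c * h\<^sup>2" .
    have D\<rho>0: "D \<rho> t = 0" if "t > r" for t using that h by (simp add: D_def \<rho>(3))
    have c\<Phi>: "continuous_on S \<Phi>" for S by (rule continuous_on_subset[OF \<Phi>]) auto
    have "L1_on r (\<lambda>t. D \<rho> t *\<^sub>R \<Phi> t)" by (intro L1_on_continuous continuous_intros D\<rho>c c\<Phi>)
    then have "y \<phi> = integral {0..r} (\<lambda>t. D \<rho> t *\<^sub>R \<Phi> t)"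
      using y\<Phi> \<phi>T Bochner_integral_halfline[of r "\<lambda>t. D \<rho> t *\<^sub>R \<Phi> t"] r D\<rho>0 by (simp add: is_second_derivative_def \<phi>'')
    also have "\<dots> = integral {- L..r} (\<lambda>t. D \<rho> t *\<^sub>R \<Phi> t)"
    proof -
      have "integral {- L..0} (\<lambda>t. D \<rho> t *\<^sub>R \<Phi> t) = integral {- L..0} (\<lambda>t. 0)"
        by (rule integral_cong) (simp add: \<Phi>0)
      moreover have "(\<lambda>t. D \<rho> t *\<^sub>R \<Phi> t) integrable_on {- L..r}"
        by (intro integrable_continuous_real continuous_intros D\<rho>c c\<Phi>)
      ultimately show ?thesis
        using Henstock_Kurzweil_Integration.integral_combine[of "- L" 0 r "\<lambda>t. D \<rho> t *\<^sub>R \<Phi> t"] r h by (simp add: L_def)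
    qed
    also have "\<dots> = I1 - 2 *\<^sub>R I2 + I3" if "I1 = integral {- L..r} (\<lambda>t. \<rho> (r - t) *\<^sub>R \<Phi> t)"
      "I2 = integral {- L..r} (\<lambda>t. \<rho> (r - h - t) *\<^sub>R \<Phi> t)" "I3 = integral {- L..r} (\<lambda>t. \<rho> (r - 2 * h - t) *\<^sub>R \<Phi> t)" for I1 I2 I3
    proof -
      have i: "((\<lambda>t. \<rho> (a - t) *\<^sub>R \<Phi> t) has_integral integral {- L..r} (\<lambda>t. \<rho> (a - t) *\<^sub>R \<Phi> t)) {- L..r}" for a
        by (intro integrable_integral integrable_continuous_real continuous_intros c\<Phi> continuous_on_compose2[OF \<rho>c]) auto
      have "((\<lambda>t. \<rho> (r - t) *\<^sub>R \<Phi> t - 2 *\<^sub>R (\<rho> (r - h - t) *\<^sub>R \<Phi> t) + \<rho> (r - 2 * h - t) *\<^sub>R \<Phi> t) has_integral I1 - 2 *\<^sub>R I2 + I3) {- L..r}"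
        unfolding that by (intro has_integral_add has_integral_diff has_integral_cmul i)
      then show ?thesis by (simp add: D_def scaleR_diff_left scaleR_add_left integral_unique)
    qed
    finally have split: "y \<phi> = integral {- L..r} (\<lambda>t. \<rho> (r - t) *\<^sub>R \<Phi> t) - 2 *\<^sub>R integral {- L..r} (\<lambda>t. \<rho> (r - h - t) *\<^sub>R \<Phi> t)
      + integral {- L..r} (\<lambda>t. \<rho> (r - 2 * h - t) *\<^sub>R \<Phi> t)" by blast
    have app: "norm (integral {- L..r} (\<lambda>t. \<rho> (a - t) *\<^sub>R \<Phi> t) - \<Phi> a) \<le> d" if "a \<le> r" "a \<ge> r - 2 * h" "e \<le> \<epsilon> a" for a
      by (rule approximate_unit_integral[OF \<Phi> \<rho>c \<rho>(2,3) N1(1-3)]) (use that \<epsilon>(3)[of _ a] r e h in \<open>auto simp: L_def\<close>)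
    have "norm (integral {- L..r} (\<lambda>t. \<rho> (r - t) *\<^sub>R \<Phi> t) - \<Phi> r) \<le> d"
      "norm (integral {- L..r} (\<lambda>t. \<rho> (r - h - t) *\<^sub>R \<Phi> t) - \<Phi> (r - h)) \<le> d"
      "norm (integral {- L..r} (\<lambda>t. \<rho> (r - 2 * h - t) *\<^sub>R \<Phi> t) - \<Phi> (r - 2 * h)) \<le> d"
      by (intro app; use h in \<open>auto simp: e_def\<close>)+
    moreover have "norm (\<Phi> r - 2 *\<^sub>R \<Phi> (r - h) + \<Phi> (r - 2 * h)) \<le> norm (I1 - 2 *\<^sub>R I2 + I3) + (norm (I1 - \<Phi> r) + 2 * norm (I2 - \<Phi> (r - h)) + norm (I3 - \<Phi> (r - 2 * h)))" for I1 I2 I3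
    proof -
      have "\<Phi> r - 2 *\<^sub>R \<Phi> (r - h) + \<Phi> (r - 2 * h) = (I1 - 2 *\<^sub>R I2 + I3) - ((I1 - \<Phi> r) - 2 *\<^sub>R (I2 - \<Phi> (r - h)) + (I3 - \<Phi> (r - 2 * h)))"
        by (simp add: algebra_simps)
      also have "norm \<dots> \<le> norm (I1 - 2 *\<^sub>R I2 + I3) + norm ((I1 - \<Phi> r) - 2 *\<^sub>R (I2 - \<Phi> (r - h)) + (I3 - \<Phi> (r - 2 * h)))"
        by (rule norm_triangle_ineq4)
      also have "norm ((I1 - \<Phi> r) - 2 *\<^sub>R (I2 - \<Phi> (r - h)) + (I3 - \<Phi> (r - 2 * h))) \<le> norm (I1 - \<Phi> r) + norm (2 *\<^sub>R (I2 - \<Phi> (r - h))) + norm (I3 - \<Phi> (r - 2 * h))"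
        using norm_triangle_ineq[of "(I1 - \<Phi> r) - 2 *\<^sub>R (I2 - \<Phi> (r - h))" "I3 - \<Phi> (r - 2 * h)"] norm_triangle_ineq4[of "I1 - \<Phi> r" "2 *\<^sub>R (I2 - \<Phi> (r - h))"]
        by linarith
      finally show ?thesis by simp
    qed
    ultimately show ?thesis using 1 unfolding split by (smt (verit))
  qed
  have "norm (\<Phi> r - 2 *\<^sub>R \<Phi> (r - h) + \<Phi> (r - 2 * h)) \<le> c * h\<^sup>2"
  proof (rule field_le_epsilon)
    fix d :: real assume "d > 0"
    then show "norm (\<Phi> r - 2 *\<^sub>R \<Phi> (r - h) + \<Phi> (r - 2 * h)) \<le> c * h\<^sup>2 + d" using approx[of "d / 4"] by simp
  qed
  moreover have "norm (diff2 h \<Phi> r) = (1 / h\<^sup>2) * norm (\<Phi> r - 2 *\<^sub>R \<Phi> (r - h) + \<Phi> (r - 2 * h))"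
    unfolding diff2_def norm_scaleR by simp
  ultimately show ?thesis using h by (simp add: pos_divide_le_eq)
qed

lemma conv_continuous_UNIV:
  assumes \<kappa>: "kern \<kappa>" and \<kappa>0: "\<And>x. \<kappa> 0 x = 0" and p: "\<And>T. L1_on T p"
  shows "continuous_on UNIV (conv \<kappa> p)" "\<And>t. t \<le> 0 \<Longrightarrow> conv \<kappa> p t = 0"
proof -
  show 0: "conv \<kappa> p t = 0" if "t \<le> 0" for t
    using that by (cases "t = 0") (simp_all add: conv_def)
  have "continuous_on {0..T} (\<lambda>t. conv \<kappa> p t)" for T using conv_continuous[OF \<kappa> p] by simp
  then have "continuous_on {0..T} (conv \<kappa> p)" for T by simp
  have c: "continuous_on UNIV (\<lambda>t. conv \<kappa> p (max 0 t))"
  proof (simp add: continuous_on_eq_continuous_at, intro allI)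
    fix t :: real
    have "continuous_on {..<t + 1} (\<lambda>t. conv \<kappa> p (max 0 t))"
      by (rule continuous_on_compose2[OF conv_continuous[OF \<kappa> p[of "max 0 (t + 1)"]]]) (auto intro!: continuous_intros)
    then show "isCont (\<lambda>t. conv \<kappa> p (max 0 t)) t" by (rule continuous_on_interior) (simp add: interior_open)
  qed
  have "conv \<kappa> p (max 0 t) = conv \<kappa> p t" for t
    using 0[of t] 0[of 0] by (cases "t \<le> 0") (simp_all add: max_def)
  then show "continuous_on UNIV (conv \<kappa> p)" using c by simp
qed

text \<open>Stability applies to a solution with the given input and provides an output function
  bounded by c; \<open>second_difference_bound\<close> converts this into a pointwise statement
  about the kernel alone.\<close>

lemma (in node) BIBO_second_difference:
  assumes BIBO: "\<And>u x y. generalised_solution N u x y \<Longrightarrow> Linf_loc u \<Longrightarrow> x 0 = 0 \<Longrightarrow>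
      \<exists>f. is_regular_distribution y f \<and> Linf_loc f \<and> (\<forall>t>0. Linf_norm t f \<le> ennreal c * Linf_norm t u)"
    and c: "0 \<le> c" and \<beta>: "\<beta> \<in> \<H>"
    and u: "Linf_loc u" "\<And>t. 0 < t \<Longrightarrow> Linf_norm t u \<le> 1" and h: "h > 0"
  shows "norm (diff2 h (conv (io_kernel \<beta>) u) r) \<le> c"
proof -
  let ?\<Phi> = "conv (io_kernel \<beta>) u"
  define y where "y \<phi> = Bochner_integral (lebesgue_on {0..}) (\<lambda>t. (deriv ^^ 2) \<phi> t *\<^sub>R ?\<Phi> t)" for \<phi>
  have y: "is_second_derivative y ?\<Phi>" by (simp add: is_second_derivative_def y_def)
  have uL: "L1_on T u" for T by (rule Linf_loc_L1_on[OF u(1)])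
  obtain x where "generalised_solution N u x y" "x 0 = 0"
    using generalised_solution_exists[OF \<beta> uL y] by blast
  then obtain f where f: "is_regular_distribution y f" "Linf_loc f" "\<And>t. 0 < t \<Longrightarrow> Linf_norm t f \<le> ennreal c * Linf_norm t u"
    using BIBO[OF _ u(1)] by blast
  have "Linf_norm t f \<le> ennreal c" if "0 < t" for t
    using order_trans[OF f(3)[OF that] mult_left_mono[OF u(2)[OF that], of "ennreal c"]] by simp
  then have ae: "AE s in lebesgue_on {0..T}. norm (f s) \<le> c" if "0 < T" for T
    using that by (intro Linf_norm_AE c)
  show ?thesis
    by (rule second_difference_bound[OF conv_continuous_UNIV[OF kern_io_kernel io_kernel_0 uL] y f(1) Linf_loc_L1_on[OF f(2)] c ae h])
qed

section \<open>Second difference quotients of second integrals\<close>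

definition delay :: "real \<Rightarrow> (real \<Rightarrow> 'a::zero) \<Rightarrow> real \<Rightarrow> 'a" where
  "delay a v s = (if s < a then 0 else v (s - a))"

lemma L1_on_delay': "L1_on T v \<Longrightarrow> 0 \<le> a \<Longrightarrow> L1_on T (delay a v)"
  using L1_on_delay[of T v a] by (simp add: delay_def[abs_def])

text \<open>Time invariance. For t < a the right-hand side is a convolution at a negative time, an
  integral over the empty interval, in agreement with the delay.\<close>

lemma conv_delay:
  assumes \<kappa>: "kern \<kappa>" and v: "\<And>T. L1_on T v" and a: "0 \<le> a"
  shows "conv \<kappa> (delay a v) t = conv \<kappa> v (t - a)"
proof -
  have "((\<lambda>s. \<kappa> (t - a - s) (v s)) has_integral conv \<kappa> v (t - a)) {0..t - a}"
    unfolding conv_def by (rule integrable_integral[OF L1_on_integrable[OF L1_on_kern[OF \<kappa> v]]])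
  from has_integral_delay[OF this a]
  have "((\<lambda>s. if s < a then 0 else \<kappa> (t - a - (s - a)) (v (s - a))) has_integral conv \<kappa> v (t - a)) {0..t}" .
  moreover have "(if s < a then 0 else \<kappa> (t - a - (s - a)) (v (s - a))) = \<kappa> (t - s) (delay a v s)" for s
    using linear_0[OF kern_linear[OF \<kappa>]] by (simp add: delay_def)
  ultimately show ?thesis by (simp add: conv_def integral_unique)
qed

text \<open>\<open>diff2\<close> with delays that insert 0 for the values of \<open>v\<close> at
  negative times, which an input leaves unspecified.\<close>

definition delay2 :: "real \<Rightarrow> (real \<Rightarrow> 'a::real_vector) \<Rightarrow> real \<Rightarrow> 'a" where
  "delay2 h v s = (1 / h\<^sup>2) *\<^sub>R (v s - 2 *\<^sub>R delay h v s + delay (2 * h) v s)"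

lemma L1_on_delay2: "L1_on T v \<Longrightarrow> 0 \<le> h \<Longrightarrow> L1_on T (delay2 h v)"
  unfolding delay2_def[abs_def] by (intro L1_on_scaleR L1_on_add L1_on_diff L1_on_delay') auto

lemma conv_delay2:
  assumes \<kappa>: "kern \<kappa>" and v: "\<And>T. L1_on T v" and h: "0 \<le> h"
  shows "conv \<kappa> (delay2 h v) t = diff2 h (conv \<kappa> v) t"
proof -
  have 1: "L1_on t (delay h v)" "L1_on t (delay (2 * h) v)" using h by (auto intro: L1_on_delay' v)
  have 2: "L1_on t (\<lambda>s. 2 *\<^sub>R delay h v s)" by (rule L1_on_scaleR[OF 1(1)])
  have "conv \<kappa> (delay2 h v) t = (1 / h\<^sup>2) *\<^sub>R (conv \<kappa> v t - 2 *\<^sub>R conv \<kappa> (delay h v) t + conv \<kappa> (delay (2 * h) v) t)"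
    unfolding delay2_def[abs_def] conv_scaleR[OF \<kappa>]
    by (simp add: conv_add[OF \<kappa> L1_on_diff[OF v 2] 1(2)] conv_diff[OF \<kappa> v 2] conv_scaleR[OF \<kappa>])
  then show ?thesis using h by (simp add: diff2_def conv_delay[OF \<kappa> v])
qed

lemma ramp_delay2: "(\<And>T. L1_on T v) \<Longrightarrow> 0 \<le> h \<Longrightarrow> ramp (delay2 h v) t = diff2 h (ramp v) t"
  unfolding ramp_def by (rule conv_delay2[OF kern_ramp])

lemma DERIV_max_square: "((\<lambda>s::real. (max 0 s)\<^sup>2 / 2) has_real_derivative max 0 t) (at t)"
proof -
  consider "t = 0" | "t < 0" | "t > 0" by linarith
  then show ?thesis
  proof cases
    case 1
    have "((\<lambda>s::real. (max 0 s)\<^sup>2 / 2) has_real_derivative 0) (at 0)"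
      by (rule DERIV_zero_quadratic[where K=1]) (auto simp: max_def)
    then show ?thesis by (simp add: 1)
  next
    case 2
    have "\<forall>\<^sub>F s in nhds t. s \<in> {..<0}" using 2 by (intro eventually_nhds_in_open) auto
    then have ev: "\<forall>\<^sub>F s in nhds t. (max 0 s)\<^sup>2 / 2 = 0" by eventually_elim simp
    have "((\<lambda>s::real. (max 0 s)\<^sup>2 / 2) has_real_derivative 0) (at t)"
      by (subst DERIV_cong_ev[OF refl ev refl]) simp
    then show ?thesis using 2 by (simp add: max_def)
  next
    case 3
    have "\<forall>\<^sub>F s in nhds t. s \<in> {0<..}" using 3 by (intro eventually_nhds_in_open) auto
    then have ev: "\<forall>\<^sub>F s in nhds t. (max 0 s)\<^sup>2 / 2 = s\<^sup>2 / 2" by eventually_elim simp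
    have "((\<lambda>s::real. s\<^sup>2 / 2) has_real_derivative t) (at t)" by (auto intro!: derivative_eq_intros)
    then have "((\<lambda>s::real. (max 0 s)\<^sup>2 / 2) has_real_derivative t) (at t)"
      by (subst DERIV_cong_ev[OF refl ev refl])
    then show ?thesis using 3 by (simp add: max_def)
  qed
qed

text \<open>The triangle on [0, 2 h] of height 1 / h, hence of area 1.\<close>

definition hat :: "real \<Rightarrow> real \<Rightarrow> real" where "hat h = diff2 h (max 0)"

text \<open>All integrals of \<open>hat\<close> come from one antiderivative, the second difference
  quotient of half the square of max 0 s, which is 0 at 0 and constantly 1 from 2 h on.\<close>

lemma hat_facts:
  assumes h: "h > 0"
  shows "0 \<le> hat h t" "t \<ge> 2 * h \<Longrightarrow> hat h t = 0" "continuous_on S (hat h)"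
    "0 \<le> t \<Longrightarrow> (hat h has_integral diff2 h (\<lambda>s. (max 0 s)\<^sup>2 / 2) t) {0..t}"
    "0 \<le> t \<Longrightarrow> ((\<lambda>s. hat h (t - s)) has_integral diff2 h (\<lambda>s. (max 0 s)\<^sup>2 / 2) t) {0..t}"
    "t \<ge> 2 * h \<Longrightarrow> diff2 h (\<lambda>s. (max 0 s)\<^sup>2 / 2) t = 1"
proof -
  show "0 \<le> hat h t" using h by (auto simp: hat_def diff2_def max_def)
  show "hat h t = 0" if "t \<ge> 2 * h" using h that by (simp add: hat_def diff2_def)
  show "continuous_on S (hat h)" unfolding hat_def diff2_def by (intro continuous_intros)
  let ?H = "diff2 h (\<lambda>s. (max 0 s)\<^sup>2 / 2)"
  have H: "(?H has_real_derivative hat h t) (at t)" for t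
  proof -
    have "((\<lambda>t. (max 0 (t - a))\<^sup>2 / 2) has_real_derivative max 0 (t - a) * 1) (at t)" for a
      by (rule DERIV_chain2[OF DERIV_max_square]) (auto intro!: derivative_eq_intros)
    then have d: "((\<lambda>t. (max 0 (t - a))\<^sup>2 / 2) has_real_derivative max 0 (t - a)) (at t)" for a by simp
    have "((\<lambda>t. (1 / h\<^sup>2) * ((max 0 t)\<^sup>2 / 2 - 2 * ((max 0 (t - h))\<^sup>2 / 2) + (max 0 (t - 2 * h))\<^sup>2 / 2)) has_real_derivative
      (1 / h\<^sup>2) * (max 0 t - 2 * max 0 (t - h) + max 0 (t - 2 * h))) (at t)"
      by (intro DERIV_cmult DERIV_add DERIV_diff d DERIV_max_square)
    then show ?thesis by (simp add: diff2_def[abs_def] hat_def)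
  qed
  have H0: "?H 0 = 0" using h by (simp add: diff2_def)
  show "(hat h has_integral ?H t) {0..t}" if t: "0 \<le> t"
  proof -
    have "(hat h has_integral ?H t - ?H 0) {0..t}"
      by (rule fundamental_theorem_of_calculus[OF t])
        (use H in \<open>auto simp: has_real_derivative_iff_has_vector_derivative intro: has_vector_derivative_at_within\<close>)
    then show ?thesis by (simp add: H0)
  qed
  show "((\<lambda>s. hat h (t - s)) has_integral ?H t) {0..t}" if t: "0 \<le> t"
  proof -
    have "((\<lambda>s. - ?H (t - s)) has_real_derivative hat h (t - s)) (at s)" for s
    proof -
      have "((\<lambda>s. ?H (t - s)) has_real_derivative hat h (t - s) * (- 1)) (at s)"
        by (rule DERIV_chain2[OF H]) (auto intro!: derivative_eq_intros)
      from DERIV_minus[OF this] show ?thesis by simp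
    qed
    then have "((\<lambda>s. hat h (t - s)) has_integral (- ?H (t - t)) - (- ?H (t - 0))) {0..t}"
      by (intro fundamental_theorem_of_calculus[OF t])
        (auto simp: has_real_derivative_iff_has_vector_derivative intro: has_vector_derivative_at_within)
    then show ?thesis by (simp add: H0)
  qed
  show "?H t = 1" if "t \<ge> 2 * h"
    using h that by (simp add: diff2_def) (simp add: field_simps power2_eq_square)
qed

lemma hat_integral_le_1:
  assumes h: "h > 0" and t: "0 \<le> t"
  shows "integral {0..t} (hat h) \<le> 1" "0 \<le> integral {0..t} (hat h)"
proof -
  have i: "hat h integrable_on {0..s}" for s by (intro integrable_continuous_real hat_facts h)
  have "integral {0..t} (hat h) \<le> integral {0..t + 2 * h} (hat h)"
    by (rule integral_subset_le) (use h i hat_facts(1)[OF h] in auto)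
  also have "\<dots> = 1" using hat_facts(4,6)[OF h, of "t + 2 * h"] t h by (simp add: integral_unique)
  finally show "integral {0..t} (hat h) \<le> 1" .
  show "0 \<le> integral {0..t} (hat h)" by (rule integral_nonneg[OF i]) (simp add: hat_facts[OF h])
qed

lemma kern_scalar:
  fixes g :: "real \<Rightarrow> real"
  assumes g: "continuous_on {0..} g"
  shows "kern (\<lambda>t (x::'a::banach). g t *\<^sub>R x)"
  unfolding kern_def
proof (intro conjI allI)
  show "linear (\<lambda>x::'a. g t *\<^sub>R x)" for t by (intro linear_compose_scale_right linear_id[unfolded id_def])
  show "continuous_on {0..} (\<lambda>t. g t *\<^sub>R x)" for x :: 'a by (rule continuous_on_scaleR[OF g continuous_on_const])
  fix T
  have "continuous_on {0..T} g" by (rule continuous_on_subset[OF g]) auto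
  then obtain B where "0 \<le> B" "\<And>s. s \<in> {0..T} \<Longrightarrow> norm (g s) \<le> B" using continuous_on_interval_bounded by blast
  then show "\<exists>M\<ge>0. \<forall>t\<in>{0..T}. \<forall>x::'a. norm (g t *\<^sub>R x) \<le> M * norm x"
    by (intro exI[of _ B]) (auto intro: mult_right_mono)
qed

text \<open>The differences can be taken of the kernel of \<open>ramp\<close>. Second difference
  quotients after second integration therefore amount to averaging against \<open>hat\<close>, an
  approximate identity.\<close>

lemma diff2_ramp:
  assumes v: "\<And>T. L1_on T v" and h: "h > 0"
  shows "diff2 h (ramp v) t = conv (\<lambda>t x. hat h t *\<^sub>R x) v t"
proof -
  have sh: "ramp v (t - a) = conv (\<lambda>r x. max 0 (r - a) *\<^sub>R x) v t" if a: "0 \<le> a" for a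
  proof -
    have k: "kern (\<lambda>r x. max 0 (r - a) *\<^sub>R x)" by (rule kern_scalar) (intro continuous_intros)
    have i: "(\<lambda>s. max 0 (t - s - a) *\<^sub>R v s) integrable_on {0..t}"
      by (rule L1_on_integrable[OF L1_on_kern[OF k v]])
    have z: "integral S (\<lambda>s. max 0 (t - s - a) *\<^sub>R v s) = 0" if "\<And>s. s \<in> S \<Longrightarrow> t - a \<le> s" for S
    proof -
      have "integral S (\<lambda>s. max 0 (t - s - a) *\<^sub>R v s) = integral S (\<lambda>s. 0)"
        by (rule integral_cong) (use that in \<open>force simp: max_def\<close>)
      then show ?thesis by simp
    qed
    show ?thesis
    proof (cases "a \<le> t")
      case True
      have "conv (\<lambda>r x. max 0 (r - a) *\<^sub>R x) v t = integral {0..t - a} (\<lambda>s. max 0 (t - s - a) *\<^sub>R v s) + integral {t - a..t} (\<lambda>s. max 0 (t - s - a) *\<^sub>R v s)"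
        unfolding conv_def using True a by (intro Henstock_Kurzweil_Integration.integral_combine[symmetric] i) auto
      also have "integral {t - a..t} (\<lambda>s. max 0 (t - s - a) *\<^sub>R v s) = 0" by (rule z) auto
      also have "integral {0..t - a} (\<lambda>s. max 0 (t - s - a) *\<^sub>R v s) = ramp v (t - a)"
        unfolding ramp_eq by (rule integral_cong) (auto simp: max_def algebra_simps)
      finally show ?thesis by simp
    next
      case False
      then show ?thesis unfolding conv_def ramp_eq by (subst z) auto
    qed
  qed
  have k: "kern (\<lambda>r x. max 0 (r - a) *\<^sub>R x)" for a :: real by (rule kern_scalar) (intro continuous_intros)
  have i: "(\<lambda>s. max 0 (t - s - a) *\<^sub>R v s) integrable_on {0..t}" for a
    by (rule L1_on_integrable[OF L1_on_kern[OF k v]])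
  have "diff2 h (ramp v) t = (1 / h\<^sup>2) *\<^sub>R (integral {0..t} (\<lambda>s. max 0 (t - s - 0) *\<^sub>R v s) - 2 *\<^sub>R integral {0..t} (\<lambda>s. max 0 (t - s - h) *\<^sub>R v s)
     + integral {0..t} (\<lambda>s. max 0 (t - s - 2 * h) *\<^sub>R v s))"
    using sh[of 0] sh[of h] sh[of "2 * h"] h by (simp add: diff2_def conv_def)
  also have "((\<lambda>s. (1 / h\<^sup>2) *\<^sub>R (max 0 (t - s - 0) *\<^sub>R v s - 2 *\<^sub>R (max 0 (t - s - h) *\<^sub>R v s) + max 0 (t - s - 2 * h) *\<^sub>R v s)) has_integral \<dots>) {0..t}"
    by (intro has_integral_cmul has_integral_add has_integral_diff integrable_integral i)
  moreover have "(1 / h\<^sup>2) *\<^sub>R (max 0 (t - s - 0) *\<^sub>R v s - 2 *\<^sub>R (max 0 (t - s - h) *\<^sub>R v s) + max 0 (t - s - 2 * h) *\<^sub>R v s) = hat h (t - s) *\<^sub>R v s" for s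
    by (simp add: hat_def diff2_def algebra_simps)
  ultimately have "((\<lambda>s. hat h (t - s) *\<^sub>R v s) has_integral diff2 h (ramp v) t) {0..t}" by simp
  then show ?thesis by (simp add: conv_def integral_unique)
qed

text \<open>Young's inequality: by \<open>integral_conv\<close> the total weight that
  \<open>hat\<close> puts on \<open>v s\<close> is its integral over {0..T - s}, which is at most
  1.\<close>

lemma integral_norm_conv_hat_le:
  fixes v :: "real \<Rightarrow> 'a::banach"
  assumes v: "L1_on T v" and h: "h > 0" and T: "0 \<le> T"
  shows "integral {0..T} (\<lambda>t. norm (conv (\<lambda>t x. hat h t *\<^sub>R x) v t)) \<le> integral {0..T} (\<lambda>t. norm (v t))"
proof -
  let ?n = "\<lambda>s. norm (v s)"
  have n: "L1_on T ?n" by (rule L1_on_norm[OF v])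
  have kr: "kern (\<lambda>t x::real. hat h t *\<^sub>R x)" and ka: "kern (\<lambda>t x::'a. hat h t *\<^sub>R x)"
    by (rule kern_scalar[OF hat_facts(3)[OF h]])+
  have "integral {0..T} (\<lambda>t. norm (conv (\<lambda>t x. hat h t *\<^sub>R x) v t)) \<le> integral {0..T} (conv (\<lambda>t x. hat h t *\<^sub>R x) ?n)"
  proof (rule integral_le)
    show "(\<lambda>t. norm (conv (\<lambda>t x. hat h t *\<^sub>R x) v t)) integrable_on {0..T}"
      by (intro integrable_continuous_real continuous_on_norm conv_continuous[OF ka v])
    show "conv (\<lambda>t x. hat h t *\<^sub>R x) ?n integrable_on {0..T}"
      by (intro integrable_continuous_real conv_continuous[OF kr n])
    fix t assume t: "t \<in> {0..T}"
    show "norm (conv (\<lambda>t x. hat h t *\<^sub>R x) v t) \<le> conv (\<lambda>t x. hat h t *\<^sub>R x) ?n t"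
      unfolding conv_def
    proof (rule integral_norm_bound_integral)
      show "(\<lambda>s. hat h (t - s) *\<^sub>R v s) integrable_on {0..t}"
        by (rule L1_on_integrable[OF L1_on_kern[OF ka L1_on_subset[OF v]]]) (use t in simp)
      show "(\<lambda>s. hat h (t - s) *\<^sub>R norm (v s)) integrable_on {0..t}"
        by (rule L1_on_integrable[OF L1_on_kern[OF kr L1_on_subset[OF n]]]) (use t in simp)
    qed (simp add: hat_facts[OF h])
  qed
  also have "\<dots> = conv (\<lambda>t x. integral {0..t} (\<lambda>r. hat h r *\<^sub>R x)) ?n T"
    by (rule integral_conv[OF kr n T])
  also have "\<dots> \<le> integral {0..T} ?n"
    unfolding conv_def
  proof (rule integral_le)
    show "(\<lambda>s. integral {0..T - s} (\<lambda>r. hat h r *\<^sub>R norm (v s))) integrable_on {0..T}"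
      using L1_on_integrable[OF L1_on_kern[OF kern_primitive[OF kr] n]] .
    show "?n integrable_on {0..T}" by (rule L1_on_integrable[OF n])
    fix s assume "s \<in> {0..T}"
    then show "integral {0..T - s} (\<lambda>r. hat h r *\<^sub>R norm (v s)) \<le> norm (v s)"
      using hat_integral_le_1[OF h, of "T - s"] by (simp add: mult_left_le_one_le)
  qed
  finally show ?thesis .
qed

text \<open>From 2 h on the averages have full mass, and uniform continuity applies. Before that
  mass is missing, and the crude bound 2 B is used on this short interval.\<close>

lemma conv_hat_continuous_approx:
  fixes q :: "real \<Rightarrow> 'a::banach"
  assumes q: "continuous_on {0..T} q" and T: "0 \<le> T" and e: "e > 0"
  shows "\<exists>d>0. \<forall>h. 0 < h \<and> h < d \<longrightarrow> integral {0..T} (\<lambda>t. norm (conv (\<lambda>t x. hat h t *\<^sub>R x) q t - q t)) \<le> e"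
proof -
  obtain B where B: "0 \<le> B" "\<And>s. s \<in> {0..T} \<Longrightarrow> norm (q s) \<le> B" using continuous_on_interval_bounded[OF q] by blast
  define e1 where "e1 = e / (2 * (T + 1))"
  have e1: "e1 > 0" "e1 * T \<le> e / 2" using e T by (auto simp: e1_def field_simps)
  have "uniformly_continuous_on {0..T} q" by (intro compact_uniformly_continuous q) auto
  then obtain d where d: "d > 0" "\<And>s t. s \<in> {0..T} \<Longrightarrow> t \<in> {0..T} \<Longrightarrow> dist s t < d \<Longrightarrow> dist (q s) (q t) < e1"
    unfolding uniformly_continuous_on_def using e1 by metis
  \<comment> \<open>2 h < d keeps the averaging window within the modulus of continuity; 8 h (B + 1)
    \<le> e makes the initial layer of length 2 h contribute at most e / 2.\<close>
  define d' where "d' = min (d / 2) (e / (8 * (B + 1)))"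
  have d': "d' > 0" using d e B by (simp add: d'_def)
  have "integral {0..T} (\<lambda>t. norm (conv (\<lambda>t x. hat h t *\<^sub>R x) q t - q t)) \<le> e" if h: "0 < h" "h < d'" for h
  proof -
    let ?c = "conv (\<lambda>t x. hat h t *\<^sub>R x) q"
    have k: "kern (\<lambda>t x::'a. hat h t *\<^sub>R x)" by (rule kern_scalar[OF hat_facts(3)[OF h(1)]])
    have qL: "L1_on T q" by (rule L1_on_continuous[OF q])
    have hd: "2 * h < d" "8 * h * (B + 1) \<le> e" using h B e by (auto simp: d'_def field_simps)
    have hq: "(\<lambda>s. hat h (t - s) *\<^sub>R q s) integrable_on {0..t}" if "t \<in> {0..T}" for t
      by (rule L1_on_integrable[OF L1_on_kern[OF k L1_on_subset[OF qL]]]) (use that in simp)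
    have far: "norm (?c t - q t) \<le> e1" if t: "t \<in> {0..T}" "2 * h \<le> t" for t
    proof -
      have one: "((\<lambda>s. hat h (t - s)) has_integral 1) {0..t}"
        using hat_facts(5,6)[OF h(1), of t] t by simp
      have I: "((\<lambda>s. hat h (t - s) *\<^sub>R q s - hat h (t - s) *\<^sub>R q t) has_integral ?c t - 1 *\<^sub>R q t) {0..t}"
        unfolding conv_def by (intro has_integral_diff integrable_integral hq t has_integral_scaleR_left one)
      then have "?c t - q t = integral {0..t} (\<lambda>s. hat h (t - s) *\<^sub>R q s - hat h (t - s) *\<^sub>R q t)"
        by (simp add: integral_unique)
      also have "norm \<dots> \<le> integral {0..t} (\<lambda>s. e1 * hat h (t - s))"
      proof (rule integral_norm_bound_integral)
        show "(\<lambda>s. hat h (t - s) *\<^sub>R q s - hat h (t - s) *\<^sub>R q t) integrable_on {0..t}" using I by blast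
        show "(\<lambda>s. e1 * hat h (t - s)) integrable_on {0..t}" using has_integral_mult_right[OF one, of e1] by blast
        fix s assume s: "s \<in> {0..t}"
        show "norm (hat h (t - s) *\<^sub>R q s - hat h (t - s) *\<^sub>R q t) \<le> e1 * hat h (t - s)"
        proof (cases "t - s \<ge> 2 * h")
          case True
          then show ?thesis by (simp add: hat_facts(2)[OF h(1)])
        next
          case False
          then have "norm (q s - q t) \<le> e1" using d(2)[of s t] s t hd by (auto simp: dist_norm less_imp_le)
          then show ?thesis
            using mult_right_mono[of "norm (q s - q t)" e1 "hat h (t - s)"] hat_facts(1)[OF h(1), of "t - s"]
            by (simp add: scaleR_diff_right[symmetric] mult.commute)
        qed
      qed
      also have "\<dots> = e1" using integral_unique[OF one] by simp
      finally show ?thesis .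
    qed
    have near: "norm (?c t - q t) \<le> 2 * B" if t: "t \<in> {0..T}" for t
    proof -
      have hint: "((\<lambda>s. hat h (t - s)) has_integral integral {0..t} (hat h)) {0..t}"
        using hat_facts(4,5)[OF h(1), of t] t by (simp add: integral_unique)
      have "norm (?c t) \<le> integral {0..t} (\<lambda>s. B * hat h (t - s))"
        unfolding conv_def
      proof (rule integral_norm_bound_integral[OF hq[OF t]])
        show "(\<lambda>s. B * hat h (t - s)) integrable_on {0..t}" using has_integral_mult_right[OF hint, of B] by blast
        show "norm (hat h (t - s) *\<^sub>R q s) \<le> B * hat h (t - s)" if "s \<in> {0..t}" for s
          using B(2)[of s] that t hat_facts(1)[OF h(1), of "t - s"] by (simp add: mult.commute mult_right_mono)
      qed
      also have "\<dots> = B * integral {0..t} (hat h)" using integral_unique[OF hint] by simp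
      also have "\<dots> \<le> B * 1" using hat_integral_le_1[OF h(1), of t] t B by (intro mult_left_mono) auto
      finally show ?thesis using norm_triangle_ineq4[of "?c t" "q t"] B(2)[OF t] by simp
    qed
    define r where "r t = e1 + (if t \<in> {0..min T (2 * h)} then 2 * B else 0)" for t
    have "((\<lambda>t. 2 * B) has_integral min T (2 * h) * (2 * B)) {0..min T (2 * h)}"
      using has_integral_const_real[of "2 * B" 0 "min T (2 * h)"] T h by simp
    then have "((\<lambda>t. if t \<in> {0..min T (2 * h)} then 2 * B else 0) has_integral min T (2 * h) * (2 * B)) {0..T}"
      by (subst has_integral_restrict) auto
    then have r: "(r has_integral e1 * T + min T (2 * h) * (2 * B)) {0..T}"
      unfolding r_def using has_integral_add[OF has_integral_const_real[of e1 0 T]] T by (simp add: mult.commute)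
    have "integral {0..T} (\<lambda>t. norm (?c t - q t)) \<le> integral {0..T} r"
    proof (rule integral_le)
      show "(\<lambda>t. norm (?c t - q t)) integrable_on {0..T}"
        by (intro integrable_continuous_real continuous_intros conv_continuous[OF k qL] q)
      show "r integrable_on {0..T}" using r by blast
      fix t assume t: "t \<in> {0..T}"
      show "norm (?c t - q t) \<le> r t"
      proof (cases "2 * h \<le> t")
        case True
        then show ?thesis using far[OF t True] B by (auto simp: r_def)
      next
        case False
        then show ?thesis using near[OF t] e1 t by (simp add: r_def)
      qed
    qed
    also have "\<dots> = e1 * T + min T (2 * h) * (2 * B)" by (rule integral_unique[OF r])
    also have "\<dots> \<le> e / 2 + (2 * h) * (2 * B)" using e1 B by (intro add_mono mult_right_mono) auto
    also have "\<dots> \<le> e" using hd(2) h B by (simp add: algebra_simps)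
    finally show ?thesis .
  qed
  then show ?thesis using d' by blast
qed

text \<open>Density of continuous functions: the error \<open>v - q\<close> is not amplified by the
  averaging (\<open>integral_norm_conv_hat_le\<close>), which leaves a continuous input.\<close>

lemma diff2_ramp_approx:
  fixes v :: "real \<Rightarrow> 'a::banach"
  assumes v: "\<And>T. L1_on T v" and T: "0 \<le> T" and e: "e > 0"
  shows "\<exists>d>0. \<forall>h. 0 < h \<and> h < d \<longrightarrow> integral {0..T} (\<lambda>t. norm (diff2 h (ramp v) t - v t)) \<le> e"
proof -
  have e3: "e / 3 > 0" using e by simp
  obtain q r where q: "continuous_on {0..T} q" and r: "r integrable_on {0..T}"
    and le: "\<And>s. s \<in> {0..T} \<Longrightarrow> norm (v s - q s) \<le> r s" and small: "integral {0..T} r \<le> e / 3"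
    using L1_onE[OF v e3] by blast
  have qL: "L1_on T q" by (rule L1_on_continuous[OF q])
  have vq: "integral {0..T} (\<lambda>t. norm (v t - q t)) \<le> e / 3"
    by (rule order_trans[OF integral_le small]) (use r le L1_on_norm_integrable[OF L1_on_diff[OF v qL]] in auto)
  obtain d where d: "d > 0" "\<And>h. 0 < h \<Longrightarrow> h < d \<Longrightarrow> integral {0..T} (\<lambda>t. norm (conv (\<lambda>t x. hat h t *\<^sub>R x) q t - q t)) \<le> e / 3"
    using conv_hat_continuous_approx[OF q T e3] by blast
  have "integral {0..T} (\<lambda>t. norm (diff2 h (ramp v) t - v t)) \<le> e" if h: "0 < h" "h < d" for h
  proof -
    let ?k = "\<lambda>t (x::'a). hat h t *\<^sub>R x"
    have k: "kern ?k" by (rule kern_scalar[OF hat_facts(3)[OF h(1)]])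
    have cL: "L1_on T (conv ?k w)" if "L1_on T w" for w by (rule L1_on_continuous[OF conv_continuous[OF k that]])
    let ?a = "\<lambda>t. norm (conv ?k (\<lambda>s. v s - q s) t)" and ?b = "\<lambda>t. norm (conv ?k q t - q t)" and ?c = "\<lambda>t. norm (v t - q t)"
    have i: "?a integrable_on {0..T}" "?b integrable_on {0..T}" "?c integrable_on {0..T}"
      by (intro L1_on_norm_integrable cL L1_on_diff v qL)+
    have "integral {0..T} (\<lambda>t. norm (diff2 h (ramp v) t - v t)) \<le> integral {0..T} (\<lambda>t. ?a t + ?b t + ?c t)"
    proof (rule integral_le)
      show "(\<lambda>t. norm (diff2 h (ramp v) t - v t)) integrable_on {0..T}"
        unfolding diff2_ramp[OF v h(1)] by (intro L1_on_norm_integrable L1_on_diff cL v)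
      show "(\<lambda>t. ?a t + ?b t + ?c t) integrable_on {0..T}"
        by (intro Henstock_Kurzweil_Integration.integrable_add i)
      fix t assume t: "t \<in> {0..T}"
      have vt: "L1_on t v" "L1_on t q" using t by (auto intro: v L1_on_subset[OF qL])
      have "diff2 h (ramp v) t - v t = conv ?k (\<lambda>s. v s - q s) t + (conv ?k q t - q t) - (v t - q t)"
        unfolding diff2_ramp[OF v h(1)] by (simp add: conv_diff[OF k vt])
      then show "norm (diff2 h (ramp v) t - v t) \<le> ?a t + ?b t + ?c t"
        using norm_triangle_ineq4[of "conv ?k (\<lambda>s. v s - q s) t + (conv ?k q t - q t)" "v t - q t"]
          norm_triangle_ineq[of "conv ?k (\<lambda>s. v s - q s) t" "conv ?k q t - q t"] by simp
    qed
    also have "\<dots> = integral {0..T} ?a + integral {0..T} ?b + integral {0..T} ?c"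
      by (simp add: Henstock_Kurzweil_Integration.integral_add i Henstock_Kurzweil_Integration.integrable_add)
    also have "\<dots> \<le> e / 3 + e / 3 + e / 3"
      by (intro add_mono vq d(2) h order_trans[OF integral_norm_conv_hat_le[OF L1_on_diff[OF v qL] h(1) T] vq])
    finally show ?thesis by simp
  qed
  then show ?thesis using d(1) by blast
qed

section \<open>The duality estimate\<close>

text \<open>The input is the difference of two constant inputs, switched on at a and at b; each
  contributes a primitive of the kernel, which is 0 as long as its interval is empty.\<close>

lemma conv_step:
  fixes \<kappa> :: "real \<Rightarrow> 'a::banach \<Rightarrow> 'b::banach"
  assumes \<kappa>: "kern \<kappa>" and a: "0 \<le> a" "a \<le> b"
  shows "((\<lambda>s. \<kappa> (t - s) (indicat_real {a..<b} s *\<^sub>R u)) has_integral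
    integral {0..t - a} (\<lambda>r. \<kappa> r u) - integral {0..t - b} (\<lambda>r. \<kappa> r u)) {0..t}"
proof -
  have kc: "continuous_on {0..S} (\<lambda>r. \<kappa> r u)" for S by (rule continuous_on_subset[OF kern_continuous[OF \<kappa>]]) auto
  have refl: "((\<lambda>s. \<kappa> (S - s) u) has_integral integral {0..S} (\<lambda>r. \<kappa> r u)) {0..S}" for S
  proof -
    have "((\<lambda>s. \<kappa> (- s) u) has_integral integral {0..S} (\<lambda>r. \<kappa> r u)) {- S..- 0}"
      using has_integral_reflect_real[of "\<lambda>r. \<kappa> r u" _ S 0] integrable_integral[OF integrable_continuous_real[OF kc]] by simp
    then have "((\<lambda>s. \<kappa> (- (s + (- S))) u) has_integral integral {0..S} (\<lambda>r. \<kappa> r u)) {- S - (- S)..- 0 - (- S)}"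
      by (subst (asm) has_integral_shift_real_ivl_iff[where c="- S"])
    then show ?thesis by simp
  qed
  have d: "((\<lambda>s. if s < c then 0 else \<kappa> (t - s) u) has_integral integral {0..t - c} (\<lambda>r. \<kappa> r u)) {0..t}" if "0 \<le> c" for c
    using has_integral_delay[OF refl that, of t] diff_diff_eq2[of "t - c" _ c] by (simp only: diff_add_cancel)
  have "(if s < a then 0 else \<kappa> (t - s) u) - (if s < b then 0 else \<kappa> (t - s) u) = \<kappa> (t - s) (indicat_real {a..<b} s *\<^sub>R u)" for s
    using a linear_0[OF kern_linear[OF \<kappa>]] by (auto simp: indicator_def)
  then show ?thesis using has_integral_diff[OF d d, of a b] a by simp
qed

definition step_fun :: "real \<Rightarrow> nat \<Rightarrow> (nat \<Rightarrow> 'a::real_vector) \<Rightarrow> real \<Rightarrow> 'a" where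
  "step_fun d n u s = (\<Sum>k<n. indicat_real {real k * d..<real (Suc k) * d} s *\<^sub>R u k)"

lemma conv_step_fun:
  assumes \<kappa>: "kern \<kappa>" and d: "0 \<le> d"
  shows "conv \<kappa> (step_fun d n u) t = (\<Sum>k<n. integral {0..t - real k * d} (\<lambda>r. \<kappa> r (u k)) - integral {0..t - real (Suc k) * d} (\<lambda>r. \<kappa> r (u k)))"
proof -
  have "((\<lambda>s. \<Sum>k<n. \<kappa> (t - s) (indicat_real {real k * d..<real (Suc k) * d} s *\<^sub>R u k)) has_integral
    (\<Sum>k<n. integral {0..t - real k * d} (\<lambda>r. \<kappa> r (u k)) - integral {0..t - real (Suc k) * d} (\<lambda>r. \<kappa> r (u k)))) {0..t}"
    using d by (intro has_integral_sum conv_step[OF \<kappa>] mult_right_mono) auto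
  moreover have "(\<Sum>k<n. \<kappa> (t - s) (indicat_real {real k * d..<real (Suc k) * d} s *\<^sub>R u k)) = \<kappa> (t - s) (step_fun d n u s)" for s
    unfolding step_fun_def by (rule linear_sum[OF kern_linear[OF \<kappa>], symmetric])
  ultimately show ?thesis by (simp add: conv_def integral_unique)
qed

text \<open>The cells are half-open and disjoint, so at most one term is nonzero.\<close>

lemma norm_step_fun:
  fixes u :: "nat \<Rightarrow> 'a::real_normed_vector"
  assumes d: "d > 0" and u: "\<And>k. norm (u k) \<le> 1"
  shows "norm (step_fun d n u s) \<le> 1"
proof (cases "\<exists>j<n. s \<in> {real j * d..<real (Suc j) * d}")
  case True
  then obtain j where j: "j < n" "s \<in> {real j * d..<real (Suc j) * d}" by blast
  have "s \<notin> {real k * d..<real (Suc k) * d}" if "k \<noteq> j" for k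
  proof
    assume "s \<in> {real k * d..<real (Suc k) * d}"
    then have "real k * d < real (Suc j) * d" "real j * d < real (Suc k) * d" using j(2) by auto
    then have "k < Suc j" "j < Suc k" using d by (auto simp: mult_less_cancel_right_disj)
    with that show False by simp
  qed
  then have "step_fun d n u s = (\<Sum>k<n. if k = j then u j else 0)"
    unfolding step_fun_def using j(2) by (intro sum.cong) (auto simp: indicator_def)
  then show ?thesis using j u by simp
next
  case False
  then have "step_fun d n u s = (\<Sum>k<n. 0)"
    unfolding step_fun_def by (intro sum.cong) (auto simp: indicator_def)
  then show ?thesis by simp
qed

lemma step_fun_Linf:
  fixes u :: "nat \<Rightarrow> 'a::cbanach"
  assumes d: "d > 0" and u: "\<And>k. norm (u k) \<le> 1"
  shows "Linf_loc (step_fun d n u)" "Linf_norm t (step_fun d n u) \<le> 1"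
proof -
  have sf: "simple_function (lebesgue_on {0..t}) (step_fun d n u)" for t
  proof (induction n)
    case 0
    then show ?case by (simp add: step_fun_def[abs_def])
  next
    case (Suc n)
    let ?A = "{real n * d..<real (Suc n) * d}"
    have "simple_function (lebesgue_on {0..t}) (indicat_real (?A \<inter> {0..t}))"
      by (rule simple_function_indicator) (simp add: sets_restrict_space_iff)
    then have "simple_function (lebesgue_on {0..t}) (\<lambda>s. step_fun d n u s + indicat_real (?A \<inter> {0..t}) s *\<^sub>R u n)"
      by (rule simple_function_compose2[OF Suc, where h="\<lambda>x y. x + y *\<^sub>R u n"])
    then show ?case
      by (subst simple_function_cong[where g="\<lambda>s. step_fun d n u s + indicat_real (?A \<inter> {0..t}) s *\<^sub>R u n"])
        (auto simp: step_fun_def indicator_def)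
  qed
  show le: "Linf_norm t (step_fun d n u) \<le> 1" for t
    unfolding Linf_norm_def
  proof (rule esssup_I)
    have "(\<lambda>s. norm (step_fun d n u s)) \<in> borel_measurable (lebesgue_on {0..t})"
      by (rule borel_measurable_simple_function) (rule simple_function_compose1[OF sf])
    then show "(\<lambda>s. ennreal (norm (step_fun d n u s))) \<in> borel_measurable (lebesgue_on {0..t})" by measurable
    show "AE s in lebesgue_on {0..t}. ennreal (norm (step_fun d n u s)) \<le> 1"
      using norm_step_fun[OF d u] by (intro AE_I2) (simp add: ennreal_le_1)
  qed
  have "strongly_measurable (lebesgue_on {0..t}) (step_fun d n u)" for t
    unfolding strongly_measurable_def using sf by (intro exI[of _ "\<lambda>i. step_fun d n u"]) simp
  then show "Linf_loc (step_fun d n u)"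
    unfolding Linf_loc_def using le_less_trans[OF le, of \<infinity>] by simp
qed

text \<open>The substitution of s + a for s. The pieces lost at the two ends vanish, because there
  the argument of \<open>R\<close> or of \<open>F\<close> is at most 0.\<close>

lemma pairing_shift:
  fixes R :: "real \<Rightarrow> 'y::cbanach cdual" and F :: "real \<Rightarrow> 'y"
  assumes R: "continuous_on UNIV R" "\<And>t. t \<le> 0 \<Longrightarrow> R t = 0" and F: "continuous_on UNIV F" "\<And>t. t \<le> 0 \<Longrightarrow> F t = 0"
    and a: "0 \<le> a" and T: "0 \<le> T"
  shows "integral {0..T} (\<lambda>s. cdual_apply (R (s - a)) (F (T - s))) = integral {0..T} (\<lambda>s. cdual_apply (R s) (F (T - s - a)))"
proof -
  let ?f = "\<lambda>s. cdual_apply (R s) (F (T - a - s))"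
  have c: "continuous_on S ?f" for S
    by (intro bounded_bilinear.continuous_on[OF bounded_bilinear_cdual_apply] continuous_on_subset[OF R(1)]
       continuous_on_compose2[OF F(1)]) (auto intro!: continuous_intros)
  have i: "?f integrable_on {b..b'}" for b b' by (intro integrable_continuous_real c)
  have "((\<lambda>s. if s < a then 0 else ?f (s - a)) has_integral integral {0..T - a} ?f) {0..T}"
    by (rule has_integral_delay[OF integrable_integral[OF i] a])
  moreover have "(if s < a then 0 else ?f (s - a)) = cdual_apply (R (s - a)) (F (T - s))" for s
    by (simp add: R(2) cdual_simps)
  ultimately have 1: "integral {0..T} (\<lambda>s. cdual_apply (R (s - a)) (F (T - s))) = integral {0..T - a} ?f"
    by (simp add: integral_unique)
  have z: "integral {b..T} ?f = 0" if "T - a \<le> b" for b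
  proof -
    have "integral {b..T} ?f = integral {b..T} (\<lambda>s. 0)"
      by (rule integral_cong) (use that in \<open>simp add: F(2) cdual_simps\<close>)
    then show ?thesis by simp
  qed
  have "integral {0..T} ?f = integral {0..T - a} ?f"
  proof (cases "a \<le> T")
    case True
    have "integral {0..T - a} ?f + integral {T - a..T} ?f = integral {0..T} ?f"
      by (rule Henstock_Kurzweil_Integration.integral_combine[OF _ _ i]) (use True a in auto)
    then show ?thesis using z[of "T - a"] by simp
  next
    case False
    then show ?thesis using z[of 0] by simp
  qed
  then show ?thesis unfolding 1 by (simp add: algebra_simps)
qed

lemma continuous_on_diff2:
  fixes F :: "real \<Rightarrow> 'a::real_normed_vector"
  assumes F: "continuous_on UNIV F"
  shows "continuous_on S (diff2 h F)"
proof -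
  have "continuous_on S (\<lambda>t. F (t - a))" for a
    by (rule continuous_on_compose2[OF F]) (auto intro: continuous_intros)
  from this[of 0] this show ?thesis unfolding diff2_def[abs_def] by (intro continuous_intros) simp_all
qed

text \<open>Moving the second difference quotient from \<open>ramp v\<close> to \<open>F\<close> and letting the step tend to \<open>0\<close>
  replaces an integration by parts: \<open>F\<close> need not be twice differentiable.\<close>

lemma pairing_le_ramp:
  fixes v :: "real \<Rightarrow> 'y::cbanach cdual" and F :: "real \<Rightarrow> 'y"
  assumes v: "\<And>T. L1_on T v" and F: "continuous_on UNIV F" "\<And>t. t \<le> 0 \<Longrightarrow> F t = 0"
    and c: "\<And>h r. 0 < h \<Longrightarrow> norm (diff2 h F r) \<le> c" and T: "0 \<le> T"
  shows "cmod (integral {0..T} (\<lambda>s. cdual_apply (v s) (F (T - s)))) \<le> c * integral {0..T} (\<lambda>s. norm (ramp v s))"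
proof (rule field_le_epsilon)
  fix e :: real assume e: "e > 0"
  have Rc: "continuous_on UNIV (ramp v)" and R0: "\<And>t. t \<le> 0 \<Longrightarrow> ramp v t = 0"
    unfolding ramp_def by (rule conv_continuous_UNIV[OF kern_ramp _ v], simp)+
  have c0: "0 \<le> c" using order_trans[OF norm_ge_zero c[of 1]] by simp
  have Fc: "continuous_on S (\<lambda>s. F (T - s))" for S by (intro continuous_on_compose2[OF F(1)] continuous_intros) auto
  obtain B where B: "0 \<le> B" "\<And>s. s \<in> {0..T} \<Longrightarrow> norm (F (T - s)) \<le> B"
    using continuous_on_interval_bounded[OF Fc[of "{0..T}"]] by blast
  have "e / (B + 1) > 0" using e B by simp
  then obtain d where d: "d > 0" "\<And>h. 0 < h \<Longrightarrow> h < d \<Longrightarrow> integral {0..T} (\<lambda>t. norm (diff2 h (ramp v) t - v t)) \<le> e / (B + 1)"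
    using diff2_ramp_approx[OF v T] by blast
  define h where "h = d / 2"
  have h: "0 < h" "h < d" using d(1) by (auto simp: h_def)
  have pair_L1: "L1_on T (\<lambda>s. cdual_apply (w s) (F (T - s)))" if "L1_on T w" for w
  proof (rule L1_on_operator[OF that, where M=B])
    show "norm (cdual_apply x (F (T - s)) - cdual_apply y (F (T - s))) \<le> B * norm (x - y)" if "s \<in> {0..T}" for s x y
      using order_trans[OF norm_cdual_apply[of "x - y" "F (T - s)"] mult_left_mono[OF B(2)[OF that], of "norm (x - y)"]]
      by (simp add: cdual_simps mult.commute)
  qed (intro bounded_bilinear.continuous_on[OF bounded_bilinear_cdual_apply] Fc)
  have dL: "L1_on T (diff2 h (ramp v))" by (intro L1_on_continuous continuous_on_diff2 Rc)
  let ?I = "\<lambda>w. integral {0..T} (\<lambda>s. cdual_apply (w s) (F (T - s)))"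
  have 1: "cmod (?I (diff2 h (ramp v)) - ?I v) \<le> e"
  proof -
    have "?I (diff2 h (ramp v)) - ?I v = integral {0..T} (\<lambda>s. cdual_apply (diff2 h (ramp v) s - v s) (F (T - s)))"
      unfolding cdual_diff_left
      by (rule Henstock_Kurzweil_Integration.integral_diff[symmetric]; rule L1_on_integrable[OF pair_L1]) (rule dL v)+
    also have "cmod \<dots> \<le> integral {0..T} (\<lambda>s. B * norm (diff2 h (ramp v) s - v s))"
    proof (rule integral_norm_bound_integral)
      show "(\<lambda>s. cdual_apply (diff2 h (ramp v) s - v s) (F (T - s))) integrable_on {0..T}"
        by (intro L1_on_integrable pair_L1 L1_on_diff dL v)
      show "(\<lambda>s. B * norm (diff2 h (ramp v) s - v s)) integrable_on {0..T}"
        by (intro integrable_on_mult_right L1_on_norm_integrable L1_on_diff dL v)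
      show "norm (cdual_apply (diff2 h (ramp v) s - v s) (F (T - s))) \<le> B * norm (diff2 h (ramp v) s - v s)" if "s \<in> {0..T}" for s
        using order_trans[OF norm_cdual_apply mult_left_mono[OF B(2)[OF that]]] by (simp add: mult.commute)
    qed
    also have "\<dots> = B * integral {0..T} (\<lambda>s. norm (diff2 h (ramp v) s - v s))" by simp
    also have "\<dots> \<le> B * (e / (B + 1))" by (intro mult_left_mono d(2) h B)
    also have "\<dots> \<le> e" using B e by (simp add: field_simps)
    finally show ?thesis .
  qed
  have 2: "cmod (?I (diff2 h (ramp v))) \<le> c * integral {0..T} (\<lambda>s. norm (ramp v s))"
  proof -
    have i1: "(\<lambda>s. cdual_apply (ramp v (s - a)) (F (T - s))) integrable_on {0..T}" for a
      by (intro integrable_continuous_real bounded_bilinear.continuous_on[OF bounded_bilinear_cdual_apply] Fc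
        continuous_on_compose2[OF Rc] continuous_intros) auto
    have i2: "(\<lambda>s. cdual_apply (ramp v s) (F (T - s - a))) integrable_on {0..T}" for a
      by (intro integrable_continuous_real bounded_bilinear.continuous_on[OF bounded_bilinear_cdual_apply]
        continuous_on_subset[OF Rc] continuous_on_compose2[OF F(1)] continuous_intros) auto
    let ?J = "\<lambda>a. integral {0..T} (\<lambda>s. cdual_apply (ramp v (s - a)) (F (T - s)))"
    have "((\<lambda>s. (1 / h\<^sup>2) *\<^sub>R (cdual_apply (ramp v (s - 0)) (F (T - s)) - 2 *\<^sub>R cdual_apply (ramp v (s - h)) (F (T - s)) + cdual_apply (ramp v (s - 2 * h)) (F (T - s))))
      has_integral (1 / h\<^sup>2) *\<^sub>R (?J 0 - 2 *\<^sub>R ?J h + ?J (2 * h))) {0..T}"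
      by (intro has_integral_cmul has_integral_add has_integral_diff integrable_integral i1)
    moreover have "(1 / h\<^sup>2) *\<^sub>R (cdual_apply (ramp v (s - 0)) (F (T - s)) - 2 *\<^sub>R cdual_apply (ramp v (s - h)) (F (T - s)) + cdual_apply (ramp v (s - 2 * h)) (F (T - s)))
      = cdual_apply (diff2 h (ramp v) s) (F (T - s))" for s
      unfolding diff2_def cdual_simps by simp
    ultimately have L: "?I (diff2 h (ramp v)) = (1 / h\<^sup>2) *\<^sub>R (?J 0 - 2 *\<^sub>R ?J h + ?J (2 * h))" by (simp add: integral_unique)
    let ?J' = "\<lambda>a. integral {0..T} (\<lambda>s. cdual_apply (ramp v s) (F (T - s - a)))"
    have "((\<lambda>s. (1 / h\<^sup>2) *\<^sub>R (cdual_apply (ramp v s) (F (T - s - 0)) - 2 *\<^sub>R cdual_apply (ramp v s) (F (T - s - h)) + cdual_apply (ramp v s) (F (T - s - 2 * h))))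
      has_integral (1 / h\<^sup>2) *\<^sub>R (?J' 0 - 2 *\<^sub>R ?J' h + ?J' (2 * h))) {0..T}"
      by (intro has_integral_cmul has_integral_add has_integral_diff integrable_integral i2)
    moreover have "(1 / h\<^sup>2) *\<^sub>R (cdual_apply (ramp v s) (F (T - s - 0)) - 2 *\<^sub>R cdual_apply (ramp v s) (F (T - s - h)) + cdual_apply (ramp v s) (F (T - s - 2 * h)))
      = cdual_apply (ramp v s) (diff2 h F (T - s))" for s
      unfolding diff2_def cdual_simps by simp
    ultimately have R: "((\<lambda>s. cdual_apply (ramp v s) (diff2 h F (T - s))) has_integral (1 / h\<^sup>2) *\<^sub>R (?J' 0 - 2 *\<^sub>R ?J' h + ?J' (2 * h))) {0..T}" by simp
    \<comment> \<open>The pairing has convolution form, so each of the three shifts moves from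
      \<open>ramp v\<close> to \<open>F\<close>.\<close>
    have "?J a = ?J' a" if "0 \<le> a" for a by (rule pairing_shift[OF Rc R0 F that T])
    then have "?I (diff2 h (ramp v)) = integral {0..T} (\<lambda>s. cdual_apply (ramp v s) (diff2 h F (T - s)))"
      using L integral_unique[OF R] h by simp
    also have "cmod \<dots> \<le> integral {0..T} (\<lambda>s. c * norm (ramp v s))"
    proof (rule integral_norm_bound_integral)
      show "(\<lambda>s. cdual_apply (ramp v s) (diff2 h F (T - s))) integrable_on {0..T}" using R by blast
      show "(\<lambda>s. c * norm (ramp v s)) integrable_on {0..T}"
        by (intro integrable_continuous_real continuous_intros continuous_on_subset[OF Rc]) auto
      show "norm (cdual_apply (ramp v s) (diff2 h F (T - s))) \<le> c * norm (ramp v s)" for s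
        using order_trans[OF norm_cdual_apply mult_left_mono[OF c[OF h(1)]]] by (simp add: mult.commute)
    qed
    finally show ?thesis by simp
  qed
  show "cmod (?I v) \<le> c * integral {0..T} (\<lambda>s. norm (ramp v s)) + e"
    using 1 2 norm_triangle_ineq4[of "?I (diff2 h (ramp v))" "?I (diff2 h (ramp v)) - ?I v"] by simp
qed

text \<open>Since \<open>conv K' v\<close> is continuous, its L1 norm is nearly a sum of integrals
  over cells of pairings with one near-norming vector per cell; a measurable selection of norming
  vectors is avoided. That sum is the pairing of \<open>v\<close> with the reversed response of
  \<open>K\<close> to the step function built from these vectors, to which
  \<open>pairing_le_ramp\<close> applies.\<close>

lemma dual_conv_estimate:
  fixes K :: "real \<Rightarrow> 'u::cbanach \<Rightarrow> 'y::cbanach" and K' :: "real \<Rightarrow> 'y cdual \<Rightarrow> 'u cdual"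
  assumes K: "kern K" "\<And>u. K 0 u = 0" and K': "kern K'"
    and pair: "\<And>t g u. 0 \<le> t \<Longrightarrow> cdual_apply (K' t g) u = cdual_apply g (K t u)"
    and bound: "\<And>d n u h r. 0 < d \<Longrightarrow> (\<And>k. norm (u k) \<le> 1) \<Longrightarrow> 0 < h \<Longrightarrow> norm (diff2 h (conv K (step_fun d n u)) r) \<le> c"
    and v: "\<And>T. L1_on T v" and T: "0 \<le> T"
  shows "integral {0..T} (\<lambda>t. norm (conv K' v t)) \<le> c * integral {0..T} (\<lambda>t. norm (ramp v t))"
proof (cases "T = 0")
  case True
  then show ?thesis by simp
next
  case False
  then have Tpos: "T > 0" using T by simp
  show ?thesis
  proof (rule field_le_epsilon)
    fix e' :: real assume e': "e' > 0"
    \<comment> \<open>Three losses of e over a time interval of length T: replacing t by the left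
      end of its cell in the norm, near-norming there, and moving the pairing back to t.\<close>
    define e where "e = e' / (3 * T)"
    have e: "e > 0" using e' Tpos by (simp add: e_def)
    let ?F = "conv K' v"
    have Fc: "continuous_on {0..T} ?F" by (rule conv_continuous[OF K' v])
    have "uniformly_continuous_on {0..T} ?F" by (intro compact_uniformly_continuous Fc) auto
    then obtain \<eta> where \<eta>: "\<eta> > 0" "\<And>s t. s \<in> {0..T} \<Longrightarrow> t \<in> {0..T} \<Longrightarrow> dist s t < \<eta> \<Longrightarrow> dist (?F s) (?F t) < e"
      unfolding uniformly_continuous_on_def using e by metis
    obtain n :: nat where n: "n > 0" "T / real n < \<eta>"
    proof -
      obtain n where "n > 0" "inverse (real n) < \<eta> / T" using \<eta>(1) Tpos ex_inverse_of_nat_less[of "\<eta> / T"] by auto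
      then show ?thesis using Tpos by (intro that[of n]) (auto simp: field_simps)
    qed
    define d where "d = T / real n"
    have d: "d > 0" "d < \<eta>" "real n * d = T" using n Tpos by (auto simp: d_def)
    \<comment> \<open>Cells are counted backwards from T, since the convolution is read at T - s;
      the vector is chosen at the left end of cell k.\<close>
    have "\<exists>u. norm u \<le> 1 \<and> norm (?F (T - real (Suc k) * d)) - e \<le> Re (cdual_apply (?F (T - real (Suc k) * d)) u)" for k
      by (rule cdual_nearly_norming[OF e])
    then obtain u where u: "\<And>k. norm (u k) \<le> 1"
      "\<And>k. norm (?F (T - real (Suc k) * d)) - e \<le> Re (cdual_apply (?F (T - real (Suc k) * d)) (u k))" by metis
    define \<phi> where "\<phi> w t = cdual_apply (?F t) w" for w t
    have \<phi>c: "continuous_on {0..T} (\<phi> w)" for w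
      unfolding \<phi>_def[abs_def] by (intro bounded_bilinear.continuous_on[OF bounded_bilinear_cdual_apply] Fc continuous_intros)
    let ?K1 = "\<lambda>t w. integral {0..t} (\<lambda>r. K r w)"
    have K1: "kern ?K1" by (rule kern_primitive[OF K(1)])
    \<comment> \<open>\<open>?K1\<close> is the response to a constant input, so its continuity
      across 0 is that of a convolution.\<close>
    have K1c: "continuous_on UNIV (\<lambda>t. ?K1 t w)" for w
    proof -
      have "continuous_on UNIV (conv K (\<lambda>s. w))"
        by (rule conv_continuous_UNIV[OF K]) (intro L1_on_continuous continuous_intros)
      moreover have "conv K (\<lambda>s. w) t = ?K1 t w" for t
      proof (cases "0 \<le> t")
        case True
        have "((\<lambda>s. K (t - s) (indicat_real {0..<t + 1} s *\<^sub>R w)) has_integral ?K1 (t - 0) w - ?K1 (t - (t + 1)) w) {0..t}"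
          by (rule conv_step[OF K(1)]) (use True in auto)
        moreover have "conv K (\<lambda>s. w) t = integral {0..t} (\<lambda>s. K (t - s) (indicat_real {0..<t + 1} s *\<^sub>R w))"
          unfolding conv_def by (rule integral_cong) auto
        ultimately show ?thesis by (simp add: integral_unique)
      next
        case False
        then show ?thesis by (simp add: conv_def)
      qed
      ultimately show ?thesis by (simp cong: continuous_on_cong)
    qed
    let ?\<kappa> = "\<lambda>w t g. cdual_apply g (K t w)"
    have \<kappa>: "kern (?\<kappa> w)" for w
      unfolding kern_def
    proof (intro conjI allI)
      show "linear (?\<kappa> w t)" for t by (rule linearI) (simp_all add: cdual_simps)
      show "continuous_on {0..} (\<lambda>t. ?\<kappa> w t g)" for g
        by (intro bounded_bilinear.continuous_on[OF bounded_bilinear_cdual_apply] continuous_intros kern_continuous[OF K(1)])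
      fix T
      obtain M where M: "M \<ge> 0" "\<And>t x. t \<in> {0..T} \<Longrightarrow> norm (K t x) \<le> M * norm x" using kern_bound[OF K(1), of T] by blast
      have "norm (?\<kappa> w t g) \<le> (M * norm w) * norm g" if "t \<in> {0..T}" for t g
        using order_trans[OF norm_cdual_apply mult_left_mono[OF M(2)[OF that]]] by (simp add: mult.commute)
      then show "\<exists>M\<ge>0. \<forall>t\<in>{0..T}. \<forall>g. norm (?\<kappa> w t g) \<le> M * norm g"
        using M(1) by (intro exI[of _ "M * norm w"]) auto
    qed
    \<comment> \<open>Adjointness moves the kernel onto w; what remains is a convolution with the
      scalar-valued kernel \<open>?\<kappa> w\<close> acting on functionals.\<close>
    have \<phi>conv: "\<phi> w t = conv (?\<kappa> w) v t" for w t
    proof -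
      have "bounded_linear (\<lambda>f. cdual_apply f w)"
        by (rule bounded_bilinear.bounded_linear_left[OF bounded_bilinear_cdual_apply])
      from conv_bounded_linear[OF this K' v]
      have "\<phi> w t = conv (\<lambda>t x. cdual_apply (K' t x) w) v t" by (simp add: \<phi>_def)
      also have "\<dots> = conv (?\<kappa> w) v t" by (rule conv_cong) (simp add: pair)
      finally show ?thesis .
    qed
    \<comment> \<open>This is the integral over {0..\<tau>} of the pairing of
      \<open>conv K' v\<close> with w (\<open>Pint\<close>), written with the primitive of
      \<open>K\<close>. The primitive vanishes at negative times, so the interval {0..T} can be kept
      fixed.\<close>
    define P where "P w \<tau> = integral {0..T} (\<lambda>s. cdual_apply (v s) (?K1 (\<tau> - s) w))" for w \<tau>
    have pairK1: "L1_on T (\<lambda>s. cdual_apply (v s) (?K1 (\<tau> - s) w))" for w \<tau>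
    proof -
      have c: "continuous_on S (\<lambda>s. ?K1 (\<tau> - s) w)" for S by (intro continuous_on_compose2[OF K1c[of w]] continuous_intros) auto
      obtain B where B: "\<And>s. s \<in> {0..T} \<Longrightarrow> norm (?K1 (\<tau> - s) w) \<le> B" using continuous_on_interval_bounded[OF c[of "{0..T}"]] by blast
      show ?thesis
      proof (rule L1_on_operator[OF v, where M=B])
        show "norm (cdual_apply x (?K1 (\<tau> - s) w) - cdual_apply y (?K1 (\<tau> - s) w)) \<le> B * norm (x - y)" if "s \<in> {0..T}" for s x y
          using order_trans[OF norm_cdual_apply[of "x - y" "?K1 (\<tau> - s) w"] mult_left_mono[OF B[OF that], of "norm (x - y)"]]
          by (simp add: cdual_simps mult.commute)
      qed (intro bounded_bilinear.continuous_on[OF bounded_bilinear_cdual_apply] c)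
    qed
    have Pint: "integral {0..\<tau>} (\<phi> w) = P w \<tau>" if \<tau>: "\<tau> \<in> {0..T}" for w \<tau>
    proof -
      have "integral {0..\<tau>} (\<phi> w) = integral {0..\<tau>} (conv (?\<kappa> w) v)" by (rule integral_cong) (rule \<phi>conv)
      also have "\<dots> = conv (\<lambda>t g. integral {0..t} (\<lambda>r. ?\<kappa> w r g)) v \<tau>"
        by (rule integral_conv[OF \<kappa> v]) (use \<tau> in simp)
      also have "\<dots> = integral {0..\<tau>} (\<lambda>s. cdual_apply (v s) (?K1 (\<tau> - s) w))"
        unfolding conv_def
      proof (rule integral_cong)
        fix s
        have "(\<lambda>r. K r w) integrable_on {0..\<tau> - s}"
          by (intro integrable_continuous_real continuous_on_subset[OF kern_continuous[OF K(1)]]) auto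
        from integral_linear[OF this bounded_bilinear.bounded_linear_right[OF bounded_bilinear_cdual_apply, of "v s"]]
        show "integral {0..\<tau> - s} (\<lambda>r. cdual_apply (v s) (K r w)) = cdual_apply (v s) (?K1 (\<tau> - s) w)" by (simp add: o_def)
      qed
      also have "\<dots> = P w \<tau>"
      proof -
        have "integral {\<tau>..T} (\<lambda>s. cdual_apply (v s) (?K1 (\<tau> - s) w)) = integral {\<tau>..T} (\<lambda>s. 0)"
        proof (rule integral_cong)
          fix s assume "s \<in> {\<tau>..T}"
          then have "?K1 (\<tau> - s) w = 0" by (cases "s = \<tau>") auto
          then show "cdual_apply (v s) (?K1 (\<tau> - s) w) = 0" by (simp add: cdual_simps)
        qed
        moreover have "integral {0..\<tau>} (\<lambda>s. cdual_apply (v s) (?K1 (\<tau> - s) w)) + integral {\<tau>..T} (\<lambda>s. cdual_apply (v s) (?K1 (\<tau> - s) w)) = P w \<tau>"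
          unfolding P_def by (rule Henstock_Kurzweil_Integration.integral_combine[OF _ _ L1_on_integrable[OF pairK1]]) (use \<tau> in auto)
        ultimately show ?thesis by simp
      qed
      finally show ?thesis .
    qed
    let ?N = "\<lambda>t. norm (?F t)"
    have Nc: "continuous_on {0..T} ?N" by (intro continuous_intros Fc)
    have Ni: "?N integrable_on {a..b}" if "0 \<le> a" "b \<le> T" for a b
      using that by (intro integrable_continuous_real continuous_on_subset[OF Nc]) auto
    have \<phi>i: "\<phi> w integrable_on {a..b}" if "0 \<le> a" "b \<le> T" for a b w
      using that by (intro integrable_continuous_real continuous_on_subset[OF \<phi>c]) auto
    have piece: "integral {T - real (Suc k) * d..T - real k * d} ?N
       \<le> Re (P (u k) (T - real k * d) - P (u k) (T - real (Suc k) * d)) + 3 * e * d" if k: "k < n" for k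
    proof -
      let ?a = "T - real (Suc k) * d" and ?b = "T - real k * d"
      have "real (Suc k) * d \<le> real n * d" using k d by (intro mult_right_mono) auto
      then have ab: "0 \<le> ?a" "?a \<le> ?b" "?b \<le> T" "?b = ?a + d" using d by (auto simp: algebra_simps)
      have pt: "?N t \<le> Re (\<phi> (u k) t) + 3 * e" if t: "t \<in> {?a..?b}" for t
      proof -
        have "dist t ?a < \<eta>" using t ab d by (auto simp: dist_real_def)
        then have "dist (?F t) (?F ?a) < e" using t ab by (intro \<eta>(2)) auto
        then have close: "norm (?F t - ?F ?a) \<le> e" by (simp add: dist_norm less_imp_le)
        have "?N t \<le> ?N ?a + e" using norm_triangle_ineq2[of "?F t" "?F ?a"] close by simp
        moreover have "?N ?a - e \<le> Re (\<phi> (u k) ?a)" using u(2)[of k] by (simp only: \<phi>_def)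
        moreover have "Re (\<phi> (u k) ?a) - Re (\<phi> (u k) t) \<le> e"
        proof -
          have "Re (\<phi> (u k) ?a) - Re (\<phi> (u k) t) = Re (cdual_apply (?F ?a - ?F t) (u k))" by (simp add: \<phi>_def cdual_simps)
          also have "\<dots> \<le> cmod (cdual_apply (?F ?a - ?F t) (u k))" by (rule complex_Re_le_cmod)
          also have "\<dots> \<le> norm (?F ?a - ?F t) * norm (u k)" by (rule norm_cdual_apply)
          also have "\<dots> \<le> e * 1" using close e by (intro mult_mono u(1)) (auto simp: norm_minus_commute)
          finally show ?thesis by simp
        qed
        ultimately show ?thesis by simp
      qed
      have \<phi>ab: "\<phi> (u k) integrable_on {?a..?b}" by (rule \<phi>i) (use ab in auto)
      have Reint: "((\<lambda>t. Re (\<phi> (u k) t)) has_integral Re (integral {?a..?b} (\<phi> (u k)))) {?a..?b}"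
        using has_integral_linear[OF integrable_integral[OF \<phi>ab] bounded_linear_Re] by (simp add: o_def)
      have "((\<lambda>t. 3 * e) has_integral d * (3 * e)) {?a..?b}"
      proof -
        have "?b - ?a = d" using ab(4) by linarith
        then have "measure lborel {?a..?b} = d" by (simp only: content_real[OF ab(2)])
        then show ?thesis using has_integral_const_real[of "3 * e" ?a ?b] by (simp only: real_scaleR_def)
      qed
      from has_integral_add[OF Reint this]
      have I: "((\<lambda>t. Re (\<phi> (u k) t) + 3 * e) has_integral Re (integral {?a..?b} (\<phi> (u k))) + d * (3 * e)) {?a..?b}" .
      have "integral {?a..?b} ?N \<le> integral {?a..?b} (\<lambda>t. Re (\<phi> (u k) t) + 3 * e)"
      proof (rule integral_le)
        show "?N integrable_on {?a..?b}" by (rule Ni) (use ab in auto)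
        show "(\<lambda>t. Re (\<phi> (u k) t) + 3 * e) integrable_on {?a..?b}" using I by blast
      qed (rule pt)
      also have "\<dots> = Re (integral {?a..?b} (\<phi> (u k))) + d * (3 * e)" by (rule integral_unique[OF I])
      also have "integral {?a..?b} (\<phi> (u k)) = P (u k) ?b - P (u k) ?a"
      proof -
        have "integral {0..?a} (\<phi> (u k)) + integral {?a..?b} (\<phi> (u k)) = integral {0..?b} (\<phi> (u k))"
          by (rule Henstock_Kurzweil_Integration.integral_combine) (use ab in \<open>auto intro: \<phi>i\<close>)
        moreover have "integral {0..?a} (\<phi> (u k)) = P (u k) ?a" "integral {0..?b} (\<phi> (u k)) = P (u k) ?b"
          using ab by (auto intro!: Pint)
        ultimately show ?thesis by (simp add: algebra_simps)
      qed
      finally show ?thesis by (simp add: mult_ac)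
    qed
    have sum: "integral {T - real m * d..T} ?N \<le> Re (\<Sum>k<m. P (u k) (T - real k * d) - P (u k) (T - real (Suc k) * d)) + 3 * e * (real m * d)" if "m \<le> n" for m
      using that
    proof (induction m)
      case (Suc m)
      let ?a = "T - real (Suc m) * d" and ?b = "T - real m * d"
      have "real (Suc m) * d \<le> real n * d" using Suc.prems d by (intro mult_right_mono) auto
      then have ab: "0 \<le> ?a" "?a \<le> ?b" "?b \<le> T" using d by (auto simp: algebra_simps)
      have "integral {?a..T} ?N = integral {?a..?b} ?N + integral {?b..T} ?N"
        by (rule Henstock_Kurzweil_Integration.integral_combine[symmetric]) (use ab in \<open>auto intro: Ni\<close>)
      then show ?case using piece[of m] Suc by (simp add: algebra_simps)
    qed simp
    let ?\<Phi> = "conv K (step_fun d n u)"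
    have sL: "L1_on S (step_fun d n u)" for S by (rule Linf_loc_L1_on[OF step_fun_Linf(1)[OF d(1) u(1)]])
    \<comment> \<open>By \<open>conv_step_fun\<close> the differences of primitives, summed over the
      cells, are the response of \<open>K\<close> to the step function, read at T - s.\<close>
    have "((\<lambda>s. \<Sum>k<n. cdual_apply (v s) (?K1 (T - real k * d - s) (u k)) - cdual_apply (v s) (?K1 (T - real (Suc k) * d - s) (u k))) has_integral
       (\<Sum>k<n. P (u k) (T - real k * d) - P (u k) (T - real (Suc k) * d))) {0..T}"
      unfolding P_def by (intro has_integral_sum has_integral_diff integrable_integral L1_on_integrable[OF pairK1]) auto
    moreover have "(\<Sum>k<n. cdual_apply (v s) (?K1 (T - real k * d - s) (u k)) - cdual_apply (v s) (?K1 (T - real (Suc k) * d - s) (u k)))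
       = cdual_apply (v s) (?\<Phi> (T - s))" for s
    proof -
      have "cdual_apply (v s) (?\<Phi> (T - s)) = (\<Sum>k<n. cdual_apply (v s) (?K1 (T - s - real k * d) (u k) - ?K1 (T - s - real (Suc k) * d) (u k)))"
        unfolding conv_step_fun[OF K(1) less_imp_le[OF d(1)]]
        by (rule linear_sum[OF bounded_linear.linear[OF bounded_bilinear.bounded_linear_right[OF bounded_bilinear_cdual_apply]]])
      moreover have "T - s - x = T - x - s" for x by simp
      ultimately show ?thesis by (simp only: cdual_diff_right)
    qed
    ultimately have Psum: "(\<Sum>k<n. P (u k) (T - real k * d) - P (u k) (T - real (Suc k) * d)) = integral {0..T} (\<lambda>s. cdual_apply (v s) (?\<Phi> (T - s)))"
      by (simp add: integral_unique)
    have "integral {0..T} ?N \<le> Re (integral {0..T} (\<lambda>s. cdual_apply (v s) (?\<Phi> (T - s)))) + 3 * e * T"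
      using sum[OF order_refl] unfolding Psum d(3) by simp
    also have "\<dots> \<le> c * integral {0..T} (\<lambda>t. norm (ramp v t)) + 3 * e * T"
      using pairing_le_ramp[OF v conv_continuous_UNIV[OF K sL] bound[OF d(1) u(1)] T]
        complex_Re_le_cmod[of "integral {0..T} (\<lambda>s. cdual_apply (v s) (?\<Phi> (T - s)))"] by simp
    also have "3 * e * T = e'" using Tpos by (simp add: e_def)
    finally show "integral {0..T} ?N \<le> c * integral {0..T} (\<lambda>t. norm (ramp v t)) + e'" .
  qed
qed

section \<open>Integrability of the output of the dual node\<close>

text \<open>Applied twice, it confines the second derivative of a test function to the left of the
  same bound.\<close>

lemma deriv_eq_0_right:
  fixes f :: "real \<Rightarrow> real"
  assumes "\<And>t. t > R \<Longrightarrow> f t = 0" "t > R"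
  shows "deriv f t = 0"
proof -
  have "\<forall>\<^sub>F s in nhds t. s > R" using assms(2) by (intro eventually_nhds_in_open[of "{R<..}" t, simplified]) auto
  then have "\<forall>\<^sub>F s in nhds t. f s = 0" by eventually_elim (rule assms(1))
  then have "(f has_real_derivative 0) (at t)" by (subst DERIV_cong_ev[OF refl _ refl]) auto
  then show ?thesis by (rule DERIV_imp_deriv)
qed

lemma test_function_shift:
  fixes F :: "real \<Rightarrow> 'a::banach"
  assumes F: "continuous_on UNIV F" "\<And>t. t \<le> 0 \<Longrightarrow> F t = 0" and \<phi>: "continuous_on UNIV \<phi>" "\<And>t. t \<ge> T \<Longrightarrow> \<phi> t = 0"
    and a: "0 \<le> a" "a \<le> T"
  shows "integral {0..T} (\<lambda>s. \<phi> s *\<^sub>R F (s - a)) = integral {0..T} (\<lambda>s. \<phi> (s + a) *\<^sub>R F s)"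
proof -
  let ?g = "\<lambda>s. \<phi> (s + a) *\<^sub>R F s"
  have c: "continuous_on S ?g" for S
    by (intro continuous_intros continuous_on_compose2[OF \<phi>(1)] continuous_on_subset[OF F(1)]) auto
  have i: "?g integrable_on {0..t}" for t by (rule integrable_continuous_real[OF c])
  have "integral {0..T} (\<lambda>s. \<phi> s *\<^sub>R F (s - a)) = integral {0..T} (\<lambda>s. if s < a then 0 else ?g (s - a))"
    by (rule integral_cong) (use F(2) in auto)
  also have "\<dots> = integral {0..T - a} ?g"
    by (rule integral_unique[OF has_integral_delay[OF integrable_integral[OF i] a(1)]])
  also have "\<dots> = integral {0..T - a} ?g + integral {T - a..T} ?g"
  proof -
    have "integral {T - a..T} ?g = integral {T - a..T} (\<lambda>s. 0)" by (rule integral_cong) (use \<phi>(2) in auto)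
    then show ?thesis by simp
  qed
  also have "\<dots> = integral {0..T} ?g" by (rule Henstock_Kurzweil_Integration.integral_combine[OF _ _ i]) (use a in auto)
  finally show ?thesis .
qed

text \<open>The integrals \<open>?A n\<close> of \<phi> against difference quotients of
  \<open>F\<close> have their limit computed twice: by the L1 convergence to \<open>f\<close>, and
  by moving the differences to \<phi>, whose quotients converge uniformly to its second
  derivative.\<close>

lemma diff2_limit_regular:
  fixes F f :: "real \<Rightarrow> 'a::cbanach"
  assumes F: "continuous_on UNIV F" "\<And>t. t \<le> 0 \<Longrightarrow> F t = 0" and f: "\<And>T. L1_on T f"
    and h: "\<And>n. h n > 0" "h \<longlonglongrightarrow> 0"
    and lim: "\<And>T. (\<lambda>n. integral {0..T} (\<lambda>s. norm (f s - diff2 (h n) F s))) \<longlonglongrightarrow> 0"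
    and y: "is_second_derivative y F"
  shows "is_regular_distribution y f"
  unfolding is_regular_distribution_def
proof
  fix \<phi> assume \<phi>t: "\<phi> \<in> test_functions"
  have \<phi>s: "smooth_fun \<phi>" using \<phi>t by (simp add: test_functions_def smooth_fun_def)
  let ?\<phi>2 = "deriv (deriv \<phi>)"
  have \<phi>2s: "smooth_fun ?\<phi>2" by (intro smooth_fun_deriv \<phi>s)
  have \<phi>c: "continuous_on S \<phi>" and \<phi>2c: "continuous_on S ?\<phi>2" for S
    by (intro continuous_at_imp_continuous_on ballI smooth_fun_isCont \<phi>s \<phi>2s)+
  have "bounded (closure {t. \<phi> t \<noteq> 0})" using \<phi>t by (simp add: test_functions_def compact_imp_bounded)
  then have "bounded {t. \<phi> t \<noteq> 0}" using bounded_subset closure_subset by blast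
  then obtain b where b: "\<And>t. \<phi> t \<noteq> 0 \<Longrightarrow> norm t \<le> b" by (auto simp: bounded_iff)
  \<comment> \<open>The margin 2 puts the support of \<phi> to the left of T and makes T exceed
    every shift 2 k with k < 1.\<close>
  define T where "T = \<bar>b\<bar> + 2"
  have T: "T \<ge> 2" by (simp add: T_def)
  have z: "\<phi> t = 0" if "t > \<bar>b\<bar>" for t using b[of t] that by fastforce
  have z2: "?\<phi>2 t = 0" if "t > \<bar>b\<bar>" for t
    by (rule deriv_eq_0_right[OF deriv_eq_0_right[OF z] that])
  have Fc: "continuous_on S F" for S by (rule continuous_on_subset[OF F(1)]) simp
  let ?A = "\<lambda>n. integral {0..T} (\<lambda>s. \<phi> s *\<^sub>R diff2 (h n) F s)"
  have A1: "?A \<longlonglongrightarrow> integral {0..T} (\<lambda>s. \<phi> s *\<^sub>R f s)"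
  proof -
    obtain B where B: "0 \<le> B" "\<And>s. s \<in> {0..T} \<Longrightarrow> norm (\<phi> s) \<le> B" using continuous_on_interval_bounded[OF \<phi>c] by blast
    have dL: "L1_on T (diff2 (h n) F)" for n by (rule L1_on_continuous[OF continuous_on_diff2[OF F(1)]])
    have "norm (?A n - integral {0..T} (\<lambda>s. \<phi> s *\<^sub>R f s)) \<le> B * integral {0..T} (\<lambda>s. norm (f s - diff2 (h n) F s))" for n
    proof -
      note L = L1_on_weight[OF f \<phi>c[of "{0..T}"]] L1_on_weight[OF dL[of n] \<phi>c]
      have n: "(\<lambda>s. norm (f s - diff2 (h n) F s)) integrable_on {0..T}"
        by (rule L1_on_norm_integrable[OF L1_on_diff[OF f dL]])
      have "norm (integral {0..T} (\<lambda>s. \<phi> s *\<^sub>R f s - \<phi> s *\<^sub>R diff2 (h n) F s)) \<le> integral {0..T} (\<lambda>s. B * norm (f s - diff2 (h n) F s))"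
      proof (rule integral_norm_bound_integral)
        show "(\<lambda>s. \<phi> s *\<^sub>R f s - \<phi> s *\<^sub>R diff2 (h n) F s) integrable_on {0..T}"
          by (rule L1_on_integrable[OF L1_on_diff[OF L]])
        show "(\<lambda>s. B * norm (f s - diff2 (h n) F s)) integrable_on {0..T}" by (rule integrable_on_mult_right[OF n])
        show "norm (\<phi> s *\<^sub>R f s - \<phi> s *\<^sub>R diff2 (h n) F s) \<le> B * norm (f s - diff2 (h n) F s)" if "s \<in> {0..T}" for s
          using mult_right_mono[OF B(2)[OF that], of "norm (f s - diff2 (h n) F s)"]
          by (simp add: scaleR_diff_right[symmetric])
      qed
      then show ?thesis
        by (simp add: Henstock_Kurzweil_Integration.integral_diff[OF L[THEN L1_on_integrable]] norm_minus_commute)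
    qed
    moreover have "(\<lambda>n. B * integral {0..T} (\<lambda>s. norm (f s - diff2 (h n) F s))) \<longlonglongrightarrow> 0"
      using tendsto_mult_left[OF lim[of T], of B] by simp
    ultimately have "(\<lambda>n. ?A n - integral {0..T} (\<lambda>s. \<phi> s *\<^sub>R f s)) \<longlonglongrightarrow> 0"
      by (rule Lim_null_comparison[OF always_eventually[OF allI]])
    then show ?thesis by (rule LIM_zero_cancel)
  qed
  have A2: "?A \<longlonglongrightarrow> integral {0..T} (\<lambda>s. ?\<phi>2 s *\<^sub>R F s)"
  proof (rule tendstoI)
    fix e :: real assume e: "e > 0"
    obtain M where M: "0 \<le> M" "\<And>s. s \<in> {0..T} \<Longrightarrow> norm (F s) \<le> M" using continuous_on_interval_bounded[OF Fc] by blast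
    define e1 where "e1 = e / (2 * (M + 1) * T)"
    have e1: "e1 > 0" using e M(1) T by (simp add: e1_def)
    have "uniformly_continuous_on {0..T + 2} ?\<phi>2" by (intro compact_uniformly_continuous \<phi>2c) auto
    then obtain d where d: "d > 0" "\<And>s t. s \<in> {0..T + 2} \<Longrightarrow> t \<in> {0..T + 2} \<Longrightarrow> dist s t < d \<Longrightarrow> dist (?\<phi>2 s) (?\<phi>2 t) < e1"
      unfolding uniformly_continuous_on_def using e1 by metis
    have "min (d / 2) 1 > 0" using d(1) by simp
    then have "\<forall>\<^sub>F n in sequentially. h n < min (d / 2) 1" by (rule order_tendstoD(2)[OF h(2)])
    then show "\<forall>\<^sub>F n in sequentially. dist (?A n) (integral {0..T} (\<lambda>s. ?\<phi>2 s *\<^sub>R F s)) < e"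
    proof eventually_elim
      case (elim n)
      define k where "k = h n"
      have k: "0 < k" "2 * k < d" "k < 1" using elim h(1)[of n] by (auto simp: k_def)
      have Fs: "continuous_on S (\<lambda>s. F (s - a))" for S a by (intro continuous_on_compose2[OF F(1)] continuous_intros) auto
      have \<phi>sh: "continuous_on S (\<lambda>s. \<phi> (s + a))" for S a by (intro continuous_on_compose2[OF \<phi>c[of UNIV]] continuous_intros) auto
      have i: "(\<lambda>s. \<phi> s *\<^sub>R F (s - a)) integrable_on {0..T}" "(\<lambda>s. \<phi> (s + a) *\<^sub>R F s) integrable_on {0..T}" for a
        by (intro integrable_continuous_real continuous_on_scaleR \<phi>c Fs \<phi>sh Fc)+
      have sh: "((\<lambda>s. \<phi> s *\<^sub>R F (s - a)) has_integral integral {0..T} (\<lambda>s. \<phi> (s + a) *\<^sub>R F s)) {0..T}" if "0 \<le> a" "a \<le> T" for a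
        using integrable_integral[OF i(1)[of a]] test_function_shift[OF F \<phi>c z that] by (auto simp: T_def)
      let ?I = "\<lambda>a. integral {0..T} (\<lambda>s. \<phi> (s + a) *\<^sub>R F s)"
      have "((\<lambda>s. (1 / k\<^sup>2) *\<^sub>R (\<phi> s *\<^sub>R F (s - 0) - 2 *\<^sub>R \<phi> s *\<^sub>R F (s - k) + \<phi> s *\<^sub>R F (s - 2 * k))) has_integral
         (1 / k\<^sup>2) *\<^sub>R (?I 0 - 2 *\<^sub>R ?I k + ?I (2 * k))) {0..T}"
        by (intro has_integral_cmul has_integral_add has_integral_diff sh) (use k T in auto)
      moreover have "(\<lambda>s. (1 / k\<^sup>2) *\<^sub>R (\<phi> s *\<^sub>R F (s - 0) - 2 *\<^sub>R \<phi> s *\<^sub>R F (s - k) + \<phi> s *\<^sub>R F (s - 2 * k))) = (\<lambda>s. \<phi> s *\<^sub>R diff2 k F s)"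
        by (simp add: diff2_def fun_eq_iff scaleR_add_right scaleR_diff_right mult_ac)
      ultimately have An: "?A n = (1 / k\<^sup>2) *\<^sub>R (?I 0 - 2 *\<^sub>R ?I k + ?I (2 * k))" by (simp add: k_def integral_unique)
      have "((\<lambda>s. (1 / k\<^sup>2) *\<^sub>R (\<phi> (s + 0) *\<^sub>R F s - 2 *\<^sub>R \<phi> (s + k) *\<^sub>R F s + \<phi> (s + 2 * k) *\<^sub>R F s)) has_integral
         (1 / k\<^sup>2) *\<^sub>R (?I 0 - 2 *\<^sub>R ?I k + ?I (2 * k))) {0..T}"
        by (intro has_integral_cmul has_integral_add has_integral_diff integrable_integral i)
      \<comment> \<open>Moving backward differences off \<open>F\<close> gives forward differences
        of \<phi>, that is \<open>diff2\<close> at s + 2 k.\<close>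
      moreover have "(\<lambda>s. (1 / k\<^sup>2) *\<^sub>R (\<phi> (s + 0) *\<^sub>R F s - 2 *\<^sub>R \<phi> (s + k) *\<^sub>R F s + \<phi> (s + 2 * k) *\<^sub>R F s)) = (\<lambda>s. diff2 k \<phi> (s + 2 * k) *\<^sub>R F s)"
      proof
        fix s
        have "s + 2 * k - k = s + k" by simp
        then show "(1 / k\<^sup>2) *\<^sub>R (\<phi> (s + 0) *\<^sub>R F s - 2 *\<^sub>R \<phi> (s + k) *\<^sub>R F s + \<phi> (s + 2 * k) *\<^sub>R F s) = diff2 k \<phi> (s + 2 * k) *\<^sub>R F s"
          by (simp add: diff2_def scaleR_add_right scaleR_diff_right scaleR_add_left scaleR_diff_left distrib_left right_diff_distrib add.commute)
      qed
      ultimately have An': "?A n = integral {0..T} (\<lambda>s. diff2 k \<phi> (s + 2 * k) *\<^sub>R F s)" by (simp add: An integral_unique)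
      have dc: "continuous_on {0..T} (\<lambda>s. diff2 k \<phi> (s + 2 * k) *\<^sub>R F s)" "continuous_on {0..T} (\<lambda>s. ?\<phi>2 s *\<^sub>R F s)"
        by (intro continuous_on_scaleR Fc \<phi>2c continuous_on_compose2[OF continuous_on_diff2[OF \<phi>c[of UNIV], of UNIV]] continuous_intros; auto)+
      have "norm (integral {0..T} (\<lambda>s. diff2 k \<phi> (s + 2 * k) *\<^sub>R F s - ?\<phi>2 s *\<^sub>R F s)) \<le> (e1 * M) * (T - 0)"
      proof (rule integral_bound)
        show "continuous_on {0..T} (\<lambda>s. diff2 k \<phi> (s + 2 * k) *\<^sub>R F s - ?\<phi>2 s *\<^sub>R F s)" by (intro continuous_on_diff dc)
        fix s assume s: "s \<in> {0..T}"
        obtain \<theta> where \<theta>: "s + 2 * k - 2 * k < \<theta>" "\<theta> < s + 2 * k"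
          "\<phi> (s + 2 * k) - 2 * \<phi> (s + 2 * k - k) + \<phi> (s + 2 * k - 2 * k) = k\<^sup>2 * ?\<phi>2 \<theta>"
          using second_difference_MVT[OF smooth_fun_deriv(2)[OF \<phi>s] smooth_fun_deriv(2)[OF smooth_fun_deriv(1)[OF \<phi>s]] k(1)] by blast
        have "diff2 k \<phi> (s + 2 * k) = ?\<phi>2 \<theta>" unfolding diff2_def using \<theta>(3) k(1) by simp
        moreover have "dist (?\<phi>2 \<theta>) (?\<phi>2 s) < e1" using \<theta> s k by (intro d(2)) (auto simp: dist_real_def)
        ultimately have "norm (diff2 k \<phi> (s + 2 * k) - ?\<phi>2 s) \<le> e1" by (simp add: dist_real_def)
        then show "norm (diff2 k \<phi> (s + 2 * k) *\<^sub>R F s - ?\<phi>2 s *\<^sub>R F s) \<le> e1 * M"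
          unfolding scaleR_diff_left[symmetric] norm_scaleR using M(2)[OF s] e1 by (intro mult_mono) auto
      qed (use T in auto)
      also have "(e1 * M) * (T - 0) < e"
      proof -
        have "(e1 * M) * (T - 0) \<le> e1 * (M + 1) * T" unfolding diff_zero using e1 M(1) T by (intro mult_right_mono mult_left_mono) auto
        also have "\<dots> = e / 2"
        proof -
          have "M + 1 \<noteq> 0" "T \<noteq> 0" using M(1) T by auto
          then show ?thesis unfolding e1_def by (simp add: divide_simps mult_ac)
        qed
        also have "\<dots> < e" using e by simp
        finally show ?thesis .
      qed
      finally show ?case
        by (simp add: dist_norm An' Henstock_Kurzweil_Integration.integral_diff[OF dc[THEN integrable_continuous_real]])
    qed
  qed
  have "y \<phi> = Bochner_integral (lebesgue_on {0..}) (\<lambda>t. ?\<phi>2 t *\<^sub>R F t)"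
    using y \<phi>t by (simp add: is_second_derivative_def numeral_2_eq_2)
  also have "\<dots> = integral {0..T} (\<lambda>s. ?\<phi>2 s *\<^sub>R F s)"
    by (rule Bochner_integral_halfline) (use T z2 in \<open>auto intro!: L1_on_continuous continuous_on_scaleR \<phi>2c Fc simp: T_def\<close>)
  also have "\<dots> = integral {0..T} (\<lambda>s. \<phi> s *\<^sub>R f s)" by (rule LIMSEQ_unique[OF A2 A1])
  also have "\<dots> = Bochner_integral (lebesgue_on {0..}) (\<lambda>t. \<phi> t *\<^sub>R f t)"
    by (rule Bochner_integral_halfline[symmetric, OF L1_on_weight[OF f \<phi>c]]) (use T z in \<open>auto simp: T_def\<close>)
  finally show "y \<phi> = Bochner_integral (lebesgue_on {0..}) (\<lambda>t. \<phi> t *\<^sub>R f t)" .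
qed

lemma second_derivative_conv_L1:
  fixes K :: "real \<Rightarrow> 'a::cbanach \<Rightarrow> 'b::cbanach"
  assumes K: "kern K" "\<And>x. K 0 x = 0" and c: "0 \<le> c"
    and est: "\<And>v T. (\<And>T. L1_on T v) \<Longrightarrow> 0 \<le> T \<Longrightarrow> integral {0..T} (\<lambda>t. norm (conv K v t)) \<le> c * integral {0..T} (\<lambda>t. norm (ramp v t))"
    and v: "\<And>T. L1_on T v"
  obtains f where "\<And>T. L1_on T f" "\<And>T. 0 \<le> T \<Longrightarrow> integral {0..T} (\<lambda>t. norm (f t)) \<le> c * integral {0..T} (\<lambda>t. norm (v t))"
    "\<And>y. is_second_derivative y (conv K v) \<Longrightarrow> is_regular_distribution y f"
proof -
  let ?F = "conv K v"
  \<comment> \<open>The error (1/2)^n on {0..n + 1} provides the rate that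
    \<open>L1_on_complete\<close> asks for; the bound 1 / (n + 1) makes the steps tend to 0.\<close>
  have "\<exists>h>0. h \<le> 1 / real (Suc n) \<and> integral {0..real n + 1} (\<lambda>t. norm (diff2 h (ramp v) t - v t)) \<le> (1/2) ^ n" for n
  proof -
    obtain d where d: "d > 0" "\<And>h. 0 < h \<Longrightarrow> h < d \<Longrightarrow> integral {0..real n + 1} (\<lambda>t. norm (diff2 h (ramp v) t - v t)) \<le> (1/2) ^ n"
      using diff2_ramp_approx[OF v, of "real n + 1" "(1/2) ^ n"] by auto
    show ?thesis using d(1) by (intro exI[of _ "min (d / 2) (1 / real (Suc n))"] conjI d(2)) auto
  qed
  then obtain h where h: "\<And>n. h n > 0" "\<And>n. h n \<le> 1 / real (Suc n)"
    "\<And>n. integral {0..real n + 1} (\<lambda>t. norm (diff2 (h n) (ramp v) t - v t)) \<le> (1/2) ^ n" by metis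
  have h0: "h \<longlonglongrightarrow> 0"
  proof (rule tendsto_sandwich)
    show "\<forall>\<^sub>F n in sequentially. 0 \<le> h n" using h(1) by (simp add: less_imp_le)
    show "\<forall>\<^sub>F n in sequentially. h n \<le> 1 / real (Suc n)" using h(2) by simp
    show "(\<lambda>n. 1 / real (Suc n)) \<longlonglongrightarrow> 0" using LIMSEQ_inverse_real_of_nat by (simp add: inverse_eq_divide)
  qed simp
  have h': "0 \<le> h n" for n using h(1)[of n] by simp
  define w where "w n = delay2 (h n) v" for n
  define y where "y n = diff2 (h n) ?F" for n
  define r where "r n = diff2 (h n) (ramp v)" for n
  have w: "L1_on T (w n)" for T n unfolding w_def by (rule L1_on_delay2[OF v h'])
  have yw: "y n t = conv K (w n) t" and rw: "r n t = ramp (w n) t" for n t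
    unfolding y_def r_def w_def by (simp_all add: conv_delay2[OF K(1) v h'] ramp_delay2[OF v h'])
  have y: "L1_on T (y n)" for T n
    by (rule L1_on_cong[OF L1_on_continuous[OF conv_continuous[OF K(1) w]]]) (simp add: yw)
  have r: "L1_on T (r n)" for T n
    by (rule L1_on_cong[OF L1_on_continuous[OF conv_continuous[OF kern_ramp w]]]) (simp add: rw ramp_def)
  have rv: "integral {0..T} (\<lambda>t. norm (r n t - v t)) \<le> (1/2) ^ n" if "T \<le> real n + 1" for n T
    using order_trans[OF L1_on_norm_mono[OF L1_on_diff[OF r v] that] h(3)[of n, folded r_def]] .
  \<comment> \<open>The factor 2 arises because the difference quotients of the ramp with indices n
    and n + 1 each deviate from \<open>v\<close> by at most (1/2)^n.\<close>
  have cau: "integral {0..T} (\<lambda>s. norm (y (Suc n) s - y n s)) \<le> (2 * c) * (1/2) ^ n" if T: "T \<le> real n" for n T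
  proof (cases "0 \<le> T")
    case False
    then show ?thesis using c by simp
  next
    case True
    let ?d = "\<lambda>s. w (Suc n) s - w n s"
    have yd: "y (Suc n) s - y n s = conv K ?d s" for s by (simp add: yw conv_diff[OF K(1) w w])
    have rd: "ramp ?d s = r (Suc n) s - r n s" for s by (simp add: rw ramp_def conv_diff[OF kern_ramp w w])
    have "integral {0..T} (\<lambda>s. norm (y (Suc n) s - y n s)) \<le> c * integral {0..T} (\<lambda>s. norm (r (Suc n) s - r n s))"
      using est[of ?d, OF L1_on_diff[OF w w] True] unfolding yd rd .
    also have "\<dots> \<le> c * (integral {0..T} (\<lambda>s. norm (r (Suc n) s - v s)) + integral {0..T} (\<lambda>s. norm (r n s - v s)))"
    proof (rule mult_left_mono[OF _ c])
      note i = L1_on_norm_integrable[OF L1_on_diff[OF r v]]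
      have "integral {0..T} (\<lambda>s. norm (r (Suc n) s - r n s)) \<le> integral {0..T} (\<lambda>s. norm (r (Suc n) s - v s) + norm (r n s - v s))"
      proof (rule integral_le)
        show "(\<lambda>s. norm (r (Suc n) s - r n s)) integrable_on {0..T}" by (rule L1_on_norm_integrable[OF L1_on_diff[OF r r]])
        show "(\<lambda>s. norm (r (Suc n) s - v s) + norm (r n s - v s)) integrable_on {0..T}" by (intro integrable_add i)
        show "norm (r (Suc n) s - r n s) \<le> norm (r (Suc n) s - v s) + norm (r n s - v s)" for s
          using norm_triangle_ineq4[of "r (Suc n) s - v s" "r n s - v s"] by simp
      qed
      then show "integral {0..T} (\<lambda>s. norm (r (Suc n) s - r n s)) \<le> integral {0..T} (\<lambda>s. norm (r (Suc n) s - v s)) + integral {0..T} (\<lambda>s. norm (r n s - v s))"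
        by (simp add: Henstock_Kurzweil_Integration.integral_add[OF i i])
    qed
    also have "\<dots> \<le> c * ((1/2) ^ n + (1/2) ^ n)"
    proof (intro mult_left_mono add_mono c)
      have "integral {0..T} (\<lambda>s. norm (r (Suc n) s - v s)) \<le> (1/2) ^ Suc n" by (rule rv) (use T in simp)
      also have "\<dots> \<le> (1/2) ^ n" by simp
      finally show "integral {0..T} (\<lambda>s. norm (r (Suc n) s - v s)) \<le> (1/2) ^ n" .
      show "integral {0..T} (\<lambda>s. norm (r n s - v s)) \<le> (1/2) ^ n" by (rule rv) (use T in simp)
    qed
    finally show ?thesis by simp
  qed
  obtain f where f: "\<And>T. L1_on T f" "\<And>T. (\<lambda>n. integral {0..T} (\<lambda>s. norm (f s - y n s))) \<longlonglongrightarrow> 0"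
    using L1_on_complete[OF y cau] by blast
  show ?thesis
  proof (rule that[OF f(1)])
    fix T :: real assume T: "0 \<le> T"
    let ?V = "integral {0..T} (\<lambda>t. norm (v t))"
    have bd: "integral {0..T} (\<lambda>t. norm (f t)) \<le> integral {0..T} (\<lambda>s. norm (f s - y n s)) + c * (?V + (1/2) ^ n)" if n: "T \<le> real n" for n
    proof -
      note i = L1_on_norm_integrable[OF L1_on_diff[OF f(1) y]] L1_on_norm_integrable[OF y]
        L1_on_norm_integrable[OF L1_on_diff[OF r v]] L1_on_norm_integrable[OF v]
      have "integral {0..T} (\<lambda>t. norm (f t)) \<le> integral {0..T} (\<lambda>s. norm (f s - y n s) + norm (y n s))"
      proof (rule integral_le)
        show "(\<lambda>t. norm (f t)) integrable_on {0..T}" by (rule L1_on_norm_integrable[OF f(1)])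
        show "(\<lambda>s. norm (f s - y n s) + norm (y n s)) integrable_on {0..T}" by (intro integrable_add i)
        show "norm (f s) \<le> norm (f s - y n s) + norm (y n s)" for s using norm_triangle_ineq[of "f s - y n s" "y n s"] by simp
      qed
      also have "\<dots> = integral {0..T} (\<lambda>s. norm (f s - y n s)) + integral {0..T} (\<lambda>s. norm (y n s))"
        by (rule Henstock_Kurzweil_Integration.integral_add[OF i(1,2)])
      also have "integral {0..T} (\<lambda>s. norm (y n s)) \<le> c * integral {0..T} (\<lambda>s. norm (r n s))"
        using est[of "w n", OF w T] unfolding yw rw .
      also have "integral {0..T} (\<lambda>s. norm (r n s)) \<le> ?V + (1/2) ^ n"
      proof -
        have "integral {0..T} (\<lambda>s. norm (r n s)) \<le> integral {0..T} (\<lambda>s. norm (r n s - v s) + norm (v s))"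
        proof (rule integral_le)
          show "(\<lambda>t. norm (r n t)) integrable_on {0..T}" by (rule L1_on_norm_integrable[OF r])
          show "(\<lambda>s. norm (r n s - v s) + norm (v s)) integrable_on {0..T}" by (intro integrable_add i)
          show "norm (r n s) \<le> norm (r n s - v s) + norm (v s)" for s using norm_triangle_ineq[of "r n s - v s" "v s"] by simp
        qed
        also have "\<dots> = integral {0..T} (\<lambda>s. norm (r n s - v s)) + ?V" by (rule Henstock_Kurzweil_Integration.integral_add[OF i(3,4)])
        finally show ?thesis using rv[of T n] n by simp
      qed
      finally show ?thesis using c by (simp add: mult_left_mono)
    qed
    have "(\<lambda>n. integral {0..T} (\<lambda>s. norm (f s - y n s)) + c * (?V + (1/2) ^ n)) \<longlonglongrightarrow> 0 + c * (?V + 0)"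
      by (intro tendsto_intros f LIMSEQ_power_zero) auto
    moreover obtain n0 where "T \<le> real n0" using real_arch_simple by blast
    ultimately show "integral {0..T} (\<lambda>t. norm (f t)) \<le> c * ?V"
      using bd by (intro LIMSEQ_le_const[where X="\<lambda>n. integral {0..T} (\<lambda>s. norm (f s - y n s)) + c * (?V + (1/2) ^ n)"] exI[of _ n0])
        (auto intro: order_trans)
  next
    show "is_regular_distribution z f" if "is_second_derivative z ?F" for z
      by (rule diff2_limit_regular[OF conv_continuous_UNIV[OF K v] f(1) h(1) h0 f(2)[unfolded y_def] that])
  qed
qed

lemma kern_primitive_adjoint:
  assumes \<kappa>: "kern \<kappa>" and \<kappa>': "kern \<kappa>'"
    and adj: "\<And>t. 0 \<le> t \<Longrightarrow> cdual_apply (\<kappa>' t f) x = cdual_apply f (\<kappa> t x)"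
  shows "cdual_apply (integral {0..t} (\<lambda>r. \<kappa>' r f)) x = cdual_apply f (integral {0..t} (\<lambda>r. \<kappa> r x))"
proof -
  have i: "(\<lambda>r. \<kappa> r x) integrable_on {0..t}" "(\<lambda>r. \<kappa>' r f) integrable_on {0..t}"
    by (intro integrable_continuous_real continuous_on_subset[OF kern_continuous[OF \<kappa>]]
        continuous_on_subset[OF kern_continuous[OF \<kappa>']]; auto)+
  have "cdual_apply (integral {0..t} (\<lambda>r. \<kappa>' r f)) x = integral {0..t} (\<lambda>r. cdual_apply (\<kappa>' r f) x)"
    using integral_linear[OF i(2) bounded_bilinear.bounded_linear_left[OF bounded_bilinear_cdual_apply, of x]] by (simp add: o_def)
  also have "\<dots> = integral {0..t} (\<lambda>r. cdual_apply f (\<kappa> r x))" by (rule integral_cong) (simp add: adj)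
  also have "\<dots> = cdual_apply f (integral {0..t} (\<lambda>r. \<kappa> r x))"
    using integral_linear[OF i(1) bounded_bilinear.bounded_linear_right[OF bounded_bilinear_cdual_apply, of f]] by (simp add: o_def)
  finally show ?thesis .
qed

section \<open>The kernel of the dual node and the conclusion\<close>

sublocale dual_pair \<subseteq> D: node "dual_node N"
  by unfold_locales (rule system_node_dual)

context dual_pair begin

text \<open>Each term of \<open>kq\<close> is built from the semigroup, its integrals and powers of
  \<beta>; adjoints conjugate the latter, hence the point cnj \<beta>.\<close>

lemma dual_kq:
  assumes t: "0 \<le> t"
  shows "cdual_apply (D.c0.kq (cnj \<beta>) t f) x = cdual_apply f (c0.kq \<beta> t x)"
proof -
  have T: "cdual_apply (cblinfun_apply (node_semigroup N' t) f) x = cdual_apply f (cblinfun_apply (\<T> t) x)" if "0 \<le> t" for t x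
    unfolding dual_semigroup[OF that] cadjoint_apply by (rule cdual_comp_apply)
  have s1: "cdual_apply (D.c0.sg1 t f) x = cdual_apply f (c0.sg1 t x)" for t x
    unfolding D.c0.sg1_def c0.sg1_def by (rule kern_primitive_adjoint[OF c0.kern_T D.c0.kern_T T])
  have s2: "cdual_apply (D.c0.sg2 t f) x = cdual_apply f (c0.sg2 t x)" for t x
    unfolding D.c0.sg2_def c0.sg2_def by (rule kern_primitive_adjoint[OF c0.kern_sg1 D.c0.kern_sg1 s1])
  show ?thesis unfolding D.c0.kq_def c0.kq_def by (simp add: cdual_simps T[OF t] s1 s2 del: dual_fields)
qed

text \<open>B and C swap roles under duality, and so do the resolvent from X_{-1} and the one into
  X_1; hence \<open>Bres\<close> of the dual node is the adjoint of \<open>Cres\<close>.\<close>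

lemma dual_Bres: "\<beta> \<in> resolvent_set \<A> \<Longrightarrow> cblinfun_apply (D.Bres (cnj \<beta>)) g = cdual_comp g (Cres \<beta>)"
  by (rule cdual_eqI) (simp add: D.Bres_def Cres_def ccomp_apply dual_resolvent_ext cadjoint_apply cdual_comp_apply)

lemma dual_Cres:
  assumes \<beta>: "\<beta> \<in> resolvent_set \<A>"
  shows "cblinfun_apply (D.Cres (cnj \<beta>)) f = cdual_comp f (Bres \<beta>)"
proof -
  have "cadjoint (res \<beta>) f = cadjoint (embm N) (cadjoint (resolvent_ext N \<beta>) f)"
    by (rule cdual_eqI) (simp add: cadjoint_apply cdual_comp_apply resolvent_ext[OF \<beta>])
  then have "inv (emb1 N') (resolvent (A_op N') (cnj \<beta>) f) = cadjoint (resolvent_ext N \<beta>) f"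
    by (simp add: dual_resolvent[OF \<beta>] dual_emb1_inv)
  then have "cblinfun_apply (D.Cres (cnj \<beta>)) f = cadjoint (B_op N) (cadjoint (resolvent_ext N \<beta>) f)"
    using D.res1_apply[of "cnj \<beta>" f] dual_resolvent(1)[OF \<beta>] by (simp add: D.Cres_def ccomp_apply)
  also have "\<dots> = cdual_comp f (Bres \<beta>)"
    by (rule cdual_eqI) (simp add: cadjoint_apply cdual_comp_apply Bres_def ccomp_apply)
  finally show ?thesis .
qed

text \<open>The kernel is the product of \<open>Cres\<close>, \<open>kq\<close> and
  \<open>Bres\<close> plus a feedthrough term. Its adjoint has the adjoint factors in reverse order,
  which is the form of the dual kernel.\<close>

lemma dual_io_kernel:
  assumes "\<beta> \<in> \<H>" "0 \<le> t"
  shows "cdual_apply (D.io_kernel (cnj \<beta>) t g) u = cdual_apply g (io_kernel \<beta> t u)"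
  unfolding D.io_kernel_def io_kernel_def dual_Bres[OF half_plane_resolvent[OF assms(1)]] dual_Cres[OF half_plane_resolvent[OF assms(1)]] dual_fields(7)
  by (simp add: cdual_simps cdual_comp_apply dual_kq[OF assms(2)] cadjoint_apply del: dual_fields)

lemma BIBO_imp_dual_LILO:
  assumes "Linf_BIBO_stable N"
  shows "L1_LILO_stable N'"
proof -
  obtain c where c: "c > 0" and BIBO: "\<And>u x y. generalised_solution N u x y \<Longrightarrow> Linf_loc u \<Longrightarrow> x 0 = 0 \<Longrightarrow>
      \<exists>f. is_regular_distribution y f \<and> Linf_loc f \<and> (\<forall>t>0. Linf_norm t f \<le> ennreal c * Linf_norm t u)"
    using assms unfolding Linf_BIBO_stable_def by blast
  \<comment> \<open>One point serves both nodes: the kernel of \<open>N\<close> is taken at \<beta>,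
    that of the dual node at cnj \<beta>.\<close>
  obtain \<beta> where \<beta>: "\<beta> \<in> \<H>" using half_plane_nonempty by blast
  have c0: "0 \<le> c" using c by simp
  let ?K = "io_kernel \<beta>" and ?K' = "D.io_kernel (cnj \<beta>)"
  have bound: "norm (diff2 h (conv ?K (step_fun d n u)) r) \<le> c" if "0 < d" "\<And>k. norm (u k) \<le> 1" "0 < h" for d n u h r
    by (rule BIBO_second_difference[OF BIBO c0 \<beta> step_fun_Linf[OF that(1,2)] that(3)])
  have est: "integral {0..T} (\<lambda>t. norm (conv ?K' v t)) \<le> c * integral {0..T} (\<lambda>t. norm (ramp v t))"
    if "\<And>T. L1_on T v" "0 \<le> T" for v T
    by (rule dual_conv_estimate[OF kern_io_kernel io_kernel_0 D.kern_io_kernel dual_io_kernel[OF \<beta>] bound that])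
  show ?thesis
    unfolding L1_LILO_stable_def
  proof (intro exI[of _ c] conjI allI impI; (elim conjE)?)
    show "c > 0" by fact
    fix v x y assume sol: "generalised_solution N' v x y" and v: "L1_loc v" and x0: "x 0 = 0"
    have vL: "L1_on T v" for T using v by (simp add: L1_loc_iff_L1_on)
    have "cnj \<beta> \<in> node_half_plane N'" using \<beta> by (simp add: dual_half_plane)
    from D.generalised_solution_output[OF this sol x0]
    have y: "is_second_derivative y (conv ?K' v)" .
    obtain f where f: "\<And>T. L1_on T f" "\<And>T. 0 \<le> T \<Longrightarrow> integral {0..T} (\<lambda>t. norm (f t)) \<le> c * integral {0..T} (\<lambda>t. norm (v t))"
      "\<And>y. is_second_derivative y (conv ?K' v) \<Longrightarrow> is_regular_distribution y f"
      using second_derivative_conv_L1[OF D.kern_io_kernel D.io_kernel_0 c0 est vL] by blast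
    have "L1_norm t f \<le> ennreal c * L1_norm t v" if "t > 0" for t
    proof -
      have "0 \<le> integral {0..t} (\<lambda>s. norm (v s))" by (rule integral_nonneg[OF L1_on_norm_integrable[OF vL]]) simp
      then show ?thesis using f(2)[of t] that c0
        by (simp add: L1_on_L1_norm[OF vL] L1_on_L1_norm[OF f(1)] ennreal_mult[symmetric] ennreal_leI)
    qed
    then show "\<exists>f. is_regular_distribution y f \<and> L1_loc f \<and> (\<forall>t>0. L1_norm t f \<le> ennreal c * L1_norm t v)"
      using f(1) f(3)[OF y] by (intro exI[of _ f]) (simp add: L1_loc_iff_L1_on)
  qed
qed

end

theorem theorem6p4:
  fixes N :: "('u::cbanach, 'x1::cbanach, 'x::cbanach, 'xm::cbanach, 'y::cbanach) node"
  assumes "system_node N"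
    and "Linf_BIBO_stable N"
    and "generates_C0_semigroup (graph_adjoint (A_op N))"
  shows "system_node (dual_node N) \<and> L1_LILO_stable (dual_node N)"
proof -
  interpret dual_pair N by unfold_locales (rule assms)+
  show ?thesis using system_node_dual BIBO_imp_dual_LILO[OF assms(2)] by blast
qed

end
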